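(* Suppose the FOCUS algorithm (described in the context) is run with exact joint maximum-likelihood estimation and exact alternative-model best responses. Then for every $\theta^\star=(D^\star,\mathbf A^\star,\mathbf\Sigma^\star)\in\Theta$, every $0<\epsilon\le\beta_{\min}/2$ and every $\delta\in(0,1)$, $$\mathbb P_{\theta^\star}\Big(\tau_\delta<\infty,\ \widehat D_{\tau_\delta}=D^\star,\ \|\widehat{\mathbf A}_{\tau_\delta}-\mathbf A^\star\|_{\max}<\epsilon\Big)\ge1-\delta ,$$ i.e. FOCUS is $(\epsilon,\delta)$-correct over $\Theta$.
   Context: **Model.** Fix an integer $p\ge1$, $[p]=\{1,\dots,p\}$, intervals $[U_{j,1},U_{j,2}]$ ($j\in[p]$), and known constants $\beta_{\min},A_{\max},\sigma_{\min},\sigma_{\max},C_{\max}>0$ with $\max_j\max_{u\in[U_{j,1},U_{j,2}]}|u|\le C_{\max}$. $\Theta$ is the set of all triples $\theta=(D,\mathbf A,\mathbf\Sigma)$ where $D$ is a directed acyclic graph on $[p]$; $\mathbf A\in\mathbb R^{p\times p}$ satisfies $A_{jk}\ne0$ if and only if $k\to j$ is an edge of $D$, and $\beta_{\min}\le|A_{jk}|\le A_{\max}$ for every nonzero $A_{jk}$; and $\mathbf\Sigma=\operatorname{diag}(\sigma_1^2,\dots,\sigma_p^2)$ with $\sigma_{\min}^2\le\sigma_j^2\le\sigma_{\max}^2$. $\|\mathbf M\|_{\max}=\max_{j,k}|M_{jk}|$. **Actions and distributions.** $\mathcal A=\{0\}\cup\{(j,U_{j,s}):j\in[p],s\in\{1,2\}\}$,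 with $K=|\mathcal A|=2p+1$; $0$ is passive observation, $(j,u)$ is the intervention $\operatorname{do}(X_j=u)$. $P_0^\theta=\mathcal N(0,(\mathbf I-\mathbf A)^{-1}\mathbf\Sigma(\mathbf I-\mathbf A)^{-\mathsf T})$ on $\mathbb R^p$; for $a=(j,u)$, $R=[p]\setminus\{j\}$, $P_a^\theta=\mathcal N\big((\mathbf I-\mathbf A_{R,R})^{-1}\mathbf A_{R,j}u,\ (\mathbf I-\mathbf A_{R,R})^{-1}\mathbf\Sigma_{R,R}(\mathbf I-\mathbf A_{R,R})^{-\mathsf T}\big)$ on $\mathbb R^R$. $p_a^\theta$ is the density of $P_a^\theta$. For $r>0$, $\operatorname{Alt}_r(\theta)=\{\lambda\in\Theta: D^\lambda\ne D^\theta\text{ or }\|\mathbf A^\lambda-\mathbf A^\theta\|_{\max}\ge r\}$. $\operatorname{KL}$ is the Kullback–Leibler divergence. **FOCUS.** Inputs $\epsilon,\delta$. At each round $t\ge1$ an action $a_t\in\mathcal A$ is selected from the past and $\mathbf X_t\sim P_{a_t}^{\theta^\star}$ is observed (conditionally on the past and $a_t$). $N_t(a)=\sum_{s\le t}\mathbf 1\{a_s=a\}$. (1) *Estimation:* $\widehat\theta_t=(\widehat D_t,\widehat{\mathbf A}_t,\widehat{\mathbf\Sigma}_t)\in\arg\max_{\theta\in\Theta}\sum_{s\le t}\log p_{a_s}^\theta(\mathbf X_s)$. (2) *Stopping:* $d_t=\inf_{\lambda\in\operatorname{Alt}_\epsilon(\widehat\theta_t)}\sum_{a\in\mathcal A}N_t(a)\operatorname{KL}(P_a^{\widehat\theta_t}\|P_a^\lambda)$;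 $\tau_\delta$ is the first $t\ge1$ with $\frac{\pi^2t^2}{6}f_t(d_t)<\delta$ ($\tau_\delta=\infty$ if none), and $\widehat\theta_{\tau_\delta}$ is returned. (3) *Best response and gains:* $\lambda_t\in\arg\min_{\lambda\in\operatorname{Alt}_\epsilon(\widehat\theta_t)}\sum_a\alpha_{t,a}\operatorname{KL}(P_a^{\widehat\theta_t}\|P_a^\lambda)$, $r_{t,a}=\operatorname{KL}(P_a^{\widehat\theta_t}\|P_a^{\lambda_t})$. (4) *Allocation (called gain-form AdaHedge):* $\alpha_{1,a}=1/K$, $\Delta_0=0$, $\eta_1=+\infty$, and $$\alpha_{t+1,a}=\frac{\alpha_{t,a}\exp(\eta_tr_{t,a})}{\sum_{b\in\mathcal A}\alpha_{t,b}\exp(\eta_tr_{t,b})},\quad m_t=\frac1{\eta_t}\log\sum_{a}\alpha_{t,a}e^{\eta_tr_{t,a}},\quad h_t=\sum_a\alpha_{t,a}r_{t,a},$$ $$\Delta_t=\Delta_{t-1}+m_t-h_t,\qquad \eta_{t+1}=\frac{\log K}{\Delta_t}.$$ The initialization $\eta_1=+\infty$ and the zero-gap cases ($\Delta_t=0$, $\eta_{t+1}=+\infty$) are interpreted by continuity, i.e. as limits $\eta_t\to+\infty$ in the formulas. (5) *Action selection:* $a_1$ is arbitrary; for $t\ge1$, $a_{t+1}\in\arg\min_aN_t(a)$ if $\min_aN_t(a)<\sqrt t$, and otherwise $a_{t+1}\in\arg\max_a\big(\sum_{s\le t}\alpha_{s,a}\big)/N_t(a)$. **The function $f_t$.** $G_p=\sum_{k=0}^{p-1}(pA_{\max})^k$,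 $B_\mu=G_p\sqrt p\,A_{\max}C_{\max}$, $v_-=\sigma_{\min}^2/(1+pA_{\max})^2$, $v_+=G_p^2\sigma_{\max}^2$, $\kappa_V=v_+/v_-$. With $g(r)=\frac12(r-1-\log r)$, $h(r)=\frac12\log\frac{1+r}{2\sqrt r}$, $h(1)/g(1):=1/4$: $\kappa_B=\min\{\frac{v_-}{4v_+},\ \min_{r\in[\kappa_V^{-1},\kappa_V]}h(r)/g(r)\}$. $d_0^{\dim}=p$, $d_a^{\dim}=p-1$ for interventions, $s_a=d_a^{\dim}(d_a^{\dim}+1)/2$, $q=\sum_{a}(d_a^{\dim}+s_a)$, $\mathcal N(\zeta)=\prod_{a\in\mathcal A}(1+8B_\mu/\zeta)^{d_a^{\dim}}(1+8\sqrt{d_a^{\dim}}\,v_+/\zeta)^{s_a}$. $R(z)=B_\mu+\sqrt{v_+}(\sqrt p+\sqrt{2z})$; $L_\ell(R)=\frac{R+B_\mu}{v_-}+\frac12\{\frac{\sqrt p}{v_-}+\frac{(R+B_\mu)^2}{v_-^2}\}$; $L_{\mathrm{KL}}=\frac{2B_\mu+\sqrt p}{v_-}$; $z_t(x)=\kappa_Bx+2\log(t+1)$; $H_t(x)=\frac12L_\ell(R(z_t(x)))+\kappa_BL_{\mathrm{KL}}$; $\zeta_t(x)=\min\{1,q/(tH_t(x))\}$; $f_t(x)=\min\{1,[e^q\mathcal N(\zeta_t(x))+1]e^{-\kappa_Bx}\}$. *)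

theory Defs
  imports "HOL-Probability.Probability"
begin

section \<open>Model\<close>

text \<open>The index set $[p]$ is a finite type \<open>'n\<close>, with $p$ = \<open>CARD('n)\<close>.\<close>

record 'n pars =
  U_lo :: "'n \<Rightarrow> real"
  U_hi :: "'n \<Rightarrow> real"
  beta_min :: real
  A_max :: real
  sigma_min :: real
  sigma_max :: real
  C_max :: real

text \<open>The strict inequality makes the $2p+1$ actions pairwise distinct.\<close>

definition valid_pars :: "'n::finite pars \<Rightarrow> bool" where
  "valid_pars P \<longleftrightarrow>
     0 < beta_min P \<and> 0 < A_max P \<and> 0 < sigma_min P \<and> 0 < sigma_max P \<and> 0 < C_max P \<and>
     (\<forall>j. U_lo P j < U_hi P j) \<and> (\<forall>j. \<forall>u\<in>{U_lo P j..U_hi P j}. \<bar>u\<bar> \<le> C_max P)"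

text \<open>A model is a triple of an edge set (\<open>(k, j)\<close> is the edge $k \to j$), a coefficient matrix and
  a noise covariance matrix.\<close>

type_synonym 'n model = "('n \<times> 'n) set \<times> (real^'n^'n) \<times> (real^'n^'n)"

abbreviation dag :: "'n model \<Rightarrow> ('n \<times> 'n) set" where "dag \<theta> \<equiv> fst \<theta>"
abbreviation coef :: "'n model \<Rightarrow> real^'n^'n" where "coef \<theta> \<equiv> fst (snd \<theta>)"
abbreviation noise :: "'n model \<Rightarrow> real^'n^'n" where "noise \<theta> \<equiv> snd (snd \<theta>)"

definition Theta :: "'n::finite pars \<Rightarrow> 'n model set" where
  "Theta P = {\<theta>. acyclic (dag \<theta>)
     \<and> (\<forall>j k. coef \<theta> $ j $ k \<noteq> 0 \<longleftrightarrow> (k, j) \<in> dag \<theta>)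
     \<and> (\<forall>j k. coef \<theta> $ j $ k \<noteq> 0 \<longrightarrow>
           beta_min P \<le> \<bar>coef \<theta> $ j $ k\<bar> \<and> \<bar>coef \<theta> $ j $ k\<bar> \<le> A_max P)
     \<and> (\<forall>j k. j \<noteq> k \<longrightarrow> noise \<theta> $ j $ k = 0)
     \<and> (\<forall>j. (sigma_min P)\<^sup>2 \<le> noise \<theta> $ j $ j \<and> noise \<theta> $ j $ j \<le> (sigma_max P)\<^sup>2)}"

definition max_norm :: "real^'n^'n \<Rightarrow> real" where
  "max_norm M = (MAX (j, k) \<in> (UNIV :: ('n::finite \<times> 'n) set). \<bar>M $ j $ k\<bar>)"

definition Alt :: "'n::finite pars \<Rightarrow> real \<Rightarrow> 'n model \<Rightarrow> 'n model set" where
  "Alt P r \<theta> = {\<nu>\<in>Theta P. dag \<nu> \<noteq> dag \<theta> \<or> max_norm (coef \<nu> - coef \<theta>) \<ge> r}"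

section \<open>Actions and distributions\<close>

datatype 'n action = Obs | Do 'n real

definition actions :: "'n::finite pars \<Rightarrow> 'n action set" where
  "actions P = {Obs} \<union> {Do j u | j u. u = U_lo P j \<or> u = U_hi P j}"

lemma card_actions:
  assumes "valid_pars (P :: 'n::finite pars)"
  shows "card (actions P) = 2 * CARD('n) + 1"
proof -
  let ?L = "(\<lambda>j. Do j (U_lo P j)) ` UNIV" and ?H = "(\<lambda>j. Do j (U_hi P j)) ` UNIV"
  have "actions P = insert Obs (?L \<union> ?H)"
    by (auto simp: actions_def)
  moreover have "?L \<inter> ?H = {}"
    using assms by (auto simp: valid_pars_def) (metis less_irrefl)
  moreover have "card ?L = CARD('n)" "card ?H = CARD('n)"
    by (auto intro!: card_image inj_onI)
  ultimately show ?thesis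
    by (subst card_insert_disjoint | subst card_Un_disjoint | auto)+
qed

definition observed :: "'n action \<Rightarrow> 'n set" where
  "observed a = (case a of Obs \<Rightarrow> UNIV | Do j u \<Rightarrow> UNIV - {j})"

text \<open>The principal submatrix $M_{R,R}$ is represented by the block-diagonal matrix that agrees with
  $M$ on $R \times R$ and with the identity on the complement of $R$.  Products, transposes, inverses
  and determinants of such matrices are those of the $R$-blocks, so the library operations on square
  matrices apply; for $R = [p]$ the matrix is $M$ itself.\<close>

definition blk :: "'n set \<Rightarrow> real^'n^'n \<Rightarrow> real^'n^'n" where
  "blk R M = (\<chi> i k. if i \<in> R \<and> k \<in> R then M $ i $ k else if i = k then 1 else 0)"

text \<open>Density and law of $\mathcal N(\mu_R, V_{R,R})$ on $\mathbb R^R$, whose elements are the functions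
  in \<open>Pi\<^sub>E R (\<lambda>_. UNIV)\<close>.  Only the entries of \<open>\<mu>\<close> and \<open>V\<close> with indices in \<open>R\<close> are used.\<close>

definition gauss_pdf :: "'n::finite set \<Rightarrow> real^'n \<Rightarrow> real^'n^'n \<Rightarrow> ('n \<Rightarrow> real) \<Rightarrow> real" where
  "gauss_pdf R \<mu> V x =
     exp (- (\<Sum>i\<in>R. \<Sum>k\<in>R. (x i - \<mu> $ i) * matrix_inv (blk R V) $ i $ k * (x k - \<mu> $ k)) / 2)
     / sqrt ((2 * pi) ^ card R * det (blk R V))"

definition gauss :: "'n::finite set \<Rightarrow> real^'n \<Rightarrow> real^'n^'n \<Rightarrow> ('n \<Rightarrow> real) measure" where
  "gauss R \<mu> V = density (Pi\<^sub>M R (\<lambda>_. lborel)) (\<lambda>x. ennreal (gauss_pdf R \<mu> V x))"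

definition resolvent :: "'n::finite model \<Rightarrow> 'n action \<Rightarrow> real^'n^'n" where
  "resolvent \<theta> a = matrix_inv (blk (observed a) (mat 1 - coef \<theta>))"

definition mean :: "'n::finite model \<Rightarrow> 'n action \<Rightarrow> real^'n" where
  "mean \<theta> a = (case a of Obs \<Rightarrow> 0
     | Do j u \<Rightarrow> resolvent \<theta> a *v (\<chi> k. if k \<in> observed a then coef \<theta> $ k $ j * u else 0))"

definition cov :: "'n::finite model \<Rightarrow> 'n action \<Rightarrow> real^'n^'n" where
  "cov \<theta> a = resolvent \<theta> a ** blk (observed a) (noise \<theta>) ** transpose (resolvent \<theta> a)"

definition pdf :: "'n::finite model \<Rightarrow> 'n action \<Rightarrow> ('n \<Rightarrow> real) \<Rightarrow> real" where
  "pdf \<theta> a = gauss_pdf (observed a) (mean \<theta> a) (cov \<theta> a)"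

definition law :: "'n::finite model \<Rightarrow> 'n action \<Rightarrow> ('n \<Rightarrow> real) measure" where
  "law \<theta> a = gauss (observed a) (mean \<theta> a) (cov \<theta> a)"

text \<open>The library's \<open>KL_divergence b M N\<close> is the divergence of \<open>N\<close> from \<open>M\<close>, i.e.\ with the
  arguments in the opposite order.\<close>

definition KL :: "'n::finite action \<Rightarrow> 'n model \<Rightarrow> 'n model \<Rightarrow> real" where
  "KL a \<theta> \<nu> = KL_divergence (exp 1) (law \<nu> a) (law \<theta> a)"

definition weighted_KL ::
  "'n::finite pars \<Rightarrow> ('n action \<Rightarrow> real) \<Rightarrow> 'n model \<Rightarrow> 'n model \<Rightarrow> real" where
  "weighted_KL P w \<theta> \<nu> = (\<Sum>a\<in>actions P. w a * KL a \<theta> \<nu>)"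

section \<open>Stopping threshold\<close>

definition G_p :: "'n::finite pars \<Rightarrow> real" where
  "G_p P = (\<Sum>k=0..<CARD('n). (real CARD('n) * A_max P) ^ k)"

definition B_mu :: "'n::finite pars \<Rightarrow> real" where
  "B_mu P = G_p P * sqrt (real CARD('n)) * A_max P * C_max P"

definition v_lo :: "'n::finite pars \<Rightarrow> real" where
  "v_lo P = (sigma_min P)\<^sup>2 / (1 + real CARD('n) * A_max P)\<^sup>2"

definition v_hi :: "'n::finite pars \<Rightarrow> real" where
  "v_hi P = (G_p P)\<^sup>2 * (sigma_max P)\<^sup>2"

definition kappa_V :: "'n::finite pars \<Rightarrow> real" where
  "kappa_V P = v_hi P / v_lo P"

definition g_fun :: "real \<Rightarrow> real" where
  "g_fun r = (r - 1 - ln r) / 2"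

definition h_fun :: "real \<Rightarrow> real" where
  "h_fun r = ln ((1 + r) / (2 * sqrt r)) / 2"

definition hg_ratio :: "real \<Rightarrow> real" where
  "hg_ratio r = (if r = 1 then 1 / 4 else h_fun r / g_fun r)"

definition kappa_B :: "'n::finite pars \<Rightarrow> real" where
  "kappa_B P = min (v_lo P / (4 * v_hi P)) (INF r\<in>{inverse (kappa_V P)..kappa_V P}. hg_ratio r)"

definition d_dim :: "'n::finite action \<Rightarrow> nat" where
  "d_dim a = (case a of Obs \<Rightarrow> CARD('n) | Do j u \<Rightarrow> CARD('n) - 1)"

definition s_dim :: "'n::finite action \<Rightarrow> nat" where
  "s_dim a = d_dim a * (d_dim a + 1) div 2"

definition q_dim :: "'n::finite pars \<Rightarrow> nat" where
  "q_dim P = (\<Sum>a\<in>actions P. d_dim a + s_dim a)"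

definition cover :: "'n::finite pars \<Rightarrow> real \<Rightarrow> real" where
  "cover P \<zeta> = (\<Prod>a\<in>actions P.
     (1 + 8 * B_mu P / \<zeta>) ^ d_dim a * (1 + 8 * sqrt (real (d_dim a)) * v_hi P / \<zeta>) ^ s_dim a)"

definition R_fun :: "'n::finite pars \<Rightarrow> real \<Rightarrow> real" where
  "R_fun P z = B_mu P + sqrt (v_hi P) * (sqrt (real CARD('n)) + sqrt (2 * z))"

definition L_ell :: "'n::finite pars \<Rightarrow> real \<Rightarrow> real" where
  "L_ell P R = (R + B_mu P) / v_lo P
     + (sqrt (real CARD('n)) / v_lo P + (R + B_mu P)\<^sup>2 / (v_lo P)\<^sup>2) / 2"

definition L_KL :: "'n::finite pars \<Rightarrow> real" where
  "L_KL P = (2 * B_mu P + sqrt (real CARD('n))) / v_lo P"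

definition z_fun :: "'n::finite pars \<Rightarrow> nat \<Rightarrow> real \<Rightarrow> real" where
  "z_fun P t x = kappa_B P * x + 2 * ln (real t + 1)"

definition H_fun :: "'n::finite pars \<Rightarrow> nat \<Rightarrow> real \<Rightarrow> real" where
  "H_fun P t x = L_ell P (R_fun P (z_fun P t x)) / 2 + kappa_B P * L_KL P"

definition zeta_fun :: "'n::finite pars \<Rightarrow> nat \<Rightarrow> real \<Rightarrow> real" where
  "zeta_fun P t x = min 1 (real (q_dim P) / (real t * H_fun P t x))"

definition f_fun :: "'n::finite pars \<Rightarrow> nat \<Rightarrow> real \<Rightarrow> real" where
  "f_fun P t x =
     min 1 ((exp (real (q_dim P)) * cover P (zeta_fun P t x) + 1) * exp (- kappa_B P * x))"

text \<open>The stopping statistic is an infimum, which is $\infty$ exactly when there is no alternative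
  (e.g. for $p = 1$); $f_t(\infty) = 0$ is the limit of $f_t(x)$ as $x \to \infty$.\<close>

definition f_ext :: "'n::finite pars \<Rightarrow> nat \<Rightarrow> ereal \<Rightarrow> real" where
  "f_ext P t x = (if x = \<infinity> then 0 else f_fun P t (real_of_ereal x))"

section \<open>Gain-form AdaHedge\<close>

definition hedge_weight ::
  "'a set \<Rightarrow> ('a \<Rightarrow> real) \<Rightarrow> ('a \<Rightarrow> real) \<Rightarrow> real \<Rightarrow> 'a \<Rightarrow> real" where
  "hedge_weight S \<alpha> r \<eta> a = \<alpha> a * exp (\<eta> * r a) / (\<Sum>b\<in>S. \<alpha> b * exp (\<eta> * r b))"

definition hedge_mix :: "'a set \<Rightarrow> ('a \<Rightarrow> real) \<Rightarrow> ('a \<Rightarrow> real) \<Rightarrow> real \<Rightarrow> real" where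
  "hedge_mix S \<alpha> r \<eta> = 1 / \<eta> * ln (\<Sum>a\<in>S. \<alpha> a * exp (\<eta> * r a))"

text \<open>\<open>adahedge S r t\<close> is the pair $(\alpha_{t+1}, \Delta_t)$ for the gain sequence \<open>r\<close> (indexed from 1).
  The learning rate used in round $t+1$ is $\log |S| / \Delta_t$, and $+\infty$ if $\Delta_t = 0$ (in
  particular in round 1); in the latter case the formulas are replaced by their limits
  as $\eta \to +\infty$.\<close>

primrec adahedge :: "'a set \<Rightarrow> (nat \<Rightarrow> 'a \<Rightarrow> real) \<Rightarrow> nat \<Rightarrow> ('a \<Rightarrow> real) \<times> real" where
  "adahedge S r 0 = ((\<lambda>a. 1 / real (card S)), 0)"
| "adahedge S r (Suc t) =
    (let \<alpha> = fst (adahedge S r t);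
         \<Delta> = snd (adahedge S r t);
         \<rho> = r (Suc t);
         \<eta> = ln (real (card S)) / \<Delta>;
         \<alpha>' = (if \<Delta> = 0 then (\<lambda>a. Lim at_top (\<lambda>\<eta>. hedge_weight S \<alpha> \<rho> \<eta> a))
                else hedge_weight S \<alpha> \<rho> \<eta>);
         m = (if \<Delta> = 0 then Lim at_top (hedge_mix S \<alpha> \<rho>) else hedge_mix S \<alpha> \<rho> \<eta>);
         h = (\<Sum>a\<in>S. \<alpha> a * \<rho> a)
     in (\<alpha>', \<Delta> + m - h))"

section \<open>The FOCUS algorithm along one trajectory\<close>

text \<open>The arguments \<open>act\<close>, \<open>X\<close>, \<open>est\<close>, \<open>br\<close> below are the sequences $a_t$, $\mathbf X_t$, $\widehat\theta_t$,
  $\lambda_t$ for one outcome; only the indices $t \ge 1$ are meaningful.\<close>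

definition play_count :: "(nat \<Rightarrow> 'a) \<Rightarrow> nat \<Rightarrow> 'a \<Rightarrow> nat" where
  "play_count act t a = card {s\<in>{1..t}. act s = a}"

definition loglik ::
  "(nat \<Rightarrow> 'n::finite action) \<Rightarrow> (nat \<Rightarrow> 'n \<Rightarrow> real) \<Rightarrow> nat \<Rightarrow> 'n model \<Rightarrow> real" where
  "loglik act X t \<theta> = (\<Sum>s=1..t. ln (pdf \<theta> (act s) (X s)))"

definition stop_stat ::
  "'n::finite pars \<Rightarrow> real \<Rightarrow> (nat \<Rightarrow> 'n action) \<Rightarrow> (nat \<Rightarrow> 'n model) \<Rightarrow> nat \<Rightarrow> ereal" where
  "stop_stat P \<epsilon> act est t =
     (INF \<nu>\<in>Alt P \<epsilon> (est t). ereal (weighted_KL P (\<lambda>a. real (play_count act t a)) (est t) \<nu>))"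

definition stop_time ::
  "'n::finite pars \<Rightarrow> real \<Rightarrow> real \<Rightarrow> (nat \<Rightarrow> 'n action) \<Rightarrow> (nat \<Rightarrow> 'n model) \<Rightarrow> enat" where
  "stop_time P \<epsilon> \<delta> act est =
     Inf (enat ` {t. 1 \<le> t \<and> pi\<^sup>2 * (real t)\<^sup>2 / 6 * f_ext P t (stop_stat P \<epsilon> act est t) < \<delta>})"

definition gain :: "(nat \<Rightarrow> 'n::finite model) \<Rightarrow> (nat \<Rightarrow> 'n model) \<Rightarrow> nat \<Rightarrow> 'n action \<Rightarrow> real" where
  "gain est br t a = KL a (est t) (br t)"

definition alloc ::
  "'n::finite pars \<Rightarrow> (nat \<Rightarrow> 'n model) \<Rightarrow> (nat \<Rightarrow> 'n model) \<Rightarrow> nat \<Rightarrow> 'n action \<Rightarrow> real" where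
  "alloc P est br t = fst (adahedge (actions P) (gain est br) (t - 1))"

section \<open>The FOCUS algorithm as a stochastic process\<close>

text \<open>\<open>F t\<close> is the information available after round \<open>t\<close> once the next action has been selected; it may
  contain external randomness used to break ties and to choose $a_1$.  The rounds are modelled for
  all $t \ge 1$, irrespective of stopping.  A best response is demanded only if an
  alternative exists (otherwise the algorithm stops).\<close>

locale focus_run = prob_space M + filtration "space M" F
  for M :: "'w measure" and F :: "nat \<Rightarrow> 'w measure" +
  fixes P :: "'n::finite pars"
    and \<epsilon> :: real
    and \<theta>s :: "'n model"
    and act :: "nat \<Rightarrow> 'w \<Rightarrow> 'n action"
    and X :: "nat \<Rightarrow> 'w \<Rightarrow> 'n \<Rightarrow> real"
    and est :: "nat \<Rightarrow> 'w \<Rightarrow> 'n model"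
    and br :: "nat \<Rightarrow> 'w \<Rightarrow> 'n model"
  assumes subalgebra_F: "\<And>t. subalgebra M (F t)"
    and act_measurable: "\<And>t. act (Suc t) \<in> F t \<rightarrow>\<^sub>M count_space (actions P)"
    and X_measurable: "\<And>t a. 1 \<le> t \<Longrightarrow> a \<in> actions P \<Longrightarrow>
      X t \<in> restrict_space (F t) {\<omega>\<in>space M. act t \<omega> = a} \<rightarrow>\<^sub>M Pi\<^sub>M (observed a) (\<lambda>_. borel)"
    and est_measurable: "\<And>t. 1 \<le> t \<Longrightarrow> est t \<in> F t \<rightarrow>\<^sub>M count_space UNIV \<Otimes>\<^sub>M borel \<Otimes>\<^sub>M borel"
    and br_measurable: "\<And>t. 1 \<le> t \<Longrightarrow> br t \<in> F t \<rightarrow>\<^sub>M count_space UNIV \<Otimes>\<^sub>M borel \<Otimes>\<^sub>M borel"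
    and observation: "\<And>t a B. a \<in> actions P \<Longrightarrow> B \<in> sets (law \<theta>s a) \<Longrightarrow>
      AE \<omega> in M. real_cond_exp M (F t)
          (indicat_real {\<omega>\<in>space M. act (Suc t) \<omega> = a \<and> X (Suc t) \<omega> \<in> B}) \<omega>
        = (if act (Suc t) \<omega> = a then measure (law \<theta>s a) B else 0)"
    and estimation: "\<And>t \<omega>. 1 \<le> t \<Longrightarrow> \<omega> \<in> space M \<Longrightarrow>
      is_arg_max (loglik (\<lambda>s. act s \<omega>) (\<lambda>s. X s \<omega>) t) (\<lambda>\<theta>. \<theta> \<in> Theta P) (est t \<omega>)"
    and best_response: "\<And>t \<omega>. 1 \<le> t \<Longrightarrow> \<omega> \<in> space M \<Longrightarrow> Alt P \<epsilon> (est t \<omega>) \<noteq> {} \<Longrightarrow>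
      is_arg_min (weighted_KL P (alloc P (\<lambda>s. est s \<omega>) (\<lambda>s. br s \<omega>) t) (est t \<omega>))
        (\<lambda>\<nu>. \<nu> \<in> Alt P \<epsilon> (est t \<omega>)) (br t \<omega>)"
    and forced_exploration: "\<And>t \<omega>. 1 \<le> t \<Longrightarrow> \<omega> \<in> space M \<Longrightarrow>
      real (MIN a\<in>actions P. play_count (\<lambda>s. act s \<omega>) t a) < sqrt (real t) \<Longrightarrow>
      is_arg_min (play_count (\<lambda>s. act s \<omega>) t) (\<lambda>a. a \<in> actions P) (act (Suc t) \<omega>)"
    and tracking: "\<And>t \<omega>. 1 \<le> t \<Longrightarrow> \<omega> \<in> space M \<Longrightarrow>
      \<not> real (MIN a\<in>actions P. play_count (\<lambda>s. act s \<omega>) t a) < sqrt (real t) \<Longrightarrow>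
      is_arg_max
        (\<lambda>a. (\<Sum>s=1..t. alloc P (\<lambda>s. est s \<omega>) (\<lambda>s. br s \<omega>) s a) / real (play_count (\<lambda>s. act s \<omega>) t a))
        (\<lambda>a. a \<in> actions P) (act (Suc t) \<omega>)"

end

theory Submission
  imports Defs
begin

text \<open>The square root in the likelihood ratio is essential: the plain ratio has expectation
  exactly 1 and leaves nothing to pay for a divergence, while its square root loses the
  Bhattacharyya factor. Jointly diagonalising the two precisions turns distance and divergence into
  sums over coordinates, and \<open>kappa_B\<close> is the constant of the coordinatewise
  comparison: the infimum of \<open>hg_ratio\<close> serves the variances,
  \<open>v_lo / (4 * v_hi)\<close> the means. The other constants are prices:
  \<open>zeta_fun\<close> is the radius at which replacing the estimate by a net point costs at most
  \<open>q_dim\<close> in the exponent, whence the factor \<open>exp q\<close>; the term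
  \<open>2 * ln (t + 1)\<close> in \<open>z_fun\<close> pays for a union over \<open>t\<close>
  observations, whence the summand 1. Two obstacles remain. The statistic is random while the tail
  bound needs a fixed level: the infimum of all levels with a small threshold replaces it, by
  continuity. And \<open>f_fun\<close> is not evidently decreasing, since the net gets finer as
  \<open>x\<close> grows; it is shown to decrease only from points where it is below 1, which is
  enough for termination.\<close>

text \<open>The Bhattacharyya distance of the laws of two models under an action is at least \<open>kappa_B\<close> times their
  divergence.  Hence, for a fixed model \<open>\<theta>\<close>, the product of the square roots of the likelihood ratios against
  \<open>\<theta>s\<close>, compensated by the exponential of \<open>kappa_B\<close> times the cumulative divergence, has expectation at most 1.
  A finite net of models and the Lipschitz continuity of log-densities (on the event that all observations are
  small) and of divergences extend this to the random model \<open>est t\<close>, whose likelihood ratio is at least 1.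
  If \<open>est t\<close> is wrong, then \<open>\<theta>s\<close> is an alternative to it, so the stopping statistic is at most the cumulative
  divergence; stopping there has probability at most \<open>6 \<delta> / (pi t)^2\<close>, and these bounds sum to \<open>\<delta>\<close>.
  Stopping is certain on every trajectory: the interventional means separate the alternatives uniformly, and
  the forced exploration makes the statistic of order $\sqrt t$, while the threshold only needs order $\log t$.\<close>

section \<open>Symmetric matrices\<close>

definition diag :: "('n::finite \<Rightarrow> real) \<Rightarrow> real^'n^'n" where
  "diag d = (\<chi> i j. if i = j then d i else 0)"

lemma diag_mult_vec: "diag d *v x = (\<chi> i. d i * x $ i)"
  by (simp add: diag_def matrix_vector_mult_def vec_eq_iff if_distrib[of "\<lambda>c. c * _"] cong: if_cong)

lemma transpose_diag [simp]: "transpose (diag d) = diag d"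
  by (auto simp: diag_def transpose_def vec_eq_iff)

lemma diag_mult_diag: "diag d ** diag e = diag (\<lambda>i. d i * e i)"
  by (auto simp: diag_def matrix_matrix_mult_def vec_eq_iff if_distrib[of "\<lambda>c. c * _"] cong: if_cong)

lemma diag_one: "diag (\<lambda>_. 1) = mat 1"
  by (auto simp: diag_def mat_def vec_eq_iff)

lemma det_diag: "det (diag d) = (\<Prod>i\<in>UNIV. d i)"
  by (subst det_diagonal) (auto simp: diag_def)

lemma inner_matrix_vector_left: "(A *v x) \<bullet> y = x \<bullet> (transpose A *v (y::real^'m))"
  for A :: "real^'n^'m"
  by (metis dot_lmul_matrix inner_commute transpose_matrix_vector transpose_transpose)

lemma inner_matrix_vector_right: "x \<bullet> (A *v y) = (transpose A *v x) \<bullet> (y::real^'n)"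
  for A :: "real^'n^'m"
  by (metis dot_lmul_matrix transpose_matrix_vector)

lemma quadratic_nonpos_imp_zero:
  fixes b c :: real
  assumes "\<And>t. t * b + t\<^sup>2 * c \<le> 0"
  shows "b = 0"
proof (rule ccontr)
  assume "b \<noteq> 0"
  \<comment> \<open>The step is small enough that \<open>t * b\<close>, which equals
    \<open>t\<^sup>2 * (\<bar>c\<bar> + 1)\<close>, outweighs the quadratic term.\<close>
  define t where "t = b / (\<bar>c\<bar> + 1)"
  have "t\<^sup>2 * c \<ge> - (t\<^sup>2 * \<bar>c\<bar>)"
    by (cases "c \<ge> 0") auto
  moreover have "t * b = t\<^sup>2 * (\<bar>c\<bar> + 1)"
  proof -
    have "b = t * (\<bar>c\<bar> + 1)" by (simp add: t_def)
    then show ?thesis by (metis mult.assoc power2_eq_square)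
  qed
  ultimately have "t * b + t\<^sup>2 * c \<ge> t\<^sup>2"
    unfolding distrib_left by linarith
  moreover have "t\<^sup>2 > 0"
    using \<open>b \<noteq> 0\<close> by (simp add: t_def)
  ultimately show False
    using assms[of t] by linarith
qed

text \<open>The eigenvector is a maximiser of the Rayleigh quotient on the orthogonal complement.\<close>

lemma symmetric_eigenvector_orthogonal:
  fixes M :: "real^'n^'n"
  assumes sym: "transpose M = M" and B: "finite B" "card B < CARD('n)"
    and eig: "\<And>b. b \<in> B \<Longrightarrow> \<exists>l. M *v b = l *\<^sub>R b"
  obtains v l where "norm v = 1" "\<And>b. b \<in> B \<Longrightarrow> v \<bullet> b = 0" "M *v v = l *\<^sub>R v"
proof -
  define U where "U = {x. \<forall>b\<in>B. x \<bullet> b = 0}"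
  have subU: "x + y \<in> U" "c *\<^sub>R x \<in> U" "x - y \<in> U" if "x \<in> U" "y \<in> U" for x y c
    using that by (auto simp: U_def inner_simps)
  have MU: "M *v x \<in> U" if "x \<in> U" for x
    using that eig by (force simp: U_def inner_matrix_vector_left sym)
  \<comment> \<open>Fewer than \<open>CARD('n)\<close> vectors span a proper subspace; the normal of
    a hyperplane containing it is a nonzero element of \<open>U\<close>.\<close>
  have "dim B < DIM(real^'n)"
    using dim_le_card'[OF B(1)] B(2) by simp
  then obtain a where a: "a \<noteq> 0" "span B \<subseteq> {x. a \<bullet> x = 0}"
    using lowdim_subset_hyperplane by blast
  then have "a \<in> U"
    by (auto simp: U_def subset_iff span_base)
  let ?C = "U \<inter> sphere 0 1"
  have "closed U"
    unfolding U_def Collect_ball_eq by (intro closed_INT ballI closed_Collect_eq continuous_intros)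
  then have "compact ?C"
    by (intro closed_Int_compact) auto
  moreover have "a /\<^sub>R norm a \<in> ?C"
    using a(1) subU(2)[OF \<open>a \<in> U\<close> \<open>a \<in> U\<close>] by simp
  moreover have "continuous_on ?C (\<lambda>x. x \<bullet> (M *v x))"
    by (intro continuous_intros matrix_vector_mult_linear_continuous_on)
  ultimately obtain v where v: "v \<in> ?C" and max: "\<And>x. x \<in> ?C \<Longrightarrow> x \<bullet> (M *v x) \<le> v \<bullet> (M *v v)"
    using continuous_attains_sup[of ?C] by blast
  define l where "l = v \<bullet> (M *v v)"
  have vU: "v \<in> U" and v1: "v \<bullet> v = 1"
    using v by (auto simp: dot_square_norm)
  have le: "x \<bullet> (M *v x) \<le> l * (x \<bullet> x)" if "x \<in> U" for x
  proof (cases "x = 0")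
    case False
    then have "x /\<^sub>R norm x \<in> ?C"
      using that subU(2)[OF that that] by simp
    from max[OF this] show ?thesis
      using False by (simp add: l_def matrix_vector_mult_scaleR dot_square_norm field_simps power2_eq_square)
  qed simp
  \<comment> \<open>First variation: moving \<open>v\<close> inside \<open>U\<close> in an
    orthogonal direction changes the quotient to first order by twice this inner product, which must
    vanish at a maximum.\<close>
  have ortho: "(M *v v) \<bullet> w = 0" if w: "w \<in> U" "v \<bullet> w = 0" for w
  proof -
    have "t * (2 * ((M *v v) \<bullet> w)) + t\<^sup>2 * (w \<bullet> (M *v w) - l * (w \<bullet> w)) \<le> 0" for t
    proof -
      have "v + t *\<^sub>R w \<in> U" using subU vU w by simp
      from le[OF this] have "v \<bullet> (M *v v) + t * (v \<bullet> (M *v w)) + t * (w \<bullet> (M *v v)) + t\<^sup>2 * (w \<bullet> (M *v w))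
           \<le> l * (1 + t\<^sup>2 * (w \<bullet> w))"
        using w(2) v1
        by (simp add: inner_simps matrix_vector_mult_scaleR matrix_vector_right_distrib
              inner_commute[of w v] power2_eq_square algebra_simps)
      moreover have "v \<bullet> (M *v w) = (M *v v) \<bullet> w" "w \<bullet> (M *v v) = (M *v v) \<bullet> w"
        by (simp_all only: inner_matrix_vector_left sym inner_commute[of w])
      ultimately show ?thesis
        unfolding l_def by (simp add: algebra_simps)
    qed
    from quadratic_nonpos_imp_zero[OF this] show ?thesis by simp
  qed
  \<comment> \<open>The residual is itself an admissible direction orthogonal to \<open>v\<close>;
    testing against it shows that its norm is zero.\<close>
  let ?w = "M *v v - l *\<^sub>R v"
  have "?w \<in> U" using MU subU vU by simp
  moreover have vw: "v \<bullet> ?w = 0" using v1 by (simp add: inner_simps l_def)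
  ultimately have "(M *v v) \<bullet> ?w = 0" by (rule ortho)
  then have "?w \<bullet> ?w = 0"
    using vw by (metis (no_types, lifting) inner_diff_left inner_scaleR_left diff_self mult_zero_right)
  then have "M *v v = l *\<^sub>R v" by simp
  with v show ?thesis
    by (intro that[of v l]) (auto simp: U_def)
qed

text \<open>Eigenvectors are collected one at a time, each orthogonal to its predecessors, until
  there are \<open>CARD('n)\<close> of them; they become the rows of \<open>Q\<close>.\<close>

theorem symmetric_matrix_diagonalization:
  fixes M :: "real^'n^'n"
  assumes sym: "transpose M = M"
  obtains Q d where "orthogonal_matrix Q" "M = transpose Q ** diag d ** Q"
proof -
  have "\<exists>B. finite B \<and> card B = k \<and> (\<forall>b\<in>B. norm b = 1 \<and> (\<exists>l. M *v b = l *\<^sub>R b)) \<and>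
      pairwise orthogonal B" if "k \<le> CARD('n)" for k
    using that
  proof (induction k)
    case 0
    show ?case by (rule exI[of _ "{}"]) (auto simp: pairwise_def)
  next
    case (Suc k)
    then obtain B where B: "finite B" "card B = k" "pairwise orthogonal B"
      "\<And>b. b \<in> B \<Longrightarrow> norm b = 1" "\<And>b. b \<in> B \<Longrightarrow> \<exists>l. M *v b = l *\<^sub>R b"
      by auto
    then obtain v l where v: "norm v = 1" "\<And>b. b \<in> B \<Longrightarrow> v \<bullet> b = 0" "M *v v = l *\<^sub>R v"
      using symmetric_eigenvector_orthogonal[OF sym B(1)] Suc.prems by (metis Suc_le_lessD)
    have "v \<notin> B" using v by (metis norm_eq_1 zero_neq_one)
    then show ?case
      using B v by (intro exI[of _ "insert v B"])
        (auto simp: pairwise_def orthogonal_def inner_commute)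
  qed
  from this[of "CARD('n)"] obtain B where B: "finite B" "card B = CARD('n)"
      "\<forall>b\<in>B. norm b = 1 \<and> (\<exists>l. M *v b = l *\<^sub>R b)" "pairwise orthogonal B"
    by auto
  obtain e where e: "bij_betw e (UNIV :: 'n set) B"
    using B(1,2) finite_same_card_bij[of "UNIV :: 'n set" B] by auto
  then have eB: "e i \<in> B" for i by (auto simp: bij_betw_def)
  then have "\<forall>i. \<exists>l. M *v e i = l *\<^sub>R e i"
    using B(3) by blast
  then obtain d where d: "\<And>i. M *v e i = d i *\<^sub>R e i"
    unfolding choice_iff by blast
  define Q where "Q = (\<chi> i. e i)"
  have Qe: "(Q *v x) $ i = e i \<bullet> x" for x i
    by (simp add: Q_def matrix_vector_mul_component)
  have orth: "orthogonal_matrix Q"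
    unfolding orthogonal_matrix_orthonormal_rows
  proof (intro conjI allI impI)
    fix i j :: 'n
    show "norm (row i Q) = 1" using B(3) eB by (simp add: Q_def row_def)
    assume "i \<noteq> j"
    then have "e i \<noteq> e j" using e by (auto simp: bij_betw_def inj_on_def)
    then show "orthogonal (row i Q) (row j Q)"
      using B(4) eB by (auto simp: Q_def row_def pairwise_def)
  qed
  have "Q ** M = diag d ** Q"
  proof (rule iffD2[OF matrix_eq], intro allI)
    fix x
    show "(Q ** M) *v x = (diag d ** Q) *v x"
      by (simp add: vec_eq_iff matrix_vector_mul_assoc[symmetric] diag_mult_vec Qe
          inner_matrix_vector_right sym d)
  qed
  then have "transpose Q ** (Q ** M) = transpose Q ** diag d ** Q"
    by (simp add: matrix_mul_assoc)
  then have "M = transpose Q ** diag d ** Q"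
    using orth by (simp add: matrix_mul_assoc orthogonal_matrix)
  with orth show ?thesis by (rule that)
qed

text \<open>Whitening by \<open>S0\<close> turns the first form into the identity and the second
  into the symmetric matrix \<open>?M\<close>; rotating by the eigenvectors of \<open>?M\<close>
  diagonalises the second and leaves the first alone. It is meant for the precisions of two Gaussian
  laws.\<close>

theorem simultaneous_diagonalization:
  fixes S0 S1 :: "real^'n^'n"
  assumes "invertible S0" "invertible S1"
  obtains S Q :: "real^'n^'n" and d where "S ** Q = mat 1" "Q ** S = mat 1" "transpose S ** S = transpose S0 ** S0"
    "transpose S ** diag d ** S = transpose S1 ** S1" "\<And>i. d i > 0"
proof -
  from assms(1) obtain Q0 where Q0: "S0 ** Q0 = mat 1" "Q0 ** S0 = mat 1"
    unfolding invertible_def by blast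
  from assms(2) obtain Q1 where Q1: "S1 ** Q1 = mat 1" "Q1 ** S1 = mat 1"
    unfolding invertible_def by blast
  let ?N = "S1 ** Q0"
  let ?M = "transpose ?N ** ?N"
  have "transpose ?M = ?M"
    by (simp add: matrix_transpose_mul)
  then obtain U d where U: "orthogonal_matrix U" and M: "?M = transpose U ** diag d ** U"
    by (rule symmetric_matrix_diagonalization)
  have UU: "transpose U ** U = mat 1" "U ** transpose U = mat 1"
    using U by (auto simp: orthogonal_matrix_def)
  have Q0t: "transpose S0 ** transpose Q0 = mat 1"
    by (metis Q0(2) matrix_transpose_mul transpose_mat)
  define S Q where "S = U ** S0" and "Q = Q0 ** transpose U"
  have 1: "S ** Q = mat 1"
    by (metis S_def Q_def Q0(1) UU(2) matrix_mul_assoc matrix_mul_rid)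
  have 2: "Q ** S = mat 1"
    by (metis S_def Q_def Q0(2) UU(1) matrix_mul_assoc matrix_mul_rid)
  have 3: "transpose S ** S = transpose S0 ** S0"
    by (metis S_def UU(1) matrix_mul_assoc matrix_mul_rid matrix_transpose_mul)
  have "transpose S ** diag d ** S = transpose S0 ** (transpose U ** diag d ** U) ** S0"
    by (simp add: S_def matrix_transpose_mul matrix_mul_assoc)
  also have "\<dots> = transpose S0 ** ?M ** S0"
    by (simp only: M)
  also have "\<dots> = (transpose S0 ** transpose Q0) ** transpose S1 ** S1 ** (Q0 ** S0)"
    by (simp add: matrix_transpose_mul matrix_mul_assoc)
  also have "\<dots> = transpose S1 ** S1"
    by (simp only: Q0t Q0(2) matrix_mul_lid matrix_mul_rid)
  finally have 4: "transpose S ** diag d ** S = transpose S1 ** S1" .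
  have "d i > 0" for i
  proof -
    \<comment> \<open>\<open>S\<close> sends this vector to the \<open>i\<close>-th unit vector, so
      \<open>d i\<close> is its squared norm under \<open>S1\<close>, which is injective.\<close>
    let ?x = "Q *v axis i 1"
    have Sx: "S *v ?x = axis i 1"
      by (simp add: matrix_vector_mul_assoc 1)
    have "d i = axis i 1 \<bullet> (diag d *v axis i 1)"
      by (simp add: diag_mult_vec inner_axis')
    also have "\<dots> = (S *v ?x) \<bullet> (diag d *v (S *v ?x))"
      by (simp only: Sx)
    also have "\<dots> = ?x \<bullet> ((transpose S ** diag d ** S) *v ?x)"
      by (simp only: matrix_vector_mul_assoc[symmetric] inner_matrix_vector_left)
    also have "\<dots> = (S1 *v ?x) \<bullet> (S1 *v ?x)"
      by (simp only: 4 matrix_vector_mul_assoc[symmetric] inner_matrix_vector_left)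
    finally have d: "d i = (S1 *v ?x) \<bullet> (S1 *v ?x)" .
    have "S1 *v ?x \<noteq> 0"
    proof
      assume "S1 *v ?x = 0"
      then have "(Q1 ** S1) *v ?x = 0" by (metis matrix_vector_mul_assoc matrix_vector_mult_0_right)
      then have "?x = 0" by (simp add: Q1(2))
      then have "axis i (1::real) = 0" using Sx by simp
      then show False by (simp add: axis_eq_0_iff)
    qed
    then show "d i > 0" unfolding d by simp
  qed
  from that[OF 1 2 3 4 this] show ?thesis .
qed

section \<open>Lebesgue measure and linear maps\<close>

lemma Basis_vec_real: "(Basis :: (real^'n) set) = range (\<lambda>i. axis i 1)"
  by (auto simp: Basis_vec_def)

lemma prod_Basis_vec: "(\<Prod>b\<in>(Basis :: (real^'n) set). f b) = (\<Prod>i\<in>UNIV. f (axis i 1))"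
  unfolding Basis_vec_real by (subst prod.reindex) (auto simp: inj_on_def axis_eq_axis)

lemma measurable_vec_lambda_PiM [measurable]:
  "vec_lambda \<in> (Pi\<^sub>M UNIV (\<lambda>_::'n::finite. lborel)) \<rightarrow>\<^sub>M (borel :: (real^'n) measure)"
proof (rule iffD2[OF borel_measurable_euclidean_space], rule ballI)
  fix b :: "real^'n" assume "b \<in> Basis"
  then obtain i where "b = axis i 1" by (auto simp: Basis_vec_real)
  then show "(\<lambda>x. vec_lambda x \<bullet> b) \<in> borel_measurable (Pi\<^sub>M UNIV (\<lambda>_. lborel))"
    by (simp add: inner_axis)
qed

lemma borel_measurable_vec_nth' [measurable (raw)]:
  "f \<in> borel_measurable M \<Longrightarrow> (\<lambda>x. f x $ i) \<in> borel_measurable M" for f :: "'a \<Rightarrow> real^'n"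
  using borel_measurable_continuous_onI[of "\<lambda>x. x $ i"]
  by (rule measurable_compose[rotated]) (intro continuous_intros)

lemma borel_measurable_vec_iff:
  "f \<in> borel_measurable M \<longleftrightarrow> (\<forall>i. (\<lambda>x. f x $ i) \<in> borel_measurable M)" for f :: "'a \<Rightarrow> real^'n"
  by (subst borel_measurable_euclidean_space) (auto simp: Basis_vec_real inner_axis)

lemma borel_measurable_matrix_vector_mult [measurable (raw)]:
  "f \<in> borel_measurable M \<Longrightarrow> (\<lambda>x. A *v f x) \<in> borel_measurable M" for f :: "'a \<Rightarrow> real^'n" and A :: "real^'n^'m"
  by (subst borel_measurable_vec_iff) (simp add: matrix_vector_mult_def)

text \<open>Both measures give a box the product of its side lengths. This bridge carries Fubini
  arguments on function spaces over to integrals over vectors, on which matrices act.\<close>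

lemma lborel_vec: "(lborel :: (real^'n) measure) = distr (Pi\<^sub>M UNIV (\<lambda>_::'n::finite. lborel)) borel vec_lambda"
proof (rule lborel_eqI)
  fix l u :: "real^'n" assume "\<And>b. b \<in> Basis \<Longrightarrow> l \<bullet> b \<le> u \<bullet> b"
  from this[of "axis i 1" for i] have le: "l $ i \<le> u $ i" for i
    by (simp add: inner_axis)
  interpret finite_product_sigma_finite "\<lambda>_::'n. lborel :: real measure" UNIV by standard auto
  have "vec_lambda -` box l u \<inter> space (Pi\<^sub>M UNIV (\<lambda>_::'n. lborel)) = Pi\<^sub>E UNIV (\<lambda>i. {l $ i<..<u $ i})"
    by (auto simp: space_PiM mem_box_cart PiE_iff)
  then have "emeasure (distr (Pi\<^sub>M UNIV (\<lambda>_::'n. lborel)) borel vec_lambda) (box l u)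
      = (\<Prod>i\<in>UNIV. emeasure lborel {l $ i<..<u $ i})"
    by (subst emeasure_distr) (auto intro: emeasure_PiM)
  also have "\<dots> = (\<Prod>i\<in>UNIV. ennreal (u $ i - l $ i))"
    using le by (intro prod.cong refl emeasure_lborel_Ioo)
  also have "\<dots> = ennreal (\<Prod>b\<in>Basis. (u - l) \<bullet> b)"
    using le by (subst prod_ennreal) (auto simp: prod_Basis_vec inner_axis)
  finally show "emeasure (distr (Pi\<^sub>M UNIV (\<lambda>_::'n. lborel)) borel vec_lambda) (box l u)
      = ennreal (\<Prod>b\<in>Basis. (u - l) \<bullet> b)" .
qed simp

lemma nn_integral_lborel_vec:
  assumes "f \<in> borel_measurable borel"
  shows "(\<integral>\<^sup>+x. f x \<partial>(lborel :: (real^'n) measure)) = (\<integral>\<^sup>+y. f (vec_lambda y) \<partial>(Pi\<^sub>M UNIV (\<lambda>_::'n::finite. lborel)))"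
  using assms by (subst lborel_vec) (simp add: nn_integral_distr)

interpretation prod_lborel: product_sigma_finite "\<lambda>_::'n. lborel :: real measure"
  by standard

text \<open>Isolates one coordinate, so that a shear acts on the inner integral as a
  translation.\<close>

lemma nn_integral_vec_insert:
  fixes f :: "real^'n \<Rightarrow> ennreal"
  assumes [measurable]: "f \<in> borel_measurable borel"
  shows "(\<integral>\<^sup>+x. f x \<partial>lborel) =
    (\<integral>\<^sup>+y. (\<integral>\<^sup>+t. f (vec_lambda (y(m := t))) \<partial>lborel) \<partial>(Pi\<^sub>M (UNIV - {m}) (\<lambda>_. lborel)))"
proof -
  have "(\<lambda>y. f (vec_lambda y)) \<in> borel_measurable (Pi\<^sub>M (insert m (UNIV - {m})) (\<lambda>_. lborel))"
    using measurable_compose[OF measurable_vec_lambda_PiM assms] by (simp add: insert_absorb)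
  from prod_lborel.product_nn_integral_insert[OF _ _ this] show ?thesis
    by (simp add: nn_integral_lborel_vec insert_absorb)
qed

text \<open>Stated for the integrals of all measurable functions at once, the substitution rule is preserved by
  matrix products, so it suffices to check it on elementary matrices.\<close>

lemma nn_integral_matrix_vector_mult:
  fixes A :: "real^'n^'n" and f :: "real^'n \<Rightarrow> ennreal"
  assumes "det A \<noteq> 0" "f \<in> borel_measurable borel"
  shows "(\<integral>\<^sup>+x. f x \<partial>lborel) = ennreal \<bar>det A\<bar> * (\<integral>\<^sup>+x. f (A *v x) \<partial>lborel)"
proof -
  have "\<forall>f\<in>borel_measurable borel. det A \<noteq> 0 \<longrightarrow>
     (\<integral>\<^sup>+x. f x \<partial>lborel) = ennreal \<bar>det A\<bar> * (\<integral>\<^sup>+x. f (A *v x) \<partial>lborel)"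
  proof (induction A rule: induct_matrix_elementary)
    case (1 A B)
    show ?case
    proof (intro ballI impI)
      fix f :: "real^'n \<Rightarrow> ennreal" assume f[measurable]: "f \<in> borel_measurable borel" and "det (A ** B) \<noteq> 0"
      then have ne: "det A \<noteq> 0" "det B \<noteq> 0" by (auto simp: det_mul)
      have "(\<lambda>x. f (A *v x)) \<in> borel_measurable borel" by measurable
      with 1(2) ne have "(\<integral>\<^sup>+x. f (A *v x) \<partial>lborel) = ennreal \<bar>det B\<bar> * (\<integral>\<^sup>+x. f (A *v (B *v x)) \<partial>lborel)"
        by blast
      moreover have "(\<integral>\<^sup>+x. f x \<partial>lborel) = ennreal \<bar>det A\<bar> * (\<integral>\<^sup>+x. f (A *v x) \<partial>lborel)"
        using 1(1) ne f by blast
      ultimately show "(\<integral>\<^sup>+x. f x \<partial>lborel) = ennreal \<bar>det (A ** B)\<bar> * (\<integral>\<^sup>+x. f ((A ** B) *v x) \<partial>lborel)"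
        by (simp add: det_mul abs_mult ennreal_mult matrix_vector_mul_assoc mult.assoc)
    qed
  next
    case (2 A i)
    then show ?case by (simp add: det_zero_row)
  next
    case (3 A)
    show ?case
    proof (intro ballI impI)
      fix f :: "real^'n \<Rightarrow> ennreal" assume f[measurable]: "f \<in> borel_measurable borel" and "det A \<noteq> 0"
      then have dA: "det A = (\<Prod>i\<in>UNIV. A $ i $ i)" and ne: "\<And>i. A $ i $ i \<noteq> 0"
        using det_diagonal[of A] 3 by auto
      \<comment> \<open>\<open>lborel_affine_euclidean\<close> takes its scaling factors indexed by
        basis vectors; \<open>c\<close> recovers the index from the basis vector and reads off the
        diagonal entry.\<close>
      define c where "c b = A $ (SOME i. b = axis i 1) $ (SOME i. b = axis i 1)" for b :: "real^'n"
      have c: "c (axis i 1) = A $ i $ i" for i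
        by (simp add: c_def axis_eq_axis)
      have T: "0 + (\<Sum>j\<in>Basis. (c j * (x \<bullet> j)) *\<^sub>R j) = A *v x" for x
      proof -
        have "(\<Sum>j\<in>Basis. (c j * (x \<bullet> j)) *\<^sub>R j) = (\<Sum>i\<in>UNIV. (A $ i $ i * x $ i) *\<^sub>R axis i 1)"
          unfolding Basis_vec_real by (subst sum.reindex) (auto simp: inj_on_def axis_eq_axis c inner_axis)
        also have "\<dots> = A *v x"
        proof (rule vec_eq_iff[THEN iffD2], rule allI)
          fix k
          have "(A *v x) $ k = (\<Sum>j\<in>UNIV. if k = j then A $ k $ k * x $ k else 0)"
            unfolding matrix_vector_mult_def vec_lambda_beta using 3 by (intro sum.cong) auto
          moreover have "(\<Sum>i\<in>UNIV. (A $ i $ i * x $ i) *\<^sub>R axis i 1) $ k = (\<Sum>i\<in>UNIV. if k = i then A $ k $ k * x $ k else 0)"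
            unfolding sum_component by (intro sum.cong) (auto simp: axis_def)
          ultimately show "(\<Sum>i\<in>UNIV. (A $ i $ i * x $ i) *\<^sub>R axis i 1) $ k = (A *v x) $ k" by simp
        qed
        finally show ?thesis by simp
      qed
      have "(lborel :: (real^'n) measure) = density (distr lborel borel (\<lambda>x. A *v x)) (\<lambda>_. (\<Prod>j\<in>Basis. \<bar>c j\<bar>))"
      proof -
        have "c j \<noteq> 0" if "j \<in> Basis" for j
          using that ne by (auto simp: Basis_vec_real c)
        from lborel_affine_euclidean[of c 0, OF this] show ?thesis unfolding T .
      qed
      moreover have "(\<Prod>j\<in>Basis. \<bar>c j\<bar>) = \<bar>det A\<bar>"
        by (simp add: prod_Basis_vec c dA abs_prod)
      ultimately have "(lborel :: (real^'n) measure) = density (distr lborel borel (\<lambda>x. A *v x)) (\<lambda>_. \<bar>det A\<bar>)"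
        by simp
      then have "(\<integral>\<^sup>+x. f x \<partial>lborel) = (\<integral>\<^sup>+x. f x \<partial>(density (distr lborel borel (\<lambda>x. A *v x)) (\<lambda>_. \<bar>det A\<bar>)))"
        by simp
      then show "(\<integral>\<^sup>+x. f x \<partial>lborel) = ennreal \<bar>det A\<bar> * (\<integral>\<^sup>+x. f (A *v x) \<partial>lborel)"
        by (simp add: nn_integral_density nn_integral_distr nn_integral_cmult)
    qed
  next
    case (4 m n)
    let ?A = "(\<chi> i j. mat 1 $ i $ Transposition.transpose m n j) :: real^'n^'n"
    let ?p = "Transposition.transpose m n"
    have perm: "?p permutes UNIV" by (rule permutes_swap_id) auto
    have A: "(?A *v x) $ i = x $ ?p i" for x i
    proof -
      have "i = ?p j \<longleftrightarrow> j = ?p i" for j by (metis transpose_involutory)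
      then have "(?A *v x) $ i = (\<Sum>j\<in>UNIV. if j = ?p i then x $ j else 0)"
        unfolding matrix_vector_mult_def mat_def vec_lambda_beta by (intro sum.cong) auto
      then show ?thesis by simp
    qed
    have "\<bar>det ?A\<bar> = 1"
      using det_permute_columns[OF perm, of "mat 1 :: real^'n^'n"] by (simp add: sign_def)
    \<comment> \<open>Permuting coordinates pulls boxes back to boxes and only reorders the product
      of the side lengths.\<close>
    have "lborel = distr lborel borel ((*v) ?A)"
    proof (rule lborel_eqI)
      fix l u :: "real^'n" assume "\<And>b. b \<in> Basis \<Longrightarrow> l \<bullet> b \<le> u \<bullet> b"
      from this[of "axis i 1" for i] have le: "l $ i \<le> u $ i" for i
        by (simp add: inner_axis)
      have "((*v) ?A) -` box l u = box (\<chi> i. l $ ?p i) (\<chi> i. u $ ?p i)"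
      proof (intro set_eqI iffI)
        fix x assume x: "x \<in> ((*v) ?A) -` box l u"
        show "x \<in> box (\<chi> i. l $ ?p i) (\<chi> i. u $ ?p i)"
          unfolding mem_box_cart vec_lambda_beta
        proof
          fix i from x show "l $ ?p i < x $ i \<and> x $ i < u $ ?p i"
            by (simp add: mem_box_cart A del: transpose_involutory) (metis transpose_involutory)
        qed
      next
        fix x assume x: "x \<in> box (\<chi> i. l $ ?p i) (\<chi> i. u $ ?p i)"
        show "x \<in> ((*v) ?A) -` box l u"
          unfolding mem_box_cart vimage_eq A
        proof
          fix i from x have "l $ ?p (?p i) < x $ ?p i \<and> x $ ?p i < u $ ?p (?p i)"
            unfolding mem_box_cart vec_lambda_beta by blast
          then show "l $ i < x $ ?p i \<and> x $ ?p i < u $ i" by simp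
        qed
      qed
      then have "emeasure (distr lborel borel ((*v) ?A)) (box l u) = emeasure lborel (box (\<chi> i. l $ ?p i) (\<chi> i. u $ ?p i))"
        by (subst emeasure_distr) auto
      also have "\<dots> = ennreal (\<Prod>i\<in>UNIV. u $ ?p i - l $ ?p i)"
        using le by (subst emeasure_lborel_box) (auto simp: Basis_vec_real inner_axis prod_Basis_vec[unfolded Basis_vec_real])
      also have "(\<Prod>i\<in>UNIV. u $ ?p i - l $ ?p i) = (\<Prod>i\<in>UNIV. u $ i - l $ i)"
        by (rule prod.permute[OF perm, of "\<lambda>i. u $ i - l $ i", unfolded comp_def, symmetric])
      finally show "emeasure (distr lborel borel ((*v) ?A)) (box l u) = ennreal (\<Prod>b\<in>Basis. (u - l) \<bullet> b)"
        by (simp add: prod_Basis_vec inner_axis)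
    qed simp
    then have eq: "(\<integral>\<^sup>+x. f x \<partial>lborel) = (\<integral>\<^sup>+x. f x \<partial>(distr lborel borel ((*v) ?A)))" for f :: "real^'n \<Rightarrow> ennreal"
      by simp
    have "(\<integral>\<^sup>+x. f x \<partial>lborel) = (\<integral>\<^sup>+x. f (?A *v x) \<partial>lborel)"
      if f: "f \<in> borel_measurable borel" for f :: "real^'n \<Rightarrow> ennreal"
      unfolding eq[of f] by (subst nn_integral_distr) (use f in auto)
    then show ?case
      unfolding \<open>\<bar>det ?A\<bar> = 1\<close> ennreal_1 mult_1 by (intro ballI impI)
  next
    case (5 m n c)
    let ?A = "(\<chi> i j. if i = m \<and> j = n then c else of_bool (i = j)) :: real^'n^'n"
    have A: "?A *v x = (\<chi> i. if i = m then x $ m + c * x $ n else x $ i)" for x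
    proof (rule vec_eq_iff[THEN iffD2], rule allI)
      fix i
      have "(?A *v x) $ i = (\<Sum>j\<in>UNIV. (if j = i then x $ i else 0) + (if j = n then (if i = m then c * x $ n else 0) else 0))"
        unfolding matrix_vector_mult_def vec_lambda_beta using 5 by (intro sum.cong) auto
      then show "(?A *v x) $ i = (\<chi> i. if i = m then x $ m + c * x $ n else x $ i) $ i"
        by (simp add: sum.distrib)
    qed
    have det: "det ?A = 1"
    proof -
      have "?A = (\<chi> k. if k = m then row m (mat 1) + c *s row n (mat 1) else row k (mat 1 :: real^'n^'n))"
        using 5 by (auto simp: vec_eq_iff row_def mat_def)
      then show ?thesis using det_row_operation[OF 5, of "mat 1 :: real^'n^'n" c] by simp
    qed
    \<comment> \<open>A shear shifts coordinate \<open>m\<close> by an amount determined by another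
      coordinate, and the inner integral over coordinate \<open>m\<close> is translation
      invariant.\<close>
    have "(\<integral>\<^sup>+x. f x \<partial>lborel) = (\<integral>\<^sup>+x. f (?A *v x) \<partial>lborel)" if f[measurable]: "f \<in> borel_measurable borel" for f
    proof -
      have "(\<integral>\<^sup>+x. f (?A *v x) \<partial>lborel) =
        (\<integral>\<^sup>+y. (\<integral>\<^sup>+t. f (?A *v vec_lambda (y(m := t))) \<partial>lborel) \<partial>(Pi\<^sub>M (UNIV - {m}) (\<lambda>_. lborel)))"
        by (rule nn_integral_vec_insert) measurable
      also have "\<dots> = (\<integral>\<^sup>+y. (\<integral>\<^sup>+t. f (vec_lambda (y(m := t))) \<partial>lborel) \<partial>(Pi\<^sub>M (UNIV - {m}) (\<lambda>_. lborel)))"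
      proof (rule nn_integral_cong)
        fix y :: "'n \<Rightarrow> real"
        have eq: "?A *v vec_lambda (y(m := t)) = vec_lambda (y(m := c * y n + 1 * t))" for t
          unfolding A using 5 by (auto simp: vec_eq_iff)
        have "(\<lambda>t. vec_lambda (y(m := t))) \<in> borel \<rightarrow>\<^sub>M (borel :: (real^'n) measure)"
          unfolding borel_measurable_vec_iff by auto
        then have "(\<lambda>t. f (vec_lambda (y(m := t)))) \<in> borel_measurable borel"
          by (rule measurable_compose) fact
        from nn_integral_real_affine[OF this, of 1 "c * y n"]
        show "(\<integral>\<^sup>+t. f (?A *v vec_lambda (y(m := t))) \<partial>lborel) = (\<integral>\<^sup>+t. f (vec_lambda (y(m := t))) \<partial>lborel)"
          unfolding eq by simp
      qed
      also have "\<dots> = (\<integral>\<^sup>+x. f x \<partial>lborel)"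
        by (rule nn_integral_vec_insert[symmetric]) fact
      finally show ?thesis by simp
    qed
    then show ?case
      unfolding det abs_one ennreal_1 mult_1 by (intro ballI impI)
  qed
  with assms show ?thesis by blast
qed

lemma nn_integral_affine_vec:
  fixes A :: "real^'n^'n" and f :: "real^'n \<Rightarrow> ennreal"
  assumes "det A \<noteq> 0" and [measurable]: "f \<in> borel_measurable borel"
  shows "(\<integral>\<^sup>+x. f x \<partial>lborel) = ennreal \<bar>det A\<bar> * (\<integral>\<^sup>+x. f (c + A *v x) \<partial>lborel)"
proof -
  have "lborel = distr lborel borel ((+) c)"
    using lborel_distr_plus[of c] by simp
  then have "(\<integral>\<^sup>+x. f x \<partial>lborel) = (\<integral>\<^sup>+x. f x \<partial>distr lborel borel ((+) c))" by simp
  also have "\<dots> = (\<integral>\<^sup>+x. f (c + x) \<partial>lborel)" by (simp add: nn_integral_distr)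
  also have "\<dots> = ennreal \<bar>det A\<bar> * (\<integral>\<^sup>+x. f (c + A *v x) \<partial>lborel)"
    by (rule nn_integral_matrix_vector_mult) (use assms in auto)
  finally show ?thesis .
qed

section \<open>Standard Gaussian vectors\<close>

definition std_gauss :: "(real^'n::finite) measure" where
  "std_gauss = density lborel (\<lambda>x. \<Prod>i\<in>UNIV. ennreal (std_normal_density (x $ i)))"

lemma sets_std_gauss [measurable_cong, simp]: "sets std_gauss = sets borel"
  and space_std_gauss [simp]: "space std_gauss = UNIV"
  by (simp_all add: std_gauss_def)

lemma prod_std_normal_density:
  "(\<Prod>i\<in>UNIV. std_normal_density (z $ i)) = exp (- (norm z)\<^sup>2 / 2) / sqrt (2 * pi) ^ CARD('n)" for z :: "real^'n"
proof -
  have "(\<Prod>i\<in>UNIV. std_normal_density (z $ i)) = (\<Prod>i\<in>(UNIV::'n set). 1 / sqrt (2 * pi)) * exp (\<Sum>i\<in>UNIV. - (z $ i)\<^sup>2 / 2)"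
    by (simp add: std_normal_density_def prod_dividef exp_sum power_one_over)
  also have "(\<Sum>i\<in>UNIV. - (z $ i)\<^sup>2 / 2) = - (norm z)\<^sup>2 / 2"
    by (simp add: norm_vec_def L2_set_def sum_nonneg sum_divide_distrib sum_negf)
  finally show ?thesis by (simp add: power_divide power_one_over)
qed

lemma nn_integral_std_gauss_prod:
  assumes [measurable]: "\<And>i. f i \<in> borel_measurable borel"
  shows "(\<integral>\<^sup>+z. (\<Prod>i\<in>UNIV. f i (z $ i)) \<partial>(std_gauss :: (real^'n) measure)) =
    (\<Prod>i\<in>UNIV. (\<integral>\<^sup>+x. ennreal (std_normal_density x) * f i x \<partial>lborel))"
proof -
  have "(\<integral>\<^sup>+z. (\<Prod>i\<in>UNIV. f i (z $ i)) \<partial>(std_gauss :: (real^'n) measure)) =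
    (\<integral>\<^sup>+z. (\<Prod>i\<in>UNIV. ennreal (std_normal_density (z $ i)) * f i (z $ i)) \<partial>lborel)"
    by (simp add: std_gauss_def nn_integral_density prod.distrib)
  also have "\<dots> = (\<integral>\<^sup>+y. (\<Prod>i\<in>UNIV. ennreal (std_normal_density (y i)) * f i (y i)) \<partial>(Pi\<^sub>M UNIV (\<lambda>_::'n. lborel)))"
    by (subst nn_integral_lborel_vec) auto
  also have "\<dots> = (\<Prod>i\<in>UNIV. (\<integral>\<^sup>+x. ennreal (std_normal_density x) * f i x \<partial>lborel))"
    by (rule prod_lborel.product_nn_integral_prod) auto
  finally show ?thesis .
qed

lemma nn_integral_std_normal_density: "(\<integral>\<^sup>+x. ennreal (std_normal_density x) \<partial>lborel) = 1"
  using nn_integral_eq_integral[of lborel std_normal_density] by (simp add: integral_normal_density)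

lemma prob_space_std_gauss: "prob_space (std_gauss :: (real^'n) measure)"
proof (rule prob_spaceI)
  have "emeasure (std_gauss :: (real^'n) measure) UNIV = (\<integral>\<^sup>+z. (\<Prod>i\<in>UNIV. (\<lambda>i x. 1) i (z $ i)) \<partial>(std_gauss :: (real^'n) measure))"
    by simp
  also have "\<dots> = 1"
    by (subst nn_integral_std_gauss_prod) (simp_all add: nn_integral_std_normal_density)
  finally show "emeasure (std_gauss :: (real^'n) measure) (space std_gauss) = 1" by simp
qed

lemma distr_std_gauss_component:
  "distr (std_gauss :: (real^'n) measure) borel (\<lambda>z. z $ k) = density lborel std_normal_density"
proof (rule measure_eqI)
  fix A :: "real set" assume "A \<in> sets (distr (std_gauss :: (real^'n) measure) borel (\<lambda>z. z $ k))"
  then have [measurable]: "A \<in> sets borel" by simp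
  \<comment> \<open>The product formula with trivial factors in all coordinates but
    \<open>k\<close>.\<close>
  let ?f = "\<lambda>i x. if i = k then indicator A x else (1::ennreal)"
  have "emeasure (distr (std_gauss :: (real^'n) measure) borel (\<lambda>z. z $ k)) A =
      (\<integral>\<^sup>+z. indicator A (z $ k) \<partial>(std_gauss :: (real^'n) measure))"
    by (subst nn_integral_indicator[symmetric], simp, subst nn_integral_distr) auto
  also have "\<dots> = (\<integral>\<^sup>+z. (\<Prod>i\<in>UNIV. ?f i (z $ i)) \<partial>(std_gauss :: (real^'n) measure))"
    by (simp add: prod.If_cases)
  also have "\<dots> = (\<Prod>i\<in>UNIV. (\<integral>\<^sup>+x. ennreal (std_normal_density x) * ?f i x \<partial>lborel))"
    by (rule nn_integral_std_gauss_prod) auto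
  also have "\<dots> = (\<Prod>i\<in>UNIV. if i = k then emeasure (density lborel std_normal_density) A else 1)"
    by (intro prod.cong) (auto simp: emeasure_density nn_integral_std_normal_density)
  also have "\<dots> = emeasure (density lborel std_normal_density) A"
    by simp
  finally show "emeasure (distr (std_gauss :: (real^'n) measure) borel (\<lambda>z. z $ k)) A = emeasure (density lborel std_normal_density) A" .
qed simp

lemma std_gauss_component_moments:
  fixes i :: "'n::finite"
  shows "integrable std_gauss (\<lambda>z::real^'n. z $ i)" "integrable std_gauss (\<lambda>z::real^'n. (z $ i)\<^sup>2)"
    and "(\<integral>z. z $ i \<partial>(std_gauss :: (real^'n) measure)) = 0"
    and "(\<integral>z. (z $ i)\<^sup>2 \<partial>(std_gauss :: (real^'n) measure)) = 1"
proof -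
  have 1: "integrable (density lborel std_normal_density) (\<lambda>x. x ^ k)" for k
    using integrable_std_normal_moment[of k] by (subst integrable_density) auto
  have 2: "(\<integral>x. x ^ k \<partial>(density lborel std_normal_density)) = (\<integral>x. std_normal_density x * x ^ k \<partial>lborel)" for k
    by (subst integral_density) auto
  have i: "integrable std_gauss (\<lambda>z::real^'n. (z $ i) ^ k)" for k
    using 1[of k] unfolding distr_std_gauss_component[of i, symmetric]
    by (subst (asm) integrable_distr_eq) auto
  have e: "(\<integral>z. (z $ i) ^ k \<partial>(std_gauss :: (real^'n) measure)) = (\<integral>x. std_normal_density x * x ^ k \<partial>lborel)" for k
    using 2[of k] unfolding distr_std_gauss_component[of i, symmetric]
    by (subst (asm) integral_distr) auto
  show "integrable std_gauss (\<lambda>z::real^'n. z $ i)" "integrable std_gauss (\<lambda>z::real^'n. (z $ i)\<^sup>2)"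
    using i[of 1] i[of 2] by simp_all
  show "(\<integral>z. z $ i \<partial>(std_gauss :: (real^'n) measure)) = 0"
    using e[of 1] integral_std_normal_moment_odd[of 0] by simp
  show "(\<integral>z. (z $ i)\<^sup>2 \<partial>(std_gauss :: (real^'n) measure)) = 1"
    using e[of 2] integral_std_normal_moment_even[of 1] by simp
qed

text \<open>Tilting the standard normal density by \<open>exp (l * x\<^sup>2)\<close> gives a
  multiple of the centred normal density with variance \<open>1 / (1 - 2 * l)\<close>; the multiple
  is its standard deviation.\<close>

lemma nn_integral_exp_square_std_normal:
  assumes "l < 1 / 2"
  shows "(\<integral>\<^sup>+x. ennreal (std_normal_density x) * ennreal (exp (l * x\<^sup>2)) \<partial>lborel) = ennreal (1 / sqrt (1 - 2 * l))"
proof -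
  define s where "s = 1 / sqrt (1 - 2 * l)"
  have s: "s > 0" "s\<^sup>2 = 1 / (1 - 2 * l)" using assms by (auto simp: s_def power_divide)
  have "std_normal_density x * exp (l * x\<^sup>2) = s * normal_density 0 s x" for x
  proof -
    have "- x\<^sup>2 / 2 + l * x\<^sup>2 = - (x - 0)\<^sup>2 / (2 * s\<^sup>2)"
      using assms by (simp add: s(2) field_simps)
    then have "std_normal_density x * exp (l * x\<^sup>2) = 1 / sqrt (2 * pi) * exp (- (x - 0)\<^sup>2 / (2 * s\<^sup>2))"
      by (simp add: std_normal_density_def exp_add[symmetric])
    then show ?thesis
      using s(1) by (simp add: normal_density_def real_sqrt_mult)
  qed
  then have "(\<integral>\<^sup>+x. ennreal (std_normal_density x) * ennreal (exp (l * x\<^sup>2)) \<partial>lborel) = (\<integral>\<^sup>+x. ennreal s * ennreal (normal_density 0 s x) \<partial>lborel)"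
    using s(1) by (simp add: ennreal_mult[symmetric])
  also have "\<dots> = ennreal s * (\<integral>\<^sup>+x. ennreal (normal_density 0 s x) \<partial>lborel)"
    by (rule nn_integral_cmult) auto
  also have "(\<integral>\<^sup>+x. ennreal (normal_density 0 s x) \<partial>lborel) = 1"
    using nn_integral_eq_integral[of lborel "normal_density 0 s"] s(1) by (simp add: integral_normal_density integrable_normal_density)
  finally show ?thesis by (simp add: s_def)
qed

lemma norm_power2_vec: "(norm z)\<^sup>2 = (\<Sum>i\<in>UNIV. (z $ i)\<^sup>2)" for z :: "real^'n"
  by (simp add: norm_vec_def L2_set_def sum_nonneg)

text \<open>Chernoff's bound for the chi-squared distribution, with $1 - 2\lambda$ equal to the ratio of the number of degrees
  of freedom to the threshold.\<close>

lemma std_gauss_norm_tail: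
  assumes "z \<ge> 0"
  shows "measure (std_gauss :: (real^'n) measure) {x. norm x > sqrt (real CARD('n)) + sqrt (2 * z)} \<le> exp (- z)"
proof (cases "z = 0")
  case True
  then show ?thesis using prob_space.prob_le_1[OF prob_space_std_gauss] by simp
next
  case False
  with assms have z: "z > 0" by simp
  interpret prob_space "std_gauss :: (real^'n) measure" by (rule prob_space_std_gauss)
  define n where "n = real CARD('n)"
  have n: "n \<ge> 1" by (simp add: n_def)
  \<comment> \<open>\<open>w\<close> is the relative excess over \<open>sqrt n\<close>, so that the
    threshold becomes \<open>c = sqrt n * (1 + w)\<close>.\<close>
  define w where "w = sqrt (2 * z) / sqrt n"
  have w: "w > 0" "w\<^sup>2 = 2 * z / n" using z n by (auto simp: w_def power_divide)
  define c where "c = sqrt n + sqrt (2 * z)"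
  have c: "c = sqrt n * (1 + w)" "c > 0" using n z by (auto simp: c_def w_def field_simps add_pos_pos)
  have c2: "c\<^sup>2 = n * (1 + w)\<^sup>2" using n by (simp add: c(1) power_mult_distrib)
  define l where "l = (1 - 1 / (1 + w)\<^sup>2) / 2"
  have w1: "(1 + w)\<^sup>2 > 1" using w(1) by (intro one_less_power) auto
  have "0 < u \<Longrightarrow> u < 1 \<Longrightarrow> 0 < (1 - u) / 2 \<and> (1 - u) / 2 < 1 / 2 \<and> 1 - 2 * ((1 - u) / 2) = u" for u :: real
    by (auto simp: field_simps)
  from this[of "1 / (1 + w)\<^sup>2"] have l: "l > 0" "l < 1 / 2" "1 - 2 * l = 1 / (1 + w)\<^sup>2"
    using w1 unfolding l_def
    by (auto simp only: divide_less_eq_1 zero_less_divide_1_iff intro: less_trans[OF zero_less_one])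
  have "emeasure std_gauss {x::real^'n. norm x > c} \<le> emeasure std_gauss {x::real^'n \<in> space std_gauss. ennreal (exp (l * c\<^sup>2)) \<le> ennreal (exp (l * (norm x)\<^sup>2))}"
  proof (rule emeasure_mono)
    show "{x::real^'n. norm x > c} \<subseteq> {x \<in> space std_gauss. ennreal (exp (l * c\<^sup>2)) \<le> ennreal (exp (l * (norm x)\<^sup>2))}"
      using l(1) c(2) by (auto simp: power2_eq_square intro!: mult_left_mono mult_mono ennreal_leI)
  qed measurable
  also have "\<dots> \<le> (\<integral>\<^sup>+x. ennreal (exp (l * (norm x)\<^sup>2)) \<partial>(std_gauss :: (real^'n) measure)) / ennreal (exp (l * c\<^sup>2))"
  proof -
    have "emeasure std_gauss {x::real^'n \<in> space std_gauss. ennreal (exp (l * c\<^sup>2)) \<le> ennreal (exp (l * (norm x)\<^sup>2))}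
       \<le> emeasure std_gauss {x::real^'n \<in> space std_gauss. 1 \<le> ennreal (exp (- (l * c\<^sup>2))) * ennreal (exp (l * (norm x)\<^sup>2))}"
      by (intro emeasure_mono) (auto simp: ennreal_mult[symmetric] exp_add[symmetric])
    also have "\<dots> = emeasure std_gauss ({x::real^'n \<in> space std_gauss. 1 \<le> ennreal (exp (- (l * c\<^sup>2))) * ennreal (exp (l * (norm x)\<^sup>2))} \<inter> UNIV)"
      by simp
    also have "\<dots> \<le> ennreal (exp (- (l * c\<^sup>2))) * (\<integral>\<^sup>+x. ennreal (exp (l * (norm x)\<^sup>2)) \<partial>(std_gauss :: (real^'n) measure))"
      using nn_integral_Markov_inequality[where M = std_gauss and A = UNIV
          and u = "\<lambda>x. ennreal (exp (l * (norm x)\<^sup>2))" and c = "ennreal (exp (- (l * c\<^sup>2)))"]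
      by simp
    also have "\<dots> = (\<integral>\<^sup>+x. ennreal (exp (l * (norm x)\<^sup>2)) \<partial>(std_gauss :: (real^'n) measure)) / ennreal (exp (l * c\<^sup>2))"
      by (simp add: divide_ennreal_def exp_minus inverse_ennreal mult.commute)
    finally show ?thesis .
  qed
  also have "(\<integral>\<^sup>+x. ennreal (exp (l * (norm x)\<^sup>2)) \<partial>(std_gauss :: (real^'n) measure)) =
      (\<integral>\<^sup>+x. (\<Prod>i\<in>UNIV. (\<lambda>_ x. ennreal (exp (l * x\<^sup>2))) i (x $ i)) \<partial>(std_gauss :: (real^'n) measure))"
    by (simp add: norm_power2_vec sum_distrib_left exp_sum prod_ennreal)
  also have "\<dots> = ennreal (1 + w) ^ CARD('n)"
  proof (subst nn_integral_std_gauss_prod)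
    have "1 / sqrt (1 / (1 + w)\<^sup>2) = 1 + w" using w(1) by (simp add: real_sqrt_divide)
    then show "(\<Prod>i\<in>(UNIV :: 'n set). \<integral>\<^sup>+x. ennreal (std_normal_density x) * ennreal (exp (l * x\<^sup>2)) \<partial>lborel) =
      ennreal (1 + w) ^ CARD('n)"
      unfolding nn_integral_exp_square_std_normal[OF l(2)] l(3) by simp
  qed measurable
  also have "ennreal (1 + w) ^ CARD('n) / ennreal (exp (l * c\<^sup>2)) = ennreal ((1 + w) ^ CARD('n) / exp (l * c\<^sup>2))"
    using w(1) by (simp add: ennreal_power divide_ennreal del: ennreal_plus)
  also have "\<dots> \<le> ennreal (exp (- z))"
  proof (rule ennreal_leI)
    \<comment> \<open>The exponent \<open>l * c\<^sup>2\<close> equals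
      \<open>n * w + n * w\<^sup>2 / 2\<close>. Its linear part cancels against
      \<open>exp (n * w)\<close>, and the quadratic part is exactly \<open>z\<close>.\<close>
    have "(1 + w) ^ CARD('n) \<le> exp w ^ CARD('n)"
      using w(1) by (intro power_mono) auto
    also have "\<dots> = exp (n * w)" by (simp add: n_def exp_of_nat_mult)
    finally have "(1 + w) ^ CARD('n) / exp (l * c\<^sup>2) \<le> exp (n * w - l * c\<^sup>2)"
      by (simp add: exp_diff divide_right_mono)
    also have "n * w - l * c\<^sup>2 = - (n * w\<^sup>2 / 2)"
    proof -
      have "l * c\<^sup>2 = n * ((1 + w)\<^sup>2 - 1) / 2"
        using w(1) by (simp add: l_def c2 field_simps)
      then show ?thesis by (simp add: power2_eq_square algebra_simps)
    qed
    also have "n * w\<^sup>2 / 2 = z"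
      using n by (simp add: w(2))
    finally show "(1 + w) ^ CARD('n) / exp (l * c\<^sup>2) \<le> exp (- z)" by simp
  qed
  finally show ?thesis
    unfolding emeasure_eq_measure c_def n_def by simp
qed

section \<open>Gaussian laws as images of the standard Gaussian vector\<close>

definition keep :: "'n set \<Rightarrow> real^'n \<Rightarrow> real^'n" where
  "keep R x = (\<chi> i. if i \<in> R then x $ i else 0)"

lemma keep_nth [simp]: "keep R x $ i = (if i \<in> R then x $ i else 0)"
  by (simp add: keep_def)

definition vec_of :: "'n set \<Rightarrow> ('n \<Rightarrow> real) \<Rightarrow> real^'n" where
  "vec_of R x = (\<chi> i. if i \<in> R then x i else 0)"

lemma vec_of_nth [simp]: "vec_of R x $ i = (if i \<in> R then x i else 0)"
  by (simp add: vec_of_def)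

text \<open>\<open>S\<close> is a whitening and \<open>Q\<close> a colouring matrix: the Gaussian in
  question has covariance \<open>Q ** transpose Q\<close> and precision
  \<open>transpose S ** S\<close>. Both are the identity off \<open>R\<close>, so determinants and
  inverses of the full matrices are those of the \<open>R\<close>-blocks.\<close>

definition block_inverse :: "'n::finite set \<Rightarrow> real^'n^'n \<Rightarrow> real^'n^'n \<Rightarrow> bool" where
  "block_inverse R S Q \<longleftrightarrow> S ** Q = mat 1 \<and> Q ** S = mat 1 \<and> blk R S = S \<and> blk R Q = Q"

lemma blk_nth: "blk R M $ i $ k = (if i \<in> R \<and> k \<in> R then M $ i $ k else if i = k then 1 else 0)"
  by (simp add: blk_def)

lemma blk_eq_iff: "blk R M = M \<longleftrightarrow> (\<forall>i k. i \<notin> R \<or> k \<notin> R \<longrightarrow> M $ i $ k = (if i = k then 1 else 0))"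
  by (auto simp: vec_eq_iff blk_nth)

lemma blk_idem [simp]: "blk R (blk R M) = blk R M"
  by (auto simp: blk_eq_iff blk_nth)

lemma blk_transpose: "blk R M = M \<Longrightarrow> blk R (transpose M) = transpose M"
  by (auto simp: blk_eq_iff transpose_def)

lemma blk_mult:
  fixes A B :: "real^'n^'n"
  assumes "blk R A = A" "blk R B = B"
  shows "blk R (A ** B) = A ** B"
  unfolding blk_eq_iff
proof (intro allI impI)
  fix i k assume ik: "i \<notin> R \<or> k \<notin> R"
  have A: "A $ i $ j = (if i = j then 1 else 0)" if "i \<notin> R \<or> j \<notin> R" for i j
    using assms(1) that unfolding blk_eq_iff by blast
  have B: "B $ i $ j = (if i = j then 1 else 0)" if "i \<notin> R \<or> j \<notin> R" for i j
    using assms(2) that unfolding blk_eq_iff by blast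
  have "(A ** B) $ i $ k = (\<Sum>j\<in>UNIV. A $ i $ j * B $ j $ k)"
    by (simp add: matrix_matrix_mult_def)
  also have "\<dots> = (if i = k then 1 else 0)"
  proof (cases "i \<in> R")
    case False
    then have "(\<Sum>j\<in>UNIV. A $ i $ j * B $ j $ k) = (\<Sum>j\<in>UNIV. if i = j then B $ j $ k else 0)"
      by (intro sum.cong) (auto simp: A)
    then show ?thesis using False by (simp add: B)
  next
    case True
    then have k: "k \<notin> R" using ik by simp
    then have "(\<Sum>j\<in>UNIV. A $ i $ j * B $ j $ k) = (\<Sum>j\<in>UNIV. if j = k then A $ i $ j else 0)"
      by (intro sum.cong) (auto simp: B)
    then show ?thesis using k by (simp add: A)
  qed
  finally show "(A ** B) $ i $ k = (if i = k then 1 else 0)" .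
qed

lemma matrix_inv_eqI:
  fixes A B :: "real^'n^'n"
  assumes "A ** B = mat 1" "B ** A = mat 1"
  shows "matrix_inv A = B"
proof -
  have "A ** matrix_inv A = mat 1 \<and> matrix_inv A ** A = mat 1"
    unfolding matrix_inv_def by (rule someI[of _ B]) (use assms in simp)
  then show ?thesis
    by (metis assms(2) matrix_mul_assoc matrix_mul_lid matrix_mul_rid)
qed

lemma blk_mult_vec_nth:
  fixes S :: "real^'n^'n"
  assumes "blk R S = S"
  shows "(S *v y) $ i = (if i \<in> R then (S *v keep R y) $ i else y $ i)"
proof -
  have S: "S $ i $ j = (if i = j then 1 else 0)" if "i \<notin> R \<or> j \<notin> R" for j
    using assms that unfolding blk_eq_iff by blast
  show ?thesis
  proof (cases "i \<in> R")
    case True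
    then have "S $ i $ j * y $ j = S $ i $ j * keep R y $ j" for j
      by (cases "j \<in> R") (auto simp: S)
    then have "(S *v y) $ i = (S *v keep R y) $ i"
      unfolding matrix_vector_mult_def vec_lambda_beta by (intro sum.cong refl)
    with True show ?thesis by simp
  next
    case False
    then have "(S *v y) $ i = (\<Sum>j\<in>UNIV. if i = j then y $ j else 0)"
      unfolding matrix_vector_mult_def vec_lambda_beta by (intro sum.cong) (auto simp: S)
    with False show ?thesis by simp
  qed
qed

text \<open>Off \<open>R\<close> the matrix is the identity and does not mix with \<open>R\<close>,
  so the norm splits by Pythagoras. This separates the genuine observation from padding
  coordinates.\<close>

lemma norm_blk_mult_vec:
  fixes S :: "real^'n^'n"
  assumes "blk R S = S"
  shows "(norm (S *v y))\<^sup>2 = (norm (S *v keep R y))\<^sup>2 + (\<Sum>i\<in>-R. (y $ i)\<^sup>2)"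
proof -
  have sp: "(\<Sum>i\<in>UNIV. f i) = (\<Sum>i\<in>R. f i) + (\<Sum>i\<in>-R. f i)" for f :: "'n \<Rightarrow> real"
    by (subst sum.union_disjoint[symmetric]) auto
  have "(\<Sum>i\<in>R. ((S *v y) $ i)\<^sup>2) = (\<Sum>i\<in>R. ((S *v keep R y) $ i)\<^sup>2)"
    by (intro sum.cong) (simp_all add: blk_mult_vec_nth[OF assms, of y])
  moreover have "(\<Sum>i\<in>-R. ((S *v y) $ i)\<^sup>2) = (\<Sum>i\<in>-R. (y $ i)\<^sup>2)"
    by (intro sum.cong) (simp_all add: blk_mult_vec_nth[OF assms, of y])
  moreover have "(\<Sum>i\<in>-R. ((S *v keep R y) $ i)\<^sup>2) = 0"
    by (intro sum.neutral) (simp_all add: blk_mult_vec_nth[OF assms, of "keep R y"])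
  ultimately show ?thesis
    unfolding norm_power2_vec sp by simp
qed

lemma block_inverse_det: "block_inverse R S Q \<Longrightarrow> det S * det Q = 1"
  by (metis block_inverse_def det_I det_mul)

lemma inverse_cov:
  fixes S Q :: "real^'n^'n"
  assumes "S ** Q = mat 1" "Q ** S = mat 1"
  shows "(Q ** transpose Q) ** (transpose S ** S) = mat 1" "(transpose S ** S) ** (Q ** transpose Q) = mat 1"
proof -
  have t: "transpose Q ** transpose S = mat 1" "transpose S ** transpose Q = mat 1"
    using assms by (metis matrix_transpose_mul transpose_mat)+
  have "(Q ** transpose Q) ** (transpose S ** S) = Q ** (transpose Q ** transpose S) ** S"
    "(transpose S ** S) ** (Q ** transpose Q) = transpose S ** (S ** Q) ** transpose Q"
    by (simp_all only: matrix_mul_assoc)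
  then show "(Q ** transpose Q) ** (transpose S ** S) = mat 1" "(transpose S ** S) ** (Q ** transpose Q) = mat 1"
    by (simp_all only: t assms matrix_mul_rid)
qed

lemma gauss_pdf_block_inverse:
  fixes S Q :: "real^'n^'n"
  assumes bi: "block_inverse R S Q" and \<mu>: "\<And>i. i \<notin> R \<Longrightarrow> \<mu> $ i = 0"
  shows "gauss_pdf R \<mu> (Q ** transpose Q) x =
    exp (- (norm (S *v (vec_of R x - \<mu>)))\<^sup>2 / 2) / (sqrt (2 * pi) ^ card R * \<bar>det Q\<bar>)"
proof -
  have SQ: "S ** Q = mat 1" "Q ** S = mat 1" "blk R S = S" "blk R Q = Q"
    using bi by (auto simp: block_inverse_def)
  have blk: "blk R (Q ** transpose Q) = Q ** transpose Q"
    by (intro blk_mult blk_transpose SQ)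
  have inv: "matrix_inv (Q ** transpose Q) = transpose S ** S"
    by (intro matrix_inv_eqI inverse_cov SQ)
  let ?y = "vec_of R x - \<mu>" and ?W = "transpose S ** S"
  have "(\<Sum>i\<in>R. \<Sum>k\<in>R. (x i - \<mu> $ i) * ?W $ i $ k * (x k - \<mu> $ k)) = (\<Sum>i\<in>UNIV. \<Sum>k\<in>UNIV. ?y $ i * ?W $ i $ k * ?y $ k)"
    by (intro sum.mono_neutral_cong_left) (auto simp: \<mu> intro!: sum.mono_neutral_cong_left)
  also have "\<dots> = ?y \<bullet> (?W *v ?y)"
    by (simp add: inner_vec_def matrix_vector_mult_def sum_distrib_left mult.assoc)
  also have "\<dots> = (norm (S *v ?y))\<^sup>2"
    by (simp only: matrix_vector_mul_assoc[symmetric] inner_matrix_vector_left[symmetric] power2_norm_eq_inner)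
  finally have q: "(\<Sum>i\<in>R. \<Sum>k\<in>R. (x i - \<mu> $ i) * ?W $ i $ k * (x k - \<mu> $ k)) = (norm (S *v ?y))\<^sup>2" .
  have "sqrt ((2 * pi) ^ card R * det (Q ** transpose Q)) = sqrt (2 * pi) ^ card R * \<bar>det Q\<bar>"
  proof -
    have "det (Q ** transpose Q) = (det Q)\<^sup>2" by (simp add: det_mul power2_eq_square)
    then show ?thesis
      unfolding real_sqrt_mult[of "(2 * pi) ^ card R"] real_sqrt_power[of "2 * pi"] by simp
  qed
  then show ?thesis
    unfolding gauss_pdf_def blk inv q by simp
qed

section \<open>Padding a Gaussian law on a coordinate subspace to the full space\<close>

lemma borel_measurable_gauss_pdf [measurable]: "gauss_pdf R \<mu> V \<in> borel_measurable (Pi\<^sub>M R (\<lambda>_. lborel))"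
  unfolding gauss_pdf_def by measurable

text \<open>The missing coordinates are filled with independent standard normal ones, which have
  total mass 1. Integrals over \<open>R\<close> become integrals over all vectors, to which the
  substitution rule for square matrices applies.\<close>

lemma nn_integral_PiM_pad:
  fixes R :: "'n::finite set"
  assumes [measurable]: "f \<in> borel_measurable (Pi\<^sub>M R (\<lambda>_. lborel))"
  shows "(\<integral>\<^sup>+y. f y \<partial>(Pi\<^sub>M R (\<lambda>_. lborel))) =
    (\<integral>\<^sup>+x. f (restrict (($) x) R) * (\<Prod>i\<in>-R. ennreal (std_normal_density (x $ i))) \<partial>(lborel :: (real^'n) measure))"
proof -
  let ?g = "\<lambda>y. f (restrict y R) * (\<Prod>i\<in>-R. ennreal (std_normal_density (y i)))"
  have U: "R \<union> - R = UNIV" by simp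
  have [measurable]: "(\<lambda>y. restrict y R) \<in> Pi\<^sub>M UNIV (\<lambda>_. lborel :: real measure) \<rightarrow>\<^sub>M Pi\<^sub>M R (\<lambda>_. lborel)"
    by (rule measurable_restrict_subset) simp
  have vl: "($) (vec_lambda y) = y" for y :: "'n \<Rightarrow> real"
    by (rule ext) simp
  have gm: "?g \<in> borel_measurable (Pi\<^sub>M (R \<union> - R) (\<lambda>_. lborel))"
    unfolding U by measurable
  have "(\<integral>\<^sup>+x. f (restrict (($) x) R) * (\<Prod>i\<in>-R. ennreal (std_normal_density (x $ i))) \<partial>(lborel :: (real^'n) measure))
     = (\<integral>\<^sup>+y. ?g y \<partial>(Pi\<^sub>M (R \<union> - R) (\<lambda>_. lborel)))"
    by (subst nn_integral_lborel_vec) (auto simp: U vl)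
  also have "\<dots> = (\<integral>\<^sup>+x. (\<integral>\<^sup>+y. ?g (merge R (-R) (x, y)) \<partial>(Pi\<^sub>M (-R) (\<lambda>_. lborel))) \<partial>(Pi\<^sub>M R (\<lambda>_. lborel)))"
    by (rule prod_lborel.product_nn_integral_fold[OF _ _ _ gm]) auto
  also have "\<dots> = (\<integral>\<^sup>+x. f x \<partial>(Pi\<^sub>M R (\<lambda>_. lborel)))"
  proof (rule nn_integral_cong)
    fix x assume x: "x \<in> space (Pi\<^sub>M R (\<lambda>_. lborel :: real measure))"
    have "restrict (merge R (-R) (x, y)) R = x" for y
      using x by (auto simp: space_PiM PiE_def extensional_def merge_def fun_eq_iff)
    moreover have "(\<Prod>i\<in>-R. ennreal (std_normal_density (merge R (-R) (x, y) i))) = (\<Prod>i\<in>-R. ennreal (std_normal_density (y i)))" for y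
      by (intro prod.cong) (auto simp: merge_def)
    moreover have "(\<integral>\<^sup>+y. (\<Prod>i\<in>-R. ennreal (std_normal_density (y i))) \<partial>(Pi\<^sub>M (-R) (\<lambda>_. lborel))) = 1"
      by (subst prod_lborel.product_nn_integral_prod) (auto simp: nn_integral_std_normal_density)
    ultimately show "(\<integral>\<^sup>+y. ?g (merge R (-R) (x, y)) \<partial>(Pi\<^sub>M (-R) (\<lambda>_. lborel))) = f x"
      by (simp add: nn_integral_cmult)
  qed
  finally show ?thesis by simp
qed

text \<open>After padding, the substitution \<open>x = \<mu> + Q *v z\<close> reduces the density to
  the standard one. Only \<open>transpose S ** S\<close> is tied to \<open>S0\<close>, since the
  jointly diagonalising \<open>S\<close> to which this is applied later need not have block
  form.\<close>

lemma gauss_eq_distr: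
  fixes S0 Q0 S Q :: "real^'n^'n"
  assumes bi: "block_inverse R S0 Q0" and SQ: "S ** Q = mat 1" "Q ** S = mat 1"
    and W: "transpose S ** S = transpose S0 ** S0" and \<mu>: "\<And>i. i \<notin> R \<Longrightarrow> \<mu> $ i = 0"
  shows "gauss R \<mu> (Q0 ** transpose Q0) =
    distr std_gauss (Pi\<^sub>M R (\<lambda>_. lborel)) (\<lambda>z. restrict (($) (\<mu> + Q *v z)) R)"
proof (rule measure_eqI)
  show "sets (gauss R \<mu> (Q0 ** transpose Q0)) =
    sets (distr std_gauss (Pi\<^sub>M R (\<lambda>_. lborel)) (\<lambda>z. restrict (($) (\<mu> + Q *v z)) R))"
    by (simp add: gauss_def)
  fix A assume "A \<in> sets (gauss R \<mu> (Q0 ** transpose Q0))"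
  then have [measurable]: "A \<in> sets (Pi\<^sub>M R (\<lambda>_. lborel))" by (simp add: gauss_def)
  have blk: "blk R S0 = S0" using bi by (simp add: block_inverse_def)
  have normS: "norm (S0 *v y) = norm (S *v y)" for y
  proof -
    have "(norm (T *v y))\<^sup>2 = y \<bullet> ((transpose T ** T) *v y)" for T :: "real^'n^'n"
      by (simp only: matrix_vector_mul_assoc[symmetric] inner_matrix_vector_left[symmetric] power2_norm_eq_inner)
    then have "(norm (S0 *v y))\<^sup>2 = (norm (S *v y))\<^sup>2" using W by simp
    then show ?thesis by (simp add: power2_eq_iff_nonneg)
  qed
  have dets: "det S * det Q = 1" using SQ by (metis det_I det_mul)
  have "(det S)\<^sup>2 = (det S0)\<^sup>2"
    using arg_cong[OF W, of det] by (simp add: det_mul power2_eq_square)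
  then have "\<bar>det S\<bar> = \<bar>det S0\<bar>" by (simp add: power2_eq_iff abs_eq_iff)
  moreover have "\<bar>det Q\<bar> = 1 / \<bar>det S\<bar>" "\<bar>det Q0\<bar> = 1 / \<bar>det S0\<bar>"
  proof -
    have "\<bar>y\<bar> = 1 / \<bar>x\<bar>" if "x * y = 1" for x y :: real
    proof -
      from that have "y = 1 / x" by (cases "x = 0") (auto simp: field_simps)
      then show ?thesis by simp
    qed
    from this[OF dets] this[OF block_inverse_det[OF bi]]
    show "\<bar>det Q\<bar> = 1 / \<bar>det S\<bar>" "\<bar>det Q0\<bar> = 1 / \<bar>det S0\<bar>" .
  qed
  ultimately have dQ: "\<bar>det Q0\<bar> = \<bar>det Q\<bar>" by simp
  have dQ0: "det Q \<noteq> 0" using dets by auto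
  let ?n = "CARD('n)"
  let ?G = "\<lambda>x. ennreal (exp (- (norm (S *v (x - \<mu>)))\<^sup>2 / 2) / (sqrt (2 * pi) ^ ?n * \<bar>det Q\<bar>))"
  let ?r = "\<lambda>x::real^'n. restrict (($) x) R"
  \<comment> \<open>With the padding factors the density becomes a full-dimensional Gaussian
    density: \<open>S0\<close> is the identity off \<open>R\<close>, so its squared norm on the full
    vector already contains the padding squares.\<close>
  have G: "ennreal (gauss_pdf R \<mu> (Q0 ** transpose Q0) (?r x)) * (\<Prod>i\<in>-R. ennreal (std_normal_density (x $ i))) = ?G x" for x
  proof -
    have v: "vec_of R (?r x) - \<mu> = keep R (x - \<mu>)" using \<mu> by (auto simp: vec_eq_iff)
    have ps: "(\<Prod>i\<in>-R. std_normal_density (x $ i)) = exp (- (\<Sum>i\<in>-R. ((x - \<mu>) $ i)\<^sup>2) / 2) / sqrt (2 * pi) ^ card (- R)"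
    proof -
      have "(\<Prod>i\<in>-R. std_normal_density (x $ i)) = (\<Prod>i\<in>-R. exp (- ((x - \<mu>) $ i)\<^sup>2 / 2) / sqrt (2 * pi))"
        by (intro prod.cong) (auto simp: std_normal_density_def \<mu>)
      then show ?thesis
        by (simp add: prod_dividef exp_sum[symmetric] sum_negf sum_divide_distrib)
    qed
    have "card R + card (- R) = ?n"
      by (metis Compl_eq_Diff_UNIV card_Diff_subset card_mono finite_class.finite_UNIV finite le_add_diff_inverse top_greatest)
    then have pw: "sqrt (2 * pi) ^ card R * sqrt (2 * pi) ^ card (- R) = sqrt (2 * pi) ^ ?n"
      by (simp add: power_add[symmetric])
    have "gauss_pdf R \<mu> (Q0 ** transpose Q0) (?r x) * (\<Prod>i\<in>-R. std_normal_density (x $ i)) =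
      (exp (- (norm (S0 *v keep R (x - \<mu>)))\<^sup>2 / 2) * exp (- (\<Sum>i\<in>-R. ((x - \<mu>) $ i)\<^sup>2) / 2)) /
        ((sqrt (2 * pi) ^ card R * sqrt (2 * pi) ^ card (- R)) * \<bar>det Q\<bar>)"
      unfolding gauss_pdf_block_inverse[OF bi \<mu>, simplified] v dQ ps by (simp add: mult_ac)
    also have "\<dots> = exp (- (norm (S *v (x - \<mu>)))\<^sup>2 / 2) / (sqrt (2 * pi) ^ ?n * \<bar>det Q\<bar>)"
      unfolding pw exp_add[symmetric] normS[symmetric]
      by (simp add: norm_blk_mult_vec[OF blk, of "x - \<mu>"] add_divide_distrib)
    finally have "gauss_pdf R \<mu> (Q0 ** transpose Q0) (?r x) * (\<Prod>i\<in>-R. std_normal_density (x $ i)) =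
        exp (- (norm (S *v (x - \<mu>)))\<^sup>2 / 2) / (sqrt (2 * pi) ^ ?n * \<bar>det Q\<bar>)" .
    moreover have "gauss_pdf R \<mu> (Q0 ** transpose Q0) (?r x) \<ge> 0"
      unfolding gauss_pdf_block_inverse[OF bi \<mu>, simplified] by simp
    ultimately show ?thesis
      by (simp add: prod_ennreal ennreal_mult[symmetric] prod_nonneg)
  qed
  have "emeasure (gauss R \<mu> (Q0 ** transpose Q0)) A =
      (\<integral>\<^sup>+y. ennreal (gauss_pdf R \<mu> (Q0 ** transpose Q0) y) * indicator A y \<partial>(Pi\<^sub>M R (\<lambda>_. lborel)))"
    by (simp add: gauss_def emeasure_density)
  also have "\<dots> = (\<integral>\<^sup>+x. ennreal (gauss_pdf R \<mu> (Q0 ** transpose Q0) (?r x)) * indicator A (?r x) *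
      (\<Prod>i\<in>-R. ennreal (std_normal_density (x $ i))) \<partial>lborel)"
    by (rule nn_integral_PiM_pad) measurable
  also have "\<dots> = (\<integral>\<^sup>+x. ?G x * indicator A (?r x) \<partial>lborel)"
    by (intro nn_integral_cong, subst G[symmetric]) (simp only: mult_ac)
  also have "\<dots> = ennreal \<bar>det Q\<bar> * (\<integral>\<^sup>+z. ?G (\<mu> + Q *v z) * indicator A (?r (\<mu> + Q *v z)) \<partial>lborel)"
    by (rule nn_integral_affine_vec[OF dQ0]) measurable
  also have "\<dots> = (\<integral>\<^sup>+z. (\<Prod>i\<in>UNIV. ennreal (std_normal_density (z $ i))) * indicator A (?r (\<mu> + Q *v z)) \<partial>lborel)"
  proof (subst nn_integral_cmult[symmetric])
    show "(\<lambda>z. ?G (\<mu> + Q *v z) * indicator A (?r (\<mu> + Q *v z))) \<in> borel_measurable lborel" by measurable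
    have "S *v (Q *v z) = z" for z by (simp add: matrix_vector_mul_assoc SQ)
    then show "(\<integral>\<^sup>+z. ennreal \<bar>det Q\<bar> * (?G (\<mu> + Q *v z) * indicator A (?r (\<mu> + Q *v z))) \<partial>lborel) =
       (\<integral>\<^sup>+z. (\<Prod>i\<in>UNIV. ennreal (std_normal_density (z $ i))) * indicator A (?r (\<mu> + Q *v z)) \<partial>lborel)"
      using dQ0 by (intro nn_integral_cong) (simp add: prod_ennreal prod_std_normal_density mult.assoc[symmetric] ennreal_mult[symmetric])
  qed
  also have "\<dots> = (\<integral>\<^sup>+z. indicator A (?r (\<mu> + Q *v z)) \<partial>std_gauss)"
    by (simp add: std_gauss_def nn_integral_density)
  also have "\<dots> = emeasure (distr std_gauss (Pi\<^sub>M R (\<lambda>_. lborel)) (\<lambda>z. ?r (\<mu> + Q *v z))) A"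
    by (subst nn_integral_indicator[symmetric], simp, subst nn_integral_distr) auto
  finally show "emeasure (gauss R \<mu> (Q0 ** transpose Q0)) A =
    emeasure (distr std_gauss (Pi\<^sub>M R (\<lambda>_. lborel)) (\<lambda>z. ?r (\<mu> + Q *v z))) A" .
qed

section \<open>Divergence and affinity of two Gaussian laws\<close>

lemma g_fun_nonneg: "r > 0 \<Longrightarrow> g_fun r \<ge> 0"
  using ln_le_minus_one[of r] by (simp add: g_fun_def)

lemma h_fun_eq: "r > 0 \<Longrightarrow> h_fun r = (ln (1 + r) - ln 2 - ln r / 2) / 2"
  by (simp add: h_fun_def ln_div ln_mult ln_sqrt)

text \<open>The exponent carries a quarter because the log-ratio of two normal densities has a
  factor one half and the square root halves it again.\<close>

lemma nn_integral_affinity_normal: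
  assumes d: "d > 0"
  shows "(\<integral>\<^sup>+x. ennreal (std_normal_density x) * ennreal (exp (- (d * (x + b)\<^sup>2 - x\<^sup>2 - ln d) / 4)) \<partial>lborel)
    = ennreal (exp (- (h_fun d + d * b\<^sup>2 / (4 * (1 + d)))))"
proof -
  \<comment> \<open>Standard deviation and mean come from completing the square in the total
    exponent, whose leading coefficient is \<open>- (1 + d) / 4\<close>.\<close>
  define s where "s = sqrt (2 / (1 + d))"
  define m where "m = - d * b / (1 + d)"
  define C where "C = exp (- (h_fun d + d * b\<^sup>2 / (4 * (1 + d))))"
  have s: "s > 0" "s\<^sup>2 = 2 / (1 + d)" using d by (auto simp: s_def)
  have lns: "ln s = (ln 2 - ln (1 + d)) / 2"
    using d by (simp add: s_def ln_sqrt ln_div)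
  have "std_normal_density x * exp (- (d * (x + b)\<^sup>2 - x\<^sup>2 - ln d) / 4) = C * normal_density m s x" for x
  proof -
    have "(x - m)\<^sup>2 / (2 * s\<^sup>2) = (1 + d) * (x - m)\<^sup>2 / 4" using d by (simp add: s(2))
    also have "\<dots> = ((1 + d) * x + d * b)\<^sup>2 / (4 * (1 + d))"
    proof -
      have "x - m = ((1 + d) * x + d * b) / (1 + d)" using d by (simp add: m_def field_simps)
      moreover have "e * (N / e)\<^sup>2 / 4 = N\<^sup>2 / (4 * e)" if "e > 0" for e N :: real
        using that by (simp add: power2_eq_square)
      ultimately show ?thesis using d by (simp only: add_pos_pos zero_less_one)
    qed
    finally have q: "(x - m)\<^sup>2 / (2 * s\<^sup>2) = ((1 + d) * x + d * b)\<^sup>2 / (4 * (1 + d))" .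
    have sq: "x\<^sup>2 / 2 + (d * (x + b)\<^sup>2 - x\<^sup>2) / 4 = ((1 + d) * x + d * b)\<^sup>2 / (4 * (1 + d)) + d * b\<^sup>2 / (4 * (1 + d))"
    proof -
      have "(x\<^sup>2 / 2 + (d * (x + b)\<^sup>2 - x\<^sup>2) / 4) * (4 * (1 + d)) = ((1 + d) * x + d * b)\<^sup>2 + d * b\<^sup>2"
      proof -
        have "(x\<^sup>2 / 2 + (d * (x + b)\<^sup>2 - x\<^sup>2) / 4) * (4 * (1 + d)) = (2 * x\<^sup>2 + (d * (x + b)\<^sup>2 - x\<^sup>2)) * (1 + d)"
        proof -
          have "a / 2 + c / 4 = (2 * a + c) / 4" for a c :: real by simp
          moreover have "a / 4 * (4 * e) = a * e" for a e :: real by simp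
          ultimately show ?thesis by metis
        qed
        also have "\<dots> = ((1 + d) * x + d * b)\<^sup>2 + d * b\<^sup>2"
          by (simp add: algebra_simps power2_eq_square)
        finally show ?thesis .
      qed
      then show ?thesis using d by (simp only: eq_divide_eq add_divide_distrib[symmetric]) simp
    qed
    have "normal_density m s x = exp (- (x - m)\<^sup>2 / (2 * s\<^sup>2)) / (sqrt (2 * pi) * s)"
      using s(1) by (simp add: normal_density_def real_sqrt_mult)
    also have "\<dots> = exp (- (x - m)\<^sup>2 / (2 * s\<^sup>2) - ln s) / sqrt (2 * pi)"
      using s(1) by (simp only: exp_diff exp_ln divide_divide_eq_left mult.commute[of s])
    finally have nd: "C * normal_density m s x = exp (- (h_fun d + d * b\<^sup>2 / (4 * (1 + d))) + (- (x - m)\<^sup>2 / (2 * s\<^sup>2) - ln s)) / sqrt (2 * pi)"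
      by (simp add: C_def exp_add[symmetric])
    have "- (h_fun d + d * b\<^sup>2 / (4 * (1 + d))) + (- (x - m)\<^sup>2 / (2 * s\<^sup>2) - ln s)
        = - x\<^sup>2 / 2 + - (d * (x + b)\<^sup>2 - x\<^sup>2 - ln d) / 4"
    proof -
      have key: "- ((l1 - l2 - ld / 2) / 2 + U) + (- T - (l2 - l1) / 2) = - X / 2 + - (D - X - ld) / 4"
        if "X / 2 + (D - X) / 4 = T + U" for X D T U l1 l2 ld :: real
        using that by argo
      have "- (x - m)\<^sup>2 / (2 * s\<^sup>2) = - (((1 + d) * x + d * b)\<^sup>2 / (4 * (1 + d)))"
        using q by simp
      then show ?thesis
        unfolding lns h_fun_eq[OF d] using key[OF sq] by metis
    qed
    then show ?thesis
      unfolding nd by (simp add: std_normal_density_def exp_add[symmetric])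
  qed
  then have "(\<integral>\<^sup>+x. ennreal (std_normal_density x) * ennreal (exp (- (d * (x + b)\<^sup>2 - x\<^sup>2 - ln d) / 4)) \<partial>lborel)
      = (\<integral>\<^sup>+x. ennreal C * ennreal (normal_density m s x) \<partial>lborel)"
    by (simp add: ennreal_mult[symmetric] C_def)
  also have "\<dots> = ennreal C * (\<integral>\<^sup>+x. ennreal (normal_density m s x) \<partial>lborel)"
    by (rule nn_integral_cmult) auto
  also have "(\<integral>\<^sup>+x. ennreal (normal_density m s x) \<partial>lborel) = 1"
    using nn_integral_eq_integral[of lborel "normal_density m s"] s(1) by (simp add: integral_normal_density integrable_normal_density)
  finally show ?thesis by (simp add: C_def)
qed

section \<open>Two Gaussian laws in jointly diagonalising coordinates\<close>

lemma matrix_inner_eq_trace: "M \<bullet> N = trace (M ** transpose N)" for M N :: "real^'n^'n"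
  by (simp add: trace_def matrix_matrix_mult_def inner_vec_def transpose_def)

lemma norm_mult_vec_power2: "(norm (S *v y))\<^sup>2 = y \<bullet> ((transpose S ** S) *v y)" for S :: "real^'n^'n"
  by (simp only: matrix_vector_mul_assoc[symmetric] inner_matrix_vector_left[symmetric] power2_norm_eq_inner)

text \<open>In the coordinates \<open>z = S *v (x - \<mu>0)\<close> of the padded vector the first
  law is standard normal, and the second has independent normal coordinates with mean
  \<open>- b $ i\<close> and variance \<open>1 / d i\<close>. Divergence and log-affinity thus
  become sums over coordinates.\<close>

locale gauss_pair =
  fixes R :: "'n::finite set" and S0 Q0 S1 Q1 S Q :: "real^'n^'n" and \<mu>0 \<mu>1 :: "real^'n" and d :: "'n \<Rightarrow> real"
  assumes bi0: "block_inverse R S0 Q0" and bi1: "block_inverse R S1 Q1"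
    and supp0: "\<And>i. i \<notin> R \<Longrightarrow> \<mu>0 $ i = 0" and supp1: "\<And>i. i \<notin> R \<Longrightarrow> \<mu>1 $ i = 0"
    and SQ: "S ** Q = mat 1" "Q ** S = mat 1"
    and W0: "transpose S ** S = transpose S0 ** S0" and W1: "transpose S ** diag d ** S = transpose S1 ** S1"
    and d_pos: "\<And>i. d i > 0"
begin

abbreviation "V0 \<equiv> Q0 ** transpose Q0"
abbreviation "V1 \<equiv> Q1 ** transpose Q1"
abbreviation "p0 \<equiv> gauss_pdf R \<mu>0 V0"
abbreviation "p1 \<equiv> gauss_pdf R \<mu>1 V1"
abbreviation "pt z \<equiv> restrict (($) (\<mu>0 + Q *v z)) R"
abbreviation "b \<equiv> S *v (\<mu>0 - \<mu>1)"

lemma S_Q_vec: "S *v (Q *v z) = z" by (simp add: matrix_vector_mul_assoc SQ)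

lemma norm_S0: "(norm (S0 *v y))\<^sup>2 = (norm (S *v y))\<^sup>2"
  by (simp only: norm_mult_vec_power2 W0)

lemma norm_S1: "(norm (S1 *v y))\<^sup>2 = (\<Sum>i\<in>UNIV. d i * ((S *v y) $ i)\<^sup>2)"
proof -
  have "(norm (S1 *v y))\<^sup>2 = (S *v y) \<bullet> (diag d *v (S *v y))"
    unfolding norm_mult_vec_power2 W1[symmetric]
    by (simp only: matrix_vector_mul_assoc[symmetric] inner_matrix_vector_left)
  then show ?thesis by (simp add: diag_mult_vec inner_vec_def power2_eq_square mult_ac)
qed

lemma dets: "det S0 \<noteq> 0" "det S1 \<noteq> 0" "\<bar>det Q0\<bar> = 1 / \<bar>det S0\<bar>" "\<bar>det Q1\<bar> = 1 / \<bar>det S1\<bar>"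
  and sum_ln_d: "(\<Sum>i\<in>UNIV. ln (d i)) = 2 * (ln \<bar>det S1\<bar> - ln \<bar>det S0\<bar>)"
proof -
  have "\<bar>y\<bar> = 1 / \<bar>x\<bar> \<and> x \<noteq> 0" if "x * y = 1" for x y :: real
  proof -
    from that have "y = 1 / x" by (cases "x = 0") (auto simp: field_simps)
    then show ?thesis using that by auto
  qed
  from this[OF block_inverse_det[OF bi0]] this[OF block_inverse_det[OF bi1]]
  show d: "det S0 \<noteq> 0" "det S1 \<noteq> 0" "\<bar>det Q0\<bar> = 1 / \<bar>det S0\<bar>" "\<bar>det Q1\<bar> = 1 / \<bar>det S1\<bar>" by auto
  have e0: "(det S)\<^sup>2 = (det S0)\<^sup>2"
    using arg_cong[OF W0, of det] by (simp add: det_mul power2_eq_square)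
  have "(det S1)\<^sup>2 = (det S0)\<^sup>2 * (\<Prod>i\<in>UNIV. d i)"
    using arg_cong[OF W1, of det] by (simp add: det_mul det_diag power2_eq_square e0[unfolded power2_eq_square, symmetric] mult_ac)
  then have "ln (\<bar>det S1\<bar>\<^sup>2) = ln (\<bar>det S0\<bar>\<^sup>2 * (\<Prod>i\<in>UNIV. d i))" by simp
  moreover have "(\<Prod>i\<in>UNIV. d i) > 0" by (intro prod_pos) (simp add: d_pos)
  ultimately have "2 * ln \<bar>det S1\<bar> = 2 * ln \<bar>det S0\<bar> + ln (\<Prod>i\<in>UNIV. d i)"
  proof -
    have "ln (\<bar>det S0\<bar>\<^sup>2 * (\<Prod>i\<in>UNIV. d i)) = ln (\<bar>det S0\<bar>\<^sup>2) + ln (\<Prod>i\<in>UNIV. d i)"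
      using d(1) \<open>(\<Prod>i\<in>UNIV. d i) > 0\<close> by (intro ln_mult_pos) auto
    with \<open>ln (\<bar>det S1\<bar>\<^sup>2) = _\<close> show ?thesis unfolding ln_realpow by simp
  qed
  moreover have "ln (\<Prod>i\<in>UNIV. d i) = (\<Sum>i\<in>UNIV. ln (d i))"
    using d_pos by (subst ln_prod) (auto simp: less_imp_neq[symmetric])
  ultimately show "(\<Sum>i\<in>UNIV. ln (d i)) = 2 * (ln \<bar>det S1\<bar> - ln \<bar>det S0\<bar>)" by simp
qed

lemma p0_eq: "p0 x = exp (- (norm (S0 *v (vec_of R x - \<mu>0)))\<^sup>2 / 2) * \<bar>det S0\<bar> / sqrt (2 * pi) ^ card R"
  by (subst gauss_pdf_block_inverse[OF bi0]) (simp_all add: supp0 dets)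

lemma p1_eq: "p1 x = exp (- (norm (S1 *v (vec_of R x - \<mu>1)))\<^sup>2 / 2) * \<bar>det S1\<bar> / sqrt (2 * pi) ^ card R"
  by (subst gauss_pdf_block_inverse[OF bi1]) (simp_all add: supp1 dets)

lemma p0_pos: "p0 x > 0" and p1_pos: "p1 x > 0"
  unfolding p0_eq p1_eq using dets(1,2) by auto

lemma ln_p0: "ln (p0 x) = - (norm (S0 *v (vec_of R x - \<mu>0)))\<^sup>2 / 2 - ln (sqrt (2 * pi) ^ card R) + ln \<bar>det S0\<bar>"
  unfolding p0_eq using dets(1) by (subst ln_divide_pos, simp, simp, subst ln_mult_pos) auto

lemma ln_p1: "ln (p1 x) = - (norm (S1 *v (vec_of R x - \<mu>1)))\<^sup>2 / 2 - ln (sqrt (2 * pi) ^ card R) + ln \<bar>det S1\<bar>"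
  unfolding p1_eq using dets(2) by (subst ln_divide_pos, simp, simp, subst ln_mult_pos) auto

text \<open>Both squared norms may be taken over full vectors: off \<open>R\<close> the two means
  vanish, so the padding squares are equal and cancel.\<close>

lemma ln_ratio:
  "ln (p0 (pt z)) - ln (p1 (pt z)) = (\<Sum>i\<in>UNIV. d i * (z $ i + b $ i)\<^sup>2 - (z $ i)\<^sup>2 - ln (d i)) / 2"
proof -
  have blk: "blk R S0 = S0" "blk R S1 = S1" using bi0 bi1 by (auto simp: block_inverse_def)
  have v: "vec_of R (pt z) - \<mu>0 = keep R (Q *v z)" "vec_of R (pt z) - \<mu>1 = keep R (Q *v z + (\<mu>0 - \<mu>1))"
    using supp0 supp1 by (auto simp: vec_eq_iff)
  have e: "(\<Sum>i\<in>-R. ((Q *v z + (\<mu>0 - \<mu>1)) $ i)\<^sup>2) = (\<Sum>i\<in>-R. ((Q *v z) $ i)\<^sup>2)"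
    by (intro sum.cong) (auto simp: supp0 supp1)
  have S: "S *v (Q *v z + (\<mu>0 - \<mu>1)) = z + b"
    by (simp add: matrix_vector_right_distrib S_Q_vec)
  have "(norm (S1 *v (vec_of R (pt z) - \<mu>1)))\<^sup>2 - (norm (S0 *v (vec_of R (pt z) - \<mu>0)))\<^sup>2
     = (norm (S1 *v (Q *v z + (\<mu>0 - \<mu>1))))\<^sup>2 - (norm (S0 *v (Q *v z)))\<^sup>2"
    unfolding v using norm_blk_mult_vec[OF blk(2), of "Q *v z + (\<mu>0 - \<mu>1)"] norm_blk_mult_vec[OF blk(1), of "Q *v z"] e
    by simp
  also have "\<dots> = (\<Sum>i\<in>UNIV. d i * (z $ i + b $ i)\<^sup>2) - (\<Sum>i\<in>UNIV. (z $ i)\<^sup>2)"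
    unfolding norm_S1 norm_S0 S S_Q_vec unfolding norm_power2_vec by simp
  finally have "(norm (S1 *v (vec_of R (pt z) - \<mu>1)))\<^sup>2 - (norm (S0 *v (vec_of R (pt z) - \<mu>0)))\<^sup>2
     = (\<Sum>i\<in>UNIV. d i * (z $ i + b $ i)\<^sup>2) - (\<Sum>i\<in>UNIV. (z $ i)\<^sup>2)" .
  then show ?thesis
    unfolding ln_p0 ln_p1 by (simp add: sum_subtractf sum_ln_d diff_divide_distrib)
qed

lemma gauss0_distr: "gauss R \<mu>0 V0 = distr std_gauss (Pi\<^sub>M R (\<lambda>_. lborel)) pt"
  by (rule gauss_eq_distr[OF bi0 SQ W0 supp0])

lemma has_bochner_integral_ln_ratio:
  "integrable std_gauss (\<lambda>z. ln (p0 (pt z)) - ln (p1 (pt z)))"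
  "(\<integral>z. ln (p0 (pt z)) - ln (p1 (pt z)) \<partial>std_gauss) = (\<Sum>i\<in>UNIV. g_fun (d i) + d i * (b $ i)\<^sup>2 / 2)"
proof -
  interpret G: prob_space "std_gauss :: (real^'n) measure" by (rule prob_space_std_gauss)
  have eq: "ln (p0 (pt z)) - ln (p1 (pt z)) =
     (\<Sum>i\<in>UNIV. (d i - 1) / 2 * (z $ i)\<^sup>2 + d i * (b $ i) * z $ i + (d i * (b $ i)\<^sup>2 - ln (d i)) / 2)" for z
    unfolding ln_ratio sum_divide_distrib by (intro sum.cong) (auto simp: power2_eq_square field_simps)
  note [simp] = std_gauss_component_moments
  have [simp]: "G.prob UNIV = 1" using G.prob_space by simp
  show "integrable std_gauss (\<lambda>z. ln (p0 (pt z)) - ln (p1 (pt z)))"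
    unfolding eq by (intro Bochner_Integration.integrable_sum Bochner_Integration.integrable_add integrable_mult_right) auto
  have "(\<integral>z. ln (p0 (pt z)) - ln (p1 (pt z)) \<partial>std_gauss) = (\<Sum>i\<in>UNIV. (\<integral>z. (d i - 1) / 2 * (z $ i)\<^sup>2 + d i * (b $ i) * z $ i
      + (d i * (b $ i)\<^sup>2 - ln (d i)) / 2 \<partial>(std_gauss :: (real^'n) measure)))"
    unfolding eq by (intro Bochner_Integration.integral_sum Bochner_Integration.integrable_add integrable_mult_right) auto
  also have "\<dots> = (\<Sum>i\<in>UNIV. (d i - 1) / 2 + (d i * (b $ i)\<^sup>2 - ln (d i)) / 2)"
    by (intro sum.cong refl, subst Bochner_Integration.integral_add, simp_all)
  finally show "(\<integral>z. ln (p0 (pt z)) - ln (p1 (pt z)) \<partial>std_gauss) = (\<Sum>i\<in>UNIV. g_fun (d i) + d i * (b $ i)\<^sup>2 / 2)"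
    by (simp add: g_fun_def diff_divide_distrib add_divide_distrib algebra_simps)
qed

lemma KL_eq_sum: "KL_divergence (exp 1) (gauss R \<mu>1 V1) (gauss R \<mu>0 V0) = (\<Sum>i\<in>UNIV. g_fun (d i) + d i * (b $ i)\<^sup>2 / 2)"
proof -
  interpret finite_product_sigma_finite "\<lambda>_::'n. lborel :: real measure" R by standard auto
  have "KL_divergence (exp 1) (gauss R \<mu>1 V1) (gauss R \<mu>0 V0) = (\<integral>x. p0 x * log (exp 1) (p0 x / p1 x) \<partial>(Pi\<^sub>M R (\<lambda>_. lborel)))"
    unfolding gauss_def by (rule KL_density_density) (auto simp: less_imp_le p0_pos p1_pos less_imp_neq[OF p1_pos, symmetric])
  also have "\<dots> = (\<integral>x. ln (p0 x) - ln (p1 x) \<partial>gauss R \<mu>0 V0)"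
  proof -
    have "log (exp 1) (p0 x / p1 x) = ln (p0 x) - ln (p1 x)" for x
      using p0_pos p1_pos by (simp add: log_def ln_divide_pos)
    then show ?thesis
      unfolding gauss_def by (subst integral_density) (auto simp: less_imp_le p0_pos p1_pos)
  qed
  also have "\<dots> = (\<integral>z. ln (p0 (pt z)) - ln (p1 (pt z)) \<partial>std_gauss)"
    unfolding gauss0_distr by (subst integral_distr) auto
  also note has_bochner_integral_ln_ratio(2)
  finally show ?thesis .
qed

text \<open>Cyclic invariance of the trace removes the jointly diagonalising basis.\<close>

lemma sum_d: "(\<Sum>i\<in>UNIV. d i) = (transpose S1 ** S1) \<bullet> V0"
proof -
  have "V0 = Q ** transpose Q"
  proof -
    have "S0 ** Q0 = mat 1" "Q0 ** S0 = mat 1" using bi0 by (auto simp: block_inverse_def)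
    then show ?thesis
      using matrix_inv_eqI[OF inverse_cov(2,1)[OF SQ]] matrix_inv_eqI[OF inverse_cov(2,1)] W0 by metis
  qed
  then have "(transpose S1 ** S1) \<bullet> V0 = trace ((transpose S ** diag d ** S) ** (Q ** transpose Q))"
    by (simp add: matrix_inner_eq_trace W1 matrix_transpose_mul)
  also have "(transpose S ** diag d ** S) ** (Q ** transpose Q) = transpose S ** (diag d ** (S ** Q) ** transpose Q)"
    by (simp only: matrix_mul_assoc)
  also have "trace \<dots> = trace (diag d ** (transpose Q ** transpose S))"
    by (subst trace_mul_sym) (simp only: SQ matrix_mul_rid matrix_mul_assoc)
  also have "transpose Q ** transpose S = mat 1"
    by (simp add: matrix_transpose_mul[symmetric] SQ)
  finally show ?thesis by (simp add: trace_def diag_def)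
qed

text \<open>This form no longer mentions \<open>S\<close>, \<open>Q\<close> and \<open>d\<close>,
  which are chosen for each pair without any control of their dependence on it; the Lipschitz and
  continuity arguments start here. The dimension is \<open>CARD('n)\<close> instead of
  \<open>card R\<close> because every padding coordinate adds 1 to the inner product.\<close>

lemma KL_eq: "KL_divergence (exp 1) (gauss R \<mu>1 V1) (gauss R \<mu>0 V0) =
  ((transpose S1 ** S1) \<bullet> V0 - real CARD('n) + (norm (S1 *v (\<mu>0 - \<mu>1)))\<^sup>2) / 2 + ln \<bar>det S0\<bar> - ln \<bar>det S1\<bar>"
  unfolding KL_eq_sum g_fun_def norm_S1
  by (simp add: sum.distrib sum_subtractf sum_d[symmetric] sum_ln_d diff_divide_distrib add_divide_distrib
      sum_divide_distrib[symmetric])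

text \<open>The integrand against Lebesgue measure is the square root of the product of the
  densities, hence symmetric in the two laws; under the first law it factorises over independent
  standard normal coordinates.\<close>

lemma affinity:
  "(\<integral>\<^sup>+x. ennreal (sqrt (p0 x / p1 x)) \<partial>gauss R \<mu>1 V1) =
    ennreal (exp (- (\<Sum>i\<in>UNIV. h_fun (d i) + d i * (b $ i)\<^sup>2 / (4 * (1 + d i)))))"
proof -
  have "(\<integral>\<^sup>+x. ennreal (sqrt (p0 x / p1 x)) \<partial>gauss R \<mu>1 V1) = (\<integral>\<^sup>+x. ennreal (p1 x) * ennreal (sqrt (p0 x / p1 x)) \<partial>Pi\<^sub>M R (\<lambda>_. lborel))"
    unfolding gauss_def by (subst nn_integral_density) auto
  also have "\<dots> = (\<integral>\<^sup>+x. ennreal (p0 x) * ennreal (sqrt (p1 x / p0 x)) \<partial>Pi\<^sub>M R (\<lambda>_. lborel))"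
  proof (rule nn_integral_cong)
    fix x
    have "p * sqrt (q / p) = q * sqrt (p / q)" if "p > 0" "q > 0" for p q :: real
    proof -
      have "p * sqrt (q / p) = sqrt p * sqrt q" "q * sqrt (p / q) = sqrt p * sqrt q"
        using that real_div_sqrt[of p] real_div_sqrt[of q] by (simp_all add: real_sqrt_divide)
          (metis mult.commute real_div_sqrt less_imp_le times_divide_eq_right)+
      then show ?thesis by simp
    qed
    from this[OF p1_pos p0_pos, of x x]
    show "ennreal (p1 x) * ennreal (sqrt (p0 x / p1 x)) = ennreal (p0 x) * ennreal (sqrt (p1 x / p0 x))"
      using less_imp_le[OF p0_pos[of x]] less_imp_le[OF p1_pos[of x]] by (simp add: ennreal_mult[symmetric])
  qed
  also have "\<dots> = (\<integral>\<^sup>+x. ennreal (sqrt (p1 x / p0 x)) \<partial>gauss R \<mu>0 V0)"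
    unfolding gauss_def by (subst nn_integral_density) auto
  also have "\<dots> = (\<integral>\<^sup>+z. ennreal (sqrt (p1 (pt z) / p0 (pt z))) \<partial>std_gauss)"
    unfolding gauss0_distr by (subst nn_integral_distr) auto
  also have "\<dots> = (\<integral>\<^sup>+z. (\<Prod>i\<in>UNIV. ennreal (exp (- (d i * (z $ i + b $ i)\<^sup>2 - (z $ i)\<^sup>2 - ln (d i)) / 4))) \<partial>std_gauss)"
  proof (rule nn_integral_cong)
    fix z :: "real^'n"
    have "sqrt (p1 (pt z) / p0 (pt z)) = exp (- (ln (p0 (pt z)) - ln (p1 (pt z))) / 2)"
    proof (rule real_sqrt_unique)
      have "(exp (- (ln (p0 (pt z)) - ln (p1 (pt z))) / 2))\<^sup>2 = exp (ln (p1 (pt z)) - ln (p0 (pt z)))"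
        by (simp add: power2_eq_square mult_exp_exp)
      then show "(exp (- (ln (p0 (pt z)) - ln (p1 (pt z))) / 2))\<^sup>2 = p1 (pt z) / p0 (pt z)"
        using p0_pos p1_pos by (simp add: exp_diff)
    qed simp
    also have "\<dots> = (\<Prod>i\<in>UNIV. exp (- (d i * (z $ i + b $ i)\<^sup>2 - (z $ i)\<^sup>2 - ln (d i)) / 4))"
    proof -
      have "- ((\<Sum>i\<in>UNIV. a i) / 2) / 2 = (\<Sum>i\<in>UNIV. - a i / 4)" for a :: "'n \<Rightarrow> real"
        by (simp add: sum_divide_distrib[symmetric] sum_negf)
      then show ?thesis unfolding ln_ratio by (simp only: exp_sum[OF finite])
    qed
    finally show "ennreal (sqrt (p1 (pt z) / p0 (pt z))) = (\<Prod>i\<in>UNIV. ennreal (exp (- (d i * (z $ i + b $ i)\<^sup>2 - (z $ i)\<^sup>2 - ln (d i)) / 4)))"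
      by (simp add: prod_ennreal)
  qed
  also have "\<dots> = (\<Prod>i\<in>UNIV. ennreal (exp (- (h_fun (d i) + d i * (b $ i)\<^sup>2 / (4 * (1 + d i))))))"
    by (subst nn_integral_std_gauss_prod[where f = "\<lambda>i x. ennreal (exp (- (d i * (x + b $ i)\<^sup>2 - x\<^sup>2 - ln (d i)) / 4))"])
       (simp_all only: nn_integral_affinity_normal[OF d_pos], measurable)
  also have "\<dots> = ennreal (exp (- (\<Sum>i\<in>UNIV. h_fun (d i) + d i * (b $ i)\<^sup>2 / (4 * (1 + d i)))))"
    by (subst prod_ennreal, simp, subst exp_sum[OF finite, symmetric], simp only: sum_negf)
  finally show ?thesis .
qed

text \<open>The comparison is made coordinate by coordinate: \<open>h_fun\<close> against
  \<open>g_fun\<close> for the variances, and for the means \<open>k * d i / 2\<close> against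
  \<open>d i / (4 * (1 + d i))\<close>, which holds once \<open>k\<close> is at most
  \<open>1 / (2 * (1 + d i))\<close>.\<close>

lemma affinity_le_exp_KL:
  assumes lo: "\<And>y. lo * (norm (S0 *v y))\<^sup>2 \<le> (norm (S1 *v y))\<^sup>2"
    and hi: "\<And>y. (norm (S1 *v y))\<^sup>2 \<le> hi * (norm (S0 *v y))\<^sup>2"
    and k: "\<And>r. lo \<le> r \<Longrightarrow> r \<le> hi \<Longrightarrow> k * g_fun r \<le> h_fun r" "k \<le> 1 / (2 * (1 + hi))"
  shows "(\<integral>\<^sup>+x. ennreal (sqrt (p0 x / p1 x)) \<partial>gauss R \<mu>1 V1) \<le>
    ennreal (exp (- (k * KL_divergence (exp 1) (gauss R \<mu>1 V1) (gauss R \<mu>0 V0))))"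
proof -
  have d: "lo \<le> d i \<and> d i \<le> hi" for i
  proof -
    \<comment> \<open>A generalised eigenvector of the two forms: its squared norm is 1 under
      \<open>S0\<close> and \<open>d i\<close> under \<open>S1\<close>.\<close>
    let ?y = "Q *v axis i 1"
    have "(norm (S0 *v ?y))\<^sup>2 = 1" by (simp add: norm_S0 S_Q_vec)
    moreover have "(norm (S1 *v ?y))\<^sup>2 = d i"
    proof -
      have "d j * (axis i 1 $ j)\<^sup>2 = (if j = i then d i else 0)" for j by (simp add: axis_def)
      then show ?thesis unfolding norm_S1 S_Q_vec by simp
    qed
    ultimately show ?thesis using lo[of ?y] hi[of ?y] by simp
  qed
  have "k * (g_fun (d i) + d i * (b $ i)\<^sup>2 / 2) \<le> h_fun (d i) + d i * (b $ i)\<^sup>2 / (4 * (1 + d i))" for i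
  proof -
    have "1 / (2 * (1 + hi)) \<le> 1 / (2 * (1 + d i))"
      using d[of i] d_pos[of i] by (intro divide_left_mono) auto
    then have "k \<le> 1 / (2 * (1 + d i))" using k(2) by simp
    then have "k * (d i * (b $ i)\<^sup>2 / 2) \<le> 1 / (2 * (1 + d i)) * (d i * (b $ i)\<^sup>2 / 2)"
      using d_pos[of i] by (intro mult_right_mono) auto
    moreover have "k * g_fun (d i) \<le> h_fun (d i)" using d[of i] k(1) by blast
    moreover have "1 / (2 * (1 + d i)) * (d i * (b $ i)\<^sup>2 / 2) = d i * (b $ i)\<^sup>2 / (4 * (1 + d i))"
      by simp
    ultimately show ?thesis unfolding distrib_left by linarith
  qed
  then have "k * (\<Sum>i\<in>UNIV. g_fun (d i) + d i * (b $ i)\<^sup>2 / 2) \<le> (\<Sum>i\<in>UNIV. h_fun (d i) + d i * (b $ i)\<^sup>2 / (4 * (1 + d i)))"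
    unfolding sum_distrib_left by (intro sum_mono)
  then show ?thesis unfolding affinity KL_eq_sum by (intro ennreal_leI) simp
qed

end

lemma gauss_pair_exists:
  fixes S0 Q0 S1 Q1 :: "real^'n^'n"
  assumes bi0: "block_inverse R S0 Q0" and bi1: "block_inverse R S1 Q1"
    and "\<And>i. i \<notin> R \<Longrightarrow> \<mu>0 $ i = 0" and "\<And>i. i \<notin> R \<Longrightarrow> \<mu>1 $ i = 0"
  obtains S Q d where "gauss_pair R S0 Q0 S1 Q1 S Q \<mu>0 \<mu>1 d"
proof -
  have inv: "invertible S0" "invertible S1" using bi0 bi1 by (auto simp: block_inverse_def invertible_def)
  show ?thesis
  proof (rule simultaneous_diagonalization[OF inv])
    fix S Q :: "real^'n^'n" and d
    assume "S ** Q = mat 1" "Q ** S = mat 1" "transpose S ** S = transpose S0 ** S0"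
      "transpose S ** diag d ** S = transpose S1 ** S1" "\<And>i. d i > 0"
    then have "gauss_pair R S0 Q0 S1 Q1 S Q \<mu>0 \<mu>1 d"
      using assms by unfold_locales auto
    then show ?thesis by (rule that)
  qed
qed

lemma KL_gauss_nonneg:
  assumes "block_inverse R S0 Q0" "block_inverse R S1 Q1"
    and "\<And>i. i \<notin> R \<Longrightarrow> \<mu>0 $ i = 0" and "\<And>i. i \<notin> R \<Longrightarrow> \<mu>1 $ i = 0"
  shows "KL_divergence (exp 1) (gauss R \<mu>1 (Q1 ** transpose Q1)) (gauss R \<mu>0 (Q0 ** transpose Q0)) \<ge> 0"
proof -
  obtain S Q d where "gauss_pair R S0 Q0 S1 Q1 S Q \<mu>0 \<mu>1 d"
    by (rule gauss_pair_exists[OF assms])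
  then interpret gauss_pair R S0 Q0 S1 Q1 S Q \<mu>0 \<mu>1 d .
  show ?thesis
    unfolding KL_eq_sum using d_pos by (intro sum_nonneg add_nonneg_nonneg g_fun_nonneg) (auto simp: less_imp_le)
qed

lemma KL_gauss_eq:
  fixes S0 Q0 S1 Q1 :: "real^'n^'n"
  assumes "block_inverse R S0 Q0" "block_inverse R S1 Q1"
    and "\<And>i. i \<notin> R \<Longrightarrow> \<mu>0 $ i = 0" and "\<And>i. i \<notin> R \<Longrightarrow> \<mu>1 $ i = 0"
  shows "KL_divergence (exp 1) (gauss R \<mu>1 (Q1 ** transpose Q1)) (gauss R \<mu>0 (Q0 ** transpose Q0)) =
    ((transpose S1 ** S1) \<bullet> (Q0 ** transpose Q0) - real CARD('n) + (norm (S1 *v (\<mu>0 - \<mu>1)))\<^sup>2) / 2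
      + ln \<bar>det S0\<bar> - ln \<bar>det S1\<bar>"
proof -
  obtain S Q d where "gauss_pair R S0 Q0 S1 Q1 S Q \<mu>0 \<mu>1 d"
    by (rule gauss_pair_exists[OF assms])
  then interpret gauss_pair R S0 Q0 S1 Q1 S Q \<mu>0 \<mu>1 d .
  show ?thesis by (rule KL_eq)
qed

section \<open>Norm bounds for the models\<close>

lemma norm_matrix_vector_mult_le: "norm (M *v y) \<le> norm M * norm y" for M :: "real^'n^'m"
proof (rule power2_le_imp_le)
  have "(norm (M *v y))\<^sup>2 = (\<Sum>i\<in>UNIV. (M $ i \<bullet> y)\<^sup>2)"
    by (simp add: norm_power2_vec matrix_vector_mul_component)
  also have "\<dots> \<le> (\<Sum>i\<in>UNIV. (norm (M $ i))\<^sup>2 * (norm y)\<^sup>2)"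
    by (intro sum_mono) (metis Cauchy_Schwarz_ineq power2_norm_eq_inner)
  also have "\<dots> = (norm M * norm y)\<^sup>2"
    by (simp add: sum_distrib_right[symmetric] power_mult_distrib norm_vec_def L2_set_def sum_nonneg)
  finally show "(norm (M *v y))\<^sup>2 \<le> (norm M * norm y)\<^sup>2" .
qed simp

lemma norm_vec_le_card:
  fixes x :: "'a::real_normed_vector^'n"
  assumes "\<And>i. norm (x $ i) \<le> c"
  shows "norm x \<le> sqrt (real CARD('n)) * c"
proof -
  have c: "c \<ge> 0" using order_trans[OF norm_ge_zero assms] .
  have "(\<Sum>i\<in>UNIV. (norm (x $ i))\<^sup>2) \<le> (\<Sum>i\<in>(UNIV::'n set). c\<^sup>2)"
    by (intro sum_mono power_mono) (auto simp: assms)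
  then have "norm x \<le> sqrt (real CARD('n) * c\<^sup>2)"
    unfolding norm_vec_def L2_set_def by simp
  then show ?thesis using c by (simp add: real_sqrt_mult)
qed

lemma norm_transpose: "norm (transpose M) = norm M" for M :: "real^'n^'m"
  unfolding norm_eq_sqrt_inner inner_vec_def transpose_def vec_lambda_beta
  by (subst sum.swap) (rule refl)

lemma norm_diag_mult_vec_le:
  assumes "\<And>i. i \<in> R \<Longrightarrow> \<bar>d i\<bar> \<le> c" "keep R y = y" "c \<ge> 0"
  shows "norm (diag d *v y) \<le> c * norm y"
proof (rule power2_le_imp_le)
  have z: "y $ i = 0" if "i \<notin> R" for i
    using arg_cong[OF assms(2), of "\<lambda>v. v $ i"] that by simp
  have "(d i * y $ i)\<^sup>2 \<le> c\<^sup>2 * (y $ i)\<^sup>2" for i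
  proof (cases "i \<in> R")
    case True
    then have "(d i)\<^sup>2 \<le> c\<^sup>2" using assms(1)[of i] by (metis abs_ge_zero power2_abs power_mono)
    then show ?thesis by (simp add: power_mult_distrib mult_right_mono)
  qed (simp add: z)
  then show "(norm (diag d *v y))\<^sup>2 \<le> (c * norm y)\<^sup>2"
    by (simp add: norm_power2_vec diag_mult_vec power_mult_distrib sum_distrib_left sum_mono)
qed (use assms in simp)

lemma keep_blk_mult:
  assumes "blk R M = M" "keep R y = y"
  shows "keep R (M *v y) = M *v y"
proof -
  have "y $ i = 0" if "i \<notin> R" for i
    using arg_cong[OF assms(2), of "\<lambda>v. v $ i"] that by simp
  then show ?thesis using blk_mult_vec_nth[OF assms(1), of y] by (auto simp: vec_eq_iff)
qed

lemma blk_inverse: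
  fixes A T :: "real^'n^'n"
  assumes A: "blk R A = A" and AT: "A ** T = mat 1" "T ** A = mat 1"
  shows "blk R T = T"
  unfolding blk_eq_iff
proof (intro allI impI)
  fix i k :: 'n assume ik: "i \<notin> R \<or> k \<notin> R"
  have A': "A $ i $ j = (if i = j then 1 else 0)" if "i \<notin> R \<or> j \<notin> R" for i j
    using A that unfolding blk_eq_iff by blast
  show "T $ i $ k = (if i = k then 1 else 0)"
  proof (cases "i \<in> R")
    case False
    then have "(A ** T) $ i $ k = (\<Sum>j\<in>UNIV. if j = i then T $ j $ k else 0)"
      unfolding matrix_matrix_mult_def vec_lambda_beta by (intro sum.cong) (auto simp: A')
    then show ?thesis unfolding AT by (auto simp: mat_def)
  next
    case True
    with ik have "k \<notin> R" by simp
    then have "(T ** A) $ i $ k = (\<Sum>j\<in>UNIV. if j = k then T $ i $ j else 0)"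
      unfolding matrix_matrix_mult_def vec_lambda_beta by (intro sum.cong) (auto simp: A')
    then show ?thesis unfolding AT by (auto simp: mat_def)
  qed
qed

text \<open>Counting proper ancestors gives a rank that increases along edges. As it stays below
  \<open>CARD('n)\<close>, it bounds the order of nilpotency of the coefficient matrix.\<close>

lemma acyclic_rank:
  fixes D :: "('n::finite \<times> 'n) set"
  assumes "acyclic D"
  obtains f :: "'n \<Rightarrow> nat" where "\<And>j k. (k, j) \<in> D \<Longrightarrow> f k < f j" "\<And>j. f j < CARD('n)"
proof
  let ?p = "\<lambda>j. {k. (k, j) \<in> D\<^sup>+}"
  have "j \<notin> ?p j" for j using assms by (simp add: acyclic_def)
  then show "card (?p j) < CARD('n)" for j
    by (intro psubset_card_mono) auto
  fix j k assume "(k, j) \<in> D"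
  then have "?p k \<subseteq> ?p j" "k \<in> ?p j" by auto
  with \<open>\<And>j. j \<notin> ?p j\<close> show "card (?p k) < card (?p j)"
    by (intro psubset_card_mono) auto
qed

text \<open>Zero off \<open>R\<close>, where \<open>blk\<close> would put the identity: so the block
  matrix is \<open>mat 1 - coef_on R \<theta>\<close>, with a nilpotent second term.\<close>

definition coef_on :: "'n set \<Rightarrow> 'n model \<Rightarrow> real^'n^'n" where
  "coef_on R \<theta> = (\<chi> i k. if i \<in> R \<and> k \<in> R then coef \<theta> $ i $ k else 0)"

lemma blk_one_minus: "blk R (mat 1 - coef \<theta>) = mat 1 - coef_on R \<theta>"
  by (auto simp: vec_eq_iff blk_nth coef_on_def mat_def)

definition sd :: "'n::finite model \<Rightarrow> 'n action \<Rightarrow> 'n \<Rightarrow> real" where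
  "sd \<theta> a i = sqrt (blk (observed a) (noise \<theta>) $ i $ i)"

text \<open>Turns a centred observation into its structural noise scaled to unit variance;
  \<open>colour\<close> is the inverse map, and \<open>prec\<close> the inverse of the
  covariance.\<close>

definition whiten :: "'n::finite model \<Rightarrow> 'n action \<Rightarrow> real^'n^'n" where
  "whiten \<theta> a = diag (\<lambda>i. 1 / sd \<theta> a i) ** blk (observed a) (mat 1 - coef \<theta>)"

definition colour :: "'n::finite model \<Rightarrow> 'n action \<Rightarrow> real^'n^'n" where
  "colour \<theta> a = resolvent \<theta> a ** diag (sd \<theta> a)"

abbreviation prec :: "'n::finite model \<Rightarrow> 'n action \<Rightarrow> real^'n^'n" where
  "prec \<theta> a \<equiv> transpose (whiten \<theta> a) ** whiten \<theta> a"

section \<open>Uniform bounds for a single model of the parameter set\<close>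

locale valid_params =
  fixes P :: "'n::finite pars"
  assumes valid: "valid_pars P"
begin

lemma pos [simp]: "beta_min P > 0" "A_max P > 0" "sigma_min P > 0" "sigma_max P > 0" "C_max P > 0"
  using valid by (auto simp: valid_pars_def)

lemma G_p_ge_1: "G_p P \<ge> 1"
proof -
  have "(\<Sum>k\<in>{0}. (real CARD('n) * A_max P) ^ k) \<le> G_p P"
    unfolding G_p_def by (intro sum_mono2) (auto simp: zero_less_card_finite less_imp_le[OF pos(2)])
  then show ?thesis by simp
qed

lemma B_mu_pos [simp]: "B_mu P > 0"
  using G_p_ge_1 by (simp add: B_mu_def)

lemma one_plus_pos: "1 + real CARD('n) * A_max P > 0"
  by (intro add_pos_nonneg) (auto simp: less_imp_le)

lemma v_lo_pos [simp]: "v_lo P > 0"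
  unfolding v_lo_def using one_plus_pos by (intro divide_pos_pos zero_less_power) auto

lemma v_hi_pos [simp]: "v_hi P > 0"
  unfolding v_hi_def using G_p_ge_1 by (intro mult_pos_pos zero_less_power) auto

lemma sqrt_v_lo: "sqrt (v_lo P) = sigma_min P / (1 + real CARD('n) * A_max P)"
  using one_plus_pos by (simp add: v_lo_def real_sqrt_divide less_imp_le[OF pos(3)])

lemma sqrt_v_hi: "sqrt (v_hi P) = G_p P * sigma_max P"
  using G_p_ge_1 by (simp add: v_hi_def real_sqrt_mult less_imp_le[OF pos(4)])

lemma finite_actions [simp]: "finite (actions P)" "actions P \<noteq> {}"
proof -
  show "finite (actions P)" using card_actions[OF valid] by (intro card_ge_0_finite) simp
qed (simp add: actions_def)

lemma action_value_bound: "Do j u \<in> actions P \<Longrightarrow> \<bar>u\<bar> \<le> C_max P"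
proof -
  assume "Do j u \<in> actions P"
  moreover have "U_lo P j < U_hi P j" "\<forall>u\<in>{U_lo P j..U_hi P j}. \<bar>u\<bar> \<le> C_max P"
    using valid by (auto simp: valid_pars_def)
  ultimately show "\<bar>u\<bar> \<le> C_max P"
    by (auto simp: actions_def)
qed

end

locale valid_model = valid_params P for P :: "'n::finite pars" +
  fixes \<theta> :: "'n model"
  assumes model: "\<theta> \<in> Theta P"
begin

lemma acyc: "acyclic (dag \<theta>)"
  and edge_iff: "coef \<theta> $ j $ k \<noteq> 0 \<longleftrightarrow> (k, j) \<in> dag \<theta>"
  and coef_le: "\<bar>coef \<theta> $ j $ k\<bar> \<le> A_max P"
  and noise_offdiag: "j \<noteq> k \<Longrightarrow> noise \<theta> $ j $ k = 0"
  and noise_bounds: "(sigma_min P)\<^sup>2 \<le> noise \<theta> $ j $ j" "noise \<theta> $ j $ j \<le> (sigma_max P)\<^sup>2"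
proof -
  show "acyclic (dag \<theta>)" "coef \<theta> $ j $ k \<noteq> 0 \<longleftrightarrow> (k, j) \<in> dag \<theta>" "j \<noteq> k \<Longrightarrow> noise \<theta> $ j $ k = 0"
    "(sigma_min P)\<^sup>2 \<le> noise \<theta> $ j $ j" "noise \<theta> $ j $ j \<le> (sigma_max P)\<^sup>2"
    using model by (auto simp: Theta_def)
  show "\<bar>coef \<theta> $ j $ k\<bar> \<le> A_max P"
    using model less_imp_le[OF pos(2)] by (cases "coef \<theta> $ j $ k = 0") (auto simp: Theta_def)
qed

lemma coef_ge: "coef \<theta> $ j $ k \<noteq> 0 \<Longrightarrow> beta_min P \<le> \<bar>coef \<theta> $ j $ k\<bar>"
  using model by (auto simp: Theta_def)

lemma v_lo_le_v_hi: "v_lo P \<le> v_hi P"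
proof -
  have "(sigma_min P)\<^sup>2 \<le> (sigma_max P)\<^sup>2" by (rule order_trans[OF noise_bounds])
  moreover have "v_lo P \<le> (sigma_min P)\<^sup>2"
  proof -
    have "1 \<le> (1 + real CARD('n) * A_max P)\<^sup>2"
      by (intro one_le_power) (auto simp: less_imp_le[OF pos(2)])
    then have "(sigma_min P)\<^sup>2 / (1 + real CARD('n) * A_max P)\<^sup>2 \<le> (sigma_min P)\<^sup>2 / 1"
      by (intro divide_left_mono) auto
    then show ?thesis by (simp add: v_lo_def)
  qed
  moreover have "(sigma_max P)\<^sup>2 \<le> v_hi P"
    using mult_right_mono[of 1 "(G_p P)\<^sup>2" "(sigma_max P)\<^sup>2"] one_le_power[OF G_p_ge_1, of 2] by (simp add: v_hi_def)
  ultimately show ?thesis by linarith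
qed

lemma norm_coef_on: "norm (coef_on R \<theta>) \<le> real CARD('n) * A_max P"
proof -
  have "norm (coef_on R \<theta> $ i) \<le> sqrt (real CARD('n)) * A_max P" for i
    by (rule norm_vec_le_card) (auto simp: coef_on_def coef_le less_imp_le[OF pos(2)])
  then have "norm (coef_on R \<theta>) \<le> sqrt (real CARD('n)) * (sqrt (real CARD('n)) * A_max P)"
    by (rule norm_vec_le_card)
  then show ?thesis by (simp add: mult.assoc[symmetric])
qed

text \<open>A node of rank below \<open>m\<close> has no directed path of length \<open>m\<close>
  ending in it, so the \<open>m\<close>-th power vanishes in its coordinate.\<close>

lemma coef_on_nilpotent: "((*v) (coef_on R \<theta>) ^^ CARD('n)) x = 0"
proof -
  obtain f :: "'n \<Rightarrow> nat" where f: "\<And>j k. (k, j) \<in> dag \<theta> \<Longrightarrow> f k < f j" "\<And>j. f j < CARD('n)"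
    using acyclic_rank[OF acyc] by blast
  have "(((*v) (coef_on R \<theta>) ^^ m) x) $ i = 0" if "f i < m" for m i
    using that
  proof (induction m arbitrary: i)
    case (Suc m)
    have "coef_on R \<theta> $ i $ j * (((*v) (coef_on R \<theta>) ^^ m) x) $ j = 0" for j
    proof (cases "coef \<theta> $ i $ j = 0")
      case False
      then have "f j < m" using f(1)[of j i] edge_iff Suc.prems by fastforce
      then show ?thesis using Suc.IH by simp
    qed (simp add: coef_on_def)
    then have "(\<Sum>j\<in>UNIV. coef_on R \<theta> $ i $ j * (((*v) (coef_on R \<theta>) ^^ m) x) $ j) = 0"
      by (intro sum.neutral) blast
    then show ?case by (simp add: matrix_vector_mul_component inner_vec_def)
  qed simp
  with f(2) show ?thesis by (simp add: vec_eq_iff)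
qed

text \<open>A vector killed by the matrix is a fixed point of a nilpotent map, hence zero. The
  Neumann series stops after \<open>CARD('n)\<close> terms, which is the origin of the finite sum
  \<open>G_p\<close>.\<close>

lemma resolvent_inverse:
  "blk (observed a) (mat 1 - coef \<theta>) ** resolvent \<theta> a = mat 1"
  "resolvent \<theta> a ** blk (observed a) (mat 1 - coef \<theta>) = mat 1"
  and resolvent_series: "resolvent \<theta> a *v x = (\<Sum>k<CARD('n). ((*v) (coef_on (observed a) \<theta>) ^^ k) x)"
proof -
  let ?B = "coef_on (observed a) \<theta>"
  let ?M = "blk (observed a) (mat 1 - coef \<theta>)"
  have M: "?M *v x = x - ?B *v x" for x
    unfolding blk_one_minus by (simp add: matrix_vector_mult_diff_rdistrib)
  have "x = y" if "?M *v x = ?M *v y" for x y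
  proof -
    have "?B *v (x - y) = x - y"
      using that unfolding M by (simp add: matrix_vector_mult_diff_distrib algebra_simps)
    then have "((*v) ?B ^^ m) (x - y) = x - y" for m
      by (induction m) auto
    with coef_on_nilpotent show "x = y" by (metis eq_iff_diff_eq_0)
  qed
  then have "inj ((*v) ?M)" by (auto simp: inj_def)
  then obtain T where "T ** ?M = mat 1"
    using matrix_left_invertible_injective by blast
  then have T: "T ** ?M = mat 1" "?M ** T = mat 1"
    by (simp_all add: matrix_left_right_inverse)
  then have res: "resolvent \<theta> a = T"
    unfolding resolvent_def by (intro matrix_inv_eqI)
  show "?M ** resolvent \<theta> a = mat 1" and inv2: "resolvent \<theta> a ** ?M = mat 1"
    using T res by auto
  have "?M *v (\<Sum>k<m. ((*v) ?B ^^ k) x) = x - ((*v) ?B ^^ m) x" for m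
  proof (induction m)
    case (Suc m)
    have "?M *v (\<Sum>k<Suc m. ((*v) ?B ^^ k) x) = ?M *v (\<Sum>k<m. ((*v) ?B ^^ k) x) + ?M *v (((*v) ?B ^^ m) x)"
      by (simp add: matrix_vector_right_distrib)
    then show ?case using Suc M[of "((*v) ?B ^^ m) x"] by simp
  qed simp
  from this[of "CARD('n)"] have "?M *v (\<Sum>k<CARD('n). ((*v) ?B ^^ k) x) = x"
    by (simp add: coef_on_nilpotent)
  then show "resolvent \<theta> a *v x = (\<Sum>k<CARD('n). ((*v) ?B ^^ k) x)"
    using inv2 by (metis matrix_vector_mul_assoc matrix_vector_mul_lid)
qed

lemma norm_resolvent_mult_vec: "norm (resolvent \<theta> a *v x) \<le> G_p P * norm x"
proof -
  let ?B = "coef_on (observed a) \<theta>" and ?c = "real CARD('n) * A_max P"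
  have "norm (((*v) ?B ^^ k) x) \<le> ?c ^ k * norm x" for k
  proof (induction k)
    case (Suc k)
    have "norm (?B *v (((*v) ?B ^^ k) x)) \<le> norm ?B * norm (((*v) ?B ^^ k) x)"
      by (rule norm_matrix_vector_mult_le)
    also have "\<dots> \<le> ?c * (?c ^ k * norm x)"
      using Suc norm_coef_on by (intro mult_mono) (auto simp: less_imp_le[OF pos(2)])
    finally show ?case by (simp add: mult.assoc)
  qed simp
  then have "norm (resolvent \<theta> a *v x) \<le> (\<Sum>k<CARD('n). ?c ^ k * norm x)"
    unfolding resolvent_series by (intro sum_norm_le) auto
  then show ?thesis by (simp add: G_p_def sum_distrib_right atLeast0LessThan)
qed

lemma blk_resolvent: "blk (observed a) (resolvent \<theta> a) = resolvent \<theta> a"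
  by (rule blk_inverse[OF _ resolvent_inverse]) simp

lemma sd_bounds:
  "i \<in> observed a \<Longrightarrow> sigma_min P \<le> sd \<theta> a i" "i \<in> observed a \<Longrightarrow> sd \<theta> a i \<le> sigma_max P"
  "i \<notin> observed a \<Longrightarrow> sd \<theta> a i = 1" "sd \<theta> a i > 0"
proof -
  show 1: "i \<in> observed a \<Longrightarrow> sigma_min P \<le> sd \<theta> a i"
    using noise_bounds(1)[of i] by (auto simp: sd_def blk_nth intro: real_le_rsqrt)
  show "i \<in> observed a \<Longrightarrow> sd \<theta> a i \<le> sigma_max P"
    using noise_bounds(2)[of i] by (auto simp: sd_def blk_nth less_imp_le intro!: real_le_lsqrt)
  show 2: "i \<notin> observed a \<Longrightarrow> sd \<theta> a i = 1" by (simp add: sd_def blk_nth)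
  show "sd \<theta> a i > 0"
    using 1 2 pos(3) by (cases "i \<in> observed a") (auto intro: less_le_trans[OF pos(3)])
qed

lemma blk_noise: "blk (observed a) (noise \<theta>) = diag (sd \<theta> a) ** diag (sd \<theta> a)"
proof -
  have "(sd \<theta> a i)\<^sup>2 = blk (observed a) (noise \<theta>) $ i $ i" for i
    using noise_bounds(1)[of i] by (simp add: sd_def blk_nth order_trans[OF zero_le_power2])
  then show ?thesis
    unfolding diag_mult_diag by (auto simp: vec_eq_iff diag_def blk_nth noise_offdiag power2_eq_square)
qed

lemma blk_diag_sd: "blk (observed a) (diag (sd \<theta> a)) = diag (sd \<theta> a)"
  "blk (observed a) (diag (\<lambda>i. 1 / sd \<theta> a i)) = diag (\<lambda>i. 1 / sd \<theta> a i)"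
  using sd_bounds(3) by (auto simp: blk_eq_iff diag_def)

lemma block_inverse_whiten: "block_inverse (observed a) (whiten \<theta> a) (colour \<theta> a)"
proof -
  have d: "diag (\<lambda>i. 1 / sd \<theta> a i) ** diag (sd \<theta> a) = mat 1" "diag (sd \<theta> a) ** diag (\<lambda>i. 1 / sd \<theta> a i) = mat 1"
    using sd_bounds(4)[of a] by (simp_all add: diag_mult_diag diag_one less_imp_neq[symmetric])
  let ?M = "blk (observed a) (mat 1 - coef \<theta>)"
  have "whiten \<theta> a ** colour \<theta> a = diag (\<lambda>i. 1 / sd \<theta> a i) ** (?M ** resolvent \<theta> a) ** diag (sd \<theta> a)"
    "colour \<theta> a ** whiten \<theta> a = resolvent \<theta> a ** (diag (sd \<theta> a) ** diag (\<lambda>i. 1 / sd \<theta> a i)) ** ?M"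
    by (simp_all only: whiten_def colour_def matrix_mul_assoc)
  then have "whiten \<theta> a ** colour \<theta> a = mat 1" "colour \<theta> a ** whiten \<theta> a = mat 1"
    by (simp_all only: resolvent_inverse d matrix_mul_rid)
  then show ?thesis
    unfolding block_inverse_def
    by (auto simp: whiten_def colour_def intro!: blk_mult blk_diag_sd blk_resolvent)
qed

lemma whiten_colour: "whiten \<theta> a ** colour \<theta> a = mat 1" "colour \<theta> a ** whiten \<theta> a = mat 1"
  and blk_whiten: "blk (observed a) (whiten \<theta> a) = whiten \<theta> a"
  and blk_colour: "blk (observed a) (colour \<theta> a) = colour \<theta> a"
  using block_inverse_whiten[of a] by (auto simp: block_inverse_def)

lemma cov_eq: "cov \<theta> a = colour \<theta> a ** transpose (colour \<theta> a)"
  by (simp add: cov_def colour_def blk_noise matrix_transpose_mul matrix_mul_assoc)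

lemma blk_cov: "blk (observed a) (cov \<theta> a) = cov \<theta> a"
  unfolding cov_eq by (intro blk_mult blk_transpose blk_colour)

lemma cov_prec: "cov \<theta> a ** prec \<theta> a = mat 1" "prec \<theta> a ** cov \<theta> a = mat 1"
  unfolding cov_eq by (intro inverse_cov whiten_colour)+

lemma det_whiten: "det (whiten \<theta> a) \<noteq> 0"
  using block_inverse_det[OF block_inverse_whiten[of a]] by auto

lemma keep_mean: "keep (observed a) (mean \<theta> a) = mean \<theta> a"
proof (cases a)
  case (Do j u)
  show ?thesis
    unfolding mean_def Do action.case
    by (rule keep_blk_mult[OF blk_resolvent]) (auto simp: vec_eq_iff)
qed (simp add: mean_def vec_eq_iff)

lemma mean_supp: "i \<notin> observed a \<Longrightarrow> mean \<theta> a $ i = 0"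
  using arg_cong[OF keep_mean[of a], of "\<lambda>v. v $ i"] by simp

lemma norm_mean:
  assumes "a \<in> actions P"
  shows "norm (mean \<theta> a) \<le> B_mu P"
proof (cases a)
  case (Do j u)
  let ?w = "\<chi> k. if k \<in> observed a then coef \<theta> $ k $ j * u else 0"
  have "norm ?w \<le> sqrt (real CARD('n)) * (A_max P * C_max P)"
    using coef_le action_value_bound assms Do
    by (intro norm_vec_le_card) (auto simp: abs_mult less_imp_le intro!: mult_mono)
  then have "norm (mean \<theta> a) \<le> G_p P * (sqrt (real CARD('n)) * (A_max P * C_max P))"
    using norm_resolvent_mult_vec[of a ?w] G_p_ge_1
    by (auto simp: mean_def Do intro: order_trans mult_left_mono)
  then show ?thesis by (simp add: B_mu_def mult.assoc)
qed (simp add: mean_def less_imp_le)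

lemma norm_one_minus_coef_on:
  "norm ((mat 1 - coef_on R \<theta>) *v y) \<le> (1 + real CARD('n) * A_max P) * norm y"
  "norm (transpose (mat 1 - coef_on R \<theta>) *v y) \<le> (1 + real CARD('n) * A_max P) * norm y"
proof -
  have B: "norm (B *v y) \<le> real CARD('n) * A_max P * norm y" if "norm B \<le> real CARD('n) * A_max P" for B :: "real^'n^'n"
    using norm_matrix_vector_mult_le[of B y] mult_right_mono[OF that, of "norm y"] by simp
  have "(mat 1 - coef_on R \<theta>) *v y = y - coef_on R \<theta> *v y"
    by (simp add: matrix_vector_mult_diff_rdistrib)
  then show "norm ((mat 1 - coef_on R \<theta>) *v y) \<le> (1 + real CARD('n) * A_max P) * norm y"
    using norm_triangle_ineq4[of y "coef_on R \<theta> *v y"] B[OF norm_coef_on[of R]]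
    unfolding distrib_right by simp
  have "transpose (mat 1 - coef_on R \<theta>) = mat 1 - transpose (coef_on R \<theta>)"
    by (auto simp: vec_eq_iff transpose_def mat_def)
  then have "transpose (mat 1 - coef_on R \<theta>) *v y = y - transpose (coef_on R \<theta>) *v y"
    by (simp add: matrix_vector_mult_diff_rdistrib del: transpose_matrix_vector)
  then show "norm (transpose (mat 1 - coef_on R \<theta>) *v y) \<le> (1 + real CARD('n) * A_max P) * norm y"
    using norm_triangle_ineq4[of y "transpose (coef_on R \<theta>) *v y"] B[of "transpose (coef_on R \<theta>)"]
    unfolding distrib_right norm_transpose using norm_coef_on[of R] by (simp del: transpose_matrix_vector)
qed

text \<open>The support condition matters: off the observed coordinates \<open>whiten\<close> is the
  identity, whose norm can exceed \<open>1 / sqrt (v_lo P)\<close>.\<close>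

lemma norm_whiten:
  assumes y: "keep (observed a) y = y"
  shows "norm (whiten \<theta> a *v y) \<le> norm y / sqrt (v_lo P)"
    and "norm (transpose (whiten \<theta> a) *v y) \<le> norm y / sqrt (v_lo P)"
proof -
  let ?M = "blk (observed a) (mat 1 - coef \<theta>)" and ?D = "diag (\<lambda>i. 1 / sd \<theta> a i)"
  have D: "norm (?D *v w) \<le> 1 / sigma_min P * norm w" if "keep (observed a) w = w" for w
    using sd_bounds by (intro norm_diag_mult_vec_le[OF _ that]) (auto intro!: divide_left_mono simp: less_imp_le abs_of_pos)
  have v: "norm y / sqrt (v_lo P) = 1 / sigma_min P * ((1 + real CARD('n) * A_max P) * norm y)"
    using one_plus_pos by (simp add: sqrt_v_lo)
  have "norm (?D *v (?M *v y)) \<le> 1 / sigma_min P * norm (?M *v y)"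
    by (intro D keep_blk_mult y) simp
  also have "\<dots> \<le> 1 / sigma_min P * ((1 + real CARD('n) * A_max P) * norm y)"
    unfolding blk_one_minus by (intro mult_left_mono norm_one_minus_coef_on) (simp add: less_imp_le)
  finally show "norm (whiten \<theta> a *v y) \<le> norm y / sqrt (v_lo P)"
    unfolding v whiten_def by (simp add: matrix_vector_mul_assoc)
  have "norm (transpose ?M *v (?D *v y)) \<le> (1 + real CARD('n) * A_max P) * norm (?D *v y)"
    unfolding blk_one_minus by (rule norm_one_minus_coef_on)
  also have "\<dots> \<le> (1 + real CARD('n) * A_max P) * (1 / sigma_min P * norm y)"
    using one_plus_pos by (intro mult_left_mono D y) simp
  finally show "norm (transpose (whiten \<theta> a) *v y) \<le> norm y / sqrt (v_lo P)"
    unfolding v whiten_def by (simp add: matrix_transpose_mul matrix_vector_mul_assoc[symmetric] mult_ac del: transpose_matrix_vector matrix_vector_mul_assoc)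
qed

lemma norm_prec:
  assumes y: "keep (observed a) y = y"
  shows "norm (prec \<theta> a *v y) \<le> norm y / v_lo P"
proof -
  have "norm (transpose (whiten \<theta> a) *v (whiten \<theta> a *v y)) \<le> norm (whiten \<theta> a *v y) / sqrt (v_lo P)"
    by (intro norm_whiten keep_blk_mult blk_whiten y)
  also have "\<dots> \<le> norm y / sqrt (v_lo P) / sqrt (v_lo P)"
    by (intro divide_right_mono norm_whiten y) (simp add: less_imp_le)
  finally show ?thesis
    by (simp add: matrix_vector_mul_assoc[symmetric] less_imp_le del: transpose_matrix_vector matrix_vector_mul_assoc)
qed

lemma norm_colour:
  assumes y: "keep (observed a) y = y"
  shows "norm (colour \<theta> a *v y) \<le> sqrt (v_hi P) * norm y"
    and "norm (transpose (colour \<theta> a) *v y) \<le> sqrt (v_hi P) * norm y"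
proof -
  have *: "norm (colour \<theta> a *v y) \<le> sqrt (v_hi P) * norm y" if y: "keep (observed a) y = y" for y
  proof -
    have "norm (colour \<theta> a *v y) \<le> G_p P * norm (diag (sd \<theta> a) *v y)"
      unfolding colour_def matrix_vector_mul_assoc[symmetric] by (rule norm_resolvent_mult_vec)
    also have "\<dots> \<le> G_p P * (sigma_max P * norm y)"
      using sd_bounds G_p_ge_1 by (intro mult_left_mono norm_diag_mult_vec_le[OF _ y]) (auto simp: less_imp_le abs_of_pos)
    finally show ?thesis by (simp add: sqrt_v_hi mult.assoc)
  qed
  then show "norm (colour \<theta> a *v y) \<le> sqrt (v_hi P) * norm y" using y .
  let ?w = "transpose (colour \<theta> a) *v y"
  have w: "keep (observed a) ?w = ?w"
    by (intro keep_blk_mult blk_transpose blk_colour y)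
  \<comment> \<open>Duality transfers the bound to the transpose: the square of the norm is at most
    \<open>norm y\<close> times the bound for \<open>colour\<close> at \<open>?w\<close>, and one
    factor \<open>norm ?w\<close> cancels.\<close>
  have "(norm ?w)\<^sup>2 = y \<bullet> (colour \<theta> a *v ?w)"
    by (simp only: power2_norm_eq_inner inner_matrix_vector_left transpose_transpose)
  also have "\<dots> \<le> norm y * (sqrt (v_hi P) * norm ?w)"
    using norm_cauchy_schwarz[of y "colour \<theta> a *v ?w"] mult_left_mono[OF *[OF w], of "norm y"] by simp
  finally show "norm ?w \<le> sqrt (v_hi P) * norm y"
    by (cases "norm ?w = 0") (auto simp: power2_eq_square mult_ac less_imp_le)
qed

lemma norm_le_whiten:
  assumes y: "keep (observed a) y = y"
  shows "norm y \<le> sqrt (v_hi P) * norm (whiten \<theta> a *v y)"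
proof -
  have "colour \<theta> a *v (whiten \<theta> a *v y) = y"
    by (simp add: matrix_vector_mul_assoc whiten_colour)
  then show ?thesis
    using norm_colour(1)[OF keep_blk_mult[OF blk_whiten y]] by simp
qed

text \<open>Bounding whole rows keeps the radius for the covariance net at
  \<open>sqrt d * v_hi\<close>; bounding single entries would cost a further factor
  \<open>sqrt d\<close>.\<close>

lemma norm_cov_row:
  assumes "i \<in> observed a"
  shows "norm (cov \<theta> a $ i) \<le> v_hi P"
proof -
  have ax: "keep (observed a) (axis i 1) = axis i 1" using assms by (auto simp: vec_eq_iff axis_def)
  have "transpose (cov \<theta> a) = cov \<theta> a" by (simp add: cov_eq matrix_transpose_mul)
  then have "cov \<theta> a $ i = cov \<theta> a *v axis i 1"
  proof -
    assume sym: "transpose (cov \<theta> a) = cov \<theta> a"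
    have "cov \<theta> a $ i $ j = cov \<theta> a $ j $ i" for j
      using arg_cong[OF sym, of "\<lambda>M. M $ j $ i"] by (simp add: transpose_def)
    then show ?thesis by (simp add: matrix_vector_mult_basis column_def vec_eq_iff)
  qed
  also have "\<dots> = colour \<theta> a *v (transpose (colour \<theta> a) *v axis i 1)"
    unfolding cov_eq by (simp add: matrix_vector_mul_assoc del: transpose_matrix_vector)
  finally have "norm (cov \<theta> a $ i) \<le> sqrt (v_hi P) * norm (transpose (colour \<theta> a) *v axis i 1)"
    using norm_colour(1)[OF keep_blk_mult[OF blk_transpose[OF blk_colour] ax]] by simp
  also have "\<dots> \<le> sqrt (v_hi P) * (sqrt (v_hi P) * 1)"
    using norm_colour(2)[OF ax] by (intro mult_left_mono) (auto simp: less_imp_le)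
  finally show ?thesis by (simp add: less_imp_le)
qed

end

section \<open>The constant \<open>kappa_B\<close>\<close>

text \<open>Both functions are compared with \<open>u = (r - 1)\<^sup>2 / (4 * r)\<close>:
  \<open>4 * h_fun r\<close> equals \<open>ln (1 + u)\<close> and is at least
  \<open>u / (1 + u)\<close>, while \<open>g_fun r\<close> is at most \<open>2 * u\<close>. This
  also controls the quotient near \<open>r = 1\<close>, where both vanish.\<close>

lemma h_fun_ge_g_fun:
  assumes "r > 0"
  shows "h_fun r \<ge> r / (2 * (1 + r)\<^sup>2) * g_fun r"
proof -
  define u where "u = (r - 1)\<^sup>2 / (4 * r)"
  have u: "u \<ge> 0" "1 + u = (1 + r)\<^sup>2 / (4 * r)"
  proof -
    show "u \<ge> 0" using assms by (simp add: u_def)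
    show "1 + u = (1 + r)\<^sup>2 / (4 * r)"
      using assms by (simp add: u_def power2_eq_square field_simps)
  qed
  have "ln (1 + u) = 4 * h_fun r"
  proof -
    have "ln (1 + u) = ln ((1 + r)\<^sup>2) - ln (4 * r)"
      unfolding u(2) using assms by (intro ln_divide_pos) auto
    also have "ln ((1 + r)\<^sup>2) = 2 * ln (1 + r)" unfolding ln_realpow by simp
    also have "ln (4 * r) = 2 * ln 2 + ln r"
      using assms ln_realpow[of 2 2] by (simp add: ln_mult_pos)
    finally show ?thesis unfolding h_fun_eq[OF assms] by simp
  qed
  moreover have "ln (1 + u) \<ge> u / (1 + u)"
  proof -
    have "ln (1 / (1 + u)) \<le> 1 / (1 + u) - 1" using u(1) by (intro ln_le_minus_one) auto
    moreover have "ln (1 / (1 + u)) = - ln (1 + u)" using u(1) by (simp add: ln_div)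
    moreover have "1 / (1 + u) - 1 = - (u / (1 + u))" using u(1) by (simp add: field_simps)
    ultimately show ?thesis by simp
  qed
  moreover have "g_fun r \<le> 2 * u"
  proof -
    have "ln (1 / r) \<le> 1 / r - 1" using assms by (intro ln_le_minus_one) auto
    then have "- ln r \<le> 1 / r - 1" using assms by (simp add: ln_div)
    then have "g_fun r \<le> (r - 1 + (1 / r - 1)) / 2" by (simp add: g_fun_def)
    also have "\<dots> = 2 * u" using assms by (simp add: u_def power2_eq_square field_simps)
    finally show ?thesis .
  qed
  moreover have "u / (1 + u) \<ge> g_fun r / 2 / (1 + u)"
    using \<open>g_fun r \<le> 2 * u\<close> u(1) by (intro divide_right_mono) auto
  moreover have "g_fun r / 2 / (1 + u) = 4 * (r / (2 * (1 + r)\<^sup>2) * g_fun r)"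
    unfolding u(2) using assms by (simp add: field_simps)
  ultimately show ?thesis by linarith
qed

text \<open>A positive lower bound on the whole interval keeps the infimum in \<open>kappa_B\<close>
  positive and bounded below; the convention \<open>1 / 4\<close> at \<open>r = 1\<close> respects
  it.\<close>

lemma hg_ratio_bounds:
  assumes "k \<ge> 1" "r \<in> {inverse k..k}"
  shows "hg_ratio r \<ge> inverse k / (2 * (1 + k)\<^sup>2)" "hg_ratio r * g_fun r \<le> h_fun r"
proof -
  have r: "r > 0" using assms by (auto intro: less_le_trans[of 0 "inverse k"])
  have c: "inverse k / (2 * (1 + k)\<^sup>2) \<le> r / (2 * (1 + r)\<^sup>2)"
    using assms r by (intro frac_le) (auto intro: power_mono)
  show "hg_ratio r * g_fun r \<le> h_fun r" "hg_ratio r \<ge> inverse k / (2 * (1 + k)\<^sup>2)"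
  proof -
    show "hg_ratio r * g_fun r \<le> h_fun r"
      using h_fun_ge_g_fun[OF r] g_fun_nonneg[OF r] r
      by (cases "g_fun r = 0") (auto simp: hg_ratio_def g_fun_def h_fun_def)
    show "hg_ratio r \<ge> inverse k / (2 * (1 + k)\<^sup>2)"
    proof (cases "r = 1")
      case True
      then show ?thesis using c by (simp add: hg_ratio_def)
    next
      case False
      then have "ln r \<noteq> r - 1" using ln_eq_minus_one[OF r] by auto
      then have "g_fun r > 0" using g_fun_nonneg[OF r] by (simp add: g_fun_def)
      then have "hg_ratio r \<ge> r / (2 * (1 + r)\<^sup>2)"
        using h_fun_ge_g_fun[OF r] False by (simp add: hg_ratio_def pos_le_divide_eq)
      with c show ?thesis by linarith
    qed
  qed
qed

context valid_model
begin

lemma kappa_V_ge_1: "kappa_V P \<ge> 1"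
  using v_lo_le_v_hi by (simp add: kappa_V_def)

lemma kappa_B_pos: "kappa_B P > 0"
  and kappa_B_le: "kappa_B P \<le> 1 / (2 * (1 + kappa_V P))"
  and kappa_B_g_fun_le: "r \<in> {inverse (kappa_V P)..kappa_V P} \<Longrightarrow> kappa_B P * g_fun r \<le> h_fun r"
proof -
  let ?k = "kappa_V P" and ?I = "{inverse (kappa_V P)..kappa_V P}"
  let ?c = "inverse ?k / (2 * (1 + ?k)\<^sup>2)"
  have c: "?c > 0" using kappa_V_ge_1 by (intro divide_pos_pos mult_pos_pos zero_less_power) auto
  have ne: "?I \<noteq> {}" 
  proof -
    have "inverse ?k \<le> 1" using kappa_V_ge_1 by (rule inverse_le_1_iff[THEN iffD2, OF disjI2])
    then have "1 \<in> ?I" using kappa_V_ge_1 by simp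
    then show ?thesis by blast
  qed
  have "?c \<le> (INF r\<in>?I. hg_ratio r)"
    using hg_ratio_bounds(1)[OF kappa_V_ge_1] by (intro cINF_greatest ne) auto
  moreover have "v_lo P / (4 * v_hi P) > 0" by simp
  ultimately show "kappa_B P > 0" using c by (simp add: kappa_B_def)
  \<comment> \<open>The condition on the means follows from the first entry of the minimum,
    \<open>1 / (4 * kappa_V P)\<close>, because \<open>kappa_V P\<close> is at least 1.\<close>
  have "kappa_B P \<le> v_lo P / (4 * v_hi P)" by (simp add: kappa_B_def)
  also have "\<dots> = 1 / (4 * ?k)" by (simp add: kappa_V_def)
  also have "\<dots> \<le> 1 / (2 * (1 + ?k))"
    using kappa_V_ge_1 by (intro divide_left_mono) auto
  finally show "kappa_B P \<le> 1 / (2 * (1 + ?k))" .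
  assume r: "r \<in> ?I"
  have "kappa_B P \<le> (INF r\<in>?I. hg_ratio r)" by (simp add: kappa_B_def)
  also have "\<dots> \<le> hg_ratio r"
    using hg_ratio_bounds(1)[OF kappa_V_ge_1] by (intro cINF_lower r bdd_belowI2[of _ ?c])
  finally have "kappa_B P * g_fun r \<le> hg_ratio r * g_fun r"
    using r kappa_V_ge_1 by (intro mult_right_mono g_fun_nonneg) (auto intro: less_le_trans[of 0 "inverse ?k"])
  with hg_ratio_bounds(2)[OF kappa_V_ge_1 r] show "kappa_B P * g_fun r \<le> h_fun r" by linarith
qed

section \<open>Densities and divergences of the models\<close>

lemma law_eq_distr:
  "law \<theta> a = distr std_gauss (Pi\<^sub>M (observed a) (\<lambda>_. lborel))
    (\<lambda>z. restrict (($) (mean \<theta> a + colour \<theta> a *v z)) (observed a))"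
  unfolding law_def cov_eq
  by (rule gauss_eq_distr[OF block_inverse_whiten whiten_colour refl mean_supp])

lemma prob_space_law: "prob_space (law \<theta> a)"
  unfolding law_eq_distr by (intro prob_space.prob_space_distr prob_space_std_gauss) measurable

lemma abs_det_colour: "\<bar>det (colour \<theta> a)\<bar> = 1 / \<bar>det (whiten \<theta> a)\<bar>"
proof -
  have "det (colour \<theta> a) = 1 / det (whiten \<theta> a)"
    using block_inverse_det[OF block_inverse_whiten[of a]] det_whiten[of a] by (simp add: field_simps)
  then show ?thesis by simp
qed

lemma pdf_eq:
  "pdf \<theta> a x = exp (- (norm (whiten \<theta> a *v (vec_of (observed a) x - mean \<theta> a)))\<^sup>2 / 2) * \<bar>det (whiten \<theta> a)\<bar>
    / sqrt (2 * pi) ^ card (observed a)"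
  unfolding pdf_def cov_eq
  by (subst gauss_pdf_block_inverse[OF block_inverse_whiten]) (simp_all add: mean_supp abs_det_colour)

lemma pdf_pos: "pdf \<theta> a x > 0"
  unfolding pdf_eq using det_whiten by simp

lemma ln_pdf:
  "ln (pdf \<theta> a x) = - (norm (whiten \<theta> a *v (vec_of (observed a) x - mean \<theta> a)))\<^sup>2 / 2
    - ln (sqrt (2 * pi) ^ card (observed a)) + ln \<bar>det (whiten \<theta> a)\<bar>"
  unfolding pdf_eq using det_whiten[of a] by (subst ln_divide_pos, simp, simp, subst ln_mult_pos) auto

text \<open>\<open>R_fun P z\<close> is the bound for the mean plus the image, under the norm bound
  for \<open>colour\<close>, of the radius that a standard Gaussian vector exceeds with probability
  at most \<open>exp (- z)\<close>.\<close>

lemma law_norm_tail: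
  assumes a: "a \<in> actions P" and z: "z \<ge> 0"
  shows "measure (law \<theta> a) {x\<in>space (law \<theta> a). norm (vec_of (observed a) x) > R_fun P z} \<le> exp (- z)"
proof -
  let ?R = "observed a"
  let ?r = "\<lambda>z. restrict (($) (mean \<theta> a + colour \<theta> a *v z)) ?R"
  interpret G: prob_space "std_gauss :: (real^'n) measure" by (rule prob_space_std_gauss)
  have [measurable]: "vec_of ?R \<in> Pi\<^sub>M ?R (\<lambda>_. lborel) \<rightarrow>\<^sub>M borel"
    unfolding borel_measurable_vec_iff
  proof
    fix i show "(\<lambda>x. vec_of ?R x $ i) \<in> borel_measurable (Pi\<^sub>M ?R (\<lambda>_. lborel))"
      by (cases "i \<in> ?R") auto
  qed
  have bound: "norm (vec_of ?R (?r w)) \<le> B_mu P + sqrt (v_hi P) * norm w" for w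
  proof -
    have v: "vec_of ?R (?r w) = mean \<theta> a + colour \<theta> a *v keep ?R w"
    proof -
      have "(colour \<theta> a *v keep ?R w) $ i = 0" if "i \<notin> ?R" for i
        using blk_mult_vec_nth[OF blk_colour, of a "keep ?R w" i] that by simp
      then show ?thesis
        using blk_mult_vec_nth[OF blk_colour, of a w] by (auto simp: vec_eq_iff mean_supp)
    qed
    have "norm (keep ?R w) \<le> norm w"
      by (intro norm_le_componentwise_cart) auto
    moreover have "norm (colour \<theta> a *v keep ?R w) \<le> sqrt (v_hi P) * norm (keep ?R w)"
      by (intro norm_colour) (auto simp: vec_eq_iff)
    moreover have "sqrt (v_hi P) * norm (keep ?R w) \<le> sqrt (v_hi P) * norm w"
      using \<open>norm (keep ?R w) \<le> norm w\<close> by (intro mult_left_mono) (auto simp: less_imp_le)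
    ultimately show ?thesis
      using norm_triangle_ineq[of "mean \<theta> a" "colour \<theta> a *v keep ?R w"] norm_mean[OF a]
      unfolding v by linarith
  qed
  have "norm w > sqrt (real CARD('n)) + sqrt (2 * z)" if "norm (vec_of ?R (?r w)) > R_fun P z" for w
  proof (rule ccontr)
    assume "\<not> ?thesis"
    then have "sqrt (v_hi P) * norm w \<le> sqrt (v_hi P) * (sqrt (real CARD('n)) + sqrt (2 * z))"
      by (intro mult_left_mono) (auto simp: less_imp_le)
    then show False using that bound[of w] unfolding R_fun_def by linarith
  qed
  then have "{w. norm (vec_of ?R (?r w)) > R_fun P z} \<subseteq> {w. norm w > sqrt (real CARD('n)) + sqrt (2 * z)}"
    by auto
  then have "measure std_gauss {w. norm (vec_of ?R (?r w)) > R_fun P z} \<le> measure std_gauss {w::real^'n. norm w > sqrt (real CARD('n)) + sqrt (2 * z)}"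
    by (intro G.finite_measure_mono) auto
  also have "\<dots> \<le> exp (- z)" by (rule std_gauss_norm_tail[OF z])
  also have "measure std_gauss {w. norm (vec_of ?R (?r w)) > R_fun P z} = measure (law \<theta> a) {x\<in>space (law \<theta> a). norm (vec_of ?R x) > R_fun P z}"
    unfolding law_eq_distr by (subst measure_distr) (auto intro!: arg_cong[of _ _ "measure std_gauss"] simp: space_PiM)
  finally show ?thesis .
qed

text \<open>Every observed row of the precision has norm at most \<open>1 / v_lo P\<close>; the
  Cauchy-Schwarz inequality over the rows yields the factor \<open>sqrt p\<close>.\<close>

lemma abs_prec_inner_le:
  assumes "\<And>i k. i \<notin> observed a \<or> k \<notin> observed a \<Longrightarrow> \<Delta> $ i $ k = 0"
  shows "\<bar>prec \<theta> a \<bullet> \<Delta>\<bar> \<le> sqrt (real CARD('n)) / v_lo P * norm \<Delta>"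
proof -
  have row: "\<bar>prec \<theta> a $ i \<bullet> \<Delta> $ i\<bar> \<le> 1 / v_lo P * norm (\<Delta> $ i)" for i
  proof (cases "i \<in> observed a")
    case True
    then have ax: "keep (observed a) (axis i 1) = axis i 1" by (auto simp: vec_eq_iff axis_def)
    have "prec \<theta> a $ i = prec \<theta> a *v axis i 1"
    proof -
      have sym: "transpose (prec \<theta> a) = prec \<theta> a" by (simp add: matrix_transpose_mul)
      have "prec \<theta> a $ i $ j = prec \<theta> a $ j $ i" for j
        using arg_cong[OF sym, of "\<lambda>M. M $ j $ i"] by (simp only: transpose_def vec_lambda_beta)
      then show ?thesis by (simp add: matrix_vector_mult_basis column_def vec_eq_iff)
    qed
    then have "norm (prec \<theta> a $ i) \<le> 1 / v_lo P" using norm_prec[OF ax] by simp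
    then have "norm (prec \<theta> a $ i) * norm (\<Delta> $ i) \<le> 1 / v_lo P * norm (\<Delta> $ i)"
      by (intro mult_right_mono) auto
    then show ?thesis using Cauchy_Schwarz_ineq2[of "prec \<theta> a $ i" "\<Delta> $ i"] by linarith
  next
    case False
    then have "\<Delta> $ i = 0" using assms by (simp add: vec_eq_iff)
    then show ?thesis by simp
  qed
  have "\<bar>prec \<theta> a \<bullet> \<Delta>\<bar> \<le> (\<Sum>i\<in>UNIV. 1 / v_lo P * norm (\<Delta> $ i))"
    unfolding inner_vec_def[of "prec \<theta> a"] by (rule order_trans[OF sum_abs sum_mono]) (rule row)
  also have "\<dots> = 1 / v_lo P * (\<Sum>i\<in>UNIV. \<bar>1\<bar> * \<bar>norm (\<Delta> $ i)\<bar>)"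
    by (simp add: sum_distrib_left)
  also have "\<dots> \<le> 1 / v_lo P * (L2_set (\<lambda>_. 1) (UNIV :: 'n set) * L2_set (\<lambda>i. norm (\<Delta> $ i)) UNIV)"
    by (intro mult_left_mono L2_set_mult_ineq) (simp add: less_imp_le)
  also have "\<dots> = sqrt (real CARD('n)) / v_lo P * norm \<Delta>"
    by (simp add: L2_set_def norm_vec_def)
  finally show ?thesis .
qed

end

section \<open>Divergence, affinity and Lipschitz bounds for two models\<close>

definition model_dist :: "'n::finite action \<Rightarrow> 'n model \<Rightarrow> 'n model \<Rightarrow> real" where
  "model_dist a \<theta> \<nu> = norm (mean \<theta> a - mean \<nu> a) + norm (cov \<theta> a - cov \<nu> a)"

locale two_models = valid_model P \<theta> + V: valid_model P \<nu> for P :: "'n::finite pars" and \<theta> \<nu>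
begin

lemma KL_eq: "KL a \<theta> \<nu> = (prec \<nu> a \<bullet> cov \<theta> a - real CARD('n)
    + (norm (whiten \<nu> a *v (mean \<theta> a - mean \<nu> a)))\<^sup>2) / 2 + ln \<bar>det (whiten \<theta> a)\<bar> - ln \<bar>det (whiten \<nu> a)\<bar>"
  unfolding KL_def law_def cov_eq V.cov_eq
  by (rule KL_gauss_eq[OF block_inverse_whiten V.block_inverse_whiten mean_supp V.mean_supp])

lemma KL_nonneg: "KL a \<theta> \<nu> \<ge> 0"
  unfolding KL_def law_def cov_eq V.cov_eq
  by (rule KL_gauss_nonneg[OF block_inverse_whiten V.block_inverse_whiten mean_supp V.mean_supp])

text \<open>This is the divergence after both means are moved to 0. It isolates the covariance part
  of \<open>KL_eq\<close>, which can then be dropped or bounded on its own.\<close>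

lemma KL_centred_nonneg:
  "(prec \<nu> a \<bullet> cov \<theta> a - real CARD('n)) / 2 + ln \<bar>det (whiten \<theta> a)\<bar> - ln \<bar>det (whiten \<nu> a)\<bar> \<ge> 0"
  using KL_gauss_nonneg[OF block_inverse_whiten[of a] V.block_inverse_whiten[of a], of 0 0]
    KL_gauss_eq[OF block_inverse_whiten[of a] V.block_inverse_whiten[of a], of 0 0]
  by (simp add: cov_eq)

lemma cov_diff_supp: "i \<notin> observed a \<or> k \<notin> observed a \<Longrightarrow> (cov \<theta> a - cov \<nu> a) $ i $ k = 0"
  using blk_cov[of a] V.blk_cov[of a] unfolding blk_eq_iff by auto

text \<open>Nonnegativity of the centred divergence bounds the change of the log-determinant by half
  the inner product of a precision with the covariance difference; it takes the place of concavity
  of the log-determinant.\<close>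

lemma ln_det_whiten_le:
  "ln \<bar>det (whiten \<nu> a)\<bar> - ln \<bar>det (whiten \<theta> a)\<bar> \<le> sqrt (real CARD('n)) / v_lo P * norm (cov \<theta> a - cov \<nu> a) / 2"
proof -
  have "transpose (cov \<nu> a) = cov \<nu> a" by (simp add: V.cov_eq matrix_transpose_mul)
  then have "prec \<nu> a \<bullet> cov \<nu> a = real CARD('n)"
    by (simp add: matrix_inner_eq_trace V.cov_prec trace_I)
  then have "prec \<nu> a \<bullet> (cov \<theta> a - cov \<nu> a) = prec \<nu> a \<bullet> cov \<theta> a - real CARD('n)"
    by (simp add: inner_diff_right)
  moreover have "\<bar>prec \<nu> a \<bullet> (cov \<theta> a - cov \<nu> a)\<bar> \<le> sqrt (real CARD('n)) / v_lo P * norm (cov \<theta> a - cov \<nu> a)"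
    by (rule V.abs_prec_inner_le[OF cov_diff_supp])
  moreover have "l2 - l1 \<le> c / 2" if "x = y - n" "\<bar>x\<bar> \<le> c" "0 \<le> (y - n) / 2 + l1 - l2" for x y n c l1 l2 :: real
    using that by argo
  ultimately show ?thesis using KL_centred_nonneg[of a] by blast
qed

lemma affinity_le:
  "(\<integral>\<^sup>+x. ennreal (sqrt (pdf \<theta> a x / pdf \<nu> a x)) \<partial>law \<nu> a) \<le> ennreal (exp (- (kappa_B P * KL a \<theta> \<nu>)))"
proof -
  let ?R = "observed a"
  obtain S Q d where "gauss_pair ?R (whiten \<theta> a) (colour \<theta> a) (whiten \<nu> a) (colour \<nu> a) S Q (mean \<theta> a) (mean \<nu> a) d"
    by (rule gauss_pair_exists[OF block_inverse_whiten V.block_inverse_whiten mean_supp V.mean_supp])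
  then interpret G: gauss_pair ?R "whiten \<theta> a" "colour \<theta> a" "whiten \<nu> a" "colour \<nu> a" S Q "mean \<theta> a" "mean \<nu> a" d .
  \<comment> \<open>On observed coordinates \<open>whiten\<close> expands by at most
    \<open>1 / sqrt v_lo\<close> and its inverse by at most \<open>sqrt v_hi\<close>, so squared
    whitened norms differ at most by the factor \<open>kappa_V\<close>. Off them both norms agree,
    and \<open>kappa_V\<close> is at least 1.\<close>
  have compare: "(norm (whiten \<alpha> a *v y))\<^sup>2 \<le> kappa_V P * (norm (whiten \<beta> a *v y))\<^sup>2"
    if "valid_model P \<alpha>" "valid_model P \<beta>" for y and \<alpha> \<beta> :: "'n model"
  proof -
    interpret A: valid_model P \<alpha> by fact
    interpret B: valid_model P \<beta> by fact
    have k: "keep ?R (keep ?R y) = keep ?R y" by (simp add: vec_eq_iff)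
    have "(norm (whiten \<alpha> a *v keep ?R y))\<^sup>2 \<le> (norm (keep ?R y) / sqrt (v_lo P))\<^sup>2"
      by (intro power_mono A.norm_whiten k) simp
    also have "\<dots> = (norm (keep ?R y))\<^sup>2 / v_lo P" by (simp add: power_divide less_imp_le)
    also have "\<dots> \<le> (sqrt (v_hi P) * norm (whiten \<beta> a *v keep ?R y))\<^sup>2 / v_lo P"
      by (intro divide_right_mono power_mono B.norm_le_whiten k) (auto simp: less_imp_le)
    also have "\<dots> = kappa_V P * (norm (whiten \<beta> a *v keep ?R y))\<^sup>2"
      by (simp add: kappa_V_def power_mult_distrib less_imp_le)
    finally have "(norm (whiten \<alpha> a *v keep ?R y))\<^sup>2 \<le> kappa_V P * (norm (whiten \<beta> a *v keep ?R y))\<^sup>2" .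
    moreover have "(\<Sum>i\<in>-?R. (y $ i)\<^sup>2) \<le> kappa_V P * (\<Sum>i\<in>-?R. (y $ i)\<^sup>2)"
      using mult_right_mono[OF kappa_V_ge_1, of "\<Sum>i\<in>-?R. (y $ i)\<^sup>2"] by (simp add: sum_nonneg)
    ultimately show ?thesis
      unfolding norm_blk_mult_vec[OF A.blk_whiten, of a y] norm_blk_mult_vec[OF B.blk_whiten, of a y]
      by (simp add: distrib_left)
  qed
  have m: "valid_model P \<theta>" "valid_model P \<nu>" by unfold_locales
  have lo: "inverse (kappa_V P) * (norm (whiten \<theta> a *v y))\<^sup>2 \<le> (norm (whiten \<nu> a *v y))\<^sup>2" for y
    using compare[OF m, of y] kappa_V_ge_1 by (simp add: field_simps)
  have hi: "(norm (whiten \<nu> a *v y))\<^sup>2 \<le> kappa_V P * (norm (whiten \<theta> a *v y))\<^sup>2" for y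
    by (rule compare[OF m(2,1)])
  show ?thesis
    using G.affinity_le_exp_KL[OF lo hi _ kappa_B_le] kappa_B_g_fun_le
    by (simp add: pdf_def law_def KL_def cov_eq V.cov_eq)
qed

end

lemma matrix_mult_diff:
  fixes A B C :: "real^'n^'n"
  shows "A ** (B - C) = A ** B - A ** C" "(B - C) ** A = B ** A - C ** A"
  by (simp_all add: matrix_matrix_mult_def vec_eq_iff right_diff_distrib left_diff_distrib sum_subtractf)

lemma norm_mult_vec_diff:
  fixes S :: "real^'n^'n"
  shows "(norm (S *v y))\<^sup>2 - (norm (S *v w))\<^sup>2 = (y - w) \<bullet> ((transpose S ** S) *v (y + w))"
proof -
  have s: "w \<bullet> ((transpose S ** S) *v y) = y \<bullet> ((transpose S ** S) *v w)"
    by (simp only: matrix_vector_mul_assoc[symmetric] inner_matrix_vector_left[symmetric] inner_commute)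
  show ?thesis
    unfolding norm_mult_vec_power2 by (simp add: matrix_vector_right_distrib inner_simps s del: transpose_matrix_vector)
qed

context two_models
begin

lemma norm_whiten_diff_le:
  assumes "keep (observed a) y = y" "keep (observed a) w = w" "norm y \<le> c" "norm w \<le> c"
  shows "\<bar>(norm (whiten \<theta> a *v y))\<^sup>2 - (norm (whiten \<theta> a *v w))\<^sup>2\<bar> \<le> norm (y - w) * (2 * c / v_lo P)"
proof -
  have "keep (observed a) (y + w) = y + w"
  proof -
    have "y $ i = 0 \<and> w $ i = 0" if "i \<notin> observed a" for i
      using that arg_cong[OF assms(1), of "\<lambda>v. v $ i"] arg_cong[OF assms(2), of "\<lambda>v. v $ i"] by simp
    then show ?thesis by (auto simp: vec_eq_iff)
  qed
  then have "norm (prec \<theta> a *v (y + w)) \<le> norm (y + w) / v_lo P"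
    by (rule norm_prec)
  also have "\<dots> \<le> 2 * c / v_lo P"
    using norm_triangle_ineq[of y w] assms(3,4) by (intro divide_right_mono) (auto simp: less_imp_le)
  finally have "norm (y - w) * norm (prec \<theta> a *v (y + w)) \<le> norm (y - w) * (2 * c / v_lo P)"
    by (rule mult_left_mono) simp
  then show ?thesis
    unfolding norm_mult_vec_diff using Cauchy_Schwarz_ineq2[of "y - w" "prec \<theta> a *v (y + w)"] by linarith
qed

text \<open>Resolvent identity: precisions \<open>W\<close>, \<open>W'\<close> with covariances
  \<open>V\<close>, \<open>V'\<close> satisfy \<open>W - W' = W (V' - V) W'\<close>, and each
  precision costs a factor \<open>1 / v_lo\<close>.\<close>

lemma prec_diff_quadratic_le:
  assumes y: "keep (observed a) y = y" "norm y \<le> c"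
  shows "\<bar>(norm (whiten \<theta> a *v y))\<^sup>2 - (norm (whiten \<nu> a *v y))\<^sup>2\<bar> \<le> (c / v_lo P)\<^sup>2 * norm (cov \<theta> a - cov \<nu> a)"
proof -
  let ?W = "prec \<theta> a" and ?W' = "prec \<nu> a" and ?\<Delta> = "cov \<nu> a - cov \<theta> a"
  have "?W ** ?\<Delta> ** ?W' = ?W ** (cov \<nu> a ** ?W') - (?W ** cov \<theta> a) ** ?W'"
    by (simp add: matrix_mult_diff matrix_mul_assoc)
  also have "\<dots> = ?W - ?W'" by (simp only: cov_prec V.cov_prec matrix_mul_lid matrix_mul_rid)
  finally have W: "?W - ?W' = ?W ** (?\<Delta> ** ?W')" by (simp add: matrix_mul_assoc)
  have "(norm (whiten \<theta> a *v y))\<^sup>2 - (norm (whiten \<nu> a *v y))\<^sup>2 = y \<bullet> ((?W - ?W') *v y)"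
    unfolding norm_mult_vec_power2 by (simp add: matrix_vector_mult_diff_rdistrib inner_diff_right)
  also have "\<dots> = (?W *v y) \<bullet> (?\<Delta> *v (?W' *v y))"
    unfolding W matrix_vector_mul_assoc[symmetric, of ?W] by (simp add: inner_matrix_vector_left matrix_transpose_mul matrix_vector_mul_assoc del: transpose_matrix_vector)
  finally have "\<bar>(norm (whiten \<theta> a *v y))\<^sup>2 - (norm (whiten \<nu> a *v y))\<^sup>2\<bar> \<le> norm (?W *v y) * norm (?\<Delta> *v (?W' *v y))"
    using Cauchy_Schwarz_ineq2[of "?W *v y" "?\<Delta> *v (?W' *v y)"] by simp
  also have "\<dots> \<le> norm (?W *v y) * (norm ?\<Delta> * norm (?W' *v y))"
    by (intro mult_left_mono norm_matrix_vector_mult_le) simp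
  also have "\<dots> \<le> (c / v_lo P) * (norm ?\<Delta> * (c / v_lo P))"
  proof -
    have "norm y / v_lo P \<le> c / v_lo P" using y(2) by (intro divide_right_mono) (auto simp: less_imp_le)
    then have "norm (?W *v y) \<le> c / v_lo P" "norm (?W' *v y) \<le> c / v_lo P"
      using norm_prec[OF y(1)] V.norm_prec[OF y(1)] by linarith+
    then show ?thesis by (intro mult_mono) (auto intro: order_trans[OF norm_ge_zero])
  qed
  finally show ?thesis by (simp add: power2_eq_square mult_ac norm_minus_commute)
qed

lemma two_models_swap: "two_models P \<nu> \<theta>" by unfold_locales

text \<open>The parameters are changed in turn: the mean under a fixed precision, then the
  precision, then the normalising determinant. The three costs are the summands of
  \<open>L_ell\<close>; the quadratic form makes a bound on the observation necessary.\<close>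

lemma ln_pdf_lipschitz:
  assumes a: "a \<in> actions P" and x: "norm (vec_of (observed a) x) \<le> r"
  shows "\<bar>ln (pdf \<theta> a x) - ln (pdf \<nu> a x)\<bar> \<le> L_ell P r * model_dist a \<theta> \<nu>"
proof -
  let ?R = "observed a" and ?y = "vec_of (observed a) x - mean \<theta> a" and ?w = "vec_of (observed a) x - mean \<nu> a"
  let ?dm = "norm (mean \<theta> a - mean \<nu> a)" and ?dV = "norm (cov \<theta> a - cov \<nu> a)" and ?c = "r + B_mu P"
  have r: "r \<ge> 0" by (rule order_trans[OF norm_ge_zero x])
  have k: "keep ?R ?y = ?y" "keep ?R ?w = ?w"
    by (auto simp: vec_eq_iff mean_supp V.mean_supp)
  have n: "norm ?y \<le> ?c" "norm ?w \<le> ?c"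
    using norm_triangle_ineq4[of "vec_of ?R x" "mean \<theta> a"] norm_triangle_ineq4[of "vec_of ?R x" "mean \<nu> a"]
      x norm_mean[OF a] V.norm_mean[OF a] by linarith+
  have dm: "norm (?y - ?w) = ?dm" by (simp add: norm_minus_commute)
  have 1: "\<bar>(norm (whiten \<theta> a *v ?y))\<^sup>2 - (norm (whiten \<theta> a *v ?w))\<^sup>2\<bar> \<le> ?dm * (2 * ?c / v_lo P)"
    using norm_whiten_diff_le[OF k n] unfolding dm .
  have 2: "\<bar>(norm (whiten \<theta> a *v ?w))\<^sup>2 - (norm (whiten \<nu> a *v ?w))\<^sup>2\<bar> \<le> (?c / v_lo P)\<^sup>2 * ?dV"
    by (rule prec_diff_quadratic_le[OF k(2) n(2)])
  have 3: "\<bar>ln \<bar>det (whiten \<theta> a)\<bar> - ln \<bar>det (whiten \<nu> a)\<bar>\<bar> \<le> sqrt (real CARD('n)) / v_lo P * ?dV / 2"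
    using ln_det_whiten_le[of a] two_models.ln_det_whiten_le[OF two_models_swap, of a]
    by (simp add: norm_minus_commute abs_le_iff)
  have "\<bar>ln (pdf \<theta> a x) - ln (pdf \<nu> a x)\<bar> \<le> ?dm * (2 * ?c / v_lo P) / 2 + (?c / v_lo P)\<^sup>2 * ?dV / 2 + sqrt (real CARD('n)) / v_lo P * ?dV / 2"
  proof -
    have "\<bar>(- A / 2 - k + l1) - (- C / 2 - k + l2)\<bar> \<le> p / 2 + q / 2 + s / 2"
      if "\<bar>A - B\<bar> \<le> p" "\<bar>B - C\<bar> \<le> q" "\<bar>l1 - l2\<bar> \<le> s / 2" for A B C k l1 l2 p q s :: real
      using that by argo
    from this[OF 1 2 3] show ?thesis unfolding ln_pdf V.ln_pdf .
  qed
  also have "\<dots> = ?c / v_lo P * ?dm + (sqrt (real CARD('n)) / v_lo P + ?c\<^sup>2 / (v_lo P)\<^sup>2) / 2 * ?dV"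
  proof -
    have "dm * (2 * c / v) / 2 + (c / v)\<^sup>2 * dV / 2 + s / v * dV / 2 = c / v * dm + (s / v + c\<^sup>2 / v\<^sup>2) / 2 * dV"
      for dm c v dV s :: real
      by (simp add: power_divide add_divide_distrib distrib_right)
    then show ?thesis .
  qed
  also have "\<dots> \<le> L_ell P r * ?dm + L_ell P r * ?dV"
    unfolding L_ell_def using r by (intro add_mono mult_right_mono) (auto simp: less_imp_le intro!: add_nonneg_nonneg divide_nonneg_nonneg)
  finally show ?thesis by (simp add: model_dist_def distrib_left)
qed

end

text \<open>Only the first argument moves, so the precision in the trace and mean terms stays that
  of \<open>\<nu>\<close>: the trace is linear in the covariance and no quadratic term enters
  \<open>L_KL\<close>.\<close>

lemma (in valid_params) KL_lipschitz:
  assumes m: "\<theta> \<in> Theta P" "\<theta>' \<in> Theta P" "\<nu> \<in> Theta P" and a: "a \<in> actions P"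
  shows "\<bar>KL a \<theta> \<nu> - KL a \<theta>' \<nu>\<bar> \<le> L_KL P * model_dist a \<theta> \<theta>'"
proof -
  interpret A: two_models P \<theta> \<nu> using m by unfold_locales
  interpret B: two_models P \<theta>' \<nu> using m by unfold_locales
  interpret C: two_models P \<theta> \<theta>' using m by unfold_locales
  interpret D: two_models P \<nu> \<nu> using m by unfold_locales
  let ?R = "observed a" and ?y = "mean \<theta> a - mean \<nu> a" and ?w = "mean \<theta>' a - mean \<nu> a"
  let ?dm = "norm (mean \<theta> a - mean \<theta>' a)" and ?dV = "norm (cov \<theta> a - cov \<theta>' a)"
  have k: "keep ?R ?y = ?y" "keep ?R ?w = ?w"
    by (auto simp: vec_eq_iff A.mean_supp B.mean_supp A.V.mean_supp)
  have n: "norm ?y \<le> 2 * B_mu P" "norm ?w \<le> 2 * B_mu P"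
    using norm_triangle_ineq4[of "mean \<theta> a" "mean \<nu> a"] norm_triangle_ineq4[of "mean \<theta>' a" "mean \<nu> a"]
      A.norm_mean[OF a] B.norm_mean[OF a] A.V.norm_mean[OF a] by linarith+
  have dm: "norm (?y - ?w) = ?dm" by simp
  have 1: "\<bar>(norm (whiten \<nu> a *v ?y))\<^sup>2 - (norm (whiten \<nu> a *v ?w))\<^sup>2\<bar> \<le> ?dm * (2 * (2 * B_mu P) / v_lo P)"
    using D.norm_whiten_diff_le[OF k n] unfolding dm .
  have 2: "\<bar>ln \<bar>det (whiten \<theta> a)\<bar> - ln \<bar>det (whiten \<theta>' a)\<bar>\<bar> \<le> sqrt (real CARD('n)) / v_lo P * ?dV / 2"
    using C.ln_det_whiten_le[of a] two_models.ln_det_whiten_le[OF C.two_models_swap, of a]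
    by (simp add: norm_minus_commute abs_le_iff)
  have "\<bar>prec \<nu> a \<bullet> (cov \<theta> a - cov \<theta>' a)\<bar> \<le> sqrt (real CARD('n)) / v_lo P * ?dV"
    by (rule A.V.abs_prec_inner_le[OF C.cov_diff_supp])
  then have 3: "\<bar>prec \<nu> a \<bullet> cov \<theta> a - prec \<nu> a \<bullet> cov \<theta>' a\<bar> \<le> sqrt (real CARD('n)) / v_lo P * ?dV"
    by (simp add: inner_diff_right)
  have "\<bar>KL a \<theta> \<nu> - KL a \<theta>' \<nu>\<bar> \<le> ?dm * (2 * (2 * B_mu P) / v_lo P) / 2 + sqrt (real CARD('n)) / v_lo P * ?dV"
  proof -
    have "\<bar>(t - n + A) / 2 + l1 - l - ((t' - n + B) / 2 + l2 - l)\<bar> \<le> p / 2 + s"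
      if "\<bar>A - B\<bar> \<le> p" "\<bar>l1 - l2\<bar> \<le> s / 2" "\<bar>t - t'\<bar> \<le> s" for A B l l1 l2 p s t t' n :: real
      using that by argo
    from this[OF 1 2 3] show ?thesis unfolding A.KL_eq B.KL_eq .
  qed
  also have "\<dots> = 2 * B_mu P / v_lo P * ?dm + sqrt (real CARD('n)) / v_lo P * ?dV" by simp
  also have "\<dots> \<le> L_KL P * ?dm + L_KL P * ?dV"
    unfolding L_KL_def by (intro add_mono mult_right_mono divide_right_mono) (auto simp: less_imp_le)
  finally show ?thesis by (simp add: model_dist_def distrib_left)
qed

section \<open>Covering numbers\<close>

text \<open>The packing set lies in the coordinate subspace indexed by \<open>I\<close>; volumes are compared in the whole
  space, with balls replaced by their products with a unit cube in the remaining coordinates.\<close>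

definition tube :: "'m::finite set \<Rightarrow> real^'m \<Rightarrow> real \<Rightarrow> (real^'m) set" where
  "tube I c r = {x. norm (keep I (x - c)) < r \<and> (\<forall>i. i \<notin> I \<longrightarrow> 0 \<le> x $ i \<and> x $ i \<le> 1)}"

lemma borel_measurable_keep [measurable (raw)]:
  "f \<in> borel_measurable M \<Longrightarrow> (\<lambda>x. keep I (f x)) \<in> borel_measurable M"
  unfolding keep_def by (subst borel_measurable_vec_iff) simp

lemma sets_tube [measurable]: "tube I c r \<in> sets borel"
proof -
  have "{x \<in> space borel. norm (keep I (x - c)) < r \<and> (\<forall>i. i \<notin> I \<longrightarrow> 0 \<le> x $ i \<and> x $ i \<le> 1)} \<in> sets borel"
    by measurable
  then show ?thesis by (simp add: tube_def)
qed

lemma emeasure_tube: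
  assumes r: "r > 0" and c: "keep I c = c"
  shows "emeasure lborel (tube I c r) = ennreal (r ^ card I) * emeasure lborel (tube I 0 1)"
proof -
  let ?A = "diag (\<lambda>i. if i \<in> I then r else 1)"
  have c0: "c $ i = 0" if "i \<notin> I" for i
    using arg_cong[OF c, of "\<lambda>v. v $ i"] that by simp
  have det: "det ?A = r ^ card I"
    by (simp add: det_diag prod.If_cases)
  have "keep I (c + ?A *v z - c) = r *\<^sub>R keep I z" for z
    by (auto simp: vec_eq_iff diag_mult_vec)
  then have iff: "c + ?A *v z \<in> tube I c r \<longleftrightarrow> z \<in> tube I 0 1" for z
    using r by (auto simp: tube_def diag_mult_vec c0)
  have "emeasure lborel (tube I c r) = (\<integral>\<^sup>+x. indicator (tube I c r) x \<partial>lborel)"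
    by simp
  also have "\<dots> = ennreal \<bar>det ?A\<bar> * (\<integral>\<^sup>+z. indicator (tube I c r) (c + ?A *v z) \<partial>lborel)"
    using det r by (intro nn_integral_affine_vec) auto
  also have "(\<lambda>z. indicator (tube I c r) (c + ?A *v z)) = (indicator (tube I 0 1) :: _ \<Rightarrow> ennreal)"
    by (auto simp: indicator_def iff)
  finally show ?thesis using r by (simp add: det)
qed

text \<open>The unit volume is cancelled in the packing bound, which needs it to be positive and
  finite.\<close>

lemma emeasure_unit_tube:
  "emeasure lborel (tube I 0 1) > 0" "emeasure lborel (tube (I :: 'm::finite set) 0 1) < \<infinity>"
proof -
  have "tube I 0 1 \<subseteq> cbox (\<chi> i. - 1) (\<chi> i. 1)"
  proof
    fix x assume x: "x \<in> tube I 0 1"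
    have "- 1 \<le> x $ i \<and> x $ i \<le> 1" for i
    proof (cases "i \<in> I")
      case True
      then show ?thesis using x component_le_norm_cart[of "keep I x" i] by (auto simp: tube_def)
    next
      case False
      then show ?thesis using x by (auto simp: tube_def intro: order_trans[of "-1" 0])
    qed
    then show "x \<in> cbox (\<chi> i. - 1) (\<chi> i. 1)" by (simp add: mem_box_cart)
  qed
  then have "emeasure lborel (tube I 0 1) \<le> emeasure lborel (cbox (\<chi> i. - 1) (\<chi> i. 1) :: (real^'m) set)"
    by (intro emeasure_mono) auto
  also have "\<dots> < \<infinity>" by (rule emeasure_lborel_cbox_finite)
  finally show "emeasure lborel (tube I 0 1) < \<infinity>" .
  \<comment> \<open>Small enough that \<open>sqrt m * e\<close> is below 1 in dimension
    \<open>m\<close>, so the cube of side \<open>e\<close> fits into the tube.\<close>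
  define e where "e = 1 / (real CARD('m) + 1)"
  have e: "e > 0" "e \<le> 1" by (auto simp: e_def)
  have "box (\<chi> i. 0) (\<chi> i. e) \<subseteq> tube I 0 1"
  proof
    fix x :: "real^'m" assume "x \<in> box (\<chi> i. 0) (\<chi> i. e)"
    then have x: "0 < x $ i" "x $ i < e" for i by (auto simp: mem_box_cart)
    have "norm (keep I x) \<le> sqrt (real CARD('m)) * e"
      using x e by (intro norm_vec_le_card) (auto simp: less_imp_le)
    also have "\<dots> < 1"
    proof -
      have "sqrt (real CARD('m)) \<le> sqrt ((real CARD('m))\<^sup>2)"
        by (intro real_sqrt_le_mono self_le_power) (auto simp: Suc_leI)
      then have "sqrt (real CARD('m)) < real CARD('m) + 1" by simp
      then show ?thesis by (simp add: e_def)
    qed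
    finally show "x \<in> tube I 0 1"
      using x e less_imp_le[OF less_le_trans[OF x(2) e(2)]] by (auto simp: tube_def less_imp_le)
  qed
  then have "emeasure lborel (box (\<chi> i. 0) (\<chi> i. e) :: (real^'m) set) \<le> emeasure lborel (tube I 0 1)"
    by (intro emeasure_mono) auto
  moreover have "emeasure lborel (box (\<chi> i. 0) (\<chi> i. e) :: (real^'m) set) = ennreal (e ^ CARD('m))"
    using e by (subst emeasure_lborel_box) (auto simp: Basis_vec_real inner_axis prod_Basis_vec[unfolded Basis_vec_real])
  moreover have "ennreal (e ^ CARD('m)) > 0" using e by simp
  ultimately show "emeasure lborel (tube I 0 1) > 0" by (metis less_le_trans)
qed

text \<open>Volume comparison: the tubes of radius \<open>r / 2\<close> around the points are
  disjoint and fit into one of radius \<open>b + r / 2\<close>, and volume scales with the power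
  \<open>card I\<close>.\<close>

lemma card_separated_le:
  fixes S :: "(real^'m) set"
  assumes S: "finite S" "\<And>x. x \<in> S \<Longrightarrow> keep I x = x" "\<And>x. x \<in> S \<Longrightarrow> norm x \<le> b"
    and sep: "\<And>x y. x \<in> S \<Longrightarrow> y \<in> S \<Longrightarrow> x \<noteq> y \<Longrightarrow> norm (x - y) \<ge> r" and r: "r > 0" and b: "b \<ge> 0"
  shows "real (card S) \<le> (1 + 2 * b / r) ^ card I"
proof -
  let ?v = "emeasure lborel (tube I 0 1)"
  have kd: "keep I (x - y) = keep I x - keep I y" for x y by (auto simp: vec_eq_iff)
  have "disjoint_family_on (\<lambda>c. tube I c (r / 2)) S"
  proof (unfold disjoint_family_on_def, intro ballI impI equals0I)
    fix c d x assume cd: "c \<in> S" "d \<in> S" "c \<noteq> d" and x: "x \<in> tube I c (r / 2) \<inter> tube I d (r / 2)"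
    then have "norm (keep I x - c) < r / 2" "norm (keep I x - d) < r / 2"
      by (auto simp: tube_def kd S(2))
    then have "norm (c - d) < r" using norm_triangle_ineq4[of "keep I x - d" "keep I x - c"] by simp
    with sep[OF cd] show False by simp
  qed
  then have "(\<Sum>c\<in>S. emeasure lborel (tube I c (r / 2))) = emeasure lborel (\<Union>c\<in>S. tube I c (r / 2))"
    using S(1) by (intro sum_emeasure) auto
  also have "\<dots> \<le> emeasure lborel (tube I 0 (b + r / 2))"
  proof (rule emeasure_mono)
    show "(\<Union>c\<in>S. tube I c (r / 2)) \<subseteq> tube I 0 (b + r / 2)"
    proof
      fix x assume "x \<in> (\<Union>c\<in>S. tube I c (r / 2))"
      then obtain c where c: "c \<in> S" "x \<in> tube I c (r / 2)" by blast
      then have "norm (keep I x - c) < r / 2" by (auto simp: tube_def kd S(2))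
      then have "norm (keep I x) < b + r / 2"
        using norm_triangle_ineq[of "keep I x - c" c] S(3)[OF c(1)] by simp
      then show "x \<in> tube I 0 (b + r / 2)" using c(2) by (simp add: tube_def)
    qed
  qed simp
  also have "\<dots> = ennreal ((b + r / 2) ^ card I) * ?v"
    using r b by (intro emeasure_tube) (auto simp: vec_eq_iff)
  also have "(\<Sum>c\<in>S. emeasure lborel (tube I c (r / 2))) = (\<Sum>c\<in>S. ennreal ((r / 2) ^ card I) * ?v)"
    using r by (intro sum.cong emeasure_tube) (auto simp: S(2))
  also have "\<dots> = ennreal (real (card S) * (r / 2) ^ card I) * ?v"
    using r by (simp add: ennreal_mult mult.assoc ennreal_of_nat_eq_real_of_nat)
  finally have "ennreal (real (card S) * (r / 2) ^ card I) * ?v \<le> ennreal ((b + r / 2) ^ card I) * ?v" .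
  then have "ennreal (real (card S) * (r / 2) ^ card I) \<le> ennreal ((b + r / 2) ^ card I)"
    using emeasure_unit_tube[of I] by (subst (asm) (1 2) mult.commute) (auto simp: ennreal_mult_le_mult_iff)
  then have "real (card S) * (r / 2) ^ card I \<le> (b + r / 2) ^ card I"
    using r b by (subst (asm) ennreal_le_iff) auto
  then have "real (card S) \<le> (b + r / 2) ^ card I / (r / 2) ^ card I"
    using r by (simp add: pos_le_divide_eq)
  also have "\<dots> = ((b + r / 2) / (r / 2)) ^ card I" by (rule power_divide[symmetric])
  also have "(b + r / 2) / (r / 2) = 1 + 2 * b / r" using r by (simp add: field_simps)
  finally show ?thesis .
qed

text \<open>A separated subset of maximal cardinality is a net, since any uncovered point could be
  added to it. A maximum exists because the cardinalities are bounded.\<close>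

lemma finite_net:
  fixes X :: "(real^'m) set"
  assumes X: "\<And>x. x \<in> X \<Longrightarrow> keep I x = x" "\<And>x. x \<in> X \<Longrightarrow> norm x \<le> b" and r: "r > 0" and b: "b \<ge> 0"
  shows "\<exists>N. finite N \<and> real (card N) \<le> (1 + 2 * b / r) ^ card I \<and> (\<forall>x\<in>X. \<exists>c\<in>N. norm (x - c) < r)"
proof -
  define sep where "sep N \<longleftrightarrow> finite N \<and> N \<subseteq> X \<and> (\<forall>x\<in>N. \<forall>y\<in>N. x \<noteq> y \<longrightarrow> norm (x - y) \<ge> r)" for N
  have bound: "real (card N) \<le> (1 + 2 * b / r) ^ card I" if "sep N" for N
    using that X r b by (intro card_separated_le) (auto simp: sep_def)
  then have "card ` {N. sep N} \<subseteq> {..nat \<lfloor>(1 + 2 * b / r) ^ card I\<rfloor>}"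
    by (auto simp: le_nat_floor)
  then have fin: "finite (card ` {N. sep N})" using finite_subset by blast
  moreover have "sep {}" by (simp add: sep_def)
  ultimately have "Max (card ` {N. sep N}) \<in> card ` {N. sep N}" by (intro Max_in) auto
  then obtain N where N: "sep N" "card N = Max (card ` {N. sep N})" by auto
  have max: "card N' \<le> card N" if "sep N'" for N'
    unfolding N(2) using fin that by (intro Max_ge) auto
  show ?thesis
  proof (intro exI[of _ N] conjI ballI)
    show "finite N" using N(1) by (simp add: sep_def)
    show "real (card N) \<le> (1 + 2 * b / r) ^ card I" by (rule bound[OF N(1)])
    fix x assume x: "x \<in> X"
    show "\<exists>c\<in>N. norm (x - c) < r"
    proof (rule ccontr)
      assume "\<not> (\<exists>c\<in>N. norm (x - c) < r)"
      then have far: "norm (x - c) \<ge> r" "norm (c - x) \<ge> r" if "c \<in> N" for c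
        using that by (force simp: norm_minus_commute)+
      then have "x \<notin> N" using r by force
      moreover have "sep (insert x N)"
        using N(1) x far by (auto simp: sep_def)
      ultimately show False using max[of "insert x N"] N(1) by (auto simp: sep_def)
    qed
  qed
qed

text \<open>\<open>f\<close> enumerates the index type, which carries no order; the set indexes the
  free entries of a symmetric \<open>R\<close>-block.\<close>

definition upper :: "('n \<Rightarrow> nat) \<Rightarrow> 'n set \<Rightarrow> ('n \<times> 'n) set" where
  "upper f R = {(i, k) \<in> R \<times> R. f i \<le> f k}"

text \<open>The factor $\sqrt 2$ makes the embedding of the symmetric matrices isometric.\<close>

definition sym_vec :: "('n::finite \<Rightarrow> nat) \<Rightarrow> 'n set \<Rightarrow> real^'n^'n \<Rightarrow> real^('n \<times> 'n)" where
  "sym_vec f R M = (\<chi> x. if x \<in> upper f R then (if fst x = snd x then 1 else sqrt 2) * M $ fst x $ snd x else 0)"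

lemma sym_vec_nth: "sym_vec f R M $ (i, k) = (if (i, k) \<in> upper f R then (if i = k then 1 else sqrt 2) * M $ i $ k else 0)"
  by (simp add: sym_vec_def)

lemma keep_sym_vec: "keep (upper f R) (sym_vec f R M) = sym_vec f R M"
  by (auto simp: vec_eq_iff sym_vec_nth)

lemma sym_vec_diff: "sym_vec f R M - sym_vec f R N = sym_vec f R (M - N)"
  by (auto simp: vec_eq_iff sym_vec_nth algebra_simps)

lemma norm_sym_vec:
  fixes M :: "real^'n^'n"
  assumes f: "inj f" and sym: "transpose M = M"
  shows "(norm (sym_vec f R M))\<^sup>2 = (\<Sum>i\<in>R. \<Sum>k\<in>R. (M $ i $ k)\<^sup>2)"
proof -
  let ?U = "upper f R" and ?L = "{(i, k) \<in> R \<times> R. f k < f i}" and ?U' = "{(i, k) \<in> R \<times> R. f i < f k}"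
  let ?D = "(\<lambda>i. (i, i)) ` R"
  have sy: "M $ i $ k = M $ k $ i" for i k
    using arg_cong[OF sym, of "\<lambda>N. N $ i $ k"] by (simp add: transpose_def)
  have U: "?U = ?D \<union> ?U'" and dj: "?D \<inter> ?U' = {}"
    using f by (auto simp: upper_def inj_def le_less)
  have RR: "R \<times> R = ?U \<union> ?L" "?U \<inter> ?L = {}" by (auto simp: upper_def)
  have "(norm (sym_vec f R M))\<^sup>2 = (\<Sum>x\<in>?U. (sym_vec f R M $ x)\<^sup>2)"
    unfolding norm_power2_vec by (intro sum.mono_neutral_right) (auto simp: sym_vec_nth)
  also have "\<dots> = (\<Sum>x\<in>?D. (sym_vec f R M $ x)\<^sup>2) + (\<Sum>x\<in>?U'. (sym_vec f R M $ x)\<^sup>2)"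
    unfolding U using dj by (intro sum.union_disjoint) auto
  also have "(\<Sum>x\<in>?D. (sym_vec f R M $ x)\<^sup>2) = (\<Sum>x\<in>?D. (M $ fst x $ snd x)\<^sup>2)"
    by (intro sum.cong) (auto simp: sym_vec_nth upper_def)
  also have "(\<Sum>x\<in>?U'. (sym_vec f R M $ x)\<^sup>2) = (\<Sum>x\<in>?U'. (M $ fst x $ snd x)\<^sup>2) + (\<Sum>x\<in>?U'. (M $ fst x $ snd x)\<^sup>2)"
    unfolding sum.distrib[symmetric] by (intro sum.cong) (auto simp: sym_vec_nth upper_def power_mult_distrib)
  also have "(\<Sum>x\<in>?D. (M $ fst x $ snd x)\<^sup>2) + \<dots> = (\<Sum>x\<in>?U. (M $ fst x $ snd x)\<^sup>2) + (\<Sum>x\<in>?U'. (M $ fst x $ snd x)\<^sup>2)"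
    unfolding U using dj by (subst sum.union_disjoint) auto
  also have "(\<Sum>x\<in>?U'. (M $ fst x $ snd x)\<^sup>2) = (\<Sum>x\<in>?L. (M $ fst x $ snd x)\<^sup>2)"
    by (rule sum.reindex_bij_witness[of _ prod.swap prod.swap]) (auto simp: sy)
  also have "(\<Sum>x\<in>?U. (M $ fst x $ snd x)\<^sup>2) + (\<Sum>x\<in>?L. (M $ fst x $ snd x)\<^sup>2) = (\<Sum>x\<in>?U \<union> ?L. (M $ fst x $ snd x)\<^sup>2)"
    using RR(2) by (intro sum.union_disjoint[symmetric]) auto
  also have "?U \<union> ?L = R \<times> R" by (rule RR(1)[symmetric])
  also have "(\<Sum>x\<in>R \<times> R. (M $ fst x $ snd x)\<^sup>2) = (\<Sum>i\<in>R. \<Sum>k\<in>R. (M $ i $ k)\<^sup>2)"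
    by (simp add: sum.cartesian_product case_prod_unfold)
  finally show ?thesis .
qed

lemma card_upper:
  fixes R :: "'n::finite set"
  assumes f: "inj f"
  shows "card (upper f R) = card R * (card R + 1) div 2"
proof -
  let ?U = "upper f R"
  have "card (prod.swap ` ?U) = card ?U" by (intro card_image) (auto simp: inj_on_def)
  moreover have "?U \<union> prod.swap ` ?U = R \<times> R" "?U \<inter> prod.swap ` ?U = (\<lambda>i. (i, i)) ` R"
    using f by (force simp: upper_def inj_def image_iff)+
  moreover have "card ((\<lambda>i. (i, i)) ` R) = card R" by (intro card_image) (auto simp: inj_on_def)
  ultimately have "card ?U + card ?U = card R * card R + card R"
    using card_Un_Int[of ?U "prod.swap ` ?U"] by (simp add: card_cartesian_product)
  then show ?thesis by simp
qed

lemma card_observed: "card (observed a) = d_dim a"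
  by (cases a) (auto simp: observed_def d_dim_def card_Diff_singleton)

text \<open>For each action the means and the covariances get nets of radius
  \<open>\<zeta> / 4\<close>, the origin of the 8 in \<open>cover\<close>. A combination of net
  points over all actions need not come from one model, so one model is chosen from every nonempty
  cell; two models of a cell differ by less than \<open>\<zeta> / 2\<close> in mean and in
  covariance. The representatives must be models for the supermartingale bound to apply to
  them.\<close>

lemma (in valid_params) model_net:
  assumes z: "\<zeta> > 0"
  obtains T where "finite T" "T \<subseteq> Theta P" "real (card T) \<le> cover P \<zeta>"
    "\<And>\<theta>. \<theta> \<in> Theta P \<Longrightarrow> \<exists>\<theta>'\<in>T. \<forall>a\<in>actions P. model_dist a \<theta> \<theta>' \<le> \<zeta>"
proof -
  obtain f :: "'n \<Rightarrow> nat" where f: "inj f"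
    using finite_imp_inj_to_nat_seg[of "UNIV :: 'n set"] by auto
  let ?sv = "\<lambda>a \<theta>. sym_vec f (observed a) (cov \<theta> a)"
  have "\<exists>N N'. finite N \<and> finite N' \<and> real (card N) \<le> (1 + 8 * B_mu P / \<zeta>) ^ d_dim a \<and>
      real (card N') \<le> (1 + 8 * sqrt (real (d_dim a)) * v_hi P / \<zeta>) ^ s_dim a \<and>
      (\<forall>\<theta>\<in>Theta P. (\<exists>c\<in>N. norm (mean \<theta> a - c) < \<zeta> / 4) \<and> (\<exists>c\<in>N'. norm (?sv a \<theta> - c) < \<zeta> / 4))"
    if a: "a \<in> actions P" for a
  proof -
    have 1: "keep (observed a) (mean \<theta> a) = mean \<theta> a \<and> norm (mean \<theta> a) \<le> B_mu P" if "\<theta> \<in> Theta P" for \<theta>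
    proof -
      interpret valid_model P \<theta> using that by unfold_locales
      show ?thesis using keep_mean norm_mean[OF a] by simp
    qed
    have "\<exists>N. finite N \<and> real (card N) \<le> (1 + 2 * B_mu P / (\<zeta> / 4)) ^ card (observed a) \<and>
      (\<forall>x\<in>(\<lambda>\<theta>. mean \<theta> a) ` Theta P. \<exists>c\<in>N. norm (x - c) < \<zeta> / 4)"
      using 1 z by (intro finite_net) (auto simp: less_imp_le)
    then obtain N where N: "finite N" "real (card N) \<le> (1 + 2 * B_mu P / (\<zeta> / 4)) ^ card (observed a)"
      "\<forall>\<theta>\<in>Theta P. \<exists>c\<in>N. norm (mean \<theta> a - c) < \<zeta> / 4"
      by blast
    have 2: "norm (?sv a \<theta>) \<le> sqrt (real (d_dim a)) * v_hi P" if "\<theta> \<in> Theta P" for \<theta>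
    proof -
      interpret valid_model P \<theta> using that by unfold_locales
      have "(norm (?sv a \<theta>))\<^sup>2 = (\<Sum>i\<in>observed a. \<Sum>k\<in>observed a. (cov \<theta> a $ i $ k)\<^sup>2)"
        by (intro norm_sym_vec f) (simp add: cov_eq matrix_transpose_mul)
      also have "\<dots> \<le> (\<Sum>i\<in>observed a. (v_hi P)\<^sup>2)"
      proof (rule sum_mono)
        fix i assume "i \<in> observed a"
        have "(\<Sum>k\<in>observed a. (cov \<theta> a $ i $ k)\<^sup>2) \<le> (norm (cov \<theta> a $ i))\<^sup>2"
          unfolding norm_power2_vec by (intro sum_mono2) auto
        also have "\<dots> \<le> (v_hi P)\<^sup>2"
          by (intro power_mono norm_cov_row \<open>i \<in> observed a\<close>) simp
        finally show "(\<Sum>k\<in>observed a. (cov \<theta> a $ i $ k)\<^sup>2) \<le> (v_hi P)\<^sup>2" .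
      qed
      also have "\<dots> = (sqrt (real (d_dim a)) * v_hi P)\<^sup>2"
        by (simp add: card_observed power_mult_distrib)
      finally show ?thesis by (rule power2_le_imp_le) (simp add: less_imp_le)
    qed
    have "\<exists>N'. finite N' \<and> real (card N') \<le> (1 + 2 * (sqrt (real (d_dim a)) * v_hi P) / (\<zeta> / 4)) ^ card (upper f (observed a)) \<and>
      (\<forall>x\<in>?sv a ` Theta P. \<exists>c\<in>N'. norm (x - c) < \<zeta> / 4)"
    proof (rule finite_net)
      show "sqrt (real (d_dim a)) * v_hi P \<ge> 0" by (simp add: less_imp_le)
    qed (use 2 z keep_sym_vec in auto)
    then obtain N' where N': "finite N'" "real (card N') \<le> (1 + 2 * (sqrt (real (d_dim a)) * v_hi P) / (\<zeta> / 4)) ^ card (upper f (observed a))"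
      "\<forall>\<theta>\<in>Theta P. \<exists>c\<in>N'. norm (?sv a \<theta> - c) < \<zeta> / 4"
      by blast
    have "1 + 2 * B_mu P / (\<zeta> / 4) = 1 + 8 * B_mu P / \<zeta>"
      "1 + 2 * (sqrt (real (d_dim a)) * v_hi P) / (\<zeta> / 4) = 1 + 8 * sqrt (real (d_dim a)) * v_hi P / \<zeta>"
      by simp_all
    then have "real (card N) \<le> (1 + 8 * B_mu P / \<zeta>) ^ d_dim a"
      "real (card N') \<le> (1 + 8 * sqrt (real (d_dim a)) * v_hi P / \<zeta>) ^ s_dim a"
      using N(2) N'(2) by (simp_all add: card_observed card_upper[OF f] s_dim_def mult.assoc)
    with N(1,3) N'(1,3) show ?thesis by blast
  qed
  then have "\<forall>a\<in>actions P. \<exists>N N'. finite N \<and> finite N' \<and> real (card N) \<le> (1 + 8 * B_mu P / \<zeta>) ^ d_dim a \<and>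
      real (card N') \<le> (1 + 8 * sqrt (real (d_dim a)) * v_hi P / \<zeta>) ^ s_dim a \<and>
      (\<forall>\<theta>\<in>Theta P. (\<exists>c\<in>N. norm (mean \<theta> a - c) < \<zeta> / 4) \<and> (\<exists>c\<in>N'. norm (?sv a \<theta> - c) < \<zeta> / 4))"
    by blast
  then obtain N N' where N: "\<And>a. a \<in> actions P \<Longrightarrow> finite (N a) \<and> finite (N' a) \<and> real (card (N a)) \<le> (1 + 8 * B_mu P / \<zeta>) ^ d_dim a \<and>
      real (card (N' a)) \<le> (1 + 8 * sqrt (real (d_dim a)) * v_hi P / \<zeta>) ^ s_dim a \<and>
      (\<forall>\<theta>\<in>Theta P. (\<exists>c\<in>N a. norm (mean \<theta> a - c) < \<zeta> / 4) \<and> (\<exists>c\<in>N' a. norm (?sv a \<theta> - c) < \<zeta> / 4))"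
    unfolding bchoice_iff by blast
  define near where "near \<theta> a p \<longleftrightarrow> p \<in> N a \<times> N' a \<and> norm (mean \<theta> a - fst p) < \<zeta> / 4 \<and> norm (?sv a \<theta> - snd p) < \<zeta> / 4" for \<theta> a p
  define cell where "cell \<theta> = (\<lambda>a\<in>actions P. SOME p. near \<theta> a p)" for \<theta>
  have cell: "near \<theta> a (cell \<theta> a)" if m: "\<theta> \<in> Theta P" and a: "a \<in> actions P" for \<theta> a
  proof -
    obtain c c' where "c \<in> N a" "c' \<in> N' a" "norm (mean \<theta> a - c) < \<zeta> / 4" "norm (?sv a \<theta> - c') < \<zeta> / 4"
      using N[OF a] m by blast
    then have "near \<theta> a (c, c')" by (simp add: near_def)
    then show ?thesis unfolding cell_def using a by (simp add: someI[of "near \<theta> a"])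
  qed
  let ?C = "cell ` Theta P" and ?E = "Pi\<^sub>E (actions P) (\<lambda>a. N a \<times> N' a)"
  have sub: "?C \<subseteq> ?E"
  proof
    fix g assume "g \<in> ?C"
    then obtain \<theta> where \<theta>: "\<theta> \<in> Theta P" "g = cell \<theta>" by blast
    show "g \<in> ?E"
    proof (rule PiE_I)
      show "g a \<in> N a \<times> N' a" if "a \<in> actions P" for a
        using cell[OF \<theta>(1) that] \<theta>(2) by (simp only: near_def)
      show "g a = undefined" if "a \<notin> actions P" for a
        using that \<theta>(2) by (simp add: cell_def)
    qed
  qed
  have finE: "finite ?E" using N by (intro finite_PiE) auto
  then have finC: "finite ?C" by (rule finite_subset[OF sub])
  define T where "T = inv_into (Theta P) cell ` ?C"
  have dist: "model_dist a \<theta> \<theta>' \<le> \<zeta>" if m: "\<theta> \<in> Theta P" "\<theta>' \<in> Theta P" "cell \<theta> = cell \<theta>'" and a: "a \<in> actions P" for \<theta> \<theta>' a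
  proof -
    interpret two_models P \<theta> \<theta>' using m by unfold_locales
    obtain c c' where c: "cell \<theta> a = (c, c')" by fastforce
    then have n: "norm (mean \<theta> a - c) < \<zeta> / 4" "norm (mean \<theta>' a - c) < \<zeta> / 4"
      "norm (?sv a \<theta> - c') < \<zeta> / 4" "norm (?sv a \<theta>' - c') < \<zeta> / 4"
      using cell[OF m(1) a] cell[OF m(2) a] m(3) by (auto simp: near_def)
    have "norm (?sv a \<theta> - ?sv a \<theta>') = norm (cov \<theta> a - cov \<theta>' a)"
    proof -
      let ?D = "cov \<theta> a - cov \<theta>' a"
      have "transpose ?D = ?D"
      proof -
        have "transpose (cov \<theta> a) = cov \<theta> a" "transpose (cov \<theta>' a) = cov \<theta>' a"
          by (simp_all add: cov_eq V.cov_eq matrix_transpose_mul)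
        then show ?thesis by (simp add: vec_eq_iff transpose_def)
      qed
      then have "(norm (sym_vec f (observed a) ?D))\<^sup>2 = (\<Sum>i\<in>observed a. \<Sum>k\<in>observed a. (?D $ i $ k)\<^sup>2)"
        by (rule norm_sym_vec[OF f])
      also have "\<dots> = (\<Sum>i\<in>UNIV. \<Sum>k\<in>UNIV. (?D $ i $ k)\<^sup>2)"
        using cov_diff_supp[of _ a] by (intro sum.mono_neutral_cong_left) (auto intro!: sum.mono_neutral_left simp del: vector_minus_component)
      also have "\<dots> = (norm ?D)\<^sup>2"
        by (simp add: norm_vec_def[of ?D] L2_set_def sum_nonneg norm_power2_vec[symmetric] del: vector_minus_component)
      finally show ?thesis unfolding sym_vec_diff by (simp add: power2_eq_iff_nonneg)
    qed
    then show ?thesis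
      using norm_triangle_ineq4[of "mean \<theta> a - c" "mean \<theta>' a - c"] norm_triangle_ineq4[of "?sv a \<theta> - c'" "?sv a \<theta>' - c'"] n
      by (simp add: model_dist_def)
  qed
  show ?thesis
  proof (rule that[of T])
    show "finite T" using finC by (simp add: T_def)
    show "T \<subseteq> Theta P" unfolding T_def using inv_into_into[of _ cell "Theta P"] by blast
    have "card T \<le> card ?C" unfolding T_def by (rule card_image_le[OF finC])
    also have "\<dots> \<le> card ?E" by (rule card_mono[OF finE sub])
    finally have "real (card T) \<le> real (\<Prod>a\<in>actions P. card (N a) * card (N' a))"
      by (simp add: card_PiE card_cartesian_product del: of_nat_prod)
    also have "\<dots> \<le> cover P \<zeta>"
      unfolding cover_def of_nat_prod of_nat_mult
    proof (intro prod_mono conjI mult_mono)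
      show "0 \<le> (1 + 8 * B_mu P / \<zeta>) ^ d_dim a" for a :: "'n action"
        using z B_mu_pos by (intro zero_le_power) (simp add: less_imp_le add_nonneg_nonneg)
    qed (use N in auto)
    finally show "real (card T) \<le> cover P \<zeta>" .
    fix \<theta> assume \<theta>: "\<theta> \<in> Theta P"
    let ?\<theta>' = "inv_into (Theta P) cell (cell \<theta>)"
    have "cell \<theta> \<in> ?C" using \<theta> by (rule imageI)
    then have "?\<theta>' \<in> Theta P" "cell ?\<theta>' = cell \<theta>"
      by (rule inv_into_into, rule f_inv_into_f)
    moreover have "?\<theta>' \<in> T" using \<theta> by (simp add: T_def)
    ultimately show "\<exists>\<theta>'\<in>T. \<forall>a\<in>actions P. model_dist a \<theta> \<theta>' \<le> \<zeta>"
      using dist[OF \<theta>] by (intro bexI[of _ ?\<theta>']) auto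
  qed
qed

section \<open>Identifiability from the interventional means\<close>

lemma norm_matrix_mult_le: "norm (A ** B) \<le> norm A * norm B" for A B :: "real^'n^'n"
proof -
  have row: "(A ** B) $ i = transpose B *v (A $ i)" for i
    by (simp add: vec_eq_iff matrix_matrix_mult_def matrix_vector_mult_def transpose_def mult.commute del: transpose_matrix_vector)
  have "norm (A ** B) \<le> L2_set (\<lambda>i. norm B * norm (A $ i)) UNIV"
    unfolding norm_vec_def[of "A ** B"] row
    by (intro L2_set_mono) (use norm_matrix_vector_mult_le[of "transpose B"] in \<open>simp_all add: norm_transpose del: transpose_matrix_vector\<close>)
  also have "\<dots> = norm B * norm A"
    by (simp add: L2_set_right_distrib norm_vec_def)
  finally show ?thesis by (simp add: mult.commute)
qed

text \<open>Column \<open>j\<close> is the mean response to setting node \<open>j\<close> to 1.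
  Acyclicity makes the whole matrix the inverse of \<open>mat 1 - coef \<theta>\<close>, so the
  interventional means determine the coefficients.\<close>

definition total_effect :: "'n::finite model \<Rightarrow> real^'n^'n" where
  "total_effect \<theta> = (\<chi> k j. if k = j then 1 else (resolvent \<theta> (Do j 1) *v (\<chi> l. if l \<noteq> j then coef \<theta> $ l $ j else 0)) $ k)"

context valid_model
begin

lemma mean_Do: "mean \<theta> (Do j u) $ k = (if k = j then 0 else u * total_effect \<theta> $ k $ j)"
proof (cases "k = j")
  case True
  then show ?thesis by (simp add: mean_supp observed_def)
next
  case False
  have "(\<chi> l. if l \<in> observed (Do j u) then coef \<theta> $ l $ j * u else 0) = u *\<^sub>R (\<chi> l. if l \<noteq> j then coef \<theta> $ l $ j else 0)"
    by (auto simp: vec_eq_iff observed_def)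
  then show ?thesis
    using False by (simp add: mean_def total_effect_def resolvent_def observed_def matrix_vector_mult_scaleR)
qed

lemma coef_diag: "coef \<theta> $ j $ j = 0"
proof -
  have "(j, j) \<notin> dag \<theta>"
    using acyc r_into_trancl[of j j "dag \<theta>"] unfolding acyclic_def by blast
  then show ?thesis using edge_iff[of j j] by simp
qed

text \<open>Column \<open>j\<close> satisfies the structural equations of all other nodes; the
  equation of \<open>j\<close> itself, deleted by the intervention, also holds because no parent of
  \<open>j\<close> reacts to \<open>j\<close>.\<close>

lemma one_minus_coef_total_effect: "(mat 1 - coef \<theta>) ** total_effect \<theta> = mat 1"
proof -
  obtain f :: "'n \<Rightarrow> nat" where f: "\<And>j k. (k, j) \<in> dag \<theta> \<Longrightarrow> f k < f j" "\<And>j. f j < CARD('n)"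
    using acyclic_rank[OF acyc] by blast
  let ?E = "total_effect \<theta>"
  have E: "?E $ k $ j = coef \<theta> $ k $ j + (\<Sum>l\<in>UNIV - {j}. coef \<theta> $ k $ l * ?E $ l $ j)" if "k \<noteq> j" for k j
  proof -
    let ?w = "\<chi> l. if l \<noteq> j then coef \<theta> $ l $ j else 0"
    let ?m = "resolvent \<theta> (Do j 1) *v ?w"
    have obs: "observed (Do j 1) = UNIV - {j}" by (simp add: observed_def)
    have "(mat 1 - coef_on (UNIV - {j}) \<theta>) *v ?m = ?w"
      using resolvent_inverse(1)[of "Do j 1"] by (simp add: matrix_vector_mul_assoc blk_one_minus obs)
    then have "?m = ?w + coef_on (UNIV - {j}) \<theta> *v ?m"
      by (simp add: matrix_vector_mult_diff_rdistrib algebra_simps)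
    from arg_cong[OF this, of "\<lambda>v. v $ k"] have "?m $ k = coef \<theta> $ k $ j + (\<Sum>l\<in>UNIV. coef_on (UNIV - {j}) \<theta> $ k $ l * ?m $ l)"
      using that by (simp add: matrix_vector_mult_def)
    also have "(\<Sum>l\<in>UNIV. coef_on (UNIV - {j}) \<theta> $ k $ l * ?m $ l) = (\<Sum>l\<in>UNIV - {j}. coef \<theta> $ k $ l * ?E $ l $ j)"
      using that by (intro sum.mono_neutral_cong_right) (auto simp: coef_on_def total_effect_def)
    finally show ?thesis using that by (simp add: total_effect_def)
  qed
  \<comment> \<open>A node of no higher rank is not a descendant of \<open>j\<close>; induction
    along the rank propagates the zero.\<close>
  have zero: "?E $ l $ j = 0" if "f l \<le> f j" "l \<noteq> j" for l j
    using that
  proof (induction "f l" arbitrary: l rule: less_induct)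
    case less
    have "coef \<theta> $ l $ j = 0" using f(1)[of j l] edge_iff[of l j] less.prems(1) by force
    moreover have "coef \<theta> $ l $ i * ?E $ i $ j = 0" if "i \<in> UNIV - {j}" for i
    proof (cases "coef \<theta> $ l $ i = 0")
      case False
      then have "f i < f l" by (intro f(1) edge_iff[THEN iffD1])
      then have "?E $ i $ j = 0" using less that by simp
      then show ?thesis by simp
    qed simp
    ultimately show ?case
      unfolding E[OF less.prems(2)] by (simp add: sum.neutral del: mult_eq_0_iff)
  qed
  have "((mat 1 - coef \<theta>) ** ?E) $ k $ j = mat 1 $ k $ j" for k j
  proof -
    have "((mat 1 - coef \<theta>) ** ?E) $ k $ j = (\<Sum>l\<in>UNIV. (if k = l then ?E $ l $ j else 0) - coef \<theta> $ k $ l * ?E $ l $ j)"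
      unfolding matrix_matrix_mult_def vec_lambda_beta by (intro sum.cong) (auto simp: mat_def left_diff_distrib)
    also have "\<dots> = ?E $ k $ j - (\<Sum>l\<in>UNIV. coef \<theta> $ k $ l * ?E $ l $ j)"
      by (simp add: sum_subtractf)
    also have "(\<Sum>l\<in>UNIV. coef \<theta> $ k $ l * ?E $ l $ j) = coef \<theta> $ k $ j + (\<Sum>l\<in>UNIV - {j}. coef \<theta> $ k $ l * ?E $ l $ j)"
      by (subst sum.remove[of _ j]) (auto simp: total_effect_def)
    also have "?E $ k $ j - \<dots> = mat 1 $ k $ j"
    proof (cases "k = j")
      case True
      have "coef \<theta> $ j $ l * ?E $ l $ j = 0" if "l \<in> UNIV - {j}" for l
      proof (cases "coef \<theta> $ j $ l = 0")
        case False
        then have "f l < f j" by (intro f(1) edge_iff[THEN iffD1])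
        then show ?thesis using zero[of l j] that by simp
      qed simp
      then have "(\<Sum>l\<in>UNIV - {j}. coef \<theta> $ j $ l * ?E $ l $ j) = 0" by (intro sum.neutral) blast
      then show ?thesis using True by (simp add: coef_diag total_effect_def mat_def)
    next
      case False
      then show ?thesis using E[OF False] by (simp add: mat_def)
    qed
    finally show ?thesis .
  qed
  then show ?thesis by (simp add: vec_eq_iff)
qed

lemma total_effect_one_minus_coef: "total_effect \<theta> ** (mat 1 - coef \<theta>) = mat 1"
  using one_minus_coef_total_effect matrix_left_right_inverse by blast

lemma norm_one_minus_coef: "norm (mat 1 - coef \<theta>) \<le> real CARD('n) * (1 + A_max P)"
proof -
  have "norm ((mat 1 - coef \<theta>) $ i) \<le> sqrt (real CARD('n)) * (1 + A_max P)" for i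
  proof (rule norm_vec_le_card)
    fix k show "norm ((mat 1 - coef \<theta>) $ i $ k) \<le> 1 + A_max P"
      using coef_le[of i k] less_imp_le[OF pos(2)] by (auto simp: mat_def coef_diag)
  qed
  then have "norm (mat 1 - coef \<theta>) \<le> sqrt (real CARD('n)) * (sqrt (real CARD('n)) * (1 + A_max P))"
    by (rule norm_vec_le_card)
  then show ?thesis by (simp add: mult.assoc[symmetric])
qed

end

context two_models
begin

lemma KL_ge_mean_diff: "KL a \<theta> \<nu> \<ge> (norm (mean \<theta> a - mean \<nu> a))\<^sup>2 / (2 * v_hi P)"
proof -
  let ?m = "mean \<theta> a - mean \<nu> a"
  have "keep (observed a) ?m = ?m" by (auto simp: vec_eq_iff mean_supp V.mean_supp)
  then have "(norm ?m)\<^sup>2 \<le> (sqrt (v_hi P) * norm (whiten \<nu> a *v ?m))\<^sup>2"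
    by (intro power_mono V.norm_le_whiten) auto
  then have "(norm ?m)\<^sup>2 / (2 * v_hi P) \<le> (norm (whiten \<nu> a *v ?m))\<^sup>2 / 2"
    by (simp add: power_mult_distrib less_imp_le field_simps)
  moreover have "x / 2 \<le> (t - n + x) / 2 + l1 - l2" if "0 \<le> (t - n) / 2 + l1 - l2" for x t n l1 l2 :: real
    using that by argo
  ultimately show ?thesis
    unfolding KL_eq using KL_centred_nonneg[of a] order_trans by blast
qed

text \<open>Graphs that differ in an edge have there one zero coefficient and one of modulus at
  least \<open>beta_min P\<close>, so both kinds of alternative move some coefficient by
  \<open>\<epsilon>\<close>.\<close>

lemma Alt_coef_diff:
  assumes alt: "\<nu> \<in> Alt P \<epsilon> \<theta>" and eps: "\<epsilon> \<le> beta_min P"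
  obtains j k where "\<bar>(coef \<nu> - coef \<theta>) $ j $ k\<bar> \<ge> \<epsilon>"
proof -
  from alt consider "dag \<nu> \<noteq> dag \<theta>" | "max_norm (coef \<nu> - coef \<theta>) \<ge> \<epsilon>" by (auto simp: Alt_def)
  then show ?thesis
  proof cases
    case 1
    then obtain k j where "(k, j) \<in> dag \<nu> \<longleftrightarrow> (k, j) \<notin> dag \<theta>" by auto
    then have "\<bar>(coef \<nu> - coef \<theta>) $ j $ k\<bar> \<ge> beta_min P"
      using edge_iff[of j k] V.edge_iff[of j k] coef_ge[of j k] V.coef_ge[of j k] by auto
    with eps show ?thesis by (intro that[of j k]) simp
  next
    case 2
    let ?S = "(\<lambda>(j, k). \<bar>(coef \<nu> - coef \<theta>) $ j $ k\<bar>) ` (UNIV :: ('n \<times> 'n) set)"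
    have "Max ?S \<in> ?S" by (intro Max_in) auto
    then obtain x where "Max ?S = (\<lambda>(j, k). \<bar>(coef \<nu> - coef \<theta>) $ j $ k\<bar>) x" by (rule imageE)
    then have "Max ?S = \<bar>(coef \<nu> - coef \<theta>) $ fst x $ snd x\<bar>" by (simp only: case_prod_beta)
    with 2 show ?thesis by (intro that[of "fst x" "snd x"]) (simp only: max_norm_def)
  qed
qed

text \<open>Sandwiched between the two matrices \<open>mat 1 - coef\<close>, the difference of the
  effects becomes the difference of the coefficients. As an alternative moves a coefficient by
  \<open>\<epsilon>\<close>, it cannot leave the effects nearly unchanged.\<close>

lemma total_effect_diff:
  assumes alt: "\<nu> \<in> Alt P \<epsilon> \<theta>" and eps: "0 < \<epsilon>" "\<epsilon> \<le> beta_min P"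
  obtains j k where "j \<noteq> k" "\<bar>(total_effect \<theta> - total_effect \<nu>) $ k $ j\<bar> \<ge> \<epsilon> / (2 * real CARD('n) ^ 3 * (1 + A_max P)\<^sup>2)"
proof -
  let ?I = "mat 1 :: real^'n^'n" and ?n = "real CARD('n)"
  let ?D = "total_effect \<theta> - total_effect \<nu>" and ?c = "?n * (1 + A_max P)"
  have c: "?c > 0" by (simp add: add_pos_pos)
  obtain j0 k0 where "\<bar>(coef \<nu> - coef \<theta>) $ j0 $ k0\<bar> \<ge> \<epsilon>"
    using Alt_coef_diff[OF alt eps(2)] by blast
  then have e: "\<epsilon> \<le> norm (coef \<nu> - coef \<theta>)"
    using component_le_norm_cart[of "(coef \<nu> - coef \<theta>) $ j0" k0] Finite_Cartesian_Product.norm_nth_le[of "coef \<nu> - coef \<theta>" j0]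
    by linarith
  have "(?I - coef \<theta>) ** ?D ** (?I - coef \<nu>) = ((?I - coef \<theta>) ** total_effect \<theta>) ** (?I - coef \<nu>)
      - (?I - coef \<theta>) ** (total_effect \<nu> ** (?I - coef \<nu>))"
  proof -
    have "M ** (X - Y) ** N = (M ** X) ** N - M ** (Y ** N)" for M N X Y :: "real^'n^'n"
      by (simp only: matrix_mult_diff matrix_mul_assoc)
    then show ?thesis .
  qed
  also have "\<dots> = coef \<theta> - coef \<nu>"
    by (simp add: one_minus_coef_total_effect V.total_effect_one_minus_coef)
  finally have "norm (coef \<nu> - coef \<theta>) = norm ((?I - coef \<theta>) ** ?D ** (?I - coef \<nu>))"
    by (simp add: norm_minus_commute)
  also have "\<dots> \<le> norm ((?I - coef \<theta>) ** ?D) * norm (?I - coef \<nu>)" by (rule norm_matrix_mult_le)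
  also have "\<dots> \<le> (norm (?I - coef \<theta>) * norm ?D) * norm (?I - coef \<nu>)"
    by (intro mult_right_mono norm_matrix_mult_le) simp
  also have "\<dots> \<le> (?c * norm ?D) * ?c"
    using c by (intro mult_mono norm_one_minus_coef V.norm_one_minus_coef) auto
  finally have eD: "\<epsilon> \<le> ?c\<^sup>2 * norm ?D" using e by (simp add: power2_eq_square mult_ac)
  \<comment> \<open>Two factors \<open>?n * (1 + A_max P)\<close> come from the sandwich and one
    \<open>?n\<close> from passing to a single entry; the 2 makes the contradiction strict.\<close>
  let ?h = "\<epsilon> / (2 * ?n ^ 3 * (1 + A_max P)\<^sup>2)"
  have "\<exists>k j. \<bar>?D $ k $ j\<bar> > ?h"
  proof (rule ccontr)
    assume "\<not> ?thesis"
    then have "norm (?D $ k) \<le> sqrt ?n * ?h" for k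
      by (intro norm_vec_le_card) (auto simp: not_less)
    then have "norm ?D \<le> sqrt ?n * (sqrt ?n * ?h)" by (rule norm_vec_le_card)
    then have "norm ?D \<le> ?n * ?h" by (simp add: mult.assoc[symmetric])
    then have "?c\<^sup>2 * norm ?D \<le> ?c\<^sup>2 * (?n * ?h)" using c by (intro mult_left_mono) auto
    also have "\<dots> = \<epsilon> / 2"
    proof -
      have "(n * A)\<^sup>2 * (n * (e / (2 * n ^ 3 * A\<^sup>2))) = e / 2" if "n > 0" "A > 0" for n A e :: real
        using that by (simp add: power2_eq_square power3_eq_cube)
      then show ?thesis by (simp add: add_pos_pos)
    qed
    finally show False using eD eps by simp
  qed
  then obtain k j where kj: "\<bar>?D $ k $ j\<bar> > ?h" by blast
  moreover have "j \<noteq> k"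
  proof
    assume "j = k"
    then have "?D $ k $ j = 0" by (simp add: total_effect_def)
    moreover have "?h > 0"
      using eps by (intro divide_pos_pos mult_pos_pos zero_less_power) (auto simp: add_pos_pos)
    ultimately show False using kj by simp
  qed
  ultimately show ?thesis by (intro that[of j k]) auto
qed

end

text \<open>At least one of the two values available for a node is nonzero because they are distinct.\<close>

definition separation :: "'n::finite pars \<Rightarrow> real \<Rightarrow> real" where
  "separation P \<epsilon> = ((MIN j. max \<bar>U_lo P j\<bar> \<bar>U_hi P j\<bar>) * (\<epsilon> / (2 * real CARD('n) ^ 3 * (1 + A_max P)\<^sup>2)))\<^sup>2 / (2 * v_hi P)"

lemma (in valid_params) separation_pos:
  assumes "\<epsilon> > 0"
  shows "separation P \<epsilon> > 0"
proof -
  have lt: "U_lo P j < U_hi P j" for j using valid by (simp add: valid_pars_def)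
  have "\<bar>U_lo P j\<bar> > 0 \<or> \<bar>U_hi P j\<bar> > 0" for j
    using lt[of j] by linarith
  then have "max \<bar>U_lo P j\<bar> \<bar>U_hi P j\<bar> > 0" for j by (simp only: less_max_iff_disj)
  then have "(MIN j. max \<bar>U_lo P j\<bar> \<bar>U_hi P j\<bar>) > 0" by (subst Min_gr_iff) auto
  moreover have "1 + A_max P > 0" by (simp add: add_pos_pos)
  ultimately show ?thesis
    unfolding separation_def using assms by (intro divide_pos_pos zero_less_power mult_pos_pos) auto
qed

text \<open>The node with a changed effect is set to the larger of its two values in modulus. The
  bound is the same for all models and alternatives, so every full round of exploration raises the
  statistic by a fixed amount.\<close>

lemma (in two_models) sum_KL_ge_separation:
  assumes alt: "\<nu> \<in> Alt P \<epsilon> \<theta>" and eps: "0 < \<epsilon>" "\<epsilon> \<le> beta_min P"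
  shows "\<exists>a\<in>actions P. separation P \<epsilon> \<le> KL a \<theta> \<nu>"
proof -
  let ?h = "\<epsilon> / (2 * real CARD('n) ^ 3 * (1 + A_max P)\<^sup>2)"
  obtain j k where jk: "j \<noteq> k" "\<bar>(total_effect \<theta> - total_effect \<nu>) $ k $ j\<bar> \<ge> ?h"
    using total_effect_diff[OF alt eps] by blast
  obtain u where u: "u = U_lo P j \<or> u = U_hi P j" "\<bar>u\<bar> = max \<bar>U_lo P j\<bar> \<bar>U_hi P j\<bar>"
    by (cases "\<bar>U_lo P j\<bar> \<le> \<bar>U_hi P j\<bar>") (auto simp: max_def)
  let ?M = "MIN j. max \<bar>U_lo P j\<bar> \<bar>U_hi P j\<bar>"
  have M: "?M \<le> \<bar>u\<bar>" unfolding u(2) by (intro Min_le) auto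
  have h: "?h \<ge> 0" using eps by simp
  have "?M \<ge> 0" by (subst Min_ge_iff) (auto simp: le_max_iff_disj)
  let ?a = "Do j u"
  have "(mean \<theta> ?a - mean \<nu> ?a) $ k = u * (total_effect \<theta> - total_effect \<nu>) $ k $ j"
    using jk(1) by (simp add: mean_Do V.mean_Do right_diff_distrib)
  then have "\<bar>u\<bar> * \<bar>(total_effect \<theta> - total_effect \<nu>) $ k $ j\<bar> \<le> norm (mean \<theta> ?a - mean \<nu> ?a)"
    using component_le_norm_cart[of "mean \<theta> ?a - mean \<nu> ?a" k] by (simp only: abs_mult)
  moreover have "?M * ?h \<le> \<bar>u\<bar> * \<bar>(total_effect \<theta> - total_effect \<nu>) $ k $ j\<bar>"
    using M jk(2) h \<open>?M \<ge> 0\<close> by (intro mult_mono) auto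
  ultimately have "?M * ?h \<le> norm (mean \<theta> ?a - mean \<nu> ?a)" by linarith
  then have "(?M * ?h)\<^sup>2 \<le> (norm (mean \<theta> ?a - mean \<nu> ?a))\<^sup>2"
    by (rule power_mono) (rule mult_nonneg_nonneg[OF \<open>?M \<ge> 0\<close> h])
  then have "separation P \<epsilon> \<le> (norm (mean \<theta> ?a - mean \<nu> ?a))\<^sup>2 / (2 * v_hi P)"
    unfolding separation_def by (intro divide_right_mono) (auto simp: less_imp_le)
  also have "\<dots> \<le> KL ?a \<theta> \<nu>" by (rule KL_ge_mean_diff)
  finally show ?thesis using u(1) by (intro bexI[of _ ?a]) (auto simp: actions_def)
qed

section \<open>The threshold function\<close>

context valid_model
begin

text \<open>\<open>H_fun\<close> depends on \<open>t\<close> and \<open>x\<close> only through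
  \<open>z_fun\<close>; with \<open>z\<close> as the variable, a single scaling bound serves both
  monotonicity in \<open>x\<close> and growth in \<open>t\<close>.\<close>

definition H_of :: "real \<Rightarrow> real" where
  "H_of z = L_ell P (R_fun P z) / 2 + kappa_B P * L_KL P"

lemma H_fun_eq: "H_fun P t x = H_of (z_fun P t x)"
  by (simp add: H_fun_def H_of_def)

lemma R_fun_pos: "z \<ge> 0 \<Longrightarrow> R_fun P z > 0"
  unfolding R_fun_def by (intro add_pos_nonneg mult_nonneg_nonneg) (auto simp: less_imp_le)

lemma L_ell_pos: "r \<ge> 0 \<Longrightarrow> L_ell P r > 0"
proof -
  assume "r \<ge> 0"
  then have "(r + B_mu P) / v_lo P > 0" by (intro divide_pos_pos) (auto intro: add_nonneg_pos)
  moreover have "0 \<le> (sqrt (real CARD('n)) / v_lo P + (r + B_mu P)\<^sup>2 / (v_lo P)\<^sup>2) / 2"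
    by (intro divide_nonneg_nonneg add_nonneg_nonneg) (auto simp: less_imp_le)
  ultimately show ?thesis unfolding L_ell_def by linarith
qed

lemma L_KL_pos: "L_KL P > 0"
  unfolding L_KL_def by (intro divide_pos_pos add_pos_nonneg mult_pos_pos) auto

lemma H_of_pos: "z \<ge> 0 \<Longrightarrow> H_of z > 0"
  unfolding H_of_def using L_ell_pos[of "R_fun P z"] R_fun_pos[of z] L_KL_pos kappa_B_pos
  by (intro add_pos_pos mult_pos_pos) (auto simp: less_imp_le)

text \<open>\<open>H_of\<close> is a polynomial of degree two in $\sqrt z$ with nonnegative coefficients.\<close>

lemma H_of_scale:
  assumes z: "0 < z" "z \<le> w"
  shows "H_of w \<le> w / z * H_of z"
proof -
  define s where "s = sqrt (w / z)"
  have s: "s \<ge> 1" "s\<^sup>2 = w / z" using z by (auto simp: s_def)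
  have s2: "s \<le> s\<^sup>2" "1 \<le> s\<^sup>2" using s(1) by (auto simp: self_le_power one_le_power)
  define p where "p = R_fun P z + B_mu P"
  define p' where "p' = R_fun P w + B_mu P"
  have pp: "p \<ge> 0" "p' \<ge> 0"
    using R_fun_pos[of z] R_fun_pos[of w] z by (auto simp: p_def p'_def less_imp_le add_nonneg_nonneg)
  have "p' \<le> s * p"
  proof -
    have "sqrt (2 * w) = s * sqrt (2 * z)"
      unfolding s_def real_sqrt_mult[symmetric] using z by simp
    moreover have "2 * B_mu P + sqrt (v_hi P) * sqrt (real CARD('n)) \<le> s * (2 * B_mu P + sqrt (v_hi P) * sqrt (real CARD('n)))"
      using s(1) mult_right_mono[of 1 s "2 * B_mu P + sqrt (v_hi P) * sqrt (real CARD('n))"]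
      by (simp add: less_imp_le add_nonneg_nonneg)
    ultimately show ?thesis
      unfolding p_def p'_def R_fun_def by (simp add: algebra_simps)
  qed
  then have p2: "p'\<^sup>2 \<le> s\<^sup>2 * p\<^sup>2" using pp power_mono[of p' "s * p" 2] by (simp add: power_mult_distrib)
  have p1: "p' \<le> s\<^sup>2 * p" using \<open>p' \<le> s * p\<close> mult_right_mono[OF s2(1) pp(1)] by linarith
  have c: "c \<le> s\<^sup>2 * c" if "c \<ge> 0" for c :: real using mult_right_mono[OF s2(2) that] by simp
  have a1: "p' / v_lo P \<le> s\<^sup>2 * (p / v_lo P)"
    using divide_right_mono[OF p1, of "v_lo P"] by (simp add: less_imp_le)
  have a2: "sqrt (real CARD('n)) / v_lo P \<le> s\<^sup>2 * (sqrt (real CARD('n)) / v_lo P)"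
    by (intro c) (simp add: less_imp_le)
  have a3: "p'\<^sup>2 / (v_lo P)\<^sup>2 \<le> s\<^sup>2 * (p\<^sup>2 / (v_lo P)\<^sup>2)"
    using divide_right_mono[OF p2, of "(v_lo P)\<^sup>2"] by simp
  have a4: "kappa_B P * L_KL P \<le> s\<^sup>2 * (kappa_B P * L_KL P)"
    using kappa_B_pos L_KL_pos by (intro c) simp
  have gen: "(A' + (C' + E') / 2) / 2 + D' \<le> k * ((A + (C + E) / 2) / 2 + D)"
    if "A' \<le> k * A" "C' \<le> k * C" "E' \<le> k * E" "D' \<le> k * D" for A' A C' C D' D E' E k :: real
    using that by (simp add: algebra_simps add_divide_distrib)
  show ?thesis
    using gen[OF a1 a2 a3 a4] unfolding H_of_def L_ell_def p_def p'_def s(2) .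
qed

lemma q_dim_pos: "q_dim P > 0"
proof -
  have "d_dim (Obs :: 'n action) + s_dim (Obs :: 'n action) \<le> q_dim P"
    unfolding q_dim_def by (rule member_le_sum[OF _ _ finite_actions(1)]) (simp_all add: actions_def)
  moreover have "d_dim (Obs :: 'n action) > 0" by (simp add: d_dim_def)
  ultimately show ?thesis by linarith
qed

lemma z_fun_pos: "x \<ge> 0 \<Longrightarrow> t \<ge> 1 \<Longrightarrow> z_fun P t x > 0"
  unfolding z_fun_def using kappa_B_pos by (intro add_nonneg_pos) (auto simp: less_imp_le)

lemma zeta_fun_pos: "x \<ge> 0 \<Longrightarrow> t \<ge> 1 \<Longrightarrow> zeta_fun P t x > 0"
  using H_of_pos[of "z_fun P t x"] z_fun_pos[of x t] q_dim_pos
  by (auto simp: zeta_fun_def H_fun_eq less_imp_le)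

lemma zeta_fun_le_1: "zeta_fun P t x \<le> 1"
  by (simp add: zeta_fun_def)

text \<open>The product has \<open>q_dim P\<close> factors of the form
  \<open>1 + c / \<zeta>\<close>, and each of them grows by at most \<open>k\<close>.\<close>

lemma cover_scale:
  assumes "0 < \<zeta>" "0 < \<zeta>'" "1 \<le> k" "\<zeta> \<le> k * \<zeta>'"
  shows "cover P \<zeta>' \<le> k ^ q_dim P * cover P \<zeta>"
proof -
  have le: "1 + c / \<zeta>' \<le> k * (1 + c / \<zeta>)" if "c \<ge> 0" for c
  proof -
    have "c / \<zeta>' \<le> k * (c / \<zeta>)"
      using assms mult_left_mono[OF assms(4) that] by (simp add: field_simps)
    then show ?thesis using assms(3) by (simp add: distrib_left)
  qed
  have nn: "0 \<le> v_hi P" "0 \<le> 8 * B_mu P" "0 \<le> 8 * sqrt (real (d_dim a)) * v_hi P" for a :: "'n action"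
    by (auto simp: less_imp_le)
  have "cover P \<zeta>' \<le> (\<Prod>a\<in>actions P. (k * (1 + 8 * B_mu P / \<zeta>)) ^ d_dim a *
      (k * (1 + 8 * sqrt (real (d_dim a)) * v_hi P / \<zeta>)) ^ s_dim a)"
    unfolding cover_def
    using assms nn by (intro prod_mono conjI mult_mono power_mono le mult_nonneg_nonneg zero_le_power add_nonneg_nonneg divide_nonneg_nonneg) auto
  also have "\<dots> = k ^ q_dim P * cover P \<zeta>"
    by (simp add: cover_def q_dim_def power_sum prod.distrib power_mult_distrib power_add mult_ac)
  finally show ?thesis .
qed

lemma cover_ge_1: "\<zeta> > 0 \<Longrightarrow> cover P \<zeta> \<ge> 1"
  unfolding cover_def
  by (intro prod_ge_1 mult_ge1_I one_le_power) (auto simp: less_imp_le)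

abbreviation f_raw :: "nat \<Rightarrow> real \<Rightarrow> real" where
  "f_raw t x \<equiv> (exp (real (q_dim P)) * cover P (zeta_fun P t x) + 1) * exp (- kappa_B P * x)"

text \<open>A larger \<open>x\<close> refines the net, and the exponential must outweigh this. With
  \<open>r\<close> the quotient of the values of \<open>z_fun\<close>, the cover grows at most by
  \<open>r ^ q\<close>, which is at most \<open>exp (q * (r - 1))\<close>; since
  \<open>f_fun P t x < 1\<close> forces \<open>q\<close> below \<open>z_fun P t x\<close>, this is
  at most \<open>exp (kappa_B P * (y - x))\<close>.\<close>

lemma f_fun_antimono:
  assumes t: "t \<ge> 1" and x: "0 \<le> x" "x \<le> y" and f: "f_fun P t x < 1"
  shows "f_fun P t y \<le> f_fun P t x"
proof -
  let ?q = "real (q_dim P)" and ?k = "kappa_B P"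
  have raw: "f_raw t x < 1" and fx: "f_fun P t x = f_raw t x"
    using f by (auto simp: f_fun_def)
  have z: "0 < z_fun P t x" "z_fun P t x \<le> z_fun P t y"
    using z_fun_pos[OF x(1) t] x kappa_B_pos by (auto simp: z_fun_def)
  have zp: "zeta_fun P t x > 0" "zeta_fun P t y > 0"
    using zeta_fun_pos t x by auto
  \<comment> \<open>As the cover is at least 1, a value of \<open>f_raw\<close> below 1 gives
    \<open>?q < ?k * x\<close>.\<close>
  have "exp ?q * exp (- ?k * x) \<le> f_raw t x"
  proof (intro mult_right_mono)
    show "exp ?q \<le> exp ?q * cover P (zeta_fun P t x) + 1"
    proof -
      have "exp ?q * 1 \<le> exp ?q * cover P (zeta_fun P t x)"
        by (intro mult_left_mono cover_ge_1 zp) simp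
      then show ?thesis by linarith
    qed
  qed simp
  moreover have "exp ?q * exp (- ?k * x) = exp (?q - ?k * x)" by (simp add: mult_exp_exp)
  ultimately have "exp (?q - ?k * x) < 1" using raw by linarith
  then have q: "?q < ?k * x" by simp
  define r where "r = z_fun P t y / z_fun P t x"
  have r: "r \<ge> 1" using z by (simp add: r_def)
  have "zeta_fun P t x \<le> r * zeta_fun P t y"
  proof -
    have "H_fun P t y \<le> r * H_fun P t x"
      unfolding H_fun_eq r_def by (rule H_of_scale[OF z])
    moreover have Hp: "H_fun P t x > 0" "H_fun P t y > 0"
      using H_of_pos z by (auto simp: H_fun_eq)
    ultimately have "?q / (real t * H_fun P t x) \<le> r * (?q / (real t * H_fun P t y))"
      using t q_dim_pos r by (simp add: field_simps)
    then show ?thesis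
      using r by (auto simp: zeta_fun_def min_def algebra_simps split: if_splits intro: order_trans)
  qed
  then have "cover P (zeta_fun P t y) \<le> r ^ q_dim P * cover P (zeta_fun P t x)"
    by (rule cover_scale[OF zp r])
  also have "\<dots> \<le> exp (?k * (y - x)) * cover P (zeta_fun P t x)"
  proof (rule mult_right_mono)
    have r1: "r - 1 = ?k * (y - x) / z_fun P t x"
      using z(1) by (simp add: r_def field_simps) (simp add: z_fun_def algebra_simps)
    have qz: "?q \<le> z_fun P t x"
    proof -
      have "0 \<le> ln (real t + 1)" by simp
      then show ?thesis using q unfolding z_fun_def by linarith
    qed
    have "?q * (r - 1) \<le> z_fun P t x * (r - 1)"
      using qz r by (intro mult_right_mono) auto
    also have "\<dots> = ?k * (y - x)" unfolding r1 using z(1) by simp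
    finally have "?q * (r - 1) \<le> ?k * (y - x)" .
    moreover have "r ^ q_dim P \<le> exp (r - 1) ^ q_dim P"
      using r exp_ge_add_one_self[of "r - 1"] by (intro power_mono) auto
    ultimately show "r ^ q_dim P \<le> exp (?k * (y - x))"
      by (simp add: exp_of_nat_mult[symmetric]) (meson exp_le_cancel_iff order_trans)
  qed (use cover_ge_1[OF zp(1)] in simp)
  finally have c: "cover P (zeta_fun P t y) * exp (- ?k * y) \<le> exp (?k * (y - x)) * cover P (zeta_fun P t x) * exp (- ?k * y)"
    by (rule mult_right_mono) simp
  also have "\<dots> = cover P (zeta_fun P t x) * exp (- ?k * x)"
    by (simp add: exp_diff exp_minus right_diff_distrib field_simps)
  finally have "exp ?q * (cover P (zeta_fun P t y) * exp (- ?k * y)) \<le> exp ?q * (cover P (zeta_fun P t x) * exp (- ?k * x))"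
    by (rule mult_left_mono) simp
  moreover have "exp (- ?k * y) \<le> exp (- ?k * x)" using x(2) kappa_B_pos by simp
  ultimately have "f_raw t y \<le> f_raw t x" by (simp only: distrib_right mult.assoc mult_1_left add_mono)
  then show ?thesis unfolding fx by (simp add: f_fun_def)
qed

text \<open>Allows the bound on the threshold to pass to an infimum of levels.\<close>

lemma continuous_on_f_fun:
  assumes t: "t \<ge> 1"
  shows "continuous_on {0..} (f_fun P t)"
proof -
  have z: "continuous_on {0..} (z_fun P t)"
    unfolding z_fun_def by (intro continuous_intros)
  have H: "continuous_on {0..} (H_fun P t)"
    unfolding H_fun_def L_ell_def R_fun_def
    by (intro continuous_intros z) (auto simp: less_imp_neq[OF v_lo_pos, symmetric])
  have Hp: "H_fun P t x > 0" if "x \<ge> 0" for x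
    using H_of_pos z_fun_pos[OF that t] by (simp add: H_fun_eq)
  have zeta: "continuous_on {0..} (zeta_fun P t)"
  proof -
    have "real t * H_fun P t x \<noteq> 0" if "x \<in> {0..}" for x
      using Hp[of x] that t by simp
    then show ?thesis unfolding zeta_fun_def by (intro continuous_intros H) blast
  qed
  have zp: "zeta_fun P t x \<noteq> 0" if "x \<ge> 0" for x using zeta_fun_pos[OF that t] by simp
  have "continuous_on {0..} (\<lambda>x. cover P (zeta_fun P t x))"
    unfolding cover_def by (intro continuous_intros zeta) (simp_all add: zp)
  then show ?thesis unfolding f_fun_def[abs_def] by (intro continuous_intros)
qed

text \<open>With \<open>K\<close> actions, \<open>L\<^sup>2 + K * L\<close> is the time by which
  forced exploration has played each of them \<open>L\<close> times. Both this time and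
  \<open>z_fun\<close> are of order \<open>L\<^sup>2\<close>, hence \<open>1 / zeta_fun\<close> is
  of order \<open>L ^ 4\<close> and the cover polynomial in \<open>L\<close>, against an exponential
  decay.\<close>

lemma f_fun_le_exp:
  assumes c: "c > 0"
  shows "\<exists>A m. \<forall>L\<ge>1. f_fun P (L\<^sup>2 + K * L) (c * real L) \<le> A * real L ^ m * exp (- kappa_B P * c * real L)"
proof (intro exI allI impI)
  let ?q = "q_dim P"
  let ?K = "real K + 1" and ?H = "H_of 1" and ?k = "kappa_B P"
  let ?C = "1 + ?K * (?k * c + 2 * ?K) * ?H"
  fix L :: nat assume L: "L \<ge> 1"
  define T where "T = L\<^sup>2 + K * L"
  let ?x = "c * real L"
  have t: "T \<ge> 1" using L by (simp add: T_def Suc_leI)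
  then have rt: "real T \<ge> 1" by simp
  have x: "?x \<ge> 0" using c by simp
  have L2: "real L \<le> (real L)\<^sup>2" "1 \<le> (real L)\<^sup>2" using L by (auto simp: self_le_power one_le_power)
  have tK: "real T \<le> ?K * (real L)\<^sup>2"
    using mult_left_mono[OF L2(1), of "real K"] by (simp add: T_def algebra_simps)
  have H1: "?H > 0" by (rule H_of_pos) simp
  let ?z = "z_fun P T ?x" and ?\<zeta> = "zeta_fun P T ?x"
  \<comment> \<open>Lets \<open>H_of_scale\<close> start from the reference value
    \<open>H_of 1\<close>.\<close>
  have z1: "?z \<ge> 1"
  proof -
    have "ln (real T + 1) \<ge> ln 2" using rt by (subst ln_le_cancel_iff) auto
    moreover have "0 \<le> ?k * ?x" using kappa_B_pos x by simp
    ultimately show ?thesis using ln2_ge_two_thirds unfolding z_fun_def by linarith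
  qed
  have zle: "?z \<le> (?k * c + 2 * ?K) * (real L)\<^sup>2"
  proof -
    have "ln (real T + 1) \<le> real T" using ln_add_one_self_le_self[of "real T"] by (simp add: add.commute)
    moreover have "?k * ?x \<le> ?k * c * (real L)\<^sup>2"
      using L2(1) kappa_B_pos c by (simp add: mult.assoc[symmetric])
    ultimately show ?thesis using tK by (simp add: z_fun_def algebra_simps)
  qed
  have "H_of ?z \<le> ?z / 1 * ?H" by (rule H_of_scale) (use z1 in auto)
  also have "\<dots> \<le> (?k * c + 2 * ?K) * (real L)\<^sup>2 * ?H"
    using zle H1 by (simp add: mult_right_mono)
  finally have Hle: "H_of ?z \<le> (?k * c + 2 * ?K) * (real L)\<^sup>2 * ?H" .
  have Hp: "H_of ?z > 0" by (rule H_of_pos) (use z1 in linarith)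
  \<comment> \<open>The inverse radius is the maximum of 1 and \<open>T * H / q\<close>, and
    \<open>q\<close> is at least 1.\<close>
  have "1 / ?\<zeta> \<le> 1 + real T * H_of ?z"
  proof -
    have "real T * H_of ?z / real ?q \<le> real T * H_of ?z"
    proof -
      have "y / n \<le> y" if "y \<ge> 0" "n \<ge> 1" for y n :: real
        using that mult_left_mono[of 1 n y] by (simp add: divide_le_eq)
      then show ?thesis using Hp q_dim_pos by (simp add: Suc_leI)
    qed
    moreover have "0 \<le> real T * H_of ?z" using Hp by simp
    ultimately show ?thesis by (auto simp: zeta_fun_def H_fun_eq min_def)
  qed
  also have "\<dots> \<le> 1 + (?K * (real L)\<^sup>2) * ((?k * c + 2 * ?K) * (real L)\<^sup>2 * ?H)"
    using tK Hle Hp by (intro add_left_mono mult_mono) auto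
  also have "\<dots> = 1 + ?K * (?k * c + 2 * ?K) * ?H * real L ^ 4"
    by (simp add: power2_eq_square power4_eq_xxxx mult_ac)
  also have "\<dots> \<le> ?C * real L ^ 4"
    using one_le_power[of "real L" 4] L by (simp add: distrib_right)
  finally have zeta: "1 / ?\<zeta> \<le> ?C * real L ^ 4" .
  have zp: "?\<zeta> > 0" by (rule zeta_fun_pos[OF x t])
  have "cover P ?\<zeta> \<le> (1 / ?\<zeta>) ^ ?q * cover P 1"
    by (rule cover_scale) (use zp zeta_fun_le_1 in auto)
  also have "\<dots> \<le> (?C * real L ^ 4) ^ ?q * cover P 1"
    using zeta zp cover_ge_1[of 1] by (intro mult_right_mono power_mono) auto
  also have "\<dots> = ?C ^ ?q * cover P 1 * real L ^ (4 * ?q)"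
    by (simp only: power_mult_distrib power_mult) (simp only: mult_ac)
  finally have cov: "cover P ?\<zeta> \<le> ?C ^ ?q * cover P 1 * real L ^ (4 * ?q)" .
  have "f_fun P T ?x \<le> (exp (real ?q) * cover P ?\<zeta> + 1) * exp (- ?k * ?x)"
    by (simp add: f_fun_def)
  also have "\<dots> \<le> ((exp (real ?q) * (?C ^ ?q * cover P 1) + 1) * real L ^ (4 * ?q)) * exp (- ?k * ?x)"
  proof (rule mult_right_mono)
    have "exp (real ?q) * cover P ?\<zeta> \<le> exp (real ?q) * (?C ^ ?q * cover P 1 * real L ^ (4 * ?q))"
      using cov by (rule mult_left_mono) simp
    have "1 \<le> real L ^ (4 * ?q)" using L by (intro one_le_power) simp
    show "exp (real ?q) * cover P ?\<zeta> + 1 \<le> (exp (real ?q) * (?C ^ ?q * cover P 1) + 1) * real L ^ (4 * ?q)"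
    proof -
      have "e * N + 1 \<le> (e * D + 1) * X" if "e * N \<le> e * (D * X)" "1 \<le> X" for e N D X :: real
        using that by (simp add: distrib_right mult.assoc)
      then show ?thesis
        using \<open>exp (real ?q) * cover P ?\<zeta> \<le> _\<close> \<open>1 \<le> real L ^ (4 * ?q)\<close> by blast
    qed
  qed simp
  finally show "f_fun P (L\<^sup>2 + K * L) ?x \<le> (exp (real ?q) * (?C ^ ?q * cover P 1) + 1) * real L ^ (4 * ?q) * exp (- ?k * c * real L)"
    by (simp add: T_def mult.assoc)
qed

lemma f_fun_eventually_small:
  assumes c: "c > 0" and d: "\<delta> > 0"
  shows "\<exists>L\<ge>1. pi\<^sup>2 * (real (L\<^sup>2 + K * L))\<^sup>2 / 6 * f_fun P (L\<^sup>2 + K * L) (c * real L) < \<delta>"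
proof -
  obtain A m where A: "\<And>L. L \<ge> 1 \<Longrightarrow> f_fun P (L\<^sup>2 + K * L) (c * real L) \<le> A * real L ^ m * exp (- kappa_B P * c * real L)"
    using f_fun_le_exp[OF c] by blast
  \<comment> \<open>The squared time in the stopping rule contributes
    \<open>(K + 1)\<^sup>2 * L ^ 4\<close>, hence the exponent \<open>m + 4\<close> below.\<close>
  let ?a = "kappa_B P * c" and ?B = "pi\<^sup>2 * (real K + 1)\<^sup>2 / 6"
  have a: "?a > 0" using kappa_B_pos c by simp
  have "((\<lambda>x::real. x ^ (m + 4) / exp x) \<longlongrightarrow> 0) at_top"
    by (rule tendsto_power_div_exp_0)
  moreover have "filterlim (\<lambda>L. ?a * real L) at_top sequentially"
    using a by (intro filterlim_tendsto_pos_mult_at_top[OF tendsto_const a] filterlim_real_sequentially)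
  ultimately have "(\<lambda>L. (?a * real L) ^ (m + 4) / exp (?a * real L)) \<longlonglongrightarrow> 0"
    by (rule filterlim_compose)
  then have "(\<lambda>L. ?B * \<bar>A\<bar> / ?a ^ (m + 4) * ((?a * real L) ^ (m + 4) / exp (?a * real L))) \<longlonglongrightarrow> 0"
    by (rule tendsto_mult_right_zero)
  then have "\<forall>\<^sub>F L in sequentially. ?B * \<bar>A\<bar> / ?a ^ (m + 4) * ((?a * real L) ^ (m + 4) / exp (?a * real L)) < \<delta>"
    using d by (rule order_tendstoD)
  then obtain N where N: "\<And>L. L \<ge> N \<Longrightarrow> ?B * \<bar>A\<bar> / ?a ^ (m + 4) * ((?a * real L) ^ (m + 4) / exp (?a * real L)) < \<delta>"
    unfolding eventually_sequentially by blast
  define L where "L = max N 1"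
  have L: "L \<ge> 1" "L \<ge> N" by (auto simp: L_def)
  define T where "T = L\<^sup>2 + K * L"
  have "real L \<le> (real L)\<^sup>2" using L by (simp add: self_le_power)
  then have tK: "real T \<le> (real K + 1) * (real L)\<^sup>2"
    using mult_left_mono[of "real L" "(real L)\<^sup>2" "real K"] by (simp add: T_def algebra_simps)
  have "(real T)\<^sup>2 \<le> ((real K + 1) * (real L)\<^sup>2)\<^sup>2"
    using tK by (rule power_mono) simp
  also have "\<dots> = (real K + 1)\<^sup>2 * real L ^ 4" by (simp only: power_mult_distrib power_mult[symmetric]) simp
  finally have "pi\<^sup>2 * (real T)\<^sup>2 / 6 \<le> pi\<^sup>2 * ((real K + 1)\<^sup>2 * real L ^ 4) / 6"
    by (intro divide_right_mono mult_left_mono) auto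
  then have t2: "pi\<^sup>2 * (real T)\<^sup>2 / 6 \<le> ?B * real L ^ 4" by (simp add: mult_ac)
  have "f_fun P T (c * real L) \<le> A * real L ^ m * exp (- ?a * real L)"
    using A[OF L(1)] unfolding T_def minus_mult_left[symmetric] .
  also have "\<dots> \<le> \<bar>A\<bar> * real L ^ m * exp (- ?a * real L)"
    by (intro mult_right_mono) auto
  finally have f: "f_fun P T (c * real L) \<le> \<bar>A\<bar> * real L ^ m * exp (- ?a * real L)" .
  have "pi\<^sup>2 * (real T)\<^sup>2 / 6 * f_fun P T (c * real L) \<le> pi\<^sup>2 * (real T)\<^sup>2 / 6 * (\<bar>A\<bar> * real L ^ m * exp (- ?a * real L))"
    using f by (rule mult_left_mono) simp
  also have "\<dots> \<le> ?B * real L ^ 4 * (\<bar>A\<bar> * real L ^ m * exp (- ?a * real L))"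
    using t2 by (rule mult_right_mono) simp
  also have "\<dots> = ?B * \<bar>A\<bar> / ?a ^ (m + 4) * ((?a * real L) ^ (m + 4) / exp (?a * real L))"
  proof -
    have "B * L4 * (A' * Lm * exp (- w)) = B * A' / (am * a4) * ((am * Lm) * (a4 * L4) / exp w)"
      if "am \<noteq> 0" "a4 \<noteq> 0" for B L4 A' Lm w am a4 :: real
      using that by (simp add: exp_minus field_simps)
    moreover have "?a ^ m \<noteq> 0" "?a ^ 4 \<noteq> 0"
      using less_imp_neq[OF a, symmetric] by (simp_all only: power_eq_0_iff simp_thms)
    ultimately have "?B * real L ^ 4 * (\<bar>A\<bar> * real L ^ m * exp (- (?a * real L)))
        = ?B * \<bar>A\<bar> / (?a ^ m * ?a ^ 4) * ((?a ^ m * real L ^ m) * (?a ^ 4 * real L ^ 4) / exp (?a * real L))"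
      by blast
    then show ?thesis
      by (simp only: power_mult_distrib power_add minus_mult_left[symmetric])
  qed
  also have "\<dots> < \<delta>" by (rule N[OF L(2)])
  finally show ?thesis using L(1) unfolding T_def by blast
qed

end

section \<open>Concentration along the trajectory\<close>

lemma sets_law: "sets (law \<theta> a) = sets (Pi\<^sub>M (observed a) (\<lambda>_. borel))"
  unfolding law_def gauss_def sets_density by (intro sets_PiM_cong) auto

lemma borel_measurable_pdf: "pdf \<theta> a \<in> borel_measurable (Pi\<^sub>M (observed a) (\<lambda>_. borel))"
proof -
  have "sets (Pi\<^sub>M (observed a) (\<lambda>_. lborel :: real measure)) = sets (Pi\<^sub>M (observed a) (\<lambda>_. borel))"
    by (intro sets_PiM_cong) auto
  then show ?thesis
    unfolding pdf_def using borel_measurable_gauss_pdf measurable_cong_sets by blast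
qed

locale focus_analysis =
  focus_run M F P \<epsilon> \<theta>s act X est br + valid_model P \<theta>s
  for M :: "'w measure" and F :: "nat \<Rightarrow> 'w measure" and P :: "'n::finite pars" and \<epsilon> :: real
    and \<theta>s :: "'n model" and act X est br
begin

section \<open>Integration of one observation given the past\<close>

lemma space_F': "space (F t) = space M"
  by (rule space_F)

lemma sets_F_subset: "A \<in> sets (F t) \<Longrightarrow> A \<in> sets M"
  using subalgebra_F[of t] by (auto simp: subalgebra_def)

lemma measurable_F: "f \<in> F t \<rightarrow>\<^sub>M N \<Longrightarrow> f \<in> M \<rightarrow>\<^sub>M N"
  by (rule measurable_from_subalg[OF subalgebra_F])

lemma act_in: "\<omega> \<in> space M \<Longrightarrow> 1 \<le> s \<Longrightarrow> act s \<omega> \<in> actions P"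
  using measurable_space[OF act_measurable[of "s - 1"], of \<omega>] by (simp add: space_F')

definition act_event :: "nat \<Rightarrow> 'n action \<Rightarrow> 'w set" where
  "act_event s a = {\<omega> \<in> space M. act s \<omega> = a}"

lemma act_event_F: "a \<in> actions P \<Longrightarrow> act_event (Suc t) a \<in> sets (F t)"
  using measurable_sets[OF act_measurable[of t], of "{a}"]
  by (simp add: act_event_def space_F' vimage_def Int_def conj_commute)

lemma act_event_F_Suc: "a \<in> actions P \<Longrightarrow> act_event (Suc t) a \<in> sets (F (Suc t))"
  using act_event_F sets_F_mono[of t "Suc t"] by auto

lemma act_event_M: "a \<in> actions P \<Longrightarrow> act_event (Suc t) a \<in> sets M"
  by (rule sets_F_subset[OF act_event_F])

lemma X_measurable':
  "a \<in> actions P \<Longrightarrow> X (Suc t) \<in> restrict_space (F (Suc t)) (act_event (Suc t) a) \<rightarrow>\<^sub>M Pi\<^sub>M (observed a) (\<lambda>_. borel)"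
  using X_measurable[of "Suc t" a] by (simp add: act_event_def)

lemma X_measurable_M:
  assumes a: "a \<in> actions P"
  shows "X (Suc t) \<in> restrict_space M (act_event (Suc t) a) \<rightarrow>\<^sub>M Pi\<^sub>M (observed a) (\<lambda>_. borel)"
proof (rule measurable_from_subalg[OF _ X_measurable'[OF a]])
  show "subalgebra (restrict_space M (act_event (Suc t) a)) (restrict_space (F (Suc t)) (act_event (Suc t) a))"
    using subalgebra_F[of "Suc t"] unfolding subalgebra_def space_restrict_space sets_restrict_space by auto
qed

lemma observation_event:
  assumes a: "a \<in> actions P" and B: "B \<in> sets (law \<theta>s a)"
  shows "{\<omega>\<in>space M. act (Suc t) \<omega> = a \<and> X (Suc t) \<omega> \<in> B} \<in> sets M"
proof -
  have "X (Suc t) -` B \<inter> space (restrict_space M (act_event (Suc t) a)) \<in> sets (restrict_space M (act_event (Suc t) a))"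
    using B by (intro measurable_sets[OF X_measurable_M[OF a]]) (simp add: sets_law)
  moreover have "act_event (Suc t) a \<inter> space M \<in> sets M"
    using act_event_M[OF a] by (simp add: act_event_def Int_absorb2)
  ultimately have "X (Suc t) -` B \<inter> space (restrict_space M (act_event (Suc t) a)) \<in> sets M"
    by (simp only: sets_restrict_space_iff)
  also have "X (Suc t) -` B \<inter> space (restrict_space M (act_event (Suc t) a)) = {\<omega>\<in>space M. act (Suc t) \<omega> = a \<and> X (Suc t) \<omega> \<in> B}"
    by (auto simp: space_restrict_space act_event_def)
  finally show ?thesis .
qed

text \<open>The hypothesis \<open>observation\<close> is integrated over an event of the past. This
  is the product rule on rectangles, from which the next two lemmas build integrals.\<close>

lemma emeasure_observation:
  assumes a: "a \<in> actions P" and B: "B \<in> sets (law \<theta>s a)" and G: "G \<in> sets (F t)"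
  shows "emeasure M (G \<inter> {\<omega>\<in>space M. act (Suc t) \<omega> = a \<and> X (Suc t) \<omega> \<in> B})
    = emeasure (law \<theta>s a) B * emeasure M (G \<inter> act_event (Suc t) a)"
proof -
  interpret S: finite_measure_subalgebra M "F t" by unfold_locales (rule subalgebra_F)
  interpret L: prob_space "law \<theta>s a" by (rule prob_space_law)
  let ?E = "{\<omega>\<in>space M. act (Suc t) \<omega> = a \<and> X (Suc t) \<omega> \<in> B}" and ?A = "act_event (Suc t) a"
  have E[measurable]: "?E \<in> sets M" by (rule observation_event[OF a B])
  have A[measurable]: "?A \<in> sets M" by (rule act_event_M[OF a])
  have GM[measurable]: "G \<in> sets M" by (rule sets_F_subset[OF G])
  have "(LINT \<omega>:G|M. indicat_real ?E \<omega>) = (LINT \<omega>:G|M. real_cond_exp M (F t) (indicat_real ?E) \<omega>)"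
    by (intro S.real_cond_exp_intA G integrable_real_indicator E) (simp add: emeasure_eq_measure)
  also have "\<dots> = (LINT \<omega>:G|M. measure (law \<theta>s a) B * indicat_real ?A \<omega>)"
    unfolding set_lebesgue_integral_def
  proof (rule integral_cong_AE)
    have r: "real_cond_exp M (F t) (indicat_real ?E) \<in> borel_measurable M"
      by (rule borel_measurable_cond_exp2)
    then show "(\<lambda>\<omega>. indicat_real G \<omega> *\<^sub>R real_cond_exp M (F t) (indicat_real ?E) \<omega>) \<in> borel_measurable M" by simp
    show "AE \<omega> in M. indicat_real G \<omega> *\<^sub>R real_cond_exp M (F t) (indicat_real ?E) \<omega> =
        indicat_real G \<omega> *\<^sub>R (measure (law \<theta>s a) B * indicat_real ?A \<omega>)"
      using observation[OF a B, of t] AE_space by eventually_elim (simp add: act_event_def indicator_def)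
  qed simp
  also have "(LINT \<omega>:G|M. indicat_real ?E \<omega>) = measure M (G \<inter> ?E)"
    by (simp add: set_lebesgue_integral_def indicator_inter_arith[symmetric] Int_absorb2 sets.sets_into_space)
  also have "(LINT \<omega>:G|M. measure (law \<theta>s a) B * indicat_real ?A \<omega>) = measure (law \<theta>s a) B * measure M (G \<inter> ?A)"
  proof -
    have "(LINT \<omega>:G|M. measure (law \<theta>s a) B * indicat_real ?A \<omega>) = (\<integral>\<omega>. measure (law \<theta>s a) B * indicat_real (G \<inter> ?A) \<omega> \<partial>M)"
      unfolding set_lebesgue_integral_def by (intro Bochner_Integration.integral_cong) (auto simp: indicator_def)
    then show ?thesis by (simp add: Int_absorb2 sets.sets_into_space)
  qed
  finally have "measure M (G \<inter> ?E) = measure (law \<theta>s a) B * measure M (G \<inter> ?A)" .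
  then show ?thesis
    by (simp add: emeasure_eq_measure L.emeasure_eq_measure ennreal_mult)
qed

text \<open>Extension from events of the past to weights \<open>Y\<close>: the measures with the two
  densities agree on every event of \<open>F t\<close>, hence integrate every
  \<open>F t\<close>-measurable function alike.\<close>

lemma nn_integral_observation_event:
  assumes a: "a \<in> actions P" and B: "B \<in> sets (law \<theta>s a)" and Y: "Y \<in> borel_measurable (F t)"
  shows "(\<integral>\<^sup>+\<omega>. Y \<omega> * indicator {\<omega>\<in>space M. act (Suc t) \<omega> = a \<and> X (Suc t) \<omega> \<in> B} \<omega> \<partial>M)
    = emeasure (law \<theta>s a) B * (\<integral>\<^sup>+\<omega>. Y \<omega> * indicator (act_event (Suc t) a) \<omega> \<partial>M)"
proof -
  let ?E = "{\<omega>\<in>space M. act (Suc t) \<omega> = a \<and> X (Suc t) \<omega> \<in> B}" and ?A = "act_event (Suc t) a"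
  let ?p = "emeasure (law \<theta>s a) B"
  have E[measurable]: "?E \<in> sets M" by (rule observation_event[OF a B])
  have A[measurable]: "?A \<in> sets M" by (rule act_event_M[OF a])
  have YM[measurable]: "Y \<in> borel_measurable M" by (rule measurable_F[OF Y])
  have sub: "subalgebra (density M h) (F t)" for h
    using subalgebra_F[of t] by (simp add: subalgebra_def)
  have "restr_to_subalg (density M (indicator ?E)) (F t) = restr_to_subalg (density M (\<lambda>\<omega>. ?p * indicator ?A \<omega>)) (F t)"
  proof (rule measure_eqI)
    fix G assume "G \<in> sets (restr_to_subalg (density M (indicator ?E)) (F t))"
    then have G: "G \<in> sets (F t)" by (simp add: sets_restr_to_subalg[OF sub])
    have GM[measurable]: "G \<in> sets M" by (rule sets_F_subset[OF G])
    have "emeasure (density M (indicator ?E)) G = emeasure M (G \<inter> ?E)"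
    proof -
      have "emeasure (density M (indicator ?E)) G = (\<integral>\<^sup>+\<omega>. indicator ?E \<omega> * indicator G \<omega> \<partial>M)"
        by (rule emeasure_density) measurable
      also have "\<dots> = (\<integral>\<^sup>+\<omega>. indicator (G \<inter> ?E) \<omega> \<partial>M)"
        by (intro nn_integral_cong) (auto simp: indicator_def)
      finally show ?thesis by simp
    qed
    also have "\<dots> = ?p * emeasure M (G \<inter> ?A)" by (rule emeasure_observation[OF a B G])
    also have "\<dots> = emeasure (density M (\<lambda>\<omega>. ?p * indicator ?A \<omega>)) G"
    proof -
      have "emeasure (density M (\<lambda>\<omega>. ?p * indicator ?A \<omega>)) G = (\<integral>\<^sup>+\<omega>. ?p * indicator (G \<inter> ?A) \<omega> \<partial>M)"
        by (subst emeasure_density) (auto intro!: nn_integral_cong simp: indicator_def)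
      then show ?thesis by (simp add: nn_integral_cmult)
    qed
    finally show "emeasure (restr_to_subalg (density M (indicator ?E)) (F t)) G =
        emeasure (restr_to_subalg (density M (\<lambda>\<omega>. ?p * indicator ?A \<omega>)) (F t)) G"
      by (simp add: emeasure_restr_to_subalg[OF sub G])
  qed (simp add: sets_restr_to_subalg[OF sub])
  then have "(\<integral>\<^sup>+\<omega>. Y \<omega> \<partial>density M (indicator ?E)) = (\<integral>\<^sup>+\<omega>. Y \<omega> \<partial>density M (\<lambda>\<omega>. ?p * indicator ?A \<omega>))"
    by (simp add: nn_integral_subalgebra2[OF sub Y, symmetric])
  then have "(\<integral>\<^sup>+\<omega>. Y \<omega> * indicator ?E \<omega> \<partial>M) = (\<integral>\<^sup>+\<omega>. ?p * (Y \<omega> * indicator ?A \<omega>) \<partial>M)"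
    by (simp add: nn_integral_density mult_ac)
  then show ?thesis by (simp add: nn_integral_cmult)
qed

text \<open>Extension from sets \<open>B\<close> to functions \<open>g\<close>: weighting by
  \<open>Y\<close> and restricting to the chosen action, the image under \<open>X (Suc t)\<close> is
  a multiple of the law of the observation.\<close>

lemma nn_integral_observation:
  assumes a: "a \<in> actions P" and Y: "Y \<in> borel_measurable (F t)"
    and g: "g \<in> borel_measurable (Pi\<^sub>M (observed a) (\<lambda>_. borel))"
  shows "(\<integral>\<^sup>+\<omega>. Y \<omega> * (if \<omega> \<in> act_event (Suc t) a then g (X (Suc t) \<omega>) else 0) \<partial>M)
    = (\<integral>\<^sup>+\<omega>. Y \<omega> * indicator (act_event (Suc t) a) \<omega> \<partial>M) * (\<integral>\<^sup>+x. g x \<partial>law \<theta>s a)"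
proof -
  let ?A = "act_event (Suc t) a" and ?N = "Pi\<^sub>M (observed a) (\<lambda>_. borel :: real measure)"
  let ?c = "\<integral>\<^sup>+\<omega>. Y \<omega> * indicator ?A \<omega> \<partial>M"
  have A[measurable]: "?A \<in> sets M" by (rule act_event_M[OF a])
  have AI: "?A \<inter> space M \<in> sets M" using A by simp
  have YM[measurable]: "Y \<in> borel_measurable M" by (rule measurable_F[OF Y])
  have YR[measurable]: "Y \<in> borel_measurable (restrict_space M ?A)" by (rule measurable_restrict_space1[OF YM])
  note XM[measurable] = X_measurable_M[OF a, of t]
  have XD: "X (Suc t) \<in> density (restrict_space M ?A) Y \<rightarrow>\<^sub>M ?N" by simp
  let ?\<nu> = "distr (density (restrict_space M ?A) Y) ?N (X (Suc t))"
  have nu: "(\<integral>\<^sup>+x. h x \<partial>?\<nu>) = (\<integral>\<^sup>+\<omega>. Y \<omega> * (if \<omega> \<in> ?A then h (X (Suc t) \<omega>) else 0) \<partial>M)"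
    if h[measurable]: "h \<in> borel_measurable ?N" for h
  proof -
    have "(\<integral>\<^sup>+x. h x \<partial>?\<nu>) = (\<integral>\<^sup>+\<omega>. Y \<omega> * h (X (Suc t) \<omega>) \<partial>restrict_space M ?A)"
      by (simp add: nn_integral_distr[OF XD] nn_integral_density)
    also have "\<dots> = (\<integral>\<^sup>+\<omega>. Y \<omega> * h (X (Suc t) \<omega>) * indicator ?A \<omega> \<partial>M)"
      by (rule nn_integral_restrict_space[OF AI])
    also have "\<dots> = (\<integral>\<^sup>+\<omega>. Y \<omega> * (if \<omega> \<in> ?A then h (X (Suc t) \<omega>) else 0) \<partial>M)"
      by (intro nn_integral_cong) (auto simp: indicator_def)
    finally show ?thesis .
  qed
  have "?\<nu> = scale_measure ?c (law \<theta>s a)"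
  proof (rule measure_eqI)
    fix B assume "B \<in> sets ?\<nu>"
    then have BN[measurable]: "B \<in> sets ?N" and B: "B \<in> sets (law \<theta>s a)" by (simp_all add: sets_law)
    have "emeasure ?\<nu> B = (\<integral>\<^sup>+x. indicator B x \<partial>?\<nu>)" by simp
    also have "\<dots> = (\<integral>\<^sup>+\<omega>. Y \<omega> * (if \<omega> \<in> ?A then indicator B (X (Suc t) \<omega>) else 0) \<partial>M)"
      by (rule nu) simp
    also have "\<dots> = (\<integral>\<^sup>+\<omega>. Y \<omega> * indicator {\<omega>\<in>space M. act (Suc t) \<omega> = a \<and> X (Suc t) \<omega> \<in> B} \<omega> \<partial>M)"
      by (intro nn_integral_cong) (auto simp: indicator_def act_event_def)
    also have "\<dots> = emeasure (law \<theta>s a) B * ?c" by (rule nn_integral_observation_event[OF a B Y])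
    finally show "emeasure ?\<nu> B = emeasure (scale_measure ?c (law \<theta>s a)) B" by (simp add: mult.commute)
  qed (simp add: sets_law)
  then have "(\<integral>\<^sup>+x. g x \<partial>?\<nu>) = ?c * (\<integral>\<^sup>+x. g x \<partial>law \<theta>s a)"
    using g by (simp add: nn_integral_scale_measure measurable_cong_sets[OF sets_law refl])
  then show ?thesis unfolding nu[OF g] .
qed

lemma sum_actions_indicator:
  fixes h :: "'n action \<Rightarrow> ennreal"
  assumes "\<omega> \<in> space M"
  shows "(\<Sum>a\<in>actions P. if \<omega> \<in> act_event (Suc t) a then h a else 0) = h (act (Suc t) \<omega>)"
proof -
  have "(\<Sum>a\<in>actions P. if \<omega> \<in> act_event (Suc t) a then h a else 0) = (\<Sum>a\<in>actions P. if a = act (Suc t) \<omega> then h a else 0)"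
    using assms by (intro sum.cong) (auto simp: act_event_def)
  then show ?thesis using act_in[OF assms, of "Suc t"] by simp
qed

text \<open>The space of observations depends on the action, so measurability is glued from the
  finitely many events on which the action is fixed.\<close>

lemma measurable_action_observation:
  fixes g :: "'n action \<Rightarrow> ('n \<Rightarrow> real) \<Rightarrow> ennreal"
  assumes g: "\<And>a. a \<in> actions P \<Longrightarrow> g a \<in> borel_measurable (Pi\<^sub>M (observed a) (\<lambda>_. borel))"
  shows "(\<lambda>\<omega>. g (act (Suc t) \<omega>) (X (Suc t) \<omega>)) \<in> borel_measurable (F (Suc t))"
    and "a \<in> actions P \<Longrightarrow> (\<lambda>\<omega>. if \<omega> \<in> act_event (Suc t) a then g a (X (Suc t) \<omega>) else 0) \<in> borel_measurable (F (Suc t))"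
proof -
  show 1: "(\<lambda>\<omega>. if \<omega> \<in> act_event (Suc t) a then g a (X (Suc t) \<omega>) else 0) \<in> borel_measurable (F (Suc t))"
    if a: "a \<in> actions P" for a
  proof (subst measurable_restrict_space_iff[symmetric])
    show "act_event (Suc t) a \<inter> space (F (Suc t)) \<in> sets (F (Suc t))"
      using act_event_F_Suc[OF a, of t] by simp
    show "(\<lambda>\<omega>. g a (X (Suc t) \<omega>)) \<in> borel_measurable (restrict_space (F (Suc t)) (act_event (Suc t) a))"
      by (rule measurable_compose[OF X_measurable'[OF a] g[OF a]])
  qed simp
  have "(\<lambda>\<omega>. \<Sum>a\<in>actions P. if \<omega> \<in> act_event (Suc t) a then g a (X (Suc t) \<omega>) else 0) \<in> borel_measurable (F (Suc t))"
    by (intro borel_measurable_sum 1)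
  then show "(\<lambda>\<omega>. g (act (Suc t) \<omega>) (X (Suc t) \<omega>)) \<in> borel_measurable (F (Suc t))"
    by (rule measurable_cong[THEN iffD1, rotated]) (simp add: sum_actions_indicator space_F')
qed

text \<open>The event is split by the action of the round, and the tails of the individual laws are
  averaged.\<close>

lemma prob_norm_X_le:
  assumes z: "z \<ge> 0" and s: "1 \<le> s"
  shows "{\<omega>\<in>space M. norm (vec_of (observed (act s \<omega>)) (X s \<omega>)) > R_fun P z} \<in> sets M"
    and "measure M {\<omega>\<in>space M. norm (vec_of (observed (act s \<omega>)) (X s \<omega>)) > R_fun P z} \<le> exp (- z)"
proof -
  obtain t where t: "s = Suc t" using s by (cases s) auto
  let ?g = "\<lambda>a x. if norm (vec_of (observed a) x) > R_fun P z then 1 else 0 :: ennreal"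
  let ?E = "{\<omega>\<in>space M. norm (vec_of (observed (act s \<omega>)) (X s \<omega>)) > R_fun P z}"
  have vm: "vec_of (observed a) \<in> Pi\<^sub>M (observed a) (\<lambda>_. borel) \<rightarrow>\<^sub>M borel" for a :: "'n action"
    unfolding borel_measurable_vec_iff
  proof
    fix i show "(\<lambda>x. vec_of (observed a) x $ i) \<in> borel_measurable (Pi\<^sub>M (observed a) (\<lambda>_. borel))"
      by (cases "i \<in> observed a") auto
  qed
  have gm: "?g a \<in> borel_measurable (Pi\<^sub>M (observed a) (\<lambda>_. borel))" for a :: "'n action"
    using vm[of a] by measurable
  have mE: "(\<lambda>\<omega>. ?g (act s \<omega>) (X s \<omega>)) \<in> borel_measurable M"
    unfolding t by (rule measurable_F[OF measurable_action_observation(1)]) (rule gm)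
  have "{\<omega>\<in>space M. ?g (act s \<omega>) (X s \<omega>) = 1} \<in> sets M"
    using mE by measurable
  also have "{\<omega>\<in>space M. ?g (act s \<omega>) (X s \<omega>) = 1} = ?E" by auto
  finally show E: "?E \<in> sets M" .
  have "emeasure M ?E = (\<integral>\<^sup>+\<omega>. (\<Sum>a\<in>actions P. 1 * (if \<omega> \<in> act_event (Suc t) a then ?g a (X (Suc t) \<omega>) else 0)) \<partial>M)"
    using E by (subst nn_integral_indicator[symmetric], simp)
      (intro nn_integral_cong, simp only: mult_1 sum_actions_indicator, simp add: t indicator_def)
  also have "\<dots> = (\<Sum>a\<in>actions P. (\<integral>\<^sup>+\<omega>. 1 * (if \<omega> \<in> act_event (Suc t) a then ?g a (X (Suc t) \<omega>) else 0) \<partial>M))"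
    using gm by (intro nn_integral_sum) (simp only: mult_1, rule measurable_F[OF measurable_action_observation(2)])
  also have "\<dots> = (\<Sum>a\<in>actions P. (\<integral>\<^sup>+\<omega>. 1 * indicator (act_event (Suc t) a) \<omega> \<partial>M) * (\<integral>\<^sup>+x. ?g a x \<partial>law \<theta>s a))"
    by (intro sum.cong refl nn_integral_observation gm) auto
  also have "\<dots> \<le> (\<Sum>a\<in>actions P. (\<integral>\<^sup>+\<omega>. 1 * indicator (act_event (Suc t) a) \<omega> \<partial>M) * ennreal (exp (- z)))"
  proof (intro sum_mono mult_left_mono)
    fix a assume a: "a \<in> actions P"
    interpret L: prob_space "law \<theta>s a" by (rule prob_space_law)
    let ?B = "{x\<in>space (law \<theta>s a). norm (vec_of (observed a) x) > R_fun P z}"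
    have vL: "vec_of (observed a) \<in> law \<theta>s a \<rightarrow>\<^sub>M borel"
      using vm[of a] by (simp add: measurable_cong_sets[OF sets_law refl])
    have "?B \<in> sets (law \<theta>s a)" using vL by measurable
    moreover have "(\<integral>\<^sup>+x. ?g a x \<partial>law \<theta>s a) = (\<integral>\<^sup>+x. indicator ?B x \<partial>law \<theta>s a)"
      by (intro nn_integral_cong) (auto simp: indicator_def)
    ultimately have "(\<integral>\<^sup>+x. ?g a x \<partial>law \<theta>s a) = emeasure (law \<theta>s a) ?B" by simp
    also have "\<dots> \<le> ennreal (exp (- z))"
      unfolding L.emeasure_eq_measure by (intro ennreal_leI law_norm_tail a z)
    finally show "(\<integral>\<^sup>+x. ?g a x \<partial>law \<theta>s a) \<le> ennreal (exp (- z))" .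
  qed simp
  also have "\<dots> = (\<integral>\<^sup>+\<omega>. (\<Sum>a\<in>actions P. if \<omega> \<in> act_event (Suc t) a then 1 else 0) \<partial>M) * ennreal (exp (- z))"
  proof -
    have "(\<Sum>a\<in>actions P. (\<integral>\<^sup>+\<omega>. 1 * indicator (act_event (Suc t) a) \<omega> \<partial>M)) =
       (\<integral>\<^sup>+\<omega>. (\<Sum>a\<in>actions P. indicator (act_event (Suc t) a) \<omega>) \<partial>M)"
      using act_event_M by (subst nn_integral_sum) auto
    also have "\<dots> = (\<integral>\<^sup>+\<omega>. (\<Sum>a\<in>actions P. if \<omega> \<in> act_event (Suc t) a then 1 else 0) \<partial>M)"
      by (intro nn_integral_cong sum.cong) (auto simp: indicator_def)
    finally show ?thesis unfolding sum_distrib_right[symmetric] by (rule arg_cong)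
  qed
  also have "(\<integral>\<^sup>+\<omega>. (\<Sum>a\<in>actions P. if \<omega> \<in> act_event (Suc t) a then 1 else 0) \<partial>M) = (\<integral>\<^sup>+\<omega>. 1 \<partial>M)"
    by (intro nn_integral_cong sum_actions_indicator)
  finally show "measure M ?E \<le> exp (- z)"
    by (simp add: emeasure_eq_measure prob_space)
qed

section \<open>The compensated likelihood-ratio process and its tail bound\<close>

definition lr_factor :: "'n model \<Rightarrow> 'n action \<Rightarrow> ('n \<Rightarrow> real) \<Rightarrow> real" where
  "lr_factor \<theta> a x = sqrt (pdf \<theta> a x / pdf \<theta>s a x) * exp (kappa_B P * KL a \<theta> \<theta>s)"

definition lr_process :: "'n model \<Rightarrow> nat \<Rightarrow> 'w \<Rightarrow> ennreal" where
  "lr_process \<theta> t \<omega> = (\<Prod>s=1..t. ennreal (lr_factor \<theta> (act s \<omega>) (X s \<omega>)))"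

lemma lr_factor_measurable: "(\<lambda>x. ennreal (lr_factor \<theta> a x)) \<in> borel_measurable (Pi\<^sub>M (observed a) (\<lambda>_. borel))"
proof -
  note [measurable] = borel_measurable_pdf[of \<theta> a] borel_measurable_pdf[of \<theta>s a]
  show ?thesis unfolding lr_factor_def by measurable
qed

lemma lr_process_measurable: "lr_process \<theta> t \<in> borel_measurable (F t)"
proof (induction t)
  case (Suc t)
  have "lr_process \<theta> t \<in> borel_measurable (F (Suc t))"
    using Suc sets_F_mono[of t "Suc t"] by (intro measurable_mono[THEN subsetD, OF _ _ _ _ Suc]) (auto simp: space_F')
  moreover have "(\<lambda>\<omega>. ennreal (lr_factor \<theta> (act (Suc t) \<omega>) (X (Suc t) \<omega>))) \<in> borel_measurable (F (Suc t))"
    by (rule measurable_action_observation(1)) (rule lr_factor_measurable)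
  ultimately show ?case unfolding lr_process_def by (simp add: mult.commute)
qed (simp add: lr_process_def)

text \<open>The product of the square roots of the likelihood ratios, compensated by \<open>kappa_B\<close> times the divergence,
  is a supermartingale because the Bhattacharyya distance is at least \<open>kappa_B\<close> times the divergence.\<close>

lemma nn_integral_lr_process_le_1:
  assumes \<theta>: "\<theta> \<in> Theta P"
  shows "(\<integral>\<^sup>+\<omega>. lr_process \<theta> t \<omega> \<partial>M) \<le> 1"
proof (induction t)
  case 0
  then show ?case by (simp add: lr_process_def emeasure_space_1)
next
  case (Suc t)
  interpret T: two_models P \<theta> \<theta>s using \<theta> by unfold_locales
  let ?Y = "lr_process \<theta> t" and ?g = "\<lambda>a x. ennreal (lr_factor \<theta> a x)"
  let ?G = "\<lambda>a \<omega>. if \<omega> \<in> act_event (Suc t) a then ?g a (X (Suc t) \<omega>) else 0"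
  have YM: "?Y \<in> borel_measurable M" by (rule measurable_F[OF lr_process_measurable])
  have GM: "a \<in> actions P \<Longrightarrow> ?G a \<in> borel_measurable M" for a
    by (rule measurable_F[OF measurable_action_observation(2)]) (rule lr_factor_measurable)
  have "(\<integral>\<^sup>+\<omega>. lr_process \<theta> (Suc t) \<omega> \<partial>M) = (\<integral>\<^sup>+\<omega>. (\<Sum>a\<in>actions P. ?Y \<omega> * ?G a \<omega>) \<partial>M)"
  proof (rule nn_integral_cong)
    fix \<omega> assume w: "\<omega> \<in> space M"
    show "lr_process \<theta> (Suc t) \<omega> = (\<Sum>a\<in>actions P. ?Y \<omega> * ?G a \<omega>)"
      unfolding sum_distrib_left[symmetric] sum_actions_indicator[OF w]
      by (simp add: lr_process_def mult.commute)
  qed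
  also have "\<dots> = (\<Sum>a\<in>actions P. (\<integral>\<^sup>+\<omega>. ?Y \<omega> * ?G a \<omega> \<partial>M))"
    using YM GM by (intro nn_integral_sum borel_measurable_times_ennreal) auto
  also have "\<dots> = (\<Sum>a\<in>actions P. (\<integral>\<^sup>+\<omega>. ?Y \<omega> * indicator (act_event (Suc t) a) \<omega> \<partial>M) * (\<integral>\<^sup>+x. ?g a x \<partial>law \<theta>s a))"
    by (intro sum.cong refl nn_integral_observation lr_process_measurable lr_factor_measurable)
  also have "\<dots> \<le> (\<Sum>a\<in>actions P. (\<integral>\<^sup>+\<omega>. ?Y \<omega> * indicator (act_event (Suc t) a) \<omega> \<partial>M) * 1)"
  proof (intro sum_mono mult_left_mono)
    fix a
    have pm: "(\<lambda>x. ennreal (sqrt (pdf \<theta> a x / pdf \<theta>s a x))) \<in> borel_measurable (law \<theta>s a)"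
    proof -
      note [measurable] = borel_measurable_pdf[of \<theta> a] borel_measurable_pdf[of \<theta>s a]
      show ?thesis by (subst measurable_cong_sets[OF sets_law refl]) measurable
    qed
    let ?k = "kappa_B P * KL a \<theta> \<theta>s"
    have "(\<integral>\<^sup>+x. ?g a x \<partial>law \<theta>s a) = (\<integral>\<^sup>+x. ennreal (exp ?k) * ennreal (sqrt (pdf \<theta> a x / pdf \<theta>s a x)) \<partial>law \<theta>s a)"
      by (simp add: lr_factor_def ennreal_mult' mult.commute)
    also have "\<dots> = ennreal (exp ?k) * (\<integral>\<^sup>+x. ennreal (sqrt (pdf \<theta> a x / pdf \<theta>s a x)) \<partial>law \<theta>s a)"
      by (rule nn_integral_cmult[OF pm])
    also have "\<dots> \<le> ennreal (exp ?k) * ennreal (exp (- ?k))"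
      by (intro mult_left_mono T.affinity_le) simp
    also have "\<dots> = 1" by (simp add: ennreal_mult[symmetric] exp_add[symmetric])
    finally show "(\<integral>\<^sup>+x. ?g a x \<partial>law \<theta>s a) \<le> 1" .
  qed simp
  also have "\<dots> = (\<integral>\<^sup>+\<omega>. (\<Sum>a\<in>actions P. ?Y \<omega> * indicator (act_event (Suc t) a) \<omega>) \<partial>M)"
    using YM act_event_M by (subst nn_integral_sum) auto
  also have "\<dots> = (\<integral>\<^sup>+\<omega>. ?Y \<omega> \<partial>M)"
  proof (rule nn_integral_cong)
    fix \<omega> assume w: "\<omega> \<in> space M"
    have "(\<Sum>a\<in>actions P. ?Y \<omega> * indicator (act_event (Suc t) a) \<omega>) = ?Y \<omega> * (\<Sum>a\<in>actions P. if \<omega> \<in> act_event (Suc t) a then 1 else 0)"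
      unfolding sum_distrib_left by (intro sum.cong) (auto simp: indicator_def)
    then show "(\<Sum>a\<in>actions P. ?Y \<omega> * indicator (act_event (Suc t) a) \<omega>) = ?Y \<omega>"
      unfolding sum_actions_indicator[OF w] by simp
  qed
  also note Suc
  finally show ?case .
qed

definition cum_KL :: "nat \<Rightarrow> 'w \<Rightarrow> 'n model \<Rightarrow> real" where
  "cum_KL t \<omega> \<theta> = (\<Sum>s=1..t. KL (act s \<omega>) \<theta> \<theta>s)"

lemma lr_process_eq:
  assumes \<theta>: "\<theta> \<in> Theta P"
  shows "lr_process \<theta> t \<omega> = ennreal (exp ((loglik (\<lambda>s. act s \<omega>) (\<lambda>s. X s \<omega>) t \<theta> - loglik (\<lambda>s. act s \<omega>) (\<lambda>s. X s \<omega>) t \<theta>s) / 2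
    + kappa_B P * cum_KL t \<omega> \<theta>))"
proof -
  interpret T: valid_model P \<theta> using \<theta> by unfold_locales
  have f: "lr_factor \<theta> a x = exp ((ln (pdf \<theta> a x) - ln (pdf \<theta>s a x)) / 2 + kappa_B P * KL a \<theta> \<theta>s)" for a x
  proof -
    have "sqrt (pdf \<theta> a x / pdf \<theta>s a x) = exp ((ln (pdf \<theta> a x) - ln (pdf \<theta>s a x)) / 2)"
    proof (rule real_sqrt_unique)
      have "(exp ((ln (pdf \<theta> a x) - ln (pdf \<theta>s a x)) / 2))\<^sup>2 = exp (ln (pdf \<theta> a x) - ln (pdf \<theta>s a x))"
        by (simp add: power2_eq_square mult_exp_exp)
      then show "(exp ((ln (pdf \<theta> a x) - ln (pdf \<theta>s a x)) / 2))\<^sup>2 = pdf \<theta> a x / pdf \<theta>s a x"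
        using T.pdf_pos pdf_pos by (simp add: exp_diff)
    qed simp
    then show ?thesis by (simp add: lr_factor_def exp_add)
  qed
  have "lr_process \<theta> t \<omega> = ennreal (exp (\<Sum>s=1..t. (ln (pdf \<theta> (act s \<omega>) (X s \<omega>)) - ln (pdf \<theta>s (act s \<omega>) (X s \<omega>))) / 2
      + kappa_B P * KL (act s \<omega>) \<theta> \<theta>s))"
    unfolding lr_process_def f by (simp add: prod_ennreal exp_sum)
  then show ?thesis
    by (simp add: sum.distrib sum_divide_distrib[symmetric] sum_subtractf sum_distrib_left[symmetric] loglik_def cum_KL_def)
qed

lemma est_Theta: "1 \<le> t \<Longrightarrow> \<omega> \<in> space M \<Longrightarrow> est t \<omega> \<in> Theta P"
  using estimation by (auto simp: is_arg_max_def)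

lemma loglik_est_ge: "1 \<le> t \<Longrightarrow> \<omega> \<in> space M \<Longrightarrow>
  loglik (\<lambda>s. act s \<omega>) (\<lambda>s. X s \<omega>) t \<theta>s \<le> loglik (\<lambda>s. act s \<omega>) (\<lambda>s. X s \<omega>) t (est t \<omega>)"
  using estimation[of t \<omega>] model unfolding is_arg_max_def not_less[symmetric] by blast

text \<open>The bad outcomes are covered by finitely many explicit events: a large process for some
  net point, or a large observation in some round. If \<open>f_raw\<close> exceeds 1, the whole
  space will do.\<close>

theorem cum_KL_tail:
  assumes t: "1 \<le> t" and x: "0 \<le> x"
  obtains E where "E \<in> sets M" "measure M E \<le> f_fun P t x" "\<And>\<omega>. \<omega> \<in> space M \<Longrightarrow> x \<le> cum_KL t \<omega> (est t \<omega>) \<Longrightarrow> \<omega> \<in> E"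
proof (cases "f_raw t x \<le> 1")
  case False
  then show ?thesis by (intro that[of "space M"]) (auto simp: f_fun_def prob_space)
next
  case True
  let ?z = "z_fun P t x" and ?\<zeta> = "zeta_fun P t x" and ?q = "real (q_dim P)" and ?k = "kappa_B P"
  have z: "?z > 0" by (rule z_fun_pos[OF x t])
  have zp: "?\<zeta> > 0" by (rule zeta_fun_pos[OF x t])
  obtain T where T: "finite T" "T \<subseteq> Theta P" "real (card T) \<le> cover P ?\<zeta>"
    "\<And>\<theta>. \<theta> \<in> Theta P \<Longrightarrow> \<exists>\<theta>'\<in>T. \<forall>a\<in>actions P. model_dist a \<theta> \<theta>' \<le> ?\<zeta>"
    by (rule model_net[OF zp]) blast
  \<comment> \<open>The Markov level is lowered by the \<open>?q\<close> that the passage from the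
    estimate to a net point may cost.\<close>
  let ?c = "exp (?k * x - ?q)"
  define A where "A \<theta> = {\<omega>\<in>space M. ennreal ?c \<le> lr_process \<theta> t \<omega>}" for \<theta>
  define B where "B s = {\<omega>\<in>space M. norm (vec_of (observed (act s \<omega>)) (X s \<omega>)) > R_fun P ?z}" for s
  have AM: "A \<theta> \<in> sets M" for \<theta>
    unfolding A_def using measurable_F[OF lr_process_measurable, of \<theta> t] by measurable
  have BM: "B s \<in> sets M" if "s \<in> {1..t}" for s
    unfolding B_def using that z by (intro prob_norm_X_le) auto
  have pA: "measure M (A \<theta>) \<le> exp (?q - ?k * x)" if "\<theta> \<in> T" for \<theta>
  proof -
    have lm: "lr_process \<theta> t \<in> borel_measurable M" by (rule measurable_F[OF lr_process_measurable])
    have "emeasure M (A \<theta>) \<le> emeasure M {\<omega>\<in>space M. 1 \<le> ennreal (exp (?q - ?k * x)) * lr_process \<theta> t \<omega>}"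
    proof (rule emeasure_mono)
      have "1 \<le> ennreal (exp (?q - ?k * x)) * y" if "ennreal ?c \<le> y" for y
      proof -
        have "ennreal (exp (?q - ?k * x)) * ennreal ?c \<le> ennreal (exp (?q - ?k * x)) * y"
          using that by (rule mult_left_mono) simp
        moreover have "ennreal (exp (?q - ?k * x)) * ennreal ?c = 1"
          by (simp add: ennreal_mult[symmetric] mult_exp_exp)
        ultimately show ?thesis by simp
      qed
      then show "A \<theta> \<subseteq> {\<omega>\<in>space M. 1 \<le> ennreal (exp (?q - ?k * x)) * lr_process \<theta> t \<omega>}"
        by (auto simp: A_def)
      show "{\<omega>\<in>space M. 1 \<le> ennreal (exp (?q - ?k * x)) * lr_process \<theta> t \<omega>} \<in> sets M"
        using lm by measurable
    qed
    also have "\<dots> \<le> ennreal (exp (?q - ?k * x)) * (\<integral>\<^sup>+\<omega>. lr_process \<theta> t \<omega> * indicator (space M) \<omega> \<partial>M)"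
      using lm by (intro nn_integral_Markov_inequality) auto
    also have "\<dots> = ennreal (exp (?q - ?k * x)) * (\<integral>\<^sup>+\<omega>. lr_process \<theta> t \<omega> \<partial>M)"
      by (simp add: nn_integral_set_ennreal cong: nn_integral_cong)
    also have "\<dots> \<le> ennreal (exp (?q - ?k * x)) * 1"
      using that T(2) by (intro mult_left_mono nn_integral_lr_process_le_1) auto
    finally show ?thesis by (simp add: emeasure_eq_measure)
  qed
  have pB: "measure M (B s) \<le> exp (- ?z)" if "s \<in> {1..t}" for s
    unfolding B_def using that z by (intro prob_norm_X_le) auto
  show ?thesis
  proof (rule that[of "(\<Union>\<theta>\<in>T. A \<theta>) \<union> (\<Union>s\<in>{1..t}. B s)"])
    show "(\<Union>\<theta>\<in>T. A \<theta>) \<union> (\<Union>s\<in>{1..t}. B s) \<in> sets M"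
      using AM BM T(1) by (intro sets.Un sets.finite_UN) auto
    have "measure M ((\<Union>\<theta>\<in>T. A \<theta>) \<union> (\<Union>s\<in>{1..t}. B s)) \<le> measure M (\<Union>\<theta>\<in>T. A \<theta>) + measure M (\<Union>s\<in>{1..t}. B s)"
      using AM BM T(1) by (intro measure_Un_le sets.finite_UN) auto
    also have "\<dots> \<le> (\<Sum>\<theta>\<in>T. measure M (A \<theta>)) + (\<Sum>s\<in>{1..t}. measure M (B s))"
      using AM BM T(1) by (intro add_mono finite_measure_subadditive_finite) auto
    also have "\<dots> \<le> (\<Sum>\<theta>\<in>T. exp (?q - ?k * x)) + (\<Sum>s\<in>{1..t}. exp (- ?z))"
      by (intro add_mono sum_mono pA pB) auto
    also have "\<dots> = real (card T) * exp (?q - ?k * x) + real t * exp (- ?z)" by simp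
    also have "\<dots> \<le> cover P ?\<zeta> * exp (?q - ?k * x) + exp (- ?k * x)"
    proof (intro add_mono mult_right_mono T(3))
      \<comment> \<open>The logarithm in \<open>z_fun\<close> leaves
        \<open>t / (t + 1)\<^sup>2\<close>, at most 1, after the union over \<open>t\<close>
        rounds.\<close>
      have "exp (- ?z) = exp (- ?k * x) * exp (- (2 * ln (real t + 1)))"
        by (simp add: z_fun_def mult_exp_exp)
      also have "exp (- (2 * ln (real t + 1))) = 1 / (real t + 1)\<^sup>2"
        by (simp add: exp_minus exp_double power2_eq_square divide_inverse)
      finally have e: "exp (- ?z) = exp (- ?k * x) * (1 / (real t + 1)\<^sup>2)" .
      have "real t * (1 / (real t + 1)\<^sup>2) \<le> 1"
        by (simp add: divide_le_eq power2_eq_square algebra_simps)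
      then have "exp (- ?k * x) * (real t * (1 / (real t + 1)\<^sup>2)) \<le> exp (- ?k * x) * 1"
        by (intro mult_left_mono) auto
      then show "real t * exp (- ?z) \<le> exp (- ?k * x)" unfolding e by (simp add: mult_ac)
    qed simp
    also have "\<dots> = f_raw t x" by (simp add: exp_diff exp_minus field_simps)
    also have "\<dots> = f_fun P t x" using True by (simp add: f_fun_def)
    finally show "measure M ((\<Union>\<theta>\<in>T. A \<theta>) \<union> (\<Union>s\<in>{1..t}. B s)) \<le> f_fun P t x" .
    fix \<omega> assume w: "\<omega> \<in> space M" and S: "x \<le> cum_KL t \<omega> (est t \<omega>)"
    show "\<omega> \<in> (\<Union>\<theta>\<in>T. A \<theta>) \<union> (\<Union>s\<in>{1..t}. B s)"
    proof (cases "\<omega> \<in> (\<Union>s\<in>{1..t}. B s)")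
      case False
      then have R: "norm (vec_of (observed (act s \<omega>)) (X s \<omega>)) \<le> R_fun P ?z" if "s \<in> {1..t}" for s
        using that w by (auto simp: B_def not_less)
      let ?\<theta> = "est t \<omega>"
      have est: "?\<theta> \<in> Theta P" by (rule est_Theta[OF t w])
      obtain \<theta>' where \<theta>': "\<theta>' \<in> T" "\<And>a. a \<in> actions P \<Longrightarrow> model_dist a ?\<theta> \<theta>' \<le> ?\<zeta>"
        using T(4)[OF est] by blast
      then have \<theta>'T: "\<theta>' \<in> Theta P" using T(2) by blast
      interpret D: two_models P ?\<theta> \<theta>' using est \<theta>'T by unfold_locales
      \<comment> \<open>One round of moving to the net point costs half of \<open>L_ell\<close>,
        because of the square root, plus \<open>kappa_B\<close> times \<open>L_KL\<close>, each
        times the radius.\<close>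
      have step: "((ln (pdf ?\<theta> (act s \<omega>) (X s \<omega>)) / 2 + ?k * KL (act s \<omega>) ?\<theta> \<theta>s)
          - (ln (pdf \<theta>' (act s \<omega>) (X s \<omega>)) / 2 + ?k * KL (act s \<omega>) \<theta>' \<theta>s)) \<le> H_of ?z * ?\<zeta>" if s: "s \<in> {1..t}" for s
      proof -
        let ?a = "act s \<omega>"
        have a: "?a \<in> actions P" using act_in[OF w] s by simp
        have Lp: "L_ell P (R_fun P ?z) \<ge> 0" using L_ell_pos R_fun_pos z by (simp add: less_imp_le)
        have 1: "\<bar>ln (pdf ?\<theta> ?a (X s \<omega>)) - ln (pdf \<theta>' ?a (X s \<omega>))\<bar> \<le> L_ell P (R_fun P ?z) * ?\<zeta>"
          using D.ln_pdf_lipschitz[OF a R[OF s]] mult_left_mono[OF \<theta>'(2)[OF a] Lp] by linarith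
        have 2: "\<bar>KL ?a ?\<theta> \<theta>s - KL ?a \<theta>' \<theta>s\<bar> \<le> L_KL P * ?\<zeta>"
          using KL_lipschitz[OF est \<theta>'T model a] mult_left_mono[OF \<theta>'(2)[OF a] less_imp_le[OF L_KL_pos]] by linarith
        have "?k * (KL ?a ?\<theta> \<theta>s - KL ?a \<theta>' \<theta>s) \<le> ?k * (L_KL P * ?\<zeta>)"
          using 2 kappa_B_pos by (intro mult_left_mono) auto
        moreover have "(u / 2 + k * v) - (u' / 2 + k * v') \<le> (l / 2 + k * m) * y"
          if "\<bar>u - u'\<bar> \<le> l * y" "k * (v - v') \<le> k * (m * y)" for u u' k v v' l m y :: real
          using that by (simp add: algebra_simps)
        ultimately show ?thesis using 1 unfolding H_of_def by blast
      qed
      let ?ll = "loglik (\<lambda>s. act s \<omega>) (\<lambda>s. X s \<omega>) t"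
      have "(?ll ?\<theta> / 2 + ?k * cum_KL t \<omega> ?\<theta>) - (?ll \<theta>' / 2 + ?k * cum_KL t \<omega> \<theta>') =
        (\<Sum>s=1..t. (ln (pdf ?\<theta> (act s \<omega>) (X s \<omega>)) / 2 + ?k * KL (act s \<omega>) ?\<theta> \<theta>s)
          - (ln (pdf \<theta>' (act s \<omega>) (X s \<omega>)) / 2 + ?k * KL (act s \<omega>) \<theta>' \<theta>s))"
        by (simp add: loglik_def cum_KL_def sum_subtractf sum.distrib sum_divide_distrib sum_distrib_left)
      also have "\<dots> \<le> (\<Sum>s=1..t. H_of ?z * ?\<zeta>)" by (intro sum_mono step)
      also have "\<dots> = real t * H_of ?z * ?\<zeta>" by simp
      \<comment> \<open>The radius \<open>zeta_fun\<close> is chosen for this bound on the cost of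
        all \<open>t\<close> rounds.\<close>
      also have "\<dots> \<le> ?q"
      proof -
        have Hp: "real t * H_of ?z > 0" using t H_of_pos[of ?z] z by simp
        have "?\<zeta> \<le> ?q / (real t * H_of ?z)" by (simp add: zeta_fun_def H_fun_eq)
        then show ?thesis using Hp by (simp add: pos_le_divide_eq mult.commute)
      qed
      finally have diff: "(?ll ?\<theta> / 2 + ?k * cum_KL t \<omega> ?\<theta>) - (?ll \<theta>' / 2 + ?k * cum_KL t \<omega> \<theta>') \<le> ?q" .
      have "?k * x \<le> ?k * cum_KL t \<omega> ?\<theta>" using S kappa_B_pos by simp
      moreover have "k - q \<le> (l' - l0) / 2 + c'"
        if "(l / 2 + c) - (l' / 2 + c') \<le> q" "k \<le> c" "l0 \<le> l" for k q l l' l0 c c' :: real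
        using that by argo
      ultimately have "?k * x - ?q \<le> (?ll \<theta>' - ?ll \<theta>s) / 2 + ?k * cum_KL t \<omega> \<theta>'"
        using diff loglik_est_ge[OF t w] by blast
      then have "ennreal ?c \<le> lr_process \<theta>' t \<omega>"
        unfolding lr_process_eq[OF \<theta>'T] by (intro ennreal_leI) simp
      then show ?thesis using \<theta>'(1) w by (auto simp: A_def)
    qed blast
  qed
qed

end

section \<open>Measurability of the stopping statistic\<close>

lemma continuous_on_matrix_mult [continuous_intros]:
  fixes f g :: "'a::topological_space \<Rightarrow> real^'n^'n"
  shows "continuous_on S f \<Longrightarrow> continuous_on S g \<Longrightarrow> continuous_on S (\<lambda>x. f x ** g x)"
  unfolding matrix_matrix_mult_def by (intro continuous_intros)

lemma continuous_on_matrix_vector [continuous_intros]: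
  fixes f :: "'a::topological_space \<Rightarrow> real^'n^'n"
  shows "continuous_on S f \<Longrightarrow> continuous_on S g \<Longrightarrow> continuous_on S (\<lambda>x. f x *v g x)"
  unfolding matrix_vector_mult_def by (intro continuous_intros)

lemma continuous_on_transpose [continuous_intros]:
  fixes f :: "'a::topological_space \<Rightarrow> real^'n^'n"
  shows "continuous_on S f \<Longrightarrow> continuous_on S (\<lambda>x. transpose (f x))"
  unfolding transpose_def by (intro continuous_intros)

lemma continuous_on_det [continuous_intros]:
  fixes f :: "'a::topological_space \<Rightarrow> real^'n^'n"
  shows "continuous_on S f \<Longrightarrow> continuous_on S (\<lambda>x. det (f x))"
  unfolding det_def by (intro continuous_intros)

lemma continuous_on_blk [continuous_intros]:
  fixes f :: "'a::topological_space \<Rightarrow> real^'n^'n"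
  assumes "continuous_on S f"
  shows "continuous_on S (\<lambda>x. blk R (f x))"
  unfolding blk_def
proof (intro continuous_on_vec_lambda)
  fix i k
  show "continuous_on S (\<lambda>x. if i \<in> R \<and> k \<in> R then f x $ i $ k else if i = k then 1 else 0)"
    by (cases "i \<in> R \<and> k \<in> R") (auto intro!: continuous_intros assms)
qed

text \<open>Continuity is stated along a family because a model contains its graph, a discrete
  component; the divergence is then continuous along pairs of families over one parameter
  space.\<close>

locale model_family = valid_params P for P :: "'n::finite pars" +
  fixes S :: "'a::topological_space set" and f :: "'a \<Rightarrow> 'n model"
  assumes fam: "\<And>x. x \<in> S \<Longrightarrow> f x \<in> Theta P"
    and cont_coef: "continuous_on S (\<lambda>x. coef (f x))" and cont_noise: "continuous_on S (\<lambda>x. noise (f x))"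
begin

lemma valid_model: "x \<in> S \<Longrightarrow> valid_model P (f x)"
  by unfold_locales (rule fam)

lemma cont_sd: "continuous_on S (\<lambda>x. sd (f x) a i)"
  unfolding sd_def by (intro continuous_intros cont_noise)

lemma cont_whiten: "continuous_on S (\<lambda>x. whiten (f x) a)"
proof -
  have "continuous_on S (\<lambda>x. diag (\<lambda>i. 1 / sd (f x) a i))"
    unfolding diag_def
  proof (intro continuous_on_vec_lambda)
    fix i j
    have "continuous_on S (\<lambda>x. 1 / sd (f x) a i)"
      using valid_model.sd_bounds(4)[OF valid_model] by (intro continuous_intros cont_sd) (auto simp: less_imp_neq[symmetric])
    then show "continuous_on S (\<lambda>x. if i = j then 1 / sd (f x) a i else 0)"
      by (cases "i = j") (auto intro!: continuous_intros)
  qed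
  then show ?thesis unfolding whiten_def by (intro continuous_intros cont_coef)
qed

text \<open>The terminating Neumann series is a polynomial in the coefficients, which gives
  continuity without inverting a matrix.\<close>

lemma cont_resolvent: "continuous_on S (\<lambda>x. resolvent (f x) a)"
proof -
  have B: "continuous_on S (\<lambda>x. coef_on (observed a) (f x))"
    unfolding coef_on_def
  proof (intro continuous_on_vec_lambda)
    fix i k
    show "continuous_on S (\<lambda>x. if i \<in> observed a \<and> k \<in> observed a then coef (f x) $ i $ k else 0)"
      by (cases "i \<in> observed a \<and> k \<in> observed a") (auto intro!: continuous_intros cont_coef)
  qed
  have pow: "continuous_on S (\<lambda>x. ((*v) (coef_on (observed a) (f x)) ^^ m) v)" for m v
    by (induction m) (auto intro!: continuous_intros B)
  have "continuous_on S (\<lambda>x. \<chi> i j. (\<Sum>k<CARD('n). ((*v) (coef_on (observed a) (f x)) ^^ k) (axis j 1)) $ i)"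
    by (intro continuous_intros pow)
  moreover have "resolvent (f x) a = (\<chi> i j. (\<Sum>k<CARD('n). ((*v) (coef_on (observed a) (f x)) ^^ k) (axis j 1)) $ i)" if "x \<in> S" for x
    unfolding valid_model.resolvent_series[OF valid_model[OF that], symmetric]
    by (simp add: matrix_vector_mult_basis column_def vec_eq_iff)
  ultimately show ?thesis by (subst continuous_on_cong[OF refl]) auto
qed

lemma cont_cov: "continuous_on S (\<lambda>x. cov (f x) a)"
  unfolding cov_def by (intro continuous_intros cont_resolvent cont_noise)

lemma cont_mean: "continuous_on S (\<lambda>x. mean (f x) a)"
proof (cases a)
  case (Do j u)
  have "continuous_on S (\<lambda>x. \<chi> k. if k \<in> observed a then coef (f x) $ k $ j * u else 0)"
  proof (intro continuous_on_vec_lambda)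
    fix k show "continuous_on S (\<lambda>x. if k \<in> observed a then coef (f x) $ k $ j * u else 0)"
      by (cases "k \<in> observed a") (auto intro!: continuous_intros cont_coef)
  qed
  from continuous_on_matrix_vector[OF cont_resolvent this, of a] show ?thesis
    by (simp add: mean_def Do)
qed (simp add: mean_def)

lemma cont_ln_det: "continuous_on S (\<lambda>x. ln \<bar>det (whiten (f x) a)\<bar>)"
  using valid_model.det_whiten[OF valid_model] by (intro continuous_intros cont_whiten) auto

end

lemma continuous_on_weighted_KL:
  assumes "model_family P S f" "model_family P S g"
  shows "continuous_on S (\<lambda>x. weighted_KL P w (f x) (g x))"
proof -
  interpret f: model_family P S f by fact
  interpret g: model_family P S g by fact
  have "continuous_on S (\<lambda>x. KL a (f x) (g x))" for a
  proof -
    have "KL a (f x) (g x) = (prec (g x) a \<bullet> cov (f x) a - real CARD('a)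
        + (norm (whiten (g x) a *v (mean (f x) a - mean (g x) a)))\<^sup>2) / 2 + ln \<bar>det (whiten (f x) a)\<bar> - ln \<bar>det (whiten (g x) a)\<bar>"
      if "x \<in> S" for x
    proof -
      interpret two_models P "f x" "g x"
        using f.fam[OF that] g.fam[OF that] by unfold_locales
      show ?thesis by (rule KL_eq)
    qed
    moreover have "continuous_on S (\<lambda>x. (prec (g x) a \<bullet> cov (f x) a - real CARD('a)
        + (norm (whiten (g x) a *v (mean (f x) a - mean (g x) a)))\<^sup>2) / 2 + ln \<bar>det (whiten (f x) a)\<bar> - ln \<bar>det (whiten (g x) a)\<bar>)"
      by (intro continuous_intros f.cont_cov f.cont_mean f.cont_ln_det g.cont_whiten g.cont_mean g.cont_ln_det) simp_all
    ultimately show ?thesis by (subst continuous_on_cong[OF refl]) auto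
  qed
  then show ?thesis unfolding weighted_KL_def by (intro continuous_intros)
qed

section \<open>Compact sets of models with a fixed graph\<close>

lemma max_norm_ge_iff: "max_norm M \<ge> r \<longleftrightarrow> (\<exists>j k. \<bar>M $ j $ k\<bar> \<ge> r)"
  unfolding max_norm_def by (subst Max_ge_iff) auto

context valid_params
begin

definition slice :: "('n \<times> 'n) set \<Rightarrow> ((real^'n^'n) \<times> (real^'n^'n)) set" where
  "slice D = {y. (D, y) \<in> Theta P}"

text \<open>Fixing the graph makes all constraints closed: the bound \<open>beta_min\<close>
  replaces the open condition that edge coefficients are nonzero.\<close>

lemma compact_slice: "compact (slice D)"
proof (cases "acyclic D")
  case False
  then have "slice D = {}" by (auto simp: slice_def Theta_def)
  then show ?thesis by simp
next
  case True
  let ?E = "\<lambda>j k. if (k, j) \<in> D then {y. beta_min P \<le> \<bar>fst y $ j $ k\<bar>} \<inter> {y. \<bar>fst y $ j $ k\<bar> \<le> A_max P}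
    else {y::(real^'n^'n) \<times> (real^'n^'n). fst y $ j $ k = 0}"
  let ?N = "\<lambda>j k. if j = k then {y. (sigma_min P)\<^sup>2 \<le> snd y $ j $ j} \<inter> {y. snd y $ j $ j \<le> (sigma_max P)\<^sup>2}
    else {y::(real^'n^'n) \<times> (real^'n^'n). snd y $ j $ k = 0}"
  have eq: "slice D = (\<Inter>j. \<Inter>k. ?E j k \<inter> ?N j k)"
  proof (intro set_eqI iffI)
    fix y assume "y \<in> slice D"
    then show "y \<in> (\<Inter>j. \<Inter>k. ?E j k \<inter> ?N j k)" by (auto simp: slice_def Theta_def)
  next
    fix y assume y: "y \<in> (\<Inter>j. \<Inter>k. ?E j k \<inter> ?N j k)"
    then have E: "y \<in> ?E j k" and N: "y \<in> ?N j k" for j k by auto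
    have "fst y $ j $ k \<noteq> 0 \<longleftrightarrow> (k, j) \<in> D" for j k
      using E[of k j] pos(1) by (cases "(k, j) \<in> D") (auto simp del: pos)
    moreover have "beta_min P \<le> \<bar>fst y $ j $ k\<bar> \<and> \<bar>fst y $ j $ k\<bar> \<le> A_max P" if "fst y $ j $ k \<noteq> 0" for j k
      using E[of k j] that by (cases "(k, j) \<in> D") auto
    moreover have "snd y $ j $ k = 0" if "j \<noteq> k" for j k using N[of j k] that by simp
    moreover have "(sigma_min P)\<^sup>2 \<le> snd y $ j $ j \<and> snd y $ j $ j \<le> (sigma_max P)\<^sup>2" for j using N[of j j] by simp
    ultimately show "y \<in> slice D" using True unfolding slice_def Theta_def by simp
  qed
  have cl: "closed (?E j k)" "closed (?N j k)" for j k
    by (auto intro!: closed_Int closed_Collect_le closed_Collect_eq continuous_intros)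
  have "closed (slice D)"
    unfolding eq by (intro closed_INT ballI closed_Int cl)
  moreover have "bounded (slice D)"
  proof (rule boundedI)
    fix y assume "y \<in> slice D"
    then have y: "(D, y) \<in> Theta P" by (simp add: slice_def)
    interpret valid_model P "(D, y)" using y by unfold_locales
    have "norm (fst y $ i) \<le> sqrt (real CARD('n)) * A_max P" for i
      using coef_le by (intro norm_vec_le_card) auto
    then have 1: "norm (fst y) \<le> sqrt (real CARD('n)) * (sqrt (real CARD('n)) * A_max P)" by (rule norm_vec_le_card)
    have "norm (snd y $ i $ k) \<le> (sigma_max P)\<^sup>2" for i k
    proof (cases "i = k")
      case True
      then show ?thesis
        using noise_bounds[of i] order_trans[OF zero_le_power2 noise_bounds(1)[of i]] by simp
    next
      case False
      then show ?thesis using noise_offdiag[of i k] by simp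
    qed
    then have "norm (snd y $ i) \<le> sqrt (real CARD('n)) * (sigma_max P)\<^sup>2" for i by (rule norm_vec_le_card)
    then have 2: "norm (snd y) \<le> sqrt (real CARD('n)) * (sqrt (real CARD('n)) * (sigma_max P)\<^sup>2)" by (rule norm_vec_le_card)
    show "norm y \<le> sqrt (real CARD('n)) * (sqrt (real CARD('n)) * A_max P) + sqrt (real CARD('n)) * (sqrt (real CARD('n)) * (sigma_max P)\<^sup>2)"
      using 1 2 norm_Pair_le[of "fst y" "snd y"] by simp
  qed
  ultimately show ?thesis by (simp add: compact_eq_bounded_closed)
qed

text \<open>The statistic is below \<open>y\<close> exactly when the estimate lies in such a set for
  some rational \<open>r\<close> below \<open>y\<close>, with the play counts as weights.\<close>

definition alt_sublevel :: "real \<Rightarrow> ('n action \<Rightarrow> real) \<Rightarrow> real \<Rightarrow> ('n \<times> 'n) set \<Rightarrow> ((real^'n^'n) \<times> (real^'n^'n)) set" where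
  "alt_sublevel e w r D = {y \<in> slice D. \<exists>\<nu>\<in>Alt P e (D, y). weighted_KL P w (D, y) \<nu> \<le> r}"

text \<open>The sublevel set is a finite union of projections of compact sets.\<close>

lemma closed_alt_sublevel: "closed (alt_sublevel e w r D)"
proof -
  let ?S = "\<lambda>D'. slice D \<times> slice D'"
  let ?g = "\<lambda>D' z. weighted_KL P w (D, fst z) (D', snd z)"
  \<comment> \<open>A different graph already makes an alternative; with the same graph some
    coefficient has to move, and finitely many closed conditions express this.\<close>
  let ?J = "\<lambda>D'. if D' \<noteq> D then UNIV else (\<Union>j. \<Union>k. {z. e \<le> \<bar>(fst (snd z) - fst (fst z)) $ j $ k\<bar>})"
  let ?K = "\<lambda>D'. {z \<in> ?S D'. ?g D' z \<le> r} \<inter> ?J D'"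
  have K: "compact (?K D')" for D'
  proof (rule compact_Int_closed)
    have c: "compact (?S D')" by (intro compact_Times compact_slice)
    have "model_family P (?S D') (\<lambda>z. (D, fst z))" "model_family P (?S D') (\<lambda>z. (D', snd z))"
      by (unfold_locales; auto simp: slice_def intro!: continuous_intros)+
    then have "continuous_on (?S D') (?g D')" by (rule continuous_on_weighted_KL)
    then have "closed {z \<in> ?S D'. ?g D' z \<le> r}"
      using compact_imp_closed[OF c] by (intro continuous_on_closed_Collect_le continuous_on_const)
    then have "compact (?S D' \<inter> {z \<in> ?S D'. ?g D' z \<le> r})"
      by (rule compact_Int_closed[OF c])
    moreover have "?S D' \<inter> {z \<in> ?S D'. ?g D' z \<le> r} = {z \<in> ?S D'. ?g D' z \<le> r}" by blast
    ultimately show "compact {z \<in> ?S D'. ?g D' z \<le> r}" by simp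
    show "closed (?J D')"
      by (auto intro!: closed_UN closed_Collect_le continuous_intros)
  qed
  have alt: "(D', y') \<in> Alt P e (D, y) \<longleftrightarrow> y' \<in> slice D' \<and> (y, y') \<in> ?J D'" for D' y y'
    by (cases "D' = D") (simp_all add: slice_def Alt_def max_norm_ge_iff)
  have "alt_sublevel e w r D = (\<Union>D'. fst ` ?K D')"
  proof (intro set_eqI iffI)
    fix y assume "y \<in> alt_sublevel e w r D"
    then obtain \<nu> where y: "y \<in> slice D" and \<nu>0: "\<nu> \<in> Alt P e (D, y)" "weighted_KL P w (D, y) \<nu> \<le> r"
      unfolding alt_sublevel_def by blast
    obtain D' y' where n: "\<nu> = (D', y')" by (rule prod.exhaust)
    note \<nu> = \<nu>0[unfolded n]
    have "(y, y') \<in> {z \<in> ?S D'. ?g D' z \<le> r}" using y \<nu>(2) \<nu>(1)[unfolded alt] by simp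
    moreover have "(y, y') \<in> ?J D'" using \<nu>(1)[unfolded alt] by (rule conjunct2)
    ultimately have "(y, y') \<in> ?K D'" by (rule IntI)
    then have "fst (y, y') \<in> fst ` ?K D'" by (rule imageI)
    then show "y \<in> (\<Union>D'. fst ` ?K D')" unfolding fst_conv by (rule UN_I[OF UNIV_I])
  next
    fix y assume "y \<in> (\<Union>D'. fst ` ?K D')"
    then obtain D' where "y \<in> fst ` ?K D'" by (rule UN_E)
    then obtain z where yz: "y = fst z" and z: "z \<in> ?K D'" by (rule imageE)
    have zJ: "z \<in> ?J D'" using z by (rule IntD2)
    have zS: "fst z \<in> slice D" "snd z \<in> slice D'" "?g D' z \<le> r"
      using IntD1[OF z] by (simp_all add: mem_Times_iff)
    have "(D', snd z) \<in> Alt P e (D, y)"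
      unfolding alt yz prod.collapse using zS(2) zJ by (rule conjI)
    then show "y \<in> alt_sublevel e w r D" unfolding alt_sublevel_def yz using zS(1,3) by blast
  qed
  moreover have "closed (\<Union>D'. fst ` ?K D')"
  proof (intro closed_UN ballI)
    fix D'
    show "closed (fst ` ?K D')"
      by (intro compact_imp_closed compact_continuous_image K continuous_intros)
  qed simp
  ultimately show ?thesis by simp
qed

end

lemma borel_measurable_f_fun: "f_fun P t \<in> borel_measurable borel"
  unfolding f_fun_def[abs_def] cover_def zeta_fun_def H_fun_def L_ell_def R_fun_def z_fun_def by measurable

context focus_analysis
begin

abbreviation statistic :: "nat \<Rightarrow> 'w \<Rightarrow> ereal" where
  "statistic t \<omega> \<equiv> stop_stat P \<epsilon> (\<lambda>s. act s \<omega>) (\<lambda>s. est s \<omega>) t"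

lemma est_events:
  assumes t: "1 \<le> t"
  shows "{\<omega>\<in>space M. dag (est t \<omega>) = D} \<in> sets M" "(\<lambda>\<omega>. snd (est t \<omega>)) \<in> borel_measurable M"
proof -
  note [measurable] = measurable_F[OF est_measurable[OF t]]
  have "(\<lambda>\<omega>. dag (est t \<omega>)) \<in> M \<rightarrow>\<^sub>M count_space UNIV" by measurable
  then show "{\<omega>\<in>space M. dag (est t \<omega>) = D} \<in> sets M" by measurable
  have "(\<lambda>\<omega>. snd (est t \<omega>)) \<in> M \<rightarrow>\<^sub>M borel \<Otimes>\<^sub>M borel" by measurable
  then show "(\<lambda>\<omega>. snd (est t \<omega>)) \<in> borel_measurable M" by (simp only: borel_prod)
qed

lemma act_event_sets: "1 \<le> s \<Longrightarrow> a \<in> actions P \<Longrightarrow> {\<omega>\<in>space M. act s \<omega> = a} \<in> sets M"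
  using act_event_M[of a "s - 1"] by (simp add: act_event_def)

text \<open>The infimum runs over uncountably many alternatives to a random estimate. Splitting by
  the action history, the graph of the estimate and a rational level leaves countably many
  conditions, each placing the estimate in a closed set.\<close>

lemma statistic_less_iff:
  assumes t: "1 \<le> t" and w: "\<omega> \<in> space M"
  shows "statistic t \<omega> < y \<longleftrightarrow> (\<exists>h\<in>Pi\<^sub>E {1..t} (\<lambda>_. actions P). \<exists>D. \<exists>r\<in>{r\<in>\<rat>. ereal r < y}.
    (\<forall>s\<in>{1..t}. act s \<omega> = h s) \<and> dag (est t \<omega>) = D \<and> snd (est t \<omega>) \<in> alt_sublevel \<epsilon> (\<lambda>a. real (play_count h t a)) r D)"
    (is "_ \<longleftrightarrow> ?R")
proof -
  let ?w = "\<lambda>a. real (play_count (\<lambda>s. act s \<omega>) t a)"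
  have count: "play_count h t a = play_count (\<lambda>s. act s \<omega>) t a" if "\<forall>s\<in>{1..t}. act s \<omega> = h s" for h a
    using that unfolding play_count_def by (intro arg_cong[of _ _ card]) auto
  have "statistic t \<omega> < y \<longleftrightarrow> (\<exists>\<nu>\<in>Alt P \<epsilon> (est t \<omega>). ereal (weighted_KL P ?w (est t \<omega>) \<nu>) < y)"
    unfolding stop_stat_def by (rule INF_less_iff)
  also have "\<dots> \<longleftrightarrow> (\<exists>r\<in>{r\<in>\<rat>. ereal r < y}. \<exists>\<nu>\<in>Alt P \<epsilon> (est t \<omega>). weighted_KL P ?w (est t \<omega>) \<nu> \<le> r)"
  proof
    assume "\<exists>\<nu>\<in>Alt P \<epsilon> (est t \<omega>). ereal (weighted_KL P ?w (est t \<omega>) \<nu>) < y"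
    then obtain \<nu> where \<nu>: "\<nu> \<in> Alt P \<epsilon> (est t \<omega>)" "ereal (weighted_KL P ?w (est t \<omega>) \<nu>) < y" by blast
    from \<nu>(2) obtain q where q: "weighted_KL P ?w (est t \<omega>) \<nu> < real_of_rat q" "ereal (real_of_rat q) < y"
      using ereal_dense3[of "ereal (weighted_KL P ?w (est t \<omega>) \<nu>)" y] by auto
    have "real_of_rat q \<in> {r\<in>\<rat>. ereal r < y}" using q(2) by simp
    then show "\<exists>r\<in>{r\<in>\<rat>. ereal r < y}. \<exists>\<nu>\<in>Alt P \<epsilon> (est t \<omega>). weighted_KL P ?w (est t \<omega>) \<nu> \<le> r"
      by (rule bexI[rotated]) (rule bexI[OF _ \<nu>(1)], rule less_imp_le[OF q(1)])
  next
    assume "\<exists>r\<in>{r\<in>\<rat>. ereal r < y}. \<exists>\<nu>\<in>Alt P \<epsilon> (est t \<omega>). weighted_KL P ?w (est t \<omega>) \<nu> \<le> r"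
    then show "\<exists>\<nu>\<in>Alt P \<epsilon> (est t \<omega>). ereal (weighted_KL P ?w (est t \<omega>) \<nu>) < y"
    proof (elim bexE)
      fix r \<nu> assume a: "r \<in> {r\<in>\<rat>. ereal r < y}" "\<nu> \<in> Alt P \<epsilon> (est t \<omega>)" "weighted_KL P ?w (est t \<omega>) \<nu> \<le> r"
      then have "ereal (weighted_KL P ?w (est t \<omega>) \<nu>) < y"
        using le_less_trans[of "ereal (weighted_KL P ?w (est t \<omega>) \<nu>)" "ereal r" y] by simp
      then show ?thesis by (rule bexI[OF _ a(2)])
    qed
  qed
  also have "\<dots> \<longleftrightarrow> (\<exists>r\<in>{r\<in>\<rat>. ereal r < y}. snd (est t \<omega>) \<in> alt_sublevel \<epsilon> ?w r (dag (est t \<omega>)))"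
    using est_Theta[OF t w] unfolding alt_sublevel_def slice_def mem_Collect_eq prod.collapse by blast
  also have "\<dots> \<longleftrightarrow> ?R"
  proof
    assume L: "\<exists>r\<in>{r\<in>\<rat>. ereal r < y}. snd (est t \<omega>) \<in> alt_sublevel \<epsilon> ?w r (dag (est t \<omega>))"
    let ?h = "\<lambda>s\<in>{1..t}. act s \<omega>"
    from L obtain r where r: "r \<in> {r\<in>\<rat>. ereal r < y}" "snd (est t \<omega>) \<in> alt_sublevel \<epsilon> ?w r (dag (est t \<omega>))"
      by (rule bexE)
    have h1: "?h \<in> Pi\<^sub>E {1..t} (\<lambda>_. actions P)"
      by (intro restrict_PiE_iff[THEN iffD2] ballI act_in[OF w]) simp
    have h2: "\<forall>s\<in>{1..t}. act s \<omega> = ?h s" by simp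
    have "snd (est t \<omega>) \<in> alt_sublevel \<epsilon> (\<lambda>a. real (play_count ?h t a)) r (dag (est t \<omega>))"
      unfolding count[OF h2] by (rule r(2))
    then show ?R
      by (intro bexI[OF _ h1] exI[of _ "dag (est t \<omega>)"] bexI[OF _ r(1)] conjI h2 refl)
  next
    assume ?R
    then obtain h r where h: "\<forall>s\<in>{1..t}. act s \<omega> = h s" and r: "r \<in> {r\<in>\<rat>. ereal r < y}"
      "snd (est t \<omega>) \<in> alt_sublevel \<epsilon> (\<lambda>a. real (play_count h t a)) r (dag (est t \<omega>))"
      by blast
    show "\<exists>r\<in>{r\<in>\<rat>. ereal r < y}. snd (est t \<omega>) \<in> alt_sublevel \<epsilon> ?w r (dag (est t \<omega>))"
      by (intro bexI[OF _ r(1)]) (rule r(2)[unfolded count[OF h]])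
  qed
  finally show ?thesis .
qed

lemma borel_measurable_statistic:
  assumes t: "1 \<le> t"
  shows "statistic t \<in> borel_measurable M"
proof (rule borel_measurableI_less)
  fix y :: ereal
  let ?H = "Pi\<^sub>E {1..t} (\<lambda>_. actions P)" and ?Q = "{r\<in>\<rat>. ereal r < y}"
  let ?A = "\<lambda>h D r. (\<Inter>s\<in>{1..t}. {\<omega>\<in>space M. act s \<omega> = h s}) \<inter> {\<omega>\<in>space M. dag (est t \<omega>) = D} \<inter>
      ((\<lambda>\<omega>. snd (est t \<omega>)) -` alt_sublevel \<epsilon> (\<lambda>a. real (play_count h t a)) r D \<inter> space M)"
  have "?A h D r \<in> sets M" if "h \<in> ?H" for h D r
  proof -
    have 1: "(\<Inter>s\<in>{1..t}. {\<omega>\<in>space M. act s \<omega> = h s}) \<in> sets M"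
      using that t by (intro sets.finite_INT) (auto intro!: act_event_sets)
    have 2: "{\<omega>\<in>space M. dag (est t \<omega>) = D} \<in> sets M" by (rule est_events(1)[OF t])
    have 3: "(\<lambda>\<omega>. snd (est t \<omega>)) -` alt_sublevel \<epsilon> (\<lambda>a. real (play_count h t a)) r D \<inter> space M \<in> sets M"
      by (intro measurable_sets[OF est_events(2)[OF t]] borel_closed closed_alt_sublevel)
    show ?thesis by (rule sets.Int[OF sets.Int[OF 1 2] 3])
  qed
  moreover have "finite ?H" by (intro finite_PiE) auto
  moreover have "countable ?Q" using countable_rat by (rule countable_subset[rotated]) auto
  ultimately have "(\<Union>h\<in>?H. \<Union>D. \<Union>r\<in>?Q. ?A h D r) \<in> sets M"
    by (intro sets.finite_UN sets.countable_UN') auto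
  also have "(\<Union>h\<in>?H. \<Union>D. \<Union>r\<in>?Q. ?A h D r) = {\<omega>\<in>space M. statistic t \<omega> < y}"
  proof (intro set_eqI iffI)
    fix \<omega> assume "\<omega> \<in> (\<Union>h\<in>?H. \<Union>D. \<Union>r\<in>?Q. ?A h D r)"
    then obtain h D r where h: "h \<in> ?H" and r: "r \<in> ?Q" and A: "\<omega> \<in> ?A h D r" by blast
    have w: "\<omega> \<in> space M" and hs: "\<forall>s\<in>{1..t}. act s \<omega> = h s" and D: "dag (est t \<omega>) = D"
      and sub: "snd (est t \<omega>) \<in> alt_sublevel \<epsilon> (\<lambda>a. real (play_count h t a)) r D"
      using A by simp_all
    have "statistic t \<omega> < y"
      unfolding statistic_less_iff[OF t w]
      by (intro bexI[OF _ h] exI[of _ D] bexI[OF _ r] conjI hs D sub)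
    with w show "\<omega> \<in> {\<omega>\<in>space M. statistic t \<omega> < y}" by simp
  next
    fix \<omega> assume "\<omega> \<in> {\<omega>\<in>space M. statistic t \<omega> < y}"
    then have w: "\<omega> \<in> space M" and less: "statistic t \<omega> < y" by simp_all
    from less obtain h D r where h: "h \<in> ?H" and r: "r \<in> ?Q" and hs: "\<forall>s\<in>{1..t}. act s \<omega> = h s"
      and D: "dag (est t \<omega>) = D" and sub: "snd (est t \<omega>) \<in> alt_sublevel \<epsilon> (\<lambda>a. real (play_count h t a)) r D"
      unfolding statistic_less_iff[OF t w] by blast
    have "\<omega> \<in> ?A h D r" using w hs D sub by simp
    then show "\<omega> \<in> (\<Union>h\<in>?H. \<Union>D. \<Union>r\<in>?Q. ?A h D r)"
      by (intro UN_I[OF h] UN_I[of D] UN_I[OF r]) simp_all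
  qed
  finally show "{\<omega>\<in>space M. statistic t \<omega> < y} \<in> sets M" .
qed

lemma borel_measurable_f_ext:
  assumes t: "1 \<le> t"
  shows "(\<lambda>\<omega>. f_ext P t (statistic t \<omega>)) \<in> borel_measurable M"
proof -
  note [measurable] = borel_measurable_statistic[OF t] borel_measurable_f_fun
  show ?thesis unfolding f_ext_def by measurable
qed

section \<open>Stopping with a wrong estimate\<close>

lemma weighted_KL_play_count:
  assumes w: "\<omega> \<in> space M"
  shows "weighted_KL P (\<lambda>a. real (play_count (\<lambda>s. act s \<omega>) t a)) \<theta> \<theta>s = cum_KL t \<omega> \<theta>"
proof -
  have "real (play_count (\<lambda>s. act s \<omega>) t a) = (\<Sum>s=1..t. if act s \<omega> = a then 1 else 0)" for a
    by (simp add: play_count_def sum.If_cases Int_def)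
  then have "weighted_KL P (\<lambda>a. real (play_count (\<lambda>s. act s \<omega>) t a)) \<theta> \<theta>s
      = (\<Sum>a\<in>actions P. \<Sum>s=1..t. if act s \<omega> = a then KL a \<theta> \<theta>s else 0)"
    unfolding weighted_KL_def by (simp add: sum_distrib_right if_distrib[of "\<lambda>c. c * _"] cong: if_cong)
  also have "\<dots> = (\<Sum>s=1..t. \<Sum>a\<in>actions P. if act s \<omega> = a then KL a \<theta> \<theta>s else 0)"
    by (rule sum.swap)
  also have "\<dots> = cum_KL t \<omega> \<theta>"
    unfolding cum_KL_def using act_in[OF w] by (intro sum.cong) auto
  finally show ?thesis .
qed

definition correct :: "nat \<Rightarrow> 'w \<Rightarrow> bool" where
  "correct t \<omega> \<longleftrightarrow> dag (est t \<omega>) = dag \<theta>s \<and> max_norm (coef (est t \<omega>) - coef \<theta>s) < \<epsilon>"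

lemma statistic_nonneg:
  assumes t: "1 \<le> t" and w: "\<omega> \<in> space M"
  shows "0 \<le> statistic t \<omega>"
  unfolding stop_stat_def
proof (rule INF_greatest)
  fix \<nu> assume \<nu>: "\<nu> \<in> Alt P \<epsilon> (est t \<omega>)"
  interpret N: two_models P "est t \<omega>" \<nu>
    using est_Theta[OF t w] \<nu> by unfold_locales (auto simp: Alt_def)
  show "0 \<le> ereal (weighted_KL P (\<lambda>a. real (play_count (\<lambda>s. act s \<omega>) t a)) (est t \<omega>) \<nu>)"
    unfolding weighted_KL_def ereal_less_eq(5) by (intro sum_nonneg mult_nonneg_nonneg N.KL_nonneg) auto
qed

lemma statistic_le_cum_KL:
  assumes w: "\<omega> \<in> space M" and wrong: "\<not> correct t \<omega>"
  shows "statistic t \<omega> \<le> ereal (cum_KL t \<omega> (est t \<omega>))"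
proof -
  have "\<theta>s \<in> Alt P \<epsilon> (est t \<omega>)"
  proof -
    have "max_norm (coef \<theta>s - coef (est t \<omega>)) = max_norm (coef (est t \<omega>) - coef \<theta>s)"
      unfolding max_norm_def by (simp add: abs_minus_commute)
    then show ?thesis using model wrong by (auto simp: Alt_def correct_def not_less)
  qed
  then show ?thesis
    unfolding stop_stat_def weighted_KL_play_count[OF w, symmetric] by (rule INF_lower)
qed

text \<open>A small threshold at a random level has to be turned into an event for one fixed level.
  All levels concerned lie above their infimum, where continuity keeps the threshold at most
  \<open>c\<close>, at the price of strictness.\<close>

lemma wrong_stop_event:
  assumes t: "1 \<le> t" and c: "0 < c"
  obtains E where "E \<in> sets M" "measure M E \<le> c"
    "\<And>\<omega>. \<omega> \<in> space M \<Longrightarrow> \<not> correct t \<omega> \<Longrightarrow> f_ext P t (statistic t \<omega>) < c \<Longrightarrow> \<omega> \<in> E"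
proof -
  define U where "U = {x. 0 \<le> x \<and> f_fun P t x < c}"
  have real: "\<exists>x\<in>U. x \<le> cum_KL t \<omega> (est t \<omega>)"
    if w: "\<omega> \<in> space M" and wrong: "\<not> correct t \<omega>" and f: "f_ext P t (statistic t \<omega>) < c" for \<omega>
  proof -
    obtain d where d: "statistic t \<omega> = ereal d"
      using statistic_nonneg[OF t w] statistic_le_cum_KL[OF w wrong] by (cases "statistic t \<omega>") auto
    then have "d \<in> U" "d \<le> cum_KL t \<omega> (est t \<omega>)"
      using statistic_nonneg[OF t w] statistic_le_cum_KL[OF w wrong] f by (auto simp: U_def f_ext_def)
    then show ?thesis by blast
  qed
  show ?thesis
  proof (cases "U = {}")
    case True
    then show ?thesis using real c by (intro that[of "{}"]) auto
  next
    case False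
    let ?x = "Inf U"
    have bdd: "bdd_below U" by (intro bdd_belowI[of _ 0]) (simp add: U_def)
    have x0: "0 \<le> ?x" using False by (intro cInf_greatest) (auto simp: U_def)
    have "closure U \<subseteq> {0..}" by (intro closure_minimal) (auto simp: U_def)
    then have "continuous_on (closure U) (f_fun P t)"
      using continuous_on_f_fun[OF t] continuous_on_subset by blast
    then have fx: "f_fun P t ?x \<le> c"
      by (rule continuous_le_on_closure) (use closure_contains_Inf[OF False bdd] in \<open>auto simp: U_def\<close>)
    obtain E where E: "E \<in> sets M" "measure M E \<le> f_fun P t ?x"
      "\<And>\<omega>. \<omega> \<in> space M \<Longrightarrow> ?x \<le> cum_KL t \<omega> (est t \<omega>) \<Longrightarrow> \<omega> \<in> E"
      by (rule cum_KL_tail[OF t x0]) blast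
    show ?thesis
    proof (rule that[OF E(1)])
      show "measure M E \<le> c" using E(2) fx by linarith
      fix \<omega> assume w: "\<omega> \<in> space M" "\<not> correct t \<omega>" "f_ext P t (statistic t \<omega>) < c"
      obtain x where "x \<in> U" "x \<le> cum_KL t \<omega> (est t \<omega>)" using real[OF w] by blast
      then show "\<omega> \<in> E" using E(3)[OF w(1)] cInf_lower[OF _ bdd] order_trans by blast
    qed
  qed
qed

end

section \<open>Termination\<close>

lemma play_count_Suc: "play_count act (Suc t) a = play_count act t a + (if act (Suc t) = a then 1 else 0)"
proof -
  have "{s\<in>{1..Suc t}. act s = a} = {s\<in>{1..t}. act s = a} \<union> (if act (Suc t) = a then {Suc t} else {})"
    by (auto simp: le_Suc_eq)
  then show ?thesis by (auto simp: play_count_def card_insert_if)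
qed

lemma play_count_mono: "s \<le> t \<Longrightarrow> play_count act s a \<le> play_count act t a"
  unfolding play_count_def by (intro card_mono) auto

text \<open>While some action has been selected fewer than \<open>L\<close> times, every forced round increases the sum of the
  counts truncated at \<open>L\<close>, which is at most \<open>L\<close> times the number of actions.\<close>

lemma forced_exploration_count:
  fixes act :: "nat \<Rightarrow> 'a" and A :: "'a set"
  assumes A: "finite A" "A \<noteq> {}"
    and forced: "\<And>t. 1 \<le> t \<Longrightarrow> real (MIN a\<in>A. play_count act t a) < sqrt (real t) \<Longrightarrow>
      is_arg_min (play_count act t) (\<lambda>a. a \<in> A) (act (Suc t))"
    and L: "1 \<le> L" and a: "a \<in> A"
  shows "L \<le> play_count act (L\<^sup>2 + card A * L) a"
proof (rule ccontr)
  assume "\<not> ?thesis"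
  then have few: "play_count act (L\<^sup>2 + card A * L) a < L" by simp
  define pot where "pot t = (\<Sum>b\<in>A. min (play_count act t b) L)" for t
  have L2: "1 \<le> L\<^sup>2" using L by simp
  have step: "pot t + 1 \<le> pot (Suc t)" if t: "L\<^sup>2 \<le> t" "t \<le> L\<^sup>2 + card A * L" for t
  proof -
    let ?N = "play_count act t"
    have "?N a < L" using few play_count_mono[OF t(2), of act a] by simp
    have "(MIN b\<in>A. ?N b) \<le> ?N a" using A a by (intro Min_le) auto
    then have "(MIN b\<in>A. ?N b) < L" using \<open>?N a < L\<close> by simp
    \<comment> \<open>From time \<open>L\<^sup>2\<close> on, a minimal count below \<open>L\<close>
      is also below \<open>sqrt t\<close>, so the round is forced.\<close>
    moreover have "real L \<le> sqrt (real t)"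
      using t(1) by (intro real_le_rsqrt) (metis of_nat_le_iff of_nat_power)
    ultimately have "is_arg_min ?N (\<lambda>a. a \<in> A) (act (Suc t))"
      using le_trans[OF L2 t(1)] by (intro forced) auto
    then have b: "act (Suc t) \<in> A" "?N (act (Suc t)) \<le> ?N a"
      using a by (auto simp: is_arg_min_def not_less)
    let ?b = "act (Suc t)"
    have le: "min (?N c) L + (if c = ?b then 1 else 0) \<le> min (play_count act (Suc t) c) L" for c
      using b(2) \<open>?N a < L\<close> by (auto simp: play_count_Suc)
    have "pot t + (\<Sum>c\<in>A. if c = ?b then 1 else 0) \<le> pot (Suc t)"
      unfolding pot_def sum.distrib[symmetric] by (intro sum_mono le)
    then show ?thesis using A(1) b(1) by simp
  qed
  have "n \<le> pot (L\<^sup>2 + n)" if "n \<le> card A * L + 1" for n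
    using that
  proof (induction n)
    case (Suc n)
    then show ?case using step[of "L\<^sup>2 + n"] by simp
  qed simp
  \<comment> \<open>One forced round more than the truncated sum can absorb.\<close>
  from this[of "card A * L + 1"] have "card A * L + 1 \<le> pot (L\<^sup>2 + (card A * L + 1))" by simp
  also have "\<dots> \<le> (\<Sum>b\<in>A. L)" unfolding pot_def by (intro sum_mono) simp
  finally show False by simp
qed

context focus_analysis
begin

definition stops :: "real \<Rightarrow> nat \<Rightarrow> 'w \<Rightarrow> bool" where
  "stops d t \<omega> \<longleftrightarrow> pi\<^sup>2 * (real t)\<^sup>2 / 6 * f_ext P t (statistic t \<omega>) < d"

lemma statistic_ge:
  assumes w: "\<omega> \<in> space M" and t: "1 \<le> t" and eps: "0 < \<epsilon>" "\<epsilon> \<le> beta_min P"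
    and L: "\<And>a. a \<in> actions P \<Longrightarrow> L \<le> play_count (\<lambda>s. act s \<omega>) t a"
  shows "ereal (separation P \<epsilon> * real L) \<le> statistic t \<omega>"
  unfolding stop_stat_def
proof (rule INF_greatest)
  fix \<nu> assume \<nu>: "\<nu> \<in> Alt P \<epsilon> (est t \<omega>)"
  interpret N: two_models P "est t \<omega>" \<nu>
    using est_Theta[OF t w] \<nu> by unfold_locales (auto simp: Alt_def)
  obtain a where a: "a \<in> actions P" "separation P \<epsilon> \<le> KL a (est t \<omega>) \<nu>"
    using N.sum_KL_ge_separation[OF \<nu> eps] by blast
  let ?N = "play_count (\<lambda>s. act s \<omega>) t"
  have "separation P \<epsilon> * real L \<le> KL a (est t \<omega>) \<nu> * real (?N a)"
    using a L[OF a(1)] N.KL_nonneg[of a] by (intro mult_mono) auto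
  also have "\<dots> = real (?N a) * KL a (est t \<omega>) \<nu>" by simp
  also have "\<dots> \<le> (\<Sum>a\<in>actions P. real (?N a) * KL a (est t \<omega>) \<nu>)"
    using a(1) N.KL_nonneg by (intro member_le_sum) auto
  finally show "ereal (separation P \<epsilon> * real L) \<le> ereal (weighted_KL P (\<lambda>a. real (?N a)) (est t \<omega>) \<nu>)"
    by (simp add: weighted_KL_def)
qed

lemma stops_eventually:
  assumes w: "\<omega> \<in> space M" and eps: "0 < \<epsilon>" "\<epsilon> \<le> beta_min P" and d: "0 < d" "d < 1"
  shows "\<exists>t\<ge>1. stops d t \<omega>"
proof -
  let ?c = "separation P \<epsilon>" and ?K = "card (actions P)"
  have c: "?c > 0" by (rule separation_pos[OF eps(1)])
  obtain L where L: "1 \<le> L" and small: "pi\<^sup>2 * (real (L\<^sup>2 + ?K * L))\<^sup>2 / 6 * f_fun P (L\<^sup>2 + ?K * L) (?c * real L) < d"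
    using f_fun_eventually_small[OF c d(1), of ?K] by blast
  define t where "t = L\<^sup>2 + ?K * L"
  have t: "1 \<le> t" using L by (simp add: t_def Suc_leI)
  have "L \<le> play_count (\<lambda>s. act s \<omega>) t a" if "a \<in> actions P" for a
    unfolding t_def using that w L forced_exploration[of _ \<omega>]
    by (intro forced_exploration_count) auto
  then have ge: "ereal (?c * real L) \<le> statistic t \<omega>"
    by (rule statistic_ge[OF w t eps])
  \<comment> \<open>With this factor at least 1, a stopping inequality with \<open>d < 1\<close>
    forces \<open>f_fun\<close> below 1, where it is known to decrease.\<close>
  have pt: "pi\<^sup>2 * (real t)\<^sup>2 / 6 \<ge> 1"
  proof -
    have "3\<^sup>2 \<le> pi\<^sup>2" using pi_gt3 by (intro power_mono) auto
    moreover have "1 \<le> (real t)\<^sup>2" using t by (intro one_le_power) simp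
    ultimately have "9 * 1 \<le> pi\<^sup>2 * (real t)\<^sup>2" by (intro mult_mono) auto
    then show ?thesis by simp
  qed
  have small': "pi\<^sup>2 * (real t)\<^sup>2 / 6 * f_fun P t (?c * real L) < d" using small by (simp only: t_def)
  have cL: "0 \<le> ?c * real L" using c by simp
  \<comment> \<open>The value 0 covers an infinite statistic, which occurs when there is no
    alternative.\<close>
  have "f_ext P t (statistic t \<omega>) \<le> max 0 (f_fun P t (?c * real L))"
  proof (cases "statistic t \<omega> = \<infinity>")
    case False
    with ge obtain y where y: "statistic t \<omega> = ereal y" "?c * real L \<le> y"
      by (cases "statistic t \<omega>") auto
    have "f_fun P t (?c * real L) < 1"
    proof (rule ccontr)
      assume "\<not> ?thesis"
      then have "1 * 1 \<le> pi\<^sup>2 * (real t)\<^sup>2 / 6 * f_fun P t (?c * real L)"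
        using pt by (intro mult_mono) auto
      then show False using small' d(2) by simp
    qed
    from f_fun_antimono[OF t cL y(2) this] show ?thesis by (simp add: f_ext_def y(1))
  qed (simp add: f_ext_def)
  then have "pi\<^sup>2 * (real t)\<^sup>2 / 6 * f_ext P t (statistic t \<omega>) \<le> pi\<^sup>2 * (real t)\<^sup>2 / 6 * max 0 (f_fun P t (?c * real L))"
    by (rule mult_left_mono) simp
  also have "\<dots> < d"
    using small' d(1) by (auto simp: max_def)
  finally show ?thesis using t unfolding stops_def by blast
qed

lemma stops_measurable: "1 \<le> t \<Longrightarrow> {\<omega>\<in>space M. stops d t \<omega>} \<in> sets M"
proof -
  assume "1 \<le> t"
  note [measurable] = borel_measurable_f_ext[OF this]
  show ?thesis unfolding stops_def by measurable
qed

lemma correct_measurable: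
  assumes t: "1 \<le> t"
  shows "{\<omega>\<in>space M. correct t \<omega>} \<in> sets M"
proof -
  have c: "(\<lambda>\<omega>. coef (est t \<omega>)) \<in> borel_measurable M"
    using measurable_F[OF est_measurable[OF t]] by measurable
  have [measurable]: "(\<lambda>\<omega>. (coef (est t \<omega>) - coef \<theta>s) $ j $ k) \<in> borel_measurable M" for j k
    by (rule measurable_compose[OF c borel_measurable_continuous_onI]) (intro continuous_intros)
  have "{\<omega>\<in>space M. dag (est t \<omega>) = dag \<theta>s} \<inter> {\<omega>\<in>space M. \<forall>j k. \<bar>(coef (est t \<omega>) - coef \<theta>s) $ j $ k\<bar> < \<epsilon>} \<in> sets M"
    by (intro sets.Int est_events(1)[OF t]) measurable
  also have "{\<omega>\<in>space M. dag (est t \<omega>) = dag \<theta>s} \<inter> {\<omega>\<in>space M. \<forall>j k. \<bar>(coef (est t \<omega>) - coef \<theta>s) $ j $ k\<bar> < \<epsilon>}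
     = {\<omega>\<in>space M. correct t \<omega>}"
    unfolding correct_def not_le[symmetric] max_norm_ge_iff by blast
  finally show ?thesis .
qed

lemma stop_time_eq:
  assumes "t \<ge> 1" "stops d t \<omega>"
  obtains T where "stop_time P \<epsilon> d (\<lambda>s. act s \<omega>) (\<lambda>s. est s \<omega>) = enat T" "1 \<le> T" "stops d T \<omega>"
    "\<And>s. 1 \<le> s \<Longrightarrow> s < T \<Longrightarrow> \<not> stops d s \<omega>"
proof -
  let ?S = "{t. 1 \<le> t \<and> stops d t \<omega>}"
  define T where "T = (LEAST t. t \<in> ?S)"
  have T: "T \<in> ?S" unfolding T_def by (rule LeastI[of _ t]) (use assms in simp)
  have least: "T \<le> s" if "s \<in> ?S" for s unfolding T_def using that by (rule Least_le)
  have "stop_time P \<epsilon> d (\<lambda>s. act s \<omega>) (\<lambda>s. est s \<omega>) = Inf (enat ` ?S)"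
    by (simp add: stop_time_def stops_def)
  also have "\<dots> = enat T"
    using T least by (intro antisym Inf_lower Inf_greatest) auto
  finally show ?thesis
    using T least by (intro that[of T]) (auto simp: not_le[symmetric])
qed

theorem correct_at_stopping:
  assumes eps: "0 < \<epsilon>" "\<epsilon> \<le> beta_min P / 2" and d: "0 < d" "d < 1"
  shows "measure M {\<omega>\<in>space M.
      let \<tau> = stop_time P \<epsilon> d (\<lambda>t. act t \<omega>) (\<lambda>t. est t \<omega>); T = the_enat \<tau>
      in \<tau> < \<infinity> \<and> dag (est T \<omega>) = dag \<theta>s \<and> max_norm (coef (est T \<omega>) - coef \<theta>s) < \<epsilon>}
    \<ge> 1 - d"
proof -
  let ?G = "{\<omega>\<in>space M.
      let \<tau> = stop_time P \<epsilon> d (\<lambda>t. act t \<omega>) (\<lambda>t. est t \<omega>); T = the_enat \<tau>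
      in \<tau> < \<infinity> \<and> dag (est T \<omega>) = dag \<theta>s \<and> max_norm (coef (est T \<omega>) - coef \<theta>s) < \<epsilon>}"
  have eps': "\<epsilon> \<le> beta_min P" using eps(2) less_imp_le[OF pos(1)] by linarith
  have time: "\<exists>T\<ge>1. stop_time P \<epsilon> d (\<lambda>s. act s \<omega>) (\<lambda>s. est s \<omega>) = enat T \<and> stops d T \<omega> \<and> (\<forall>s. 1 \<le> s \<longrightarrow> s < T \<longrightarrow> \<not> stops d s \<omega>)"
    if "\<omega> \<in> space M" for \<omega>
    using stops_eventually[OF that eps(1) eps' d] stop_time_eq by metis
  have G_iff: "\<omega> \<in> ?G \<longleftrightarrow> correct T \<omega>"
    if "\<omega> \<in> space M" "stop_time P \<epsilon> d (\<lambda>s. act s \<omega>) (\<lambda>s. est s \<omega>) = enat T" for \<omega> T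
    using that by (simp add: correct_def)
  let ?C = "\<lambda>T. {\<omega>\<in>space M. stops d T \<omega>} \<inter> (\<Inter>s\<in>{1..<T}. space M - {\<omega>\<in>space M. stops d s \<omega>}) \<inter> {\<omega>\<in>space M. correct T \<omega>}"
  \<comment> \<open>Decomposition by the value of the stopping time. At \<open>T = 1\<close> the
    intersection over no earlier round is \<open>UNIV\<close>, hence the factor
    \<open>space M\<close>.\<close>
  have G: "?G = (\<Union>T\<in>{1..}. ?C T \<inter> space M)"
  proof (intro set_eqI iffI)
    fix \<omega> assume g: "\<omega> \<in> ?G"
    then have w: "\<omega> \<in> space M" by simp
    obtain T where T: "T \<ge> 1" "stop_time P \<epsilon> d (\<lambda>s. act s \<omega>) (\<lambda>s. est s \<omega>) = enat T" "stops d T \<omega>"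
      "\<forall>s. 1 \<le> s \<longrightarrow> s < T \<longrightarrow> \<not> stops d s \<omega>"
      using time[OF w] by blast
    have "\<omega> \<in> ?C T \<inter> space M" using w T(3,4) g[unfolded G_iff[OF w T(2)]] by simp
    then show "\<omega> \<in> (\<Union>T\<in>{1..}. ?C T \<inter> space M)" using T(1) by (intro UN_I[of T]) simp_all
  next
    fix \<omega> assume "\<omega> \<in> (\<Union>T\<in>{1..}. ?C T \<inter> space M)"
    then obtain T where T: "1 \<le> T" "\<omega> \<in> ?C T \<inter> space M" by (auto simp only: UN_iff atLeast_iff)
    then have w: "\<omega> \<in> space M" and s: "stops d T \<omega>" "\<And>s. 1 \<le> s \<Longrightarrow> s < T \<Longrightarrow> \<not> stops d s \<omega>" and c: "correct T \<omega>"
      by auto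
    obtain T' where T': "T' \<ge> 1" "stop_time P \<epsilon> d (\<lambda>s. act s \<omega>) (\<lambda>s. est s \<omega>) = enat T'" "stops d T' \<omega>"
      "\<forall>s. 1 \<le> s \<longrightarrow> s < T' \<longrightarrow> \<not> stops d s \<omega>"
      using time[OF w] by blast
    have "T' = T" using s T' T(1) by (metis linorder_neqE_nat)
    then show "\<omega> \<in> ?G" unfolding G_iff[OF w T'(2)] using c by simp
  qed
  have CM: "?C T \<inter> space M \<in> sets M" if "1 \<le> T" for T
  proof -
    have "(\<Inter>s\<in>{1..<T}. space M - {\<omega>\<in>space M. stops d s \<omega>}) \<inter> space M \<in> sets M"
    proof (cases "T = 1")
      case False
      then show ?thesis using that
        by (intro sets.Int sets.finite_INT sets.compl_sets stops_measurable) auto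
    qed simp
    then have "{\<omega>\<in>space M. stops d T \<omega>} \<inter> ((\<Inter>s\<in>{1..<T}. space M - {\<omega>\<in>space M. stops d s \<omega>}) \<inter> space M) \<inter> {\<omega>\<in>space M. correct T \<omega>} \<in> sets M"
      using that by (intro sets.Int[OF sets.Int] stops_measurable correct_measurable)
    then show ?thesis by (simp only: Int_ac)
  qed
  have GM: "?G \<in> sets M"
    unfolding G using CM by (intro sets.countable_UN'') auto
  \<comment> \<open>Solves the stopping inequality of round \<open>t\<close> for the threshold; by
    the Basel sum these levels add up to \<open>d\<close>.\<close>
  define c where "c t = 6 * d / (pi\<^sup>2 * (real t)\<^sup>2)" for t
  have cpos: "c t > 0" if "1 \<le> t" for t using that d(1) by (simp add: c_def)
  have "\<forall>t. \<exists>E. E \<in> sets M \<and> measure M E \<le> c (Suc t) \<and>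
    (\<forall>\<omega>\<in>space M. \<not> correct (Suc t) \<omega> \<longrightarrow> f_ext P (Suc t) (statistic (Suc t) \<omega>) < c (Suc t) \<longrightarrow> \<omega> \<in> E)"
    using wrong_stop_event[OF _ cpos] by (metis One_nat_def Suc_le_mono zero_le)
  then obtain E where E: "\<And>t. E t \<in> sets M" "\<And>t. measure M (E t) \<le> c (Suc t)"
    "\<And>t \<omega>. \<omega> \<in> space M \<Longrightarrow> \<not> correct (Suc t) \<omega> \<Longrightarrow> f_ext P (Suc t) (statistic (Suc t) \<omega>) < c (Suc t) \<Longrightarrow> \<omega> \<in> E t"
    by metis
  have "(\<lambda>n. 6 * d / pi\<^sup>2 * (1 / (real n + 1)\<^sup>2)) sums (6 * d / pi\<^sup>2 * (pi\<^sup>2 / 6))"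
    by (rule sums_mult) (use inverse_squares_sums in \<open>simp only: of_nat_power of_nat_add of_nat_1\<close>)
  moreover have "6 * d / pi\<^sup>2 * (1 / (real n + 1)\<^sup>2) = c (Suc n)" for n
    by (simp add: c_def add.commute)
  moreover have "6 * d / pi\<^sup>2 * (pi\<^sup>2 / 6) = d" by simp
  ultimately have sums: "(\<lambda>n. c (Suc n)) sums d" by (simp only:)
  have summ: "summable (\<lambda>n. measure M (E n))"
    by (rule summable_comparison_test'[OF sums_summable[OF sums], of 0]) (use E(2) in simp)
  have UE: "(\<Union>n. E n) \<in> sets M" using E(1) by auto
  have "measure M (\<Union>n. E n) \<le> (\<Sum>n. measure M (E n))"
    using E(1) summ by (intro finite_measure_subadditive_countably) auto
  also have "\<dots> \<le> (\<Sum>n. c (Suc n))"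
    by (rule suminf_le[OF _ summ sums_summable[OF sums]]) (rule E(2))
  also have "\<dots> = d" by (rule sums_unique[OF sums, symmetric])
  finally have PE: "measure M (\<Union>n. E n) \<le> d" .
  \<comment> \<open>Stopping is certain, so outside the exceptional events the estimate at the
    stopping time can only be correct. The event of round \<open>T\<close> is
    \<open>E (T - 1)\<close>.\<close>
  have "space M - (\<Union>n. E n) \<subseteq> ?G"
  proof
    fix \<omega> assume "\<omega> \<in> space M - (\<Union>n. E n)"
    then have w: "\<omega> \<in> space M" and nE: "\<And>n. \<omega> \<notin> E n" by auto
    obtain T where T: "T \<ge> 1" "stop_time P \<epsilon> d (\<lambda>s. act s \<omega>) (\<lambda>s. est s \<omega>) = enat T" "stops d T \<omega>"
      using time[OF w] by blast
    have "f_ext P T (statistic T \<omega>) < c T"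
      using T(1,3) by (simp add: stops_def c_def field_simps)
    then have "correct T \<omega>"
      using nE[of "T - 1"] E(3)[OF w, of "T - 1"] T(1) by auto
    then show "\<omega> \<in> ?G" unfolding G_iff[OF w T(2)] .
  qed
  then have "measure M (space M - (\<Union>n. E n)) \<le> measure M ?G"
    by (rule finite_measure_mono) (rule GM)
  then show ?thesis using PE prob_compl[OF UE] by simp
qed

end

theorem theorem5p1:
  fixes P :: "'n::finite pars"
    and \<epsilon> \<delta> :: real
    and \<theta>s :: "'n model"
    and M :: "'w measure"
    and F :: "nat \<Rightarrow> 'w measure"
    and act :: "nat \<Rightarrow> 'w \<Rightarrow> 'n action"
    and X :: "nat \<Rightarrow> 'w \<Rightarrow> 'n \<Rightarrow> real"
    and est br :: "nat \<Rightarrow> 'w \<Rightarrow> 'n model"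
  assumes "valid_pars P"
    and "\<theta>s \<in> Theta P"
    and "0 < \<epsilon>" and "\<epsilon> \<le> beta_min P / 2"
    and "0 < \<delta>" and "\<delta> < 1"
    and "focus_run M F P \<epsilon> \<theta>s act X est br"
  shows "measure M {\<omega>\<in>space M.
      let \<tau> = stop_time P \<epsilon> \<delta> (\<lambda>t. act t \<omega>) (\<lambda>t. est t \<omega>); T = the_enat \<tau>
      in \<tau> < \<infinity> \<and> dag (est T \<omega>) = dag \<theta>s \<and> max_norm (coef (est T \<omega>) - coef \<theta>s) < \<epsilon>}
    \<ge> 1 - \<delta>"
proof -
  interpret run: focus_run M F P \<epsilon> \<theta>s act X est br by fact
  interpret focus_analysis M F P \<epsilon> \<theta>s act X est br
    using assms(1,2) by unfold_locales
  show ?thesis by (rule correct_at_stopping[OF assms(3-6)])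
qed

end
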